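(* Let $\varepsilon>0$ be given, assume $L\ge1$, and suppose Assumptions A1, A2, A3 (stated in the context) hold. Let $$\eta_y=\frac1{4L},\qquad \eta_x=\min\Big\{\frac{(1-\rho)^2}{180L_P},\ \frac{1}{20(L+1)(12\kappa^2+2\kappa+5)}\Big\},$$ $$\eta_\Lambda=\min\Big\{\frac{5L_P(1-\rho)^2}{24L^2(12\kappa^2+\kappa+1)},\ \frac{1}{2L_P+128L\kappa^2+\frac{(L+1)(20\kappa^2+\kappa+1)}{2}+\frac{4L^2(12\kappa^2+\kappa+1)}{30L_P}}\Big\},$$ with $L_P=L\sqrt{4\kappa^2+1}$. Suppose $$\|V_{\perp,x}^{(0)}\|_F^2=\mathcal O\big(mL_P(1-\rho)\big),\qquad \|\widetilde Y^{(0)}-Y^{(0)}\|_F^2=\mathcal O\Big(\min\Big\{\frac{m\kappa}{L},\frac{mL_P\kappa(1-\rho)^2}{L^2}\Big\}\Big).$$ Then the VRLM algorithm with the SPIDER option, with these step sizes, $\mathcal S_1=\Theta\Big(\frac{\sigma^2\max\{\kappa^2,(1-\rho)^{-4}\}}{\varepsilon^2}\Big)$ in the general stochastic case and $\mathcal S_0=\mathcal S_1=n$ in the finite-sum case, and $\mathcal S_2=q=\lceil\sqrt{\mathcal S_1}\rceil$, can find an $\varepsilon$-stationary point in expectation (as defined in the context) by $T_s$ stochastic gradients and $T_c$ local neighbor communications, where $$T_c=\Theta\Big(\frac{L\kappa^2}{\varepsilon^2\min\{1,\kappa(1-\rho)^2\}}\Big(\phi(\bar x^{(0)},\Lambda^{(0)})-\phi^*+\frac{\hat\delta_0}{\min\{1,\kappa(1-\rho)^2\}}+1\Big)\Big),$$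 and $T_s=n+\sqrt n\,T_c$ in the finite-sum case, $T_s=\frac{\sigma}{\varepsilon}\max\{\kappa,(1-\rho)^{-2}\}\,T_c$ in the general stochastic case.
   Context: **Setting and notation.** $m,d_1,d_2\ge1$ are integers, $[m]=\{1,\dots,m\}$. For $i\in[m]$, $\mathcal D_i$ is a probability distribution and $f_i(x,y)=\mathbb E_{\xi\sim\mathcal D_i}[\tilde f_i(x,y;\xi)]$ on $\mathbb R^{d_1}\times\mathbb R^{d_2}$. The finite-sum case is $f_i=\frac1n\sum_{j=1}^n\tilde f_i(\cdot,\cdot;\xi_{ij})$, i.e. $\mathcal D_i$ uniform on $\{\xi_{i1},\dots,\xi_{in}\}$. $g:\mathbb R^{d_1}\to\mathbb R\cup\{+\infty\}$ and $h:\mathbb R^{d_2}\to\mathbb R\cup\{+\infty\}$ are closed convex functions. $W=(w_{ij})\in\mathbb R^{m\times m}$ is the mixing matrix, $I$ the identity, $\mathbf 1\in\mathbb R^m$ the all-ones vector. $X=[x_1,\dots,x_m]^\top\in\mathbb R^{m\times d_1}$, $Y=[y_1,\dots,y_m]^\top\in\mathbb R^{m\times d_2}$, $\Lambda=[\lambda_1,\dots,\lambda_m]^\top\in\mathbb R^{m\times d_2}$. For such a matrix, $\bar x=\frac1m\sum_i x_i$, $X_\perp=X-\mathbf 1\bar x^\top$ (similarly $V_{\perp,x}=(V_x)_\perp$). $\mathrm{prox}_r(u)=\arg\min_v\{r(v)+\frac12\|v-u\|^2\}$, acting row-wise on matrices. $$\Phi(X,\Lambda,Y)=\frac1m\sum_{i=1}^m\big(f_i(x_i,y_i)-h(y_i)\big)-\frac{L}{2\sqrt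 m}\langle\Lambda,(W-I)Y\rangle,$$ $P(x,\Lambda)=\max_Y\Phi(\mathbf 1x^\top,\Lambda,Y)$, $\phi(x,\Lambda)=P(x,\Lambda)+g(x)$, $Q(X,\Lambda)=\max_Y\Phi(X,\Lambda,Y)$, $\widetilde Y^{(t)}=\arg\max_Y\Phi(X^{(t)},\Lambda^{(t)},Y)$, and $\hat\delta_t=Q(X^{(t)},\Lambda^{(t)})-\Phi(X^{(t)},\Lambda^{(t)},Y^{(t)})$. The problem being solved is $\min_{X,\Lambda}\max_Y\Phi(X,\Lambda,Y)+\frac1m\sum_ig(x_i)$ s.t. $x_i=x_j$ for all $i,j$. **$\varepsilon$-stationary point in expectation:** a random $(X,\Lambda)$ such that for some $\eta_x>0$, $$\mathbb E\Big\|\tfrac1{\eta_x}\big(\bar x-\mathrm{prox}_{\eta_xg}(\bar x-\eta_x\nabla_xP(\bar x,\Lambda))\big)\Big\|_2^2+\tfrac{L^2}m\mathbb E\|X_\perp\|_F^2\le\varepsilon^2,\qquad \mathbb E\|\nabla_\Lambda P(\bar x,\Lambda)\|_F^2\le\varepsilon^2.$$ **Assumptions.** A1: for each $i$, $f_i(x,\cdot)$ is $\mu$-strongly concave with $\mu>0$; there is $\phi^*\in\mathbb R$ with $\phi(x,\Lambda)\ge\phi^*$ for all $x,\Lambda$; $\mathrm{dom}(h)$ has nonempty relative interior. A2: $\mathrm{Null}(W-I)=\mathrm{Span}\{\mathbf 1\}$, $W^\top\mathbf 1=\mathbf 1$, $\rho:=\|W-\frac1m\mathbf 1\mathbf 1^\top\|_2<1$,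 $\|W-I\|_2\le2$. A3: each $f_i$ is $L$-smooth (gradient $L$-Lipschitz), and the stochastic gradient $\tilde\nabla f_i(x,y;\xi)$, $\xi\sim\mathcal D_i$, satisfies (i) $\mathbb E_\xi[\tilde\nabla f_i(x,y;\xi)]=\nabla f_i(x,y)$; (ii) $\mathbb E_\xi\|\tilde\nabla f_i(x,y;\xi)-\nabla f_i(x,y)\|_2^2\le\sigma^2$ for some $\sigma^2\ge0$; (iii) $\mathbb E_\xi\|\tilde\nabla f_i(x,y;\xi)-\tilde\nabla f_i(x',y';\xi)\|_2^2\le L^2(\|x-x'\|_2^2+\|y-y'\|_2^2)$ for all $(x,y),(x',y')$. The condition number is $\kappa=L/\mu$. **VRLM algorithm with SPIDER option.** For a finite sample set $\mathcal B$, $G_i^{(t)}(\mathcal B)=\frac1{|\mathcal B|}\sum_{\xi\in\mathcal B}\tilde\nabla f_i(x_i^{(t)},y_i^{(t)};\xi)$. Samples are drawn i.i.d. from $\mathcal D_i$, independently of the past. Start from deterministic $x_i^{(0)}=x^{(0)}\in\mathrm{dom}(g)$, $y_i^{(0)}=y^{(0)}\in\mathrm{dom}(h)$ for all $i$, $\Lambda^{(0)}=0$; $d_i^{(0)}=[d_{x,i}^{(0)};d_{y,i}^{(0)}]=G_i^{(0)}(\mathcal B_i^{(0)})$ with $|\mathcal B_i^{(0)}|=\mathcal S_0$; $V_x^{(0)}=D_x^{(0)}$. Here $D_x^{(t)},D_y^{(t)}$ have rows $d_{x,i}^{(t)},d_{y,i}^{(t)}$. For $t\ge1$: - if $t\equiv0\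 (\mathrm{mod}\ q)$: $d_i^{(t)}=G_i^{(t)}(\tilde{\mathcal B}_i^{(t)})$ with $|\tilde{\mathcal B}_i^{(t)}|=\mathcal S_1$; otherwise $d_i^{(t)}=G_i^{(t)}(\mathcal B_i^{(t)})-G_i^{(t-1)}(\mathcal B_i^{(t)})+d_i^{(t-1)}$ with $|\mathcal B_i^{(t)}|=\mathcal S_2$; - $V_x^{(t)}=W(V_x^{(t-1)}+D_x^{(t)}-D_x^{(t-1)})$. For $t\ge0$: $V_y^{(t)}=D_y^{(t)}-\frac{L\sqrt m}{2}(W-I)^\top\Lambda^{(t)}$, $\Lambda^{(t+1)}=\Lambda^{(t)}+\frac{L\eta_\Lambda}{2\sqrt m}(W-I)Y^{(t)}$, $X^{(t+1)}=\mathrm{prox}_{\eta_xg}(WX^{(t)}-\eta_xV_x^{(t)})$, $Y^{(t+1)}=\mathrm{prox}_{\eta_yh}(Y^{(t)}+\eta_yV_y^{(t)})$. In the general case $\mathcal S_0=\mathcal S_1$; in the finite-sum case with $\mathcal S_0=\mathcal S_1=n$ each such batch consists of all $n$ local samples. The algorithm is run for some number $T$ of iterations and the point returned is $(X^{(\tau)},\Lambda^{(\tau)})$ with $\tau$ uniform on $\{0,\dots,T-1\}$, independent of the samples. Each iteration counts as one neighbor communication; $T_s$ counts the stochastic gradients sampled per agent. $\mathcal O,\Theta$ hide absolute constants, and the equalities for $T_s$ are understood up to such constants.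
   Formalization: In the general stochastic case T_s is of order S_1+√S_1·T_c (S_1 rounded up to at least 1); the printed T_s=s·T_c, s=(σ/ε)max{κ,(1−ρ)^-2}, is claimed only if s≤T_c and unrounded S_1≥1, since the first batch alone costs about s² and σ=0 would give T_s=0. *)

theory Defs
  imports "HOL-Probability.Probability"
begin

section \<open>Convexity, gradients and proximal maps\<close>

definition effective_domain :: "('a \<Rightarrow> ereal) \<Rightarrow> 'a set" where
  "effective_domain r = {v. r v < \<infinity>}"

definition closed_convex_fun :: "('a::real_normed_vector \<Rightarrow> ereal) \<Rightarrow> bool" where
  "closed_convex_fun r \<longleftrightarrow>
     (\<forall>v. r v \<noteq> -\<infinity>) \<and>
     convex {(v, c :: real). r v \<le> ereal c} \<and> closed {(v, c :: real). r v \<le> ereal c}"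

definition strongly_concave :: "real \<Rightarrow> ('a::real_normed_vector \<Rightarrow> real) \<Rightarrow> bool" where
  "strongly_concave \<mu> F \<longleftrightarrow>
     (\<forall>u v. \<forall>s\<in>{0..1}.
        F (s *\<^sub>R u + (1 - s) *\<^sub>R v)
          \<ge> s * F u + (1 - s) * F v + \<mu> / 2 * s * (1 - s) * (norm (u - v))\<^sup>2)"

definition gradient :: "('a::real_inner \<Rightarrow> real) \<Rightarrow> 'a \<Rightarrow> 'a" where
  "gradient F u = (THE D. GDERIV F u :> D)"

definition smooth_fun :: "real \<Rightarrow> ('a::real_inner \<Rightarrow> real) \<Rightarrow> bool" where
  "smooth_fun K F \<longleftrightarrow> (\<forall>u. \<exists>D. GDERIV F u :> D) \<and> K-lipschitz_on UNIV (gradient F)"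

definition prox :: "('a::real_normed_vector \<Rightarrow> ereal) \<Rightarrow> 'a \<Rightarrow> 'a" where
  "prox r u = (ARG_MIN (\<lambda>v. r v + ereal (1 / 2 * (norm (v - u))\<^sup>2)) v. True)"

definition prox_rows :: "(real^'d \<Rightarrow> ereal) \<Rightarrow> real^'d^'m \<Rightarrow> real^'d^'m" where
  "prox_rows r U = (\<chi> i. prox r (U $ i))"

section \<open>Stacked variables\<close>

text \<open>
  A stacked variable in $R^{m \times d}$ has type \<open>real^'d^'m\<close>: its rows \<open>X $ i\<close> are the
  local copies, \<open>W ** X\<close> is the matrix product, and the Euclidean \<open>norm\<close> and inner product
  of this type are the Frobenius ones.
\<close>

definition all_rows :: "real^'d \<Rightarrow> real^'d^'m" where
  "all_rows u = (\<chi> i. u)"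

definition row_mean :: "real^'d^'m \<Rightarrow> real^'d" where
  "row_mean X = (1 / real CARD('m)) *\<^sub>R (\<Sum>i\<in>UNIV. X $ i)"

definition row_dev :: "real^'d^'m \<Rightarrow> real^'d^'m" where
  "row_dev X = X - all_rows (row_mean X)"

section \<open>The decentralized minimax problem\<close>

text \<open>
  The field \<open>sgrad\<close> is the stochastic gradient oracle; only the conditions imposed by
  \<open>stochastic_smooth\<close> below relate it to \<open>cost\<close>.
\<close>

record ('m::finite, 'a, 'b, 's) problem =
  cost :: "'m \<Rightarrow> (real^'a) \<times> (real^'b) \<Rightarrow> 's \<Rightarrow> real"
  sgrad :: "'m \<Rightarrow> (real^'a) \<times> (real^'b) \<Rightarrow> 's \<Rightarrow> (real^'a) \<times> (real^'b)"
  law :: "'m \<Rightarrow> 's measure"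
  reg_x :: "real^'a \<Rightarrow> ereal"
  reg_y :: "real^'b \<Rightarrow> ereal"
  mixing :: "real^'m^'m"
  Lip :: real
  scv :: real

definition local_fun ::
  "('m::finite, 'a::finite, 'b::finite, 's) problem \<Rightarrow> 'm \<Rightarrow> (real^'a) \<times> (real^'b) \<Rightarrow> real" where
  "local_fun p i z = (\<integral>\<xi>. cost p i z \<xi> \<partial>law p i)"

definition kappa :: "('m::finite, 'a::finite, 'b::finite, 's) problem \<Rightarrow> real" where
  "kappa p = Lip p / scv p"

definition rho :: "('m::finite, 'a::finite, 'b::finite, 's) problem \<Rightarrow> real" where
  "rho p = onorm (\<lambda>v. (mixing p - (\<chi> i j. 1 / real CARD('m))) *v v)"

definition Phi ::
  "('m::finite, 'a::finite, 'b::finite, 's) problem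
     \<Rightarrow> real^'a^'m \<Rightarrow> real^'b^'m \<Rightarrow> real^'b^'m \<Rightarrow> ereal" where
  "Phi p X \<Lambda> Y =
     ereal (1 / real CARD('m)) *
       (\<Sum>i\<in>UNIV. ereal (local_fun p i (X $ i, Y $ i)) - reg_y p (Y $ i))
     - ereal (Lip p / (2 * sqrt (real CARD('m))) * (\<Lambda> \<bullet> ((mixing p - mat 1) ** Y)))"

text \<open>
  Under the assumptions below the supremum is finite and attained, so \<open>Qmax\<close> is the maximum
  over \<open>Y\<close> and \<open>Yargmax\<close> the unique maximizer.
\<close>

definition Qmax ::
  "('m::finite, 'a::finite, 'b::finite, 's) problem \<Rightarrow> real^'a^'m \<Rightarrow> real^'b^'m \<Rightarrow> real" where
  "Qmax p X \<Lambda> = real_of_ereal (SUP Y. Phi p X \<Lambda> Y)"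

definition Yargmax ::
  "('m::finite, 'a::finite, 'b::finite, 's) problem \<Rightarrow> real^'a^'m \<Rightarrow> real^'b^'m \<Rightarrow> real^'b^'m" where
  "Yargmax p X \<Lambda> = (ARG_MAX (\<lambda>Y. Phi p X \<Lambda> Y) Y. True)"

definition Pmax ::
  "('m::finite, 'a::finite, 'b::finite, 's) problem \<Rightarrow> real^'a \<Rightarrow> real^'b^'m \<Rightarrow> real" where
  "Pmax p x \<Lambda> = Qmax p (all_rows x) \<Lambda>"

definition phi ::
  "('m::finite, 'a::finite, 'b::finite, 's) problem \<Rightarrow> real^'a \<Rightarrow> real^'b^'m \<Rightarrow> ereal" where
  "phi p x \<Lambda> = ereal (Pmax p x \<Lambda>) + reg_x p x"

definition primal_gap ::
  "('m::finite, 'a::finite, 'b::finite, 's) problem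
     \<Rightarrow> real^'a^'m \<Rightarrow> real^'b^'m \<Rightarrow> real^'b^'m \<Rightarrow> real" where
  "primal_gap p X \<Lambda> Y = Qmax p X \<Lambda> - real_of_ereal (Phi p X \<Lambda> Y)"

subsection \<open>Assumptions\<close>

text \<open>
  Joint measurability of the oracle makes the iterates random variables. For a law with finite
  space it follows from the mean-square Lipschitz condition in \<open>stochastic_smooth\<close>.
\<close>

definition well_posed :: "('m::finite, 'a::finite, 'b::finite, 's) problem \<Rightarrow> bool" where
  "well_posed p \<longleftrightarrow>
     closed_convex_fun (reg_x p) \<and> closed_convex_fun (reg_y p) \<and>
     (\<forall>i. prob_space (law p i)) \<and>
     (\<forall>i z. integrable (law p i) (cost p i z)) \<and>
     (\<forall>i. (\<lambda>(z, \<xi>). sgrad p i z \<xi>) \<in> borel_measurable (borel \<Otimes>\<^sub>M law p i))"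

definition concave_bounded ::
  "('m::finite, 'a::finite, 'b::finite, 's) problem \<Rightarrow> real \<Rightarrow> bool" where
  "concave_bounded p \<phi>lb \<longleftrightarrow>
     scv p > 0 \<and>
     (\<forall>i x. strongly_concave (scv p) (\<lambda>y. local_fun p i (x, y))) \<and>
     (\<forall>x \<Lambda>. phi p x \<Lambda> \<ge> ereal \<phi>lb) \<and>
     rel_interior (effective_domain (reg_y p)) \<noteq> {}"

definition mixing_matrix :: "('m::finite, 'a::finite, 'b::finite, 's) problem \<Rightarrow> bool" where
  "mixing_matrix p \<longleftrightarrow>
     {v. (mixing p - mat 1) *v v = 0} = span {1} \<and>
     transpose (mixing p) *v 1 = 1 \<and>
     rho p < 1 \<and>
     onorm (\<lambda>v. (mixing p - mat 1) *v v) \<le> 2"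

definition stochastic_smooth ::
  "('m::finite, 'a::finite, 'b::finite, 's) problem \<Rightarrow> real \<Rightarrow> bool" where
  "stochastic_smooth p \<sigma> \<longleftrightarrow>
     \<sigma> \<ge> 0 \<and>
     (\<forall>i. smooth_fun (Lip p) (local_fun p i)) \<and>
     (\<forall>i z. integrable (law p i) (sgrad p i z) \<and>
        (\<integral>\<xi>. sgrad p i z \<xi> \<partial>law p i) = gradient (local_fun p i) z) \<and>
     (\<forall>i z. integrable (law p i) (\<lambda>\<xi>. (norm (sgrad p i z \<xi> - gradient (local_fun p i) z))\<^sup>2) \<and>
        (\<integral>\<xi>. (norm (sgrad p i z \<xi> - gradient (local_fun p i) z))\<^sup>2 \<partial>law p i) \<le> \<sigma>\<^sup>2) \<and>
     (\<forall>i x y x' y'.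
        integrable (law p i) (\<lambda>\<xi>. (norm (sgrad p i (x, y) \<xi> - sgrad p i (x', y') \<xi>))\<^sup>2) \<and>
        (\<integral>\<xi>. (norm (sgrad p i (x, y) \<xi> - sgrad p i (x', y') \<xi>))\<^sup>2 \<partial>law p i)
          \<le> (Lip p)\<^sup>2 * ((norm (x - x'))\<^sup>2 + (norm (y - y'))\<^sup>2))"

text \<open>
  The law of the index image lives on the finite set of local samples, and counts repeated
  samples with multiplicity.
\<close>

definition finite_sum ::
  "('m::finite, 'a::finite, 'b::finite, 's) problem \<Rightarrow> nat \<Rightarrow> ('m \<Rightarrow> nat \<Rightarrow> 's) \<Rightarrow> bool" where
  "finite_sum p n \<zeta> \<longleftrightarrow>
     n \<ge> 1 \<and>
     (\<forall>i. law p i = distr (uniform_count_measure {..<n}) (count_space (\<zeta> i ` {..<n})) (\<zeta> i))"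

subsection \<open>Stationarity in expectation\<close>

definition prox_gradient_map ::
  "('m::finite, 'a::finite, 'b::finite, 's) problem
     \<Rightarrow> real \<Rightarrow> real^'a \<Rightarrow> real^'b^'m \<Rightarrow> real^'a" where
  "prox_gradient_map p \<eta> x \<Lambda> =
     (1 / \<eta>) *\<^sub>R
       (x - prox (\<lambda>v. ereal \<eta> * reg_x p v) (x - \<eta> *\<^sub>R gradient (\<lambda>x. Pmax p x \<Lambda>) x))"

definition stationary_in_expectation ::
  "('m::finite, 'a::finite, 'b::finite, 's) problem \<Rightarrow> 'w measure \<Rightarrow> real
     \<Rightarrow> ('w \<Rightarrow> real^'a^'m) \<Rightarrow> ('w \<Rightarrow> real^'b^'m) \<Rightarrow> bool" where
  "stationary_in_expectation p M \<epsilon> X \<Lambda> \<longleftrightarrow>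
     (\<exists>\<eta>>0.
        integrable M (\<lambda>\<omega>. (norm (prox_gradient_map p \<eta> (row_mean (X \<omega>)) (\<Lambda> \<omega>)))\<^sup>2) \<and>
        integrable M (\<lambda>\<omega>. (norm (row_dev (X \<omega>)))\<^sup>2) \<and>
        (\<integral>\<omega>. (norm (prox_gradient_map p \<eta> (row_mean (X \<omega>)) (\<Lambda> \<omega>)))\<^sup>2 \<partial>M)
          + (Lip p)\<^sup>2 / real CARD('m) * (\<integral>\<omega>. (norm (row_dev (X \<omega>)))\<^sup>2 \<partial>M) \<le> \<epsilon>\<^sup>2) \<and>
     integrable M (\<lambda>\<omega>. (norm (gradient (\<lambda>\<Lambda>. Pmax p (row_mean (X \<omega>)) \<Lambda>) (\<Lambda> \<omega>)))\<^sup>2) \<and>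
     (\<integral>\<omega>. (norm (gradient (\<lambda>\<Lambda>. Pmax p (row_mean (X \<omega>)) \<Lambda>) (\<Lambda> \<omega>)))\<^sup>2 \<partial>M) \<le> \<epsilon>\<^sup>2"

section \<open>The VRLM iteration with SPIDER gradients\<close>

definition L_P :: "('m::finite, 'a::finite, 'b::finite, 's) problem \<Rightarrow> real" where
  "L_P p = Lip p * sqrt (4 * (kappa p)\<^sup>2 + 1)"

definition eta_y :: "('m::finite, 'a::finite, 'b::finite, 's) problem \<Rightarrow> real" where
  "eta_y p = 1 / (4 * Lip p)"

definition eta_x :: "('m::finite, 'a::finite, 'b::finite, 's) problem \<Rightarrow> real" where
  "eta_x p =
     (let L = Lip p; \<kappa> = kappa p in
      min ((1 - rho p)\<^sup>2 / (180 * L_P p))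
          (1 / (20 * (L + 1) * (12 * \<kappa>\<^sup>2 + 2 * \<kappa> + 5))))"

definition eta_Lam :: "('m::finite, 'a::finite, 'b::finite, 's) problem \<Rightarrow> real" where
  "eta_Lam p =
     (let L = Lip p; \<kappa> = kappa p in
      min (5 * L_P p * (1 - rho p)\<^sup>2 / (24 * L\<^sup>2 * (12 * \<kappa>\<^sup>2 + \<kappa> + 1)))
          (1 / (2 * L_P p + 128 * L * \<kappa>\<^sup>2 + (L + 1) * (20 * \<kappa>\<^sup>2 + \<kappa> + 1) / 2
                + 4 * L\<^sup>2 * (12 * \<kappa>\<^sup>2 + \<kappa> + 1) / (30 * L_P p))))"

definition batch_grad ::
  "('m::finite, 'a::finite, 'b::finite, 's) problem
     \<Rightarrow> 'm \<Rightarrow> real^'a^'m \<Rightarrow> real^'b^'m \<Rightarrow> 's list \<Rightarrow> (real^'a) \<times> (real^'b)" where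
  "batch_grad p i X Y B = (1 / real (length B)) *\<^sub>R (\<Sum>\<xi>\<leftarrow>B. sgrad p i (X $ i, Y $ i) \<xi>)"

record ('m::finite, 'a, 'b) iterate =
  it_X :: "real^'a^'m"
  it_Lam :: "real^'b^'m"
  it_Y :: "real^'b^'m"
  it_d :: "'m \<Rightarrow> (real^'a) \<times> (real^'b)"
  it_Vx :: "real^'a^'m"

definition rows_x :: "('m::finite \<Rightarrow> (real^'a) \<times> (real^'b)) \<Rightarrow> real^'a^'m" where
  "rows_x d = (\<chi> i. fst (d i))"

definition rows_y :: "('m::finite \<Rightarrow> (real^'a) \<times> (real^'b)) \<Rightarrow> real^'b^'m" where
  "rows_y d = (\<chi> i. snd (d i))"

definition vrlm_step ::
  "('m::finite, 'a::finite, 'b::finite, 's) problem \<Rightarrow> bool \<Rightarrow> ('m \<Rightarrow> 's list)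
     \<Rightarrow> ('m, 'a, 'b) iterate \<Rightarrow> ('m, 'a, 'b) iterate" where
  "vrlm_step p checkpoint B st =
     (let L = Lip p; m = real CARD('m); W = mixing p;
          X = it_X st; \<Lambda> = it_Lam st; Y = it_Y st; d = it_d st; Vx = it_Vx st;
          Vy = rows_y d - (L * sqrt m / 2) *\<^sub>R (transpose (W - mat 1) ** \<Lambda>);
          \<Lambda>' = \<Lambda> + (L * eta_Lam p / (2 * sqrt m)) *\<^sub>R ((W - mat 1) ** Y);
          X' = prox_rows (\<lambda>v. ereal (eta_x p) * reg_x p v) (W ** X - eta_x p *\<^sub>R Vx);
          Y' = prox_rows (\<lambda>v. ereal (eta_y p) * reg_y p v) (Y + eta_y p *\<^sub>R Vy);
          d' = (\<lambda>i. if checkpoint then batch_grad p i X' Y' (B i)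
                    else batch_grad p i X' Y' (B i) - batch_grad p i X Y (B i) + d i);
          Vx' = W ** (Vx + rows_x d' - rows_x d)
      in \<lparr>it_X = X', it_Lam = \<Lambda>', it_Y = Y', it_d = d', it_Vx = Vx'\<rparr>)"

text \<open>\<open>B t i\<close> is the list of samples that agent \<open>i\<close> uses to form $d_i^{(t)}$.\<close>

primrec vrlm ::
  "('m::finite, 'a::finite, 'b::finite, 's) problem \<Rightarrow> real^'a \<Rightarrow> real^'b \<Rightarrow> nat
     \<Rightarrow> (nat \<Rightarrow> 'm \<Rightarrow> 's list) \<Rightarrow> nat \<Rightarrow> ('m, 'a, 'b) iterate" where
  "vrlm p x\<^sub>0 y\<^sub>0 q B 0 =
     (let X = all_rows x\<^sub>0; Y = all_rows y\<^sub>0; d = (\<lambda>i. batch_grad p i X Y (B 0 i))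
      in \<lparr>it_X = X, it_Lam = 0, it_Y = Y, it_d = d, it_Vx = rows_x d\<rparr>)"
| "vrlm p x\<^sub>0 y\<^sub>0 q B (Suc t) = vrlm_step p (q dvd Suc t) (B (Suc t)) (vrlm p x\<^sub>0 y\<^sub>0 q B t)"

definition stochastic_batches ::
  "nat \<Rightarrow> nat \<Rightarrow> nat \<Rightarrow> (nat \<times> 'm \<times> nat \<Rightarrow> 's) \<Rightarrow> nat \<Rightarrow> 'm \<Rightarrow> 's list" where
  "stochastic_batches S\<^sub>1 S\<^sub>2 q s t i =
     map (\<lambda>j. s (t, i, j)) [0..<(if q dvd t then S\<^sub>1 else S\<^sub>2)]"

definition finite_sum_batches ::
  "nat \<Rightarrow> ('m \<Rightarrow> nat \<Rightarrow> 's) \<Rightarrow> nat \<Rightarrow> nat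
     \<Rightarrow> (nat \<times> 'm \<times> nat \<Rightarrow> 's) \<Rightarrow> nat \<Rightarrow> 'm \<Rightarrow> 's list" where
  "finite_sum_batches n \<zeta> S\<^sub>2 q s t i =
     (if q dvd t then map (\<zeta> i) [0..<n] else map (\<lambda>j. s (t, i, j)) [0..<S\<^sub>2])"

text \<open>
  Number of stochastic gradients per agent in \<open>T\<close> iterations; away from the checkpoints each
  sample is used at two points.
\<close>

definition grad_count :: "nat \<Rightarrow> nat \<Rightarrow> nat \<Rightarrow> nat \<Rightarrow> nat" where
  "grad_count S\<^sub>1 S\<^sub>2 q T = (\<Sum>t<T. if q dvd t then S\<^sub>1 else 2 * S\<^sub>2)"

section \<open>Random samples and orders of magnitude\<close>

definition sampling ::
  "('m::finite, 'a::finite, 'b::finite, 's) problem \<Rightarrow> 'w measure \<Rightarrow> nat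
     \<Rightarrow> (nat \<times> 'm \<times> nat \<Rightarrow> 'w \<Rightarrow> 's) \<Rightarrow> ('w \<Rightarrow> nat) \<Rightarrow> bool" where
  "sampling p M T S \<tau> \<longleftrightarrow>
     prob_space M \<and>
     prob_space.indep_vars M (\<lambda>(t, i, j). law p i) S UNIV \<and>
     (\<forall>t i j. distr M (law p i) (S (t, i, j)) = law p i) \<and>
     \<tau> \<in> measurable M (count_space UNIV) \<and>
     distr M (count_space UNIV) \<tau> = measure_pmf (pmf_of_set {..<T}) \<and>
     prob_space.indep_set M
       (sets (vimage_algebra (space M) \<tau> (count_space UNIV)))
       (sets (vimage_algebra (space M) (\<lambda>\<omega> k. S k \<omega>) (\<Pi>\<^sub>M (t, i, j)\<in>UNIV. law p i)))"

definition initial_tracker_bound ::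
  "('m::finite, 'a::finite, 'b::finite, 's) problem \<Rightarrow> 'w measure \<Rightarrow> real
     \<Rightarrow> real^'a \<Rightarrow> real^'b \<Rightarrow> nat \<Rightarrow> ('w \<Rightarrow> nat \<Rightarrow> 'm \<Rightarrow> 's list) \<Rightarrow> bool" where
  "initial_tracker_bound p M C x\<^sub>0 y\<^sub>0 q B \<longleftrightarrow>
     (\<integral>\<omega>. (norm (row_dev (it_Vx (vrlm p x\<^sub>0 y\<^sub>0 q (B \<omega>) 0))))\<^sup>2 \<partial>M)
       \<le> C * (real CARD('m) * L_P p * (1 - rho p))"

definition initial_dual_bound ::
  "('m::finite, 'a::finite, 'b::finite, 's) problem \<Rightarrow> real \<Rightarrow> real^'a \<Rightarrow> real^'b \<Rightarrow> bool" where
  "initial_dual_bound p C x\<^sub>0 y\<^sub>0 \<longleftrightarrow>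
     (norm (Yargmax p (all_rows x\<^sub>0) 0 - all_rows y\<^sub>0))\<^sup>2
       \<le> C * min (real CARD('m) * kappa p / Lip p)
                (real CARD('m) * L_P p * kappa p * (1 - rho p)\<^sup>2 / (Lip p)\<^sup>2)"

definition vrlm_stationary ::
  "('m::finite, 'a::finite, 'b::finite, 's) problem \<Rightarrow> 'w measure \<Rightarrow> real
     \<Rightarrow> real^'a \<Rightarrow> real^'b \<Rightarrow> nat \<Rightarrow> ('w \<Rightarrow> nat \<Rightarrow> 'm \<Rightarrow> 's list) \<Rightarrow> ('w \<Rightarrow> nat) \<Rightarrow> bool" where
  "vrlm_stationary p M \<epsilon> x\<^sub>0 y\<^sub>0 q B \<tau> \<longleftrightarrow>
     stationary_in_expectation p M \<epsilon>
       (\<lambda>\<omega>. it_X (vrlm p x\<^sub>0 y\<^sub>0 q (B \<omega>) (\<tau> \<omega>)))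
       (\<lambda>\<omega>. it_Lam (vrlm p x\<^sub>0 y\<^sub>0 q (B \<omega>) (\<tau> \<omega>)))"

definition communication_order ::
  "('m::finite, 'a::finite, 'b::finite, 's) problem \<Rightarrow> real \<Rightarrow> real \<Rightarrow> real^'a \<Rightarrow> real^'b \<Rightarrow> real" where
  "communication_order p \<epsilon> \<phi>lb x\<^sub>0 y\<^sub>0 =
     (let X\<^sub>0 = all_rows x\<^sub>0 :: real^'a^'m; Y\<^sub>0 = all_rows y\<^sub>0 :: real^'b^'m;
          \<theta> = min 1 (kappa p * (1 - rho p)\<^sup>2)
      in Lip p * (kappa p)\<^sup>2 / (\<epsilon>\<^sup>2 * \<theta>)
           * (real_of_ereal (phi p (row_mean X\<^sub>0) 0) - \<phi>lb + primal_gap p X\<^sub>0 0 Y\<^sub>0 / \<theta> + 1))"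

definition noise_order :: "('m::finite, 'a::finite, 'b::finite, 's) problem \<Rightarrow> real \<Rightarrow> real \<Rightarrow> real" where
  "noise_order p \<epsilon> \<sigma> = \<sigma> / \<epsilon> * max (kappa p) (1 / (1 - rho p)\<^sup>2)"

definition same_order :: "real \<Rightarrow> real \<Rightarrow> real \<Rightarrow> bool" where
  "same_order C a b \<longleftrightarrow> b / C \<le> a \<and> a \<le> C * b"

text \<open>
  An absolute constant must be independent of the dimensions, which are types here, so it cannot
  be bound by a quantifier inside a theorem. The value is deliberately generous.
\<close>

definition theta_threshold :: real where
  "theta_threshold = 10 ^ 12"

end

theory Submission
  imports Defs
begin

text \<open>
  Fix a realization of the samples. Since $W$ may have negative entries, Jensen's inequality is not
  available for $WX$; instead the proximal step of agent $i$ is compared with $x_i$ itself, which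
  yields a descent inequality for $\frac1m\sum_i\phi(x_i,\Lambda)$ with a penalty
  $\frac1{\eta_x}\|X_\perp\|^2$. The remaining error terms are the distance of $Y$ to the inner
  maximizer, which contracts up to the drift of $(X,\Lambda)$; the ascent of $Y$, bounded by the
  decrease of the primal gap; the consensus errors of $X$ and of the tracker, which contract at rate
  $\rho$; and the SPIDER error. All of these inequalities are linear in squared norms, so they
  survive summation over the iterations and expectation. In expectation the SPIDER errors are at
  most $L^2$ times the squared steps of $X$ and $Y$ plus the checkpoint variance, because the
  increments are conditionally centered. For the given step sizes the system closes: the squared
  steps, weighted by $1/\eta_x$ and $1/\eta_\Lambda$, are bounded by the initial data, and they
  control both stationarity measures.
\<close>

section \<open>Closed convex functions and proximal maps\<close>

text \<open>The coupling term is linear in Y, so the inner maximum splits into one strongly concave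
  problem per agent in which the multiplier is only a linear tilt; regularity of the value functions
  is proved for one agent and averaged. Each local copy is evaluated with the functions of all
  agents, so descent is a double average over pairs (i, j); its first-order error cancels over j
  because tracking keeps the mean of the tracker equal to the mean of the gradient estimates. The
  penalty with factor 1/\<eta> is affordable since the summed squared consensus error is at most
  \<eta>^2/(1-\<rho>)^2 times the summed tracker error. The obstacle is circularity: gradient error,
  ascent of Y and dual distance bound one another. It is resolved by solving for the ascent of Y
  first. The SPIDER bound holds only in expectation, so the system is closed for abstract real
  sequences, later taken to be expectations. Constants such as 240, 138 and 19 are read off the step
  sizes; 10^12 leaves ample room above the largest factor that finally appears, less than 2 *
  10^6.\<close>

lemma closed_convex_real:
  assumes "closed_convex_fun r" "r v < \<infinity>"
  shows "r v = ereal (real_of_ereal (r v))"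
  using assms unfolding closed_convex_fun_def by (cases "r v") auto

lemma closed_convex_funD:
  fixes r :: "'a::real_normed_vector \<Rightarrow> ereal"
  assumes r: "closed_convex_fun r" and uv: "r u < \<infinity>" "r v < \<infinity>" and s: "s \<in> {0..1}"
  shows "r (s *\<^sub>R u + (1 - s) *\<^sub>R v) < \<infinity>"
    and "real_of_ereal (r (s *\<^sub>R u + (1 - s) *\<^sub>R v))
           \<le> s * real_of_ereal (r u) + (1 - s) * real_of_ereal (r v)"
proof -
  let ?E = "{(v, c :: real). r v \<le> ereal c}"
  have conv: "convex ?E" and ninf: "\<And>v. r v \<noteq> -\<infinity>"
    using r unfolding closed_convex_fun_def by auto
  have "(u, real_of_ereal (r u)) \<in> ?E" "(v, real_of_ereal (r v)) \<in> ?E"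
    using closed_convex_real[OF r] uv by (auto simp del: ereal_real)
  from convexD[OF conv this, of s "1 - s"] s
  have le: "r (s *\<^sub>R u + (1 - s) *\<^sub>R v)
      \<le> ereal (s * real_of_ereal (r u) + (1 - s) * real_of_ereal (r v))"
    by auto
  then show *: "r (s *\<^sub>R u + (1 - s) *\<^sub>R v) < \<infinity>"
    using le_less_trans[OF le, of "\<infinity>"] by simp
  obtain w where "r (s *\<^sub>R u + (1 - s) *\<^sub>R v) = ereal w"
    using closed_convex_real[OF r *] by blast
  with le show "real_of_ereal (r (s *\<^sub>R u + (1 - s) *\<^sub>R v))
           \<le> s * real_of_ereal (r u) + (1 - s) * real_of_ereal (r v)" by simp
qed

text \<open>Closed sublevel sets take the place of lower semicontinuity. Those at levels above the
  infimum are nonempty and nested, so a finite family of them meets in the one of smallest level; by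
  compactness all of them meet, and a common point attains the infimum.\<close>

lemma compact_attains_inf_ereal:
  fixes f :: "'a::topological_space \<Rightarrow> ereal"
  assumes K: "compact K" "K \<noteq> {}"
    and cl: "\<And>c::real. closed {v \<in> K. f v \<le> ereal c}"
  shows "\<exists>v\<in>K. \<forall>w\<in>K. f v \<le> f w"
proof -
  define I where "I = (INF w\<in>K. f w)"
  let ?F = "(\<lambda>c. {v \<in> K. f v \<le> ereal c}) ` {c. I < ereal c}"
  have "K \<inter> \<Inter> ?F \<noteq> {}"
  proof (rule compact_imp_fip)
    fix A assume A: "finite A" "A \<subseteq> ?F"
    then obtain C where C: "finite C" "C \<subseteq> {c. I < ereal c}"
      "A = (\<lambda>c. {v \<in> K. f v \<le> ereal c}) ` C"
      by (meson finite_subset_image)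
    show "K \<inter> \<Inter> A \<noteq> {}"
    proof (cases "C = {}")
      case False
      then have "I < ereal (Min C)"
        using C Min_in by blast
      then obtain v where v: "v \<in> K" "f v < ereal (Min C)"
        unfolding I_def by (meson INF_less_iff)
      have "f v \<le> ereal c" if "c \<in> C" for c
        using v(2) Min_le[OF C(1) that] by (meson ereal_less_eq(3) less_imp_le order_trans)
      then show ?thesis using v C by auto
    qed (use C K in auto)
  qed (use K cl in auto)
  then obtain v where v: "v \<in> K" "\<And>c. I < ereal c \<Longrightarrow> f v \<le> ereal c" by auto
  have "f v \<le> I"
  proof (rule ccontr)
    assume "\<not> f v \<le> I"
    then obtain c where "I < ereal c" "ereal c < f v"
      using ereal_dense2[of I "f v"] by (auto simp: not_le)
    with v(2)[of c] show False by simp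
  qed
  then show ?thesis
    using v(1) unfolding I_def by (meson INF_lower order_trans)
qed

text \<open>Compactness bounds the sum from below on the unit ball around \<open>v0\<close>, and
  strong convexity propagates this bound: a far point no worse than \<open>v0\<close> would force a
  value below it at distance one. So the search reduces to a ball; the bound plays the part of an
  affine minorant of \<open>r\<close>.\<close>

lemma closed_convex_plus_strongly_convex_min:
  fixes r :: "'a::euclidean_space \<Rightarrow> ereal" and s :: "'a \<Rightarrow> real"
  assumes r: "closed_convex_fun r" and v0: "r v0 < \<infinity>"
    and s: "continuous_on UNIV s" "strongly_concave \<mu> (\<lambda>v. - s v)" and \<mu>: "\<mu> > 0"
  shows "\<exists>x. r x < \<infinity> \<and> (\<forall>v. r v < \<infinity> \<longrightarrow>
      real_of_ereal (r x) + s x + \<mu> / 2 * (norm (v - x))\<^sup>2 \<le> real_of_ereal (r v) + s v)"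
proof -
  define R where "R v = real_of_ereal (r v)" for v
  define \<psi> where "\<psi> v = r v + ereal (s v)" for v
  have rR: "r v = ereal (R v)" if "r v < \<infinity>" for v
    using closed_convex_real[OF r that] unfolding R_def .
  have conv: "R (t *\<^sub>R u + (1 - t) *\<^sub>R v) + s (t *\<^sub>R u + (1 - t) *\<^sub>R v)
      \<le> t * (R u + s u) + (1 - t) * (R v + s v) - \<mu> / 2 * t * (1 - t) * (norm (u - v))\<^sup>2"
    if "r u < \<infinity>" "r v < \<infinity>" "t \<in> {0..1}" for u v t
  proof -
    have "s (t *\<^sub>R u + (1 - t) *\<^sub>R v)
        \<le> t * s u + (1 - t) * s v - \<mu> / 2 * t * (1 - t) * (norm (u - v))\<^sup>2"
      using s(2)[unfolded strongly_concave_def, rule_format, OF that(3), of u v] by argo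
    with closed_convex_funD(2)[OF r that] show ?thesis
      unfolding R_def by (simp add: algebra_simps)
  qed
  have closed_sub: "closed {v \<in> K. \<psi> v \<le> ereal c}" if "compact K" for K c
  proof -
    have "closed ((\<lambda>v. (v, c - s v)) -` {(v, c :: real). r v \<le> ereal c})"
      using r unfolding closed_convex_fun_def
      by (intro closed_vimage continuous_intros s) auto
    moreover have "{v \<in> K. \<psi> v \<le> ereal c} = K \<inter> (\<lambda>v. (v, c - s v)) -` {(v, c :: real). r v \<le> ereal c}"
    proof -
      have "\<psi> v \<le> ereal c \<longleftrightarrow> r v \<le> ereal (c - s v)" for v
        unfolding \<psi>_def by (cases "r v") auto
      then show ?thesis by auto
    qed
    ultimately show ?thesis using compact_imp_closed[OF that] by auto
  qed
  have att: "\<exists>v\<in>cball v0 b. \<forall>w\<in>cball v0 b. \<psi> v \<le> \<psi> w" if "b \<ge> 0" for b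
    by (rule compact_attains_inf_ereal) (use that closed_sub[OF compact_cball] in \<open>simp_all del: mem_cball\<close>)
  obtain v1 where v1: "v1 \<in> cball v0 1" "\<And>w. w \<in> cball v0 1 \<Longrightarrow> \<psi> v1 \<le> \<psi> w"
    using att[of 1] by auto
  have "\<psi> v1 \<le> \<psi> v0" using v1(2)[of v0] by simp
  then have fin1: "r v1 < \<infinity>"
    using v0 unfolding \<psi>_def by (cases "r v1"; cases "r v0") auto
  define C where "C = R v1 + s v1"
  have C: "C \<le> R w + s w" if "r w < \<infinity>" "w \<in> cball v0 1" for w
    using v1(2)[OF that(2)] unfolding \<psi>_def rR[OF that(1)] rR[OF fin1] C_def by simp
  \<comment> \<open>Solves \<mu>/2 * (N - 1) > (value at \<open>v0\<close>) - \<open>C\<close> for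
    the distance N; the \<open>max 1\<close> ensures that the point at distance one from
    \<open>v0\<close> lies on the segment.\<close>
  define b where "b = max 1 (1 + 2 * (R v0 + s v0 - C) / \<mu>)"
  have b0: "b \<ge> 0" unfolding b_def by simp
  have bnd: "v \<in> cball v0 b" if v: "r v < \<infinity>" "R v + s v \<le> R v0 + s v0" for v
  proof (rule ccontr)
    assume "v \<notin> cball v0 b"
    then have nb: "norm (v - v0) > b" by (simp add: dist_norm norm_minus_commute)
    define N where "N = norm (v - v0)"
    have N1: "N > 1" and NC: "N > 1 + 2 * (R v0 + s v0 - C) / \<mu>"
      using nb unfolding N_def b_def by auto
    define t where "t = 1 / N"
    have t: "t \<in> {0..1}" "t * N = 1" "0 < t" using N1 unfolding t_def by auto
    let ?w = "t *\<^sub>R v + (1 - t) *\<^sub>R v0"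
    have "?w - v0 = t *\<^sub>R (v - v0)" by (simp add: algebra_simps)
    then have "norm (?w - v0) = 1"
      using t N_def by (metis abs_of_pos norm_scaleR)
    then have "?w \<in> cball v0 1" by (simp add: dist_norm norm_minus_commute)
    then have "C \<le> R ?w + s ?w"
      using C closed_convex_funD(1)[OF r v(1) v0 t(1)] by blast
    also have "\<dots> \<le> t * (R v + s v) + (1 - t) * (R v0 + s v0) - \<mu> / 2 * t * (1 - t) * N\<^sup>2"
      using conv[OF v(1) v0 t(1)] unfolding N_def .
    also have "\<dots> \<le> t * (R v0 + s v0) + (1 - t) * (R v0 + s v0) - \<mu> / 2 * t * (1 - t) * N\<^sup>2"
      using mult_left_mono[OF v(2), of t] t by simp
    also have "\<mu> / 2 * t * (1 - t) * N\<^sup>2 = \<mu> / 2 * (t * N) * (N - t * N)"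
      by (simp add: power2_eq_square algebra_simps)
    finally have "\<mu> / 2 * (N - 1) \<le> R v0 + s v0 - C"
      unfolding t(2) by (simp add: algebra_simps)
    moreover have "\<mu> / 2 * (N - 1) > R v0 + s v0 - C"
      using NC \<mu> by (simp add: field_simps)
    ultimately show False by simp
  qed
  obtain x where x: "x \<in> cball v0 b" "\<And>w. w \<in> cball v0 b \<Longrightarrow> \<psi> x \<le> \<psi> w"
    using att[of b] b0 by blast
  have "v0 \<in> cball v0 b" unfolding b_def by simp
  then have xle0: "\<psi> x \<le> \<psi> v0" using x(2) by blast
  then have fx: "r x < \<infinity>"
    using v0 unfolding \<psi>_def by (cases "r x"; cases "r v0") auto
  have xmin: "R x + s x \<le> R v + s v" if v: "r v < \<infinity>" for v
  proof (cases "R v + s v \<le> R v0 + s v0")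
    case True
    then show ?thesis
      using x(2)[OF bnd[OF v True]] unfolding \<psi>_def rR[OF v] rR[OF fx] by simp
  next
    case False
    with xle0 show ?thesis unfolding \<psi>_def rR[OF v0] rR[OF fx] by simp
  qed
  have "R x + s x + \<mu> / 2 * (norm (v - x))\<^sup>2 \<le> R v + s v" if v: "r v < \<infinity>" for v
  proof -
    let ?N = "\<mu> / 2 * (norm (v - x))\<^sup>2"
    \<comment> \<open>Comparing the minimizer with the point a fraction \<open>1 - z\<close> of the
      way to \<open>v\<close> and dividing by \<open>1 - z\<close> leaves the factor
      \<open>z\<close>; letting \<open>z\<close> tend to 1 gives the growth with its full
      modulus.\<close>
    have "z * ?N \<le> R v + s v - (R x + s x)" if z: "0 < z" "z < 1" for z
    proof -
      let ?t = "1 - z"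
      have t: "?t \<in> {0..1}" using z by auto
      have "R x + s x \<le> R (?t *\<^sub>R v + (1 - ?t) *\<^sub>R x) + s (?t *\<^sub>R v + (1 - ?t) *\<^sub>R x)"
        by (rule xmin[OF closed_convex_funD(1)[OF r v fx t]])
      also have "\<dots> \<le> ?t * (R v + s v) + (1 - ?t) * (R x + s x) - \<mu> / 2 * ?t * (1 - ?t) * (norm (v - x))\<^sup>2"
        by (rule conv[OF v fx t])
      finally have "?t * (z * ?N) \<le> ?t * (R v + s v - (R x + s x))"
        by (simp add: algebra_simps)
      then show ?thesis using z by (simp add: mult_le_cancel_left)
    qed
    from field_le_mult_one_interval[OF this] show ?thesis by simp
  qed
  with fx show ?thesis unfolding R_def by blast
qed

text \<open>For half the squared distance, strong convexity with modulus one holds with equality;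
  this is the identity for \<open>A\<close> and \<open>B\<close>.\<close>

lemma strongly_concave_neg_half_dist:
  fixes u :: "'a::real_inner"
  shows "strongly_concave 1 (\<lambda>v. - (1 / 2 * (norm (v - u))\<^sup>2))"
  unfolding strongly_concave_def
proof (intro allI ballI)
  fix a b :: 'a and s :: real
  have key: "s * - (1 / 2 * x) + (1 - s) * - (1 / 2 * y) + 1 / 2 * s * (1 - s) * z \<le> - (1 / 2 * w)"
    if "w + s * (1 - s) * z = s * x + (1 - s) * y" for x y z w :: real
    using that by (simp add: field_simps)
  define A where "A = a - u"
  define B where "B = b - u"
  have 1: "s *\<^sub>R a + (1 - s) *\<^sub>R b - u = s *\<^sub>R A + (1 - s) *\<^sub>R B"
    unfolding A_def B_def by (simp add: algebra_simps)
  have 2: "a - b = A - B" unfolding A_def B_def by simp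
  have "(norm (s *\<^sub>R A + (1 - s) *\<^sub>R B))\<^sup>2 + s * (1 - s) * (norm (A - B))\<^sup>2
      = s * (norm A)\<^sup>2 + (1 - s) * (norm B)\<^sup>2"
    unfolding power2_norm_eq_inner
    by (simp add: inner_add_left inner_add_right inner_diff_left inner_diff_right inner_commute algebra_simps)
  then show "s * - (1 / 2 * (norm (a - u))\<^sup>2) + (1 - s) * - (1 / 2 * (norm (b - u))\<^sup>2) + 1 / 2 * s * (1 - s) * (norm (a - b))\<^sup>2
    \<le> - (1 / 2 * (norm (s *\<^sub>R a + (1 - s) *\<^sub>R b - u))\<^sup>2)"
    unfolding 1 2 A_def[symmetric] B_def[symmetric] by (rule key)
qed

text \<open>\<open>ARG_MIN\<close> chooses among minimizers. Quadratic growth around one of them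
  forces the chosen point to coincide with it, so the growth transfers to
  \<open>prox r u\<close>.\<close>

lemma prox_minimal:
  fixes r :: "'a::euclidean_space \<Rightarrow> ereal"
  assumes r: "closed_convex_fun r" and v0: "r v0 < \<infinity>"
  shows "r (prox r u) < \<infinity>"
    and "r v < \<infinity> \<Longrightarrow> real_of_ereal (r (prox r u)) + 1 / 2 * (norm (prox r u - u))\<^sup>2
           + 1 / 2 * (norm (v - prox r u))\<^sup>2 \<le> real_of_ereal (r v) + 1 / 2 * (norm (v - u))\<^sup>2"
proof -
  let ?f = "\<lambda>v. r v + ereal (1 / 2 * (norm (v - u))\<^sup>2)"
  have cont: "continuous_on UNIV (\<lambda>v. 1 / 2 * (norm (v - u))\<^sup>2)"
    by (intro continuous_intros)
  obtain x where x: "r x < \<infinity>" and growth: "\<And>v. r v < \<infinity> \<Longrightarrow>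
      real_of_ereal (r x) + 1 / 2 * (norm (x - u))\<^sup>2 + 1 / 2 * (norm (v - x))\<^sup>2
        \<le> real_of_ereal (r v) + 1 / 2 * (norm (v - u))\<^sup>2"
    using closed_convex_plus_strongly_convex_min[OF r v0 _ strongly_concave_neg_half_dist[of u]
      zero_less_one] by (metis (no_types, lifting) cont)
  have "is_arg_min ?f (\<lambda>_. True) x"
    unfolding is_arg_min_def
  proof (intro conjI TrueI notI)
    assume "\<exists>y. True \<and> ?f y < ?f x"
    then obtain y where y: "?f y < ?f x" by blast
    then have ry: "r y < \<infinity>" using x by (cases "r y") auto
    obtain a b where ab: "r x = ereal a" "r y = ereal b"
      using closed_convex_real[OF r x] closed_convex_real[OF r ry] by blast
    have "a + 1 / 2 * (norm (x - u))\<^sup>2 \<le> b + 1 / 2 * (norm (y - u))\<^sup>2"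
      using growth[OF ry] zero_le_power2[of "norm (y - x)"] unfolding ab real_of_ereal.simps by argo
    with y show False unfolding ab by simp
  qed
  then have am: "is_arg_min ?f (\<lambda>_. True) (prox r u)"
    unfolding prox_def arg_min_def by (rule someI)
  have px: "r (prox r u) < \<infinity>"
    using am x unfolding is_arg_min_def by (cases "r (prox r u)"; cases "r x") fastforce+
  have "?f (prox r u) \<le> ?f x"
    using am unfolding is_arg_min_def by (simp add: not_less)
  then have "real_of_ereal (r (prox r u)) + 1 / 2 * (norm (prox r u - u))\<^sup>2
      \<le> real_of_ereal (r x) + 1 / 2 * (norm (x - u))\<^sup>2"
    using closed_convex_real[OF r x] closed_convex_real[OF r px]
    by (cases "r x"; cases "r (prox r u)") auto
  with growth[OF px] have "(norm (prox r u - x))\<^sup>2 \<le> 0" by argo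
  then have "prox r u = x" by simp
  with x growth show "r (prox r u) < \<infinity>"
    and "r v < \<infinity> \<Longrightarrow> real_of_ereal (r (prox r u)) + 1 / 2 * (norm (prox r u - u))\<^sup>2
           + 1 / 2 * (norm (v - prox r u))\<^sup>2 \<le> real_of_ereal (r v) + 1 / 2 * (norm (v - u))\<^sup>2"
    by auto
qed

text \<open>The epigraph of the scaled function is the preimage of that of \<open>r\<close> under
  the linear map dividing heights by \<eta>.\<close>

lemma closed_convex_fun_scale:
  fixes r :: "'a::real_normed_vector \<Rightarrow> ereal"
  assumes r: "closed_convex_fun r" and \<eta>: "\<eta> > 0"
  shows "closed_convex_fun (\<lambda>v. ereal \<eta> * r v)"
proof -
  have iff: "ereal \<eta> * r v \<le> ereal c \<longleftrightarrow> r v \<le> ereal (c / \<eta>)" for v c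
    using \<eta> by (cases "r v") (auto simp: field_simps)
  have eq: "{(v, c :: real). ereal \<eta> * r v \<le> ereal c}
      = (\<lambda>(v, c). (v, c / \<eta>)) -` {(v, c :: real). r v \<le> ereal c}"
    unfolding iff by auto
  have lin: "linear (\<lambda>(v::'a, c::real). (v, c / \<eta>))"
    by (auto intro!: linearI simp: add_divide_distrib)
  have "convex {(v, c :: real). r v \<le> ereal c}" "closed {(v, c :: real). r v \<le> ereal c}"
    using r unfolding closed_convex_fun_def by auto
  moreover have "continuous_on UNIV (\<lambda>(v::'a, c::real). (v, c / \<eta>))"
    using \<eta> by (auto intro!: continuous_intros simp: case_prod_beta)
  ultimately have "convex {(v, c :: real). ereal \<eta> * r v \<le> ereal c}"
      "closed {(v, c :: real). ereal \<eta> * r v \<le> ereal c}"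
    unfolding eq by (blast intro: convex_linear_vimage[OF lin] closed_vimage)+
  moreover have "ereal \<eta> * r v \<noteq> -\<infinity>" for v
    using r \<eta> unfolding closed_convex_fun_def by (cases "r v") auto
  ultimately show ?thesis unfolding closed_convex_fun_def by blast
qed

text \<open>The term \<open>1 / 2 * (norm (v - x u))\<^sup>2\<close> gained from strong convexity is
  exactly the quadratic term in the expansion of the squared distance from \<open>v\<close> to
  \<open>u\<close> about \<open>x u\<close>, so only the linear subgradient term survives.
  Nonexpansiveness follows by adding the inequalities for \<open>u\<close> and \<open>u'\<close>,
  each tested at the other's proximal point.\<close>

lemma prox_scaled:
  fixes r :: "'a::euclidean_space \<Rightarrow> ereal"
  assumes r: "closed_convex_fun r" and v0: "r v0 < \<infinity>" and \<eta>: "\<eta> > 0"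
  defines "x \<equiv> \<lambda>u. prox (\<lambda>v. ereal \<eta> * r v) u"
  shows prox_scaled_finite: "r (x u) < \<infinity>"
    and prox_scaled_subgradient:
      "r v < \<infinity> \<Longrightarrow> real_of_ereal (r (x u)) + (1 / \<eta>) * ((u - x u) \<bullet> (v - x u)) \<le> real_of_ereal (r v)"
    and prox_scaled_nonexpansive: "norm (x u - x u') \<le> norm (u - u')"
proof -
  let ?r = "\<lambda>v. ereal \<eta> * r v"
  have r': "closed_convex_fun ?r" by (rule closed_convex_fun_scale[OF r \<eta>])
  have fin: "?r v < \<infinity> \<longleftrightarrow> r v < \<infinity>" for v
    using \<eta> r by (cases "r v") (auto simp: closed_convex_fun_def)
  have re: "real_of_ereal (?r v) = \<eta> * real_of_ereal (r v)" for v by simp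
  have finx: "r (x u) < \<infinity>" for u
    using prox_minimal(1)[OF r', of v0 u] fin v0 unfolding x_def by auto
  then show "r (x u) < \<infinity>" .
  have sub: "real_of_ereal (r (x u)) + (1 / \<eta>) * ((u - x u) \<bullet> (v - x u)) \<le> real_of_ereal (r v)"
    if v: "r v < \<infinity>" for u v
  proof -
    have "\<eta> * real_of_ereal (r (x u)) + 1 / 2 * (norm (x u - u))\<^sup>2
           + 1 / 2 * (norm (v - x u))\<^sup>2 \<le> \<eta> * real_of_ereal (r v) + 1 / 2 * (norm (v - u))\<^sup>2"
      using prox_minimal(2)[OF r', of v0 v u] v v0 unfolding fin re x_def by auto
    moreover have "(norm (v - u))\<^sup>2 = (norm (v - x u))\<^sup>2 + (norm (x u - u))\<^sup>2 - 2 * ((u - x u) \<bullet> (v - x u))"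
    proof -
      have "(norm ((v - x u) - (u - x u)))\<^sup>2
          = (norm (v - x u))\<^sup>2 + (norm (u - x u))\<^sup>2 - 2 * ((u - x u) \<bullet> (v - x u))"
        unfolding power2_norm_eq_inner
        by (simp only: inner_diff_left[of "v - x u"] inner_diff_right[of _ "v - x u"]) (simp add: inner_commute)
      then show ?thesis by (simp add: norm_minus_commute)
    qed
    ultimately have "\<eta> * real_of_ereal (r (x u)) + ((u - x u) \<bullet> (v - x u)) \<le> \<eta> * real_of_ereal (r v)"
      by argo
    then have "(\<eta> * real_of_ereal (r (x u)) + ((u - x u) \<bullet> (v - x u))) / \<eta> \<le> (\<eta> * real_of_ereal (r v)) / \<eta>"
      using \<eta> by (intro divide_right_mono) auto
    then show ?thesis using \<eta> by (simp add: add_divide_distrib)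
  qed
  then show "r v < \<infinity> \<Longrightarrow> real_of_ereal (r (x u)) + (1 / \<eta>) * ((u - x u) \<bullet> (v - x u)) \<le> real_of_ereal (r v)" .
  have "(1 / \<eta>) * ((u - x u) \<bullet> (x u' - x u) + (u' - x u') \<bullet> (x u - x u')) \<le> 0"
    using sub[OF finx[of u'], of u] sub[OF finx[of u], of u'] by (simp add: algebra_simps)
  then have "(u - x u) \<bullet> (x u' - x u) + (u' - x u') \<bullet> (x u - x u') \<le> 0"
    using \<eta> by (simp add: divide_le_0_iff)
  then have "(norm (x u - x u'))\<^sup>2 \<le> (u - u') \<bullet> (x u - x u')"
    unfolding power2_norm_eq_inner by (simp add: inner_diff_left inner_diff_right inner_commute algebra_simps)
  also have "\<dots> \<le> norm (u - u') * norm (x u - x u')" by (rule norm_cauchy_schwarz)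
  finally have "norm (x u - x u') * norm (x u - x u') \<le> norm (u - u') * norm (x u - x u')"
    by (simp add: power2_eq_square)
  then show "norm (x u - x u') \<le> norm (u - u')"
    using mult_right_le_imp_le[of "norm (x u - x u')" "norm (x u - x u')" "norm (u - u')"]
    by (cases "norm (x u - x u') = 0") (simp, smt (verit) norm_ge_zero)
qed

section \<open>Smooth functions\<close>

lemma GDERIV_unique:
  assumes "GDERIV F u :> D" "GDERIV F u :> D'"
  shows "D = D'"
proof -
  have "(\<lambda>h. h \<bullet> D) = (\<lambda>h. h \<bullet> D')"
    using assms unfolding gderiv_def by (rule has_derivative_unique)
  then have "(D - D') \<bullet> D = (D - D') \<bullet> D'" by meson
  then have "(D - D') \<bullet> (D - D') = 0" by (simp add: inner_diff_right)
  then show ?thesis by simp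
qed

lemma gradient_eqI: "GDERIV F u :> D \<Longrightarrow> gradient F u = D"
  unfolding gradient_def by (rule the_equality) (simp_all add: GDERIV_unique)

lemma smooth_fun_GDERIV:
  assumes "smooth_fun K F"
  shows "GDERIV F u :> gradient F u"
proof -
  obtain D where "GDERIV F u :> D" using assms unfolding smooth_fun_def by blast
  then show ?thesis using gradient_eqI[of F u D] by simp
qed

lemma smooth_fun_gradient_lipschitz:
  "smooth_fun K F \<Longrightarrow> norm (gradient F u - gradient F v) \<le> K * norm (u - v)"
  unfolding smooth_fun_def using lipschitz_onD[of K UNIV "gradient F" u v] by (simp add: dist_norm)

lemma smooth_fun_nonneg: "smooth_fun K F \<Longrightarrow> 0 \<le> K"
  unfolding smooth_fun_def by (auto dest: lipschitz_on_nonneg)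

lemma GDERIV_line:
  fixes F :: "'a::real_inner \<Rightarrow> real"
  assumes "GDERIV F (u + s *\<^sub>R d) :> D"
  shows "((\<lambda>s. F (u + s *\<^sub>R d)) has_real_derivative d \<bullet> D) (at s)"
proof -
  have "((\<lambda>s. u + s *\<^sub>R d) has_derivative (\<lambda>h. h *\<^sub>R d)) (at s)"
    by (auto intro!: derivative_eq_intros)
  from has_derivative_compose[OF this assms[unfolded gderiv_def]]
  show ?thesis
    unfolding has_field_derivative_def by (rule has_derivative_eq_rhs) (simp add: fun_eq_iff)
qed

lemma smooth_fun_continuous:
  assumes "smooth_fun K F"
  shows "continuous_on S F"
  using has_derivative_continuous[OF smooth_fun_GDERIV[OF assms, unfolded gderiv_def]]
  by (simp add: continuous_at_imp_continuous_on)

lemma smooth_fun_gradient_continuous: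
  assumes "smooth_fun K F"
  shows "continuous_on S (gradient F)"
  using assms lipschitz_on_continuous_on[of K UNIV "gradient F"] continuous_on_subset[of UNIV _ S]
  unfolding smooth_fun_def by simp

lemma smooth_fun_uminus: 
  assumes "smooth_fun K F" shows "smooth_fun K (\<lambda>u. - F u)"
proof -
  have g: "GDERIV (\<lambda>u. - F u) u :> - gradient F u" for u
    by (rule GDERIV_minus[OF smooth_fun_GDERIV[OF assms]])
  then have "gradient (\<lambda>u. - F u) = (\<lambda>u. - gradient F u)" by (intro ext gradient_eqI)
  moreover have "K-lipschitz_on UNIV (\<lambda>u. - gradient F u)"
    using assms unfolding smooth_fun_def by (auto intro: lipschitz_on_minus)
  ultimately show ?thesis unfolding smooth_fun_def using g by auto
qed

text \<open>Descent lemma: subtracting the quadratic model along the segment leaves a function whose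
  derivative is nonpositive, by Cauchy-Schwarz and the Lipschitz gradient.\<close>

lemma smooth_fun_upper:
  fixes F :: "'a::real_inner \<Rightarrow> real"
  assumes F: "smooth_fun K F"
  shows "F v \<le> F u + (v - u) \<bullet> gradient F u + K / 2 * (norm (v - u))\<^sup>2"
proof -
  define d where "d = v - u"
  define \<phi> where "\<phi> s = F (u + s *\<^sub>R d) - s * (d \<bullet> gradient F u) - K / 2 * s\<^sup>2 * (norm d)\<^sup>2" for s
  have "\<phi> 1 \<le> \<phi> 0"
  proof (rule DERIV_nonpos_imp_nonincreasing[of 0 1 \<phi>])
    fix s :: real assume s: "0 \<le> s" "s \<le> 1"
    let ?y = "d \<bullet> gradient F (u + s *\<^sub>R d) - d \<bullet> gradient F u - K * s * (norm d)\<^sup>2"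
    have "(\<phi> has_real_derivative ?y) (at s)"
      unfolding \<phi>_def
      by (rule derivative_eq_intros GDERIV_line[OF smooth_fun_GDERIV[OF F]] refl | simp)+
    moreover have "?y \<le> 0"
    proof -
      have "d \<bullet> (gradient F (u + s *\<^sub>R d) - gradient F u) \<le> norm d * (K * norm (s *\<^sub>R d))"
        using norm_cauchy_schwarz[of d "gradient F (u + s *\<^sub>R d) - gradient F u"]
          smooth_fun_gradient_lipschitz[OF F, of "u + s *\<^sub>R d" u]
        by (smt (verit) add_diff_cancel_left' mult_left_mono norm_ge_zero)
      then show ?thesis using s by (simp add: inner_diff_right power2_eq_square algebra_simps)
    qed
    ultimately show "\<exists>y. (\<phi> has_real_derivative y) (at s) \<and> y \<le> 0" by blast
  qed simp
  then show ?thesis unfolding \<phi>_def d_def by simp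
qed

lemma smooth_fun_lower:
  fixes F :: "'a::real_inner \<Rightarrow> real"
  assumes F: "smooth_fun K F"
  shows "F v \<ge> F u + (v - u) \<bullet> gradient F u - K / 2 * (norm (v - u))\<^sup>2"
proof -
  have "gradient (\<lambda>u. - F u) u = - gradient F u"
    by (rule gradient_eqI[OF GDERIV_minus[OF smooth_fun_GDERIV[OF F]]])
  with smooth_fun_upper[OF smooth_fun_uminus[OF F], of v u] show ?thesis by simp
qed

text \<open>Meant for value functions: they are given as maxima, and a two-sided quadratic estimate
  is what the envelope argument delivers for them.\<close>

lemma GDERIV_quadratic_remainder:
  fixes F :: "'a::real_inner \<Rightarrow> real"
  assumes "\<And>v. \<bar>F v - F u - (v - u) \<bullet> D\<bar> \<le> K * (norm (v - u))\<^sup>2"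
  shows "GDERIV F u :> D"
  unfolding gderiv_def
proof (rule has_derivativeI_sandwich[of 1])
  show "bounded_linear (\<lambda>h. h \<bullet> D)" by (rule bounded_linear_inner_left)
  fix v assume "v \<noteq> u"
  then have "norm (v - u) > 0" by simp
  then show "norm (F v - F u - (v - u) \<bullet> D) / norm (v - u) \<le> K * norm (v - u)"
    using assms[of v] by (simp add: divide_le_eq power2_eq_square mult.assoc)
next
  have "((\<lambda>v. K * norm (v - u)) \<longlongrightarrow> K * norm (u - u)) (at u)" by (intro tendsto_intros)
  then show "((\<lambda>v. K * norm (v - u)) \<longlongrightarrow> 0) (at u)" by simp
qed simp

section \<open>Quadratic inequalities with weights\<close>

lemma power2_sum_le_weighted:
  fixes a b c :: real
  assumes "c > 0"
  shows "(a + b)\<^sup>2 \<le> (1 + c) * a\<^sup>2 + (1 + 1 / c) * b\<^sup>2"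
proof -
  have "0 \<le> (c * a - b)\<^sup>2 / c" using assms by simp
  also have "\<dots> = c * a\<^sup>2 - 2 * a * b + b\<^sup>2 / c"
    using assms by (simp add: power2_eq_square field_simps)
  finally show ?thesis by (simp add: power2_sum algebra_simps)
qed

lemma mult_le_weighted_squares:
  fixes a b c :: real
  assumes "c > 0"
  shows "a * b \<le> c / 2 * a\<^sup>2 + b\<^sup>2 / (2 * c)"
proof -
  have "0 \<le> (c * a - b)\<^sup>2 / (2 * c)" using assms by simp
  also have "\<dots> = c / 2 * a\<^sup>2 - a * b + b\<^sup>2 / (2 * c)"
    using assms by (simp add: power2_eq_square field_simps)
  finally show ?thesis by simp
qed

lemma norm_fst_le': "norm (fst z) \<le> norm z"
  and norm_snd_le': "norm (snd z) \<le> norm z"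
  using norm_fst_le[of "fst z" "snd z"] norm_snd_le[of "snd z" "fst z"] by simp_all

section \<open>The inner maximization of one agent\<close>

locale minimax_agent =
  fixes f :: "'a::euclidean_space \<times> 'b::euclidean_space \<Rightarrow> real" and h :: "'b \<Rightarrow> ereal"
    and L \<mu> :: real
  assumes smooth: "smooth_fun L f"
    and conc: "\<And>x. strongly_concave \<mu> (\<lambda>y. f (x, y))"
    and mu_pos: "0 < \<mu>"
    and h_ccf: "closed_convex_fun h"
    and h_dom: "\<exists>y. h y < \<infinity>"
begin

definition hr :: "'b \<Rightarrow> real" where "hr y = real_of_ereal (h y)"

text \<open>The tilt \<open>c\<close> is the only way in which the multiplier will enter. Where
  \<open>h\<close> is infinite, \<open>hr\<close> has the default value 0, so inequalities about
  competitors are restricted to points with \<open>h v < \<infinity>\<close>.\<close>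

definition obj :: "'a \<Rightarrow> 'b \<Rightarrow> 'b \<Rightarrow> real" where
  "obj x c y = f (x, y) - hr y - c \<bullet> y"

text \<open>Chosen by its growth property rather than as an arg max, so that strong concavity is
  available directly from the choice; attainment and uniqueness are consequences.\<close>

definition ystar :: "'a \<Rightarrow> 'b \<Rightarrow> 'b" where
  "ystar x c = (SOME y. h y < \<infinity> \<and>
     (\<forall>v. h v < \<infinity> \<longrightarrow> obj x c v + \<mu> / 2 * (norm (v - y))\<^sup>2 \<le> obj x c y))"

definition val :: "'a \<Rightarrow> 'b \<Rightarrow> real" where "val x c = obj x c (ystar x c)"

abbreviation gx :: "'a \<times> 'b \<Rightarrow> 'a" where "gx z \<equiv> fst (gradient f z)"
abbreviation gy :: "'a \<times> 'b \<Rightarrow> 'b" where "gy z \<equiv> snd (gradient f z)"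

lemma ystar_ex:
  "\<exists>y. h y < \<infinity> \<and> (\<forall>v. h v < \<infinity> \<longrightarrow> obj x c v + \<mu> / 2 * (norm (v - y))\<^sup>2 \<le> obj x c y)"
proof -
  obtain y0 where y0: "h y0 < \<infinity>" using h_dom by blast
  let ?s = "\<lambda>v. c \<bullet> v - f (x, v)"
  have cont: "continuous_on UNIV ?s"
    by (intro continuous_intros continuous_on_compose2[OF smooth_fun_continuous[OF smooth, of UNIV]]) auto
  have sc: "strongly_concave \<mu> (\<lambda>v. - ?s v)"
    unfolding strongly_concave_def
  proof (intro allI ballI)
    fix u v :: 'b and s :: real assume s: "s \<in> {0..1}"
    have "c \<bullet> (s *\<^sub>R u + (1 - s) *\<^sub>R v) = s * (c \<bullet> u) + (1 - s) * (c \<bullet> v)"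
      by (simp add: inner_add_right)
    then show "s * - ?s u + (1 - s) * - ?s v + \<mu> / 2 * s * (1 - s) * (norm (u - v))\<^sup>2
        \<le> - ?s (s *\<^sub>R u + (1 - s) *\<^sub>R v)"
      using conc[of x, unfolded strongly_concave_def, rule_format, OF s, of u v]
      by (simp add: algebra_simps)
  qed
  obtain y where y: "h y < \<infinity>" and "\<And>v. h v < \<infinity> \<Longrightarrow>
      real_of_ereal (h y) + ?s y + \<mu> / 2 * (norm (v - y))\<^sup>2 \<le> real_of_ereal (h v) + ?s v"
    using closed_convex_plus_strongly_convex_min[OF h_ccf y0 cont sc mu_pos] by blast
  then show ?thesis
    unfolding obj_def hr_def by (intro exI[of _ y]) (simp add: algebra_simps)
qed

lemma ystar_finite: "h (ystar x c) < \<infinity>"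
  and ystar_growth: "h v < \<infinity> \<Longrightarrow> obj x c v + \<mu> / 2 * (norm (v - ystar x c))\<^sup>2 \<le> val x c"
  using someI_ex[OF ystar_ex[of x c]] unfolding ystar_def[symmetric] val_def by blast+

lemma obj_le_val: "h v < \<infinity> \<Longrightarrow> obj x c v \<le> val x c"
  using ystar_growth[of v x c] mu_pos zero_le_power2[of "norm (v - ystar x c)"]
  by (smt (verit) mult_nonneg_nonneg divide_nonneg_nonneg)

lemma L_nonneg: "0 \<le> L"
  by (rule smooth_fun_nonneg[OF smooth])

section \<open>Smoothness and concavity estimates for one agent\<close>

lemma gradient_lipschitz:
  "norm (gradient f (x, y) - gradient f (x', y')) \<le> L * (norm (x - x') + norm (y - y'))"
proof -
  have "norm (gradient f (x, y) - gradient f (x', y')) \<le> L * norm ((x, y) - (x', y'))"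
    by (rule smooth_fun_gradient_lipschitz[OF smooth])
  also have "norm ((x, y) - (x', y')) \<le> norm (x - x') + norm (y - y')"
    using norm_Pair_le[of "x - x'" "y - y'"] by simp
  finally show ?thesis using L_nonneg mult_left_mono by blast
qed

lemma gx_lipschitz: "norm (gx (x, y) - gx (x', y')) \<le> L * (norm (x - x') + norm (y - y'))"
proof -
  have "norm (gx (x, y) - gx (x', y')) \<le> norm (gradient f (x, y) - gradient f (x', y'))"
    unfolding fst_diff[symmetric] by (rule norm_fst_le')
  then show ?thesis using gradient_lipschitz[of x y x' y'] by linarith
qed

text \<open>The mean value theorem is applied in the direction of \<open>y\<close> to the difference
  of \<open>f\<close> at \<open>x'\<close> and \<open>x\<close>: its derivative is a difference of
  gradients at points that differ only in the first component. This serves in place of a bound on a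
  mixed second derivative.\<close>

lemma f_cross_difference:
  "(f (x', y) - f (x, y)) - (f (x', y') - f (x, y')) \<le> L * norm (x' - x) * norm (y - y')"
proof -
  let ?d = "(0 :: 'a, y - y')"
  let ?\<phi> = "\<lambda>s. f ((x', y') + s *\<^sub>R ?d) - f ((x, y') + s *\<^sub>R ?d)"
  let ?D = "\<lambda>s. ?d \<bullet> gradient f ((x', y') + s *\<^sub>R ?d) - ?d \<bullet> gradient f ((x, y') + s *\<^sub>R ?d)"
  have "\<And>s. (?\<phi> has_real_derivative ?D s) (at s)"
    by (intro DERIV_diff GDERIV_line smooth_fun_GDERIV[OF smooth])
  then obtain s where s: "?\<phi> 1 - ?\<phi> 0 = (1 - 0) * ?D s"
    using MVT2[of 0 1 ?\<phi> ?D] by auto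
  have "?D s = ?d \<bullet> (gradient f ((x', y') + s *\<^sub>R ?d) - gradient f ((x, y') + s *\<^sub>R ?d))"
    by (simp only: inner_diff_right)
  also have "\<dots> \<le> norm ?d * norm (gradient f ((x', y') + s *\<^sub>R ?d) - gradient f ((x, y') + s *\<^sub>R ?d))"
    by (rule norm_cauchy_schwarz)
  also have "\<dots> \<le> norm ?d * (L * norm (((x', y') + s *\<^sub>R ?d) - ((x, y') + s *\<^sub>R ?d)))"
    by (intro mult_left_mono smooth_fun_gradient_lipschitz[OF smooth]) simp
  also have "\<dots> = L * norm (x' - x) * norm (y - y')"
    by (simp add: norm_Pair)
  finally show ?thesis using s by simp
qed

lemma f_upper_x: "f (x', y) \<le> f (x, y) + (x' - x) \<bullet> gx (x, y) + L / 2 * (norm (x' - x))\<^sup>2"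
  and f_lower_x: "f (x', y) \<ge> f (x, y) + (x' - x) \<bullet> gx (x, y) - L / 2 * (norm (x' - x))\<^sup>2"
  using smooth_fun_upper[OF smooth, of "(x', y)" "(x, y)"]
    smooth_fun_lower[OF smooth, of "(x, y)" "(x', y)"]
  by (simp_all add: inner_prod_def norm_Pair)

lemma f_upper_y: "f (x, y') \<le> f (x, y) + (y' - y) \<bullet> gy (x, y) + L / 2 * (norm (y' - y))\<^sup>2"
  and f_lower_y: "f (x, y') \<ge> f (x, y) + (y' - y) \<bullet> gy (x, y) - L / 2 * (norm (y' - y))\<^sup>2"
  using smooth_fun_upper[OF smooth, of "(x, y')" "(x, y)"]
    smooth_fun_lower[OF smooth, of "(x, y)" "(x, y')"]
  by (simp_all add: inner_prod_def norm_Pair)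

text \<open>Strong concavity at a point a small fraction \<open>s\<close> of the way to
  \<open>y'\<close>, combined with the smooth upper model there, costs an error of second order in
  \<open>s\<close>; dividing by \<open>s\<close> makes it vanish in the limit.\<close>

lemma f_concave_upper:
  "f (x, y') \<le> f (x, y) + (y' - y) \<bullet> gy (x, y) - \<mu> / 2 * (norm (y' - y))\<^sup>2"
proof -
  let ?N = "(norm (y' - y))\<^sup>2" and ?g = "(y' - y) \<bullet> gy (x, y)"
  have "f (x, y') - f (x, y) + \<mu> / 2 * ?N - ?g \<le> 0"
  proof (rule field_le_epsilon)
    fix e :: real assume e: "e > 0"
    \<comment> \<open>Small enough that the second-order error is at most \<open>e\<close>; the
      \<open>+ 1\<close> keeps the denominator positive when both points coincide.\<close>
    define s where "s = min 1 (e / ((L + \<mu>) / 2 * ?N + 1))"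
    have pos: "(L + \<mu>) / 2 * ?N + 1 > 0"
      using L_nonneg mu_pos by (simp add: add_nonneg_pos)
    have s: "0 < s" "s \<le> 1" "s * ((L + \<mu>) / 2 * ?N) \<le> e"
    proof -
      show "0 < s" "s \<le> 1" using e pos unfolding s_def by auto
      have "s * ((L + \<mu>) / 2 * ?N) \<le> s * ((L + \<mu>) / 2 * ?N + 1)"
        using \<open>0 < s\<close> by simp
      also have "\<dots> \<le> e"
        using pos by (subst pos_le_divide_eq[symmetric]) (simp_all add: s_def)
      finally show "s * ((L + \<mu>) / 2 * ?N) \<le> e" .
    qed
    have eq: "s *\<^sub>R y' + (1 - s) *\<^sub>R y = y + s *\<^sub>R (y' - y)" by (simp add: algebra_simps)
    have "s * f (x, y') + (1 - s) * f (x, y) + \<mu> / 2 * s * (1 - s) * ?N \<le> f (x, y + s *\<^sub>R (y' - y))"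
      using conc[of x, unfolded strongly_concave_def, rule_format, of s y' y] s unfolding eq by simp
    also have "\<dots> \<le> f (x, y) + s * ?g + L / 2 * (s\<^sup>2 * ?N)"
      using f_upper_y[of x "y + s *\<^sub>R (y' - y)" y] by (simp add: power_mult_distrib)
    finally have "s * (f (x, y') - f (x, y) + \<mu> / 2 * ?N - ?g) \<le> s * (s * ((L + \<mu>) / 2 * ?N))"
      by (simp add: algebra_simps power2_eq_square add_divide_distrib diff_divide_distrib)
    then have "f (x, y') - f (x, y) + \<mu> / 2 * ?N - ?g \<le> s * ((L + \<mu>) / 2 * ?N)"
      using s(1) by (simp add: mult_le_cancel_left_pos)
    then show "f (x, y') - f (x, y) + \<mu> / 2 * ?N - ?g \<le> 0 + e" using s(3) by linarith
  qed
  then show ?thesis by simp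
qed

text \<open>Compare the two quadratic models across a unit vector, which exists since the space is
  not trivial.\<close>

lemma mu_le_L: "\<mu> \<le> L"
proof -
  obtain b :: 'b where b: "b \<in> Basis" using nonempty_Basis by blast
  have "(\<mu> / 2) * (norm (b - 0))\<^sup>2 \<le> (L / 2) * (norm (b - 0))\<^sup>2"
    using f_concave_upper[of 0 b 0] f_lower_y[of 0 0 b] by linarith
  then show ?thesis using b by simp
qed

lemma L_pos: "0 < L"
  using mu_le_L mu_pos by linarith

text \<open>Testing the growth of each problem at the maximizer of the other cancels
  \<open>h\<close>; a mixed difference of \<open>f\<close> and a tilt term remain, both linear in
  the distance of the maximizers.\<close>

lemma ystar_lipschitz:
  "norm (ystar x' c' - ystar x c) \<le> (L * norm (x' - x) + norm (c' - c)) / \<mu>"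
proof -
  let ?y = "ystar x c" and ?y' = "ystar x' c'"
  let ?D = "norm (?y' - ?y)"
  have "\<mu> * ?D\<^sup>2 \<le> (obj x c ?y - obj x c ?y') + (obj x' c' ?y' - obj x' c' ?y)"
    using ystar_growth[OF ystar_finite[of x' c'], of x c] ystar_growth[OF ystar_finite[of x c], of x' c']
    unfolding val_def by (simp add: norm_minus_commute)
  also have "\<dots> = ((f (x', ?y') - f (x, ?y')) - (f (x', ?y) - f (x, ?y))) - (c' - c) \<bullet> (?y' - ?y)"
    unfolding obj_def by (simp add: inner_diff_left inner_diff_right)
  also have "\<dots> \<le> L * norm (x' - x) * ?D + norm (c' - c) * ?D"
    using f_cross_difference[of x' ?y' x ?y] Cauchy_Schwarz_ineq2[of "c' - c" "?y' - ?y"] by linarith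
  finally have "(\<mu> * ?D) * ?D \<le> (L * norm (x' - x) + norm (c' - c)) * ?D"
    by (simp add: power2_eq_square algebra_simps)
  then have "\<mu> * ?D \<le> L * norm (x' - x) + norm (c' - c)"
    using L_nonneg by (cases "?D = 0") (simp_all add: mult_le_cancel_right)
  then show ?thesis using mu_pos by (simp add: field_simps)
qed

lemma ystar_lipschitz':
  "norm (ystar x' c' - ystar x c) \<le> L / \<mu> * (norm (x' - x) + norm (c' - c) / L)"
proof -
  have "(L * norm (x' - x) + norm (c' - c)) / \<mu> = L / \<mu> * (norm (x' - x) + norm (c' - c) / L)"
    using L_pos mu_pos by (simp add: field_simps)
  then show ?thesis using ystar_lipschitz[of x' c' x c] by (simp only:)
qed

lemma continuous_on_ystar:
  assumes "continuous_on S X" "continuous_on S C"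
  shows "continuous_on S (\<lambda>w. ystar (X w) (C w))"
proof -
  have "((L + 1) / \<mu>)-lipschitz_on UNIV (\<lambda>z. ystar (fst z) (snd z))"
  proof (rule lipschitz_onI)
    fix z z' :: "'a \<times> 'b"
    have "L * norm (fst (z - z')) + norm (snd (z - z')) \<le> L * norm (z - z') + norm (z - z')"
      by (intro add_mono mult_left_mono norm_fst_le' norm_snd_le' L_nonneg)
    then have "(L * norm (fst z - fst z') + norm (snd z - snd z')) / \<mu> \<le> ((L + 1) * norm (z - z')) / \<mu>"
      using mu_pos by (intro divide_right_mono) (simp_all add: algebra_simps)
    then have "(L * norm (fst z - fst z') + norm (snd z - snd z')) / \<mu> \<le> (L + 1) / \<mu> * norm (z - z')"
      by simp
    then show "dist (ystar (fst z) (snd z)) (ystar (fst z') (snd z')) \<le> (L + 1) / \<mu> * dist z z'"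
      using ystar_lipschitz[of "fst z" "snd z" "fst z'" "snd z'"] unfolding dist_norm by linarith
  qed (use L_nonneg mu_pos in auto)
  from lipschitz_on_continuous_on[OF this]
  have "continuous_on S (\<lambda>w. (\<lambda>z. ystar (fst z) (snd z)) (X w, C w))"
    by (rule continuous_on_compose2) (use assms in \<open>auto intro!: continuous_intros\<close>)
  then show ?thesis by simp
qed

section \<open>Envelope estimates for the value function\<close>

text \<open>The new maximizer is a competitor in the old problem, and \<open>h\<close>
  cancels.\<close>

lemma val_diff_le:
  "val x' c' - val x c \<le> f (x', ystar x' c') - f (x, ystar x' c') - (c' - c) \<bullet> ystar x' c'"
  using obj_le_val[OF ystar_finite[of x' c'], of x c]
  unfolding val_def[of x' c'] obj_def by (simp add: inner_diff_left)

text \<open>Envelope theorem with explicit remainder. From below the old maximizer is kept; from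
  above the new one is replaced by the old one, at the price of its displacement, which
  \<open>ystar_lipschitz\<close> controls.\<close>

lemma val_linearization:
  "\<bar>val x' c' - val x c - ((x' - x) \<bullet> gx (x, ystar x c) - (c' - c) \<bullet> ystar x c)\<bar>
     \<le> L / 2 * (norm (x' - x))\<^sup>2 + (L * norm (x' - x) + norm (c' - c))\<^sup>2 / \<mu>"
proof -
  let ?y = "ystar x c" and ?y' = "ystar x' c'"
  let ?l = "(x' - x) \<bullet> gx (x, ?y) - (c' - c) \<bullet> ?y"
  let ?A = "L * norm (x' - x) + norm (c' - c)"
  have "?l - L / 2 * (norm (x' - x))\<^sup>2 \<le> val x' c' - val x c"
  proof -
    have "val x c - val x' c' \<le> f (x, ?y) - f (x', ?y) - (c - c') \<bullet> ?y" by (rule val_diff_le)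
    then show ?thesis using f_lower_x[of x ?y x'] by (simp add: inner_diff_left)
  qed
  moreover have "val x' c' - val x c \<le> ?l + L / 2 * (norm (x' - x))\<^sup>2 + ?A\<^sup>2 / \<mu>"
  proof -
    have "val x' c' - val x c \<le> f (x', ?y') - f (x, ?y') - (c' - c) \<bullet> ?y'" by (rule val_diff_le)
    also have "\<dots> \<le> f (x', ?y) - f (x, ?y) + L * norm (x' - x) * norm (?y' - ?y)
        - (c' - c) \<bullet> ?y + norm (c' - c) * norm (?y' - ?y)"
      using f_cross_difference[of x' ?y' x ?y] Cauchy_Schwarz_ineq2[of "c' - c" "?y' - ?y"]
      by (simp add: inner_diff_right)
    also have "\<dots> \<le> ?l + L / 2 * (norm (x' - x))\<^sup>2 + ?A * norm (?y' - ?y)"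
      using f_upper_x[of x' ?y x] by (simp add: algebra_simps)
    also have "?A * norm (?y' - ?y) \<le> ?A * (?A / \<mu>)"
      using L_nonneg by (intro mult_left_mono ystar_lipschitz) auto
    finally show ?thesis by (simp add: power2_eq_square)
  qed
  moreover have "?A\<^sup>2 / \<mu> \<ge> 0" using mu_pos by simp
  ultimately show ?thesis by linarith
qed

text \<open>With the same \<open>y\<close> on both sides, value and objective change alike up to a
  mixed difference of \<open>f\<close> and a tilt term, both proportional to the distance of
  \<open>y\<close> from the new maximizer.\<close>

lemma gap_move:
  assumes "h y < \<infinity>"
  shows "(val x' c' - obj x' c' y) - (val x c - obj x c y)
    \<le> (L * norm (x' - x) + norm (c' - c)) * norm (ystar x' c' - y)"
proof -
  let ?y' = "ystar x' c'"
  have "(val x' c' - obj x' c' y) - (val x c - obj x c y)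
      \<le> ((f (x', ?y') - f (x, ?y')) - (f (x', y) - f (x, y))) - (c' - c) \<bullet> (?y' - y)"
    using val_diff_le[of x' c' x c] unfolding obj_def by (simp add: inner_diff_left inner_diff_right)
  also have "\<dots> \<le> L * norm (x' - x) * norm (?y' - y) + norm (c' - c) * norm (?y' - y)"
    using f_cross_difference[of x' ?y' x y] Cauchy_Schwarz_ineq2[of "c' - c" "?y' - y"] by linarith
  finally show ?thesis by (simp add: algebra_simps)
qed

text \<open>The gradient is taken at the new maximizer, so no factor \<open>1 / \<mu>\<close>
  appears here; the distance of that maximizer from the current \<open>Y\<close> is charged
  separately.\<close>

lemma val_step:
  "val x' c' - val x c \<le> (x' - x) \<bullet> gx (x, ystar x' c') + L / 2 * (norm (x' - x))\<^sup>2 - (c' - c) \<bullet> ystar x' c'"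
  using val_diff_le[of x' c' x c] f_upper_x[of x' "ystar x' c'" x] by linarith

text \<open>One inexact proximal ascent step of length \<open>1 / (4 * L)\<close>, given by its optimality condition.\<close>

context
  fixes x :: 'a and c d y y' :: 'b
  assumes y: "h y < \<infinity>" and y': "h y' < \<infinity>"
    and sub: "\<And>v. h v < \<infinity> \<Longrightarrow> hr y' + (4 * L) * ((y - y') \<bullet> (v - y')) + (d - c) \<bullet> (v - y') \<le> hr v"
begin

text \<open>Optimality of the step at \<open>v = y\<close> contributes 4L; smoothness and Young's
  inequality for the gradient error each take L/2.\<close>

lemma prox_ascent:
  "obj x c y' - obj x c y \<ge> 3 * L * (norm (y' - y))\<^sup>2 - (norm (d - gy (x, y)))\<^sup>2 / (2 * L)"
proof -
  let ?N = "(norm (y' - y))\<^sup>2"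
  have N: "(y - y') \<bullet> (y - y') = ?N" by (simp add: power2_norm_eq_inner[symmetric] norm_minus_commute)
  have "hr y' + (4 * L) * ?N + (d - c) \<bullet> (y - y') \<le> hr y"
    using sub[OF y] unfolding N .
  then have "obj x c y' - obj x c y \<ge> f (x, y') - f (x, y) + (4 * L) * ?N - d \<bullet> (y' - y)"
    unfolding obj_def by (simp add: inner_diff_left inner_diff_right)
  moreover have "f (x, y') - f (x, y) \<ge> (y' - y) \<bullet> gy (x, y) - L / 2 * ?N"
    using f_lower_y[of x y y'] by linarith
  moreover have "(y' - y) \<bullet> gy (x, y) - d \<bullet> (y' - y) = - ((d - gy (x, y)) \<bullet> (y' - y))"
    by (simp add: inner_diff_left inner_diff_right inner_commute)
  moreover have "(d - gy (x, y)) \<bullet> (y' - y) \<le> norm (y' - y) * norm (d - gy (x, y))"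
    using norm_cauchy_schwarz[of "d - gy (x, y)" "y' - y"] by (simp add: mult.commute)
  moreover have "norm (y' - y) * norm (d - gy (x, y)) \<le> L / 2 * ?N + (norm (d - gy (x, y)))\<^sup>2 / (2 * L)"
    by (rule mult_le_weighted_squares[OF L_pos])
  ultimately show ?thesis by argo
qed

text \<open>Optimality is tested at the maximizer, and the product of differences is resolved by the
  three-point identity \<open>split\<close>. Strong concavity enters twice: as growth of the
  objective at \<open>y'\<close> and as the quadratic term of the tangent inequality at
  \<open>y\<close>.\<close>

lemma prox_contraction:
  "(2 * L + \<mu> / 4) * (norm (ystar x c - y'))\<^sup>2
     \<le> (2 * L - \<mu> / 2) * (norm (ystar x c - y))\<^sup>2 + (norm (d - gy (x, y)))\<^sup>2 / \<mu>"
proof -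
  let ?s = "ystar x c"
  let ?N = "(norm (y' - y))\<^sup>2" and ?D = "(norm (?s - y))\<^sup>2" and ?P = "(norm (?s - y'))\<^sup>2"
  define w where "w = (y - y') \<bullet> (?s - y')"
  have split: "2 * w = ?P + ?N - ?D"
  proof -
    have "(norm ((?s - y') - (y - y')))\<^sup>2 = ?P + (norm (y - y'))\<^sup>2 - 2 * ((y - y') \<bullet> (?s - y'))"
      unfolding power2_norm_eq_inner
      by (simp only: inner_diff_left[of "?s - y'"] inner_diff_right[of _ "?s - y'"]) (simp add: inner_commute)
    then show ?thesis unfolding w_def[symmetric] by (simp add: norm_minus_commute)
  qed
  have "hr y' + (4 * L) * w + (d - c) \<bullet> (?s - y') \<le> hr ?s"
    using sub[OF ystar_finite] unfolding w_def .
  moreover have "obj x c y' + \<mu> / 2 * ?P \<le> obj x c ?s"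
    using ystar_growth[OF y', of x c] unfolding val_def by (simp add: norm_minus_commute)
  ultimately have "\<mu> / 2 * ?P \<le> f (x, ?s) - f (x, y') - (2 * L) * (2 * w) - d \<bullet> (?s - y')"
    unfolding obj_def by (simp add: inner_diff_left inner_diff_right)
  moreover have "f (x, ?s) - f (x, y') \<le> gy (x, y) \<bullet> (?s - y') + L / 2 * ?N - \<mu> / 2 * ?D"
    using f_concave_upper[of x ?s y] f_lower_y[of x y y']
    by (simp add: inner_diff_left inner_diff_right inner_commute)
  moreover have "gy (x, y) \<bullet> (?s - y') - d \<bullet> (?s - y') \<le> norm (?s - y') * norm (d - gy (x, y))"
    using Cauchy_Schwarz_ineq2[of "d - gy (x, y)" "?s - y'"]
    by (simp add: inner_diff_left mult.commute abs_le_iff)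
  moreover have "norm (?s - y') * norm (d - gy (x, y)) \<le> (\<mu> / 2) / 2 * ?P + (norm (d - gy (x, y)))\<^sup>2 / (2 * (\<mu> / 2))"
    by (rule mult_le_weighted_squares) (use mu_pos in simp)
  moreover have "(2 * (\<mu> / 2)) = \<mu>" by simp
  ultimately have "\<mu> / 2 * ?P \<le> L / 2 * ?N - \<mu> / 2 * ?D - (2 * L) * (?P + ?N - ?D)
      + \<mu> / 4 * ?P + (norm (d - gy (x, y)))\<^sup>2 / \<mu>"
    unfolding split by simp
  \<comment> \<open>The squared step occurs with the coefficient L/2 - 2L, so it can be
    discarded.\<close>
  moreover have "L * ?N \<ge> 0" using L_nonneg by simp
  ultimately show ?thesis by (simp add: algebra_simps)
qed

text \<open>The contraction is measured against the old maximizer; passing to the new one adds the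
  drift of the maximizer, which is Lipschitz with constant \<open>K\<close> once tilts are divided
  by \<open>L\<close>.\<close>

lemma ystar_dist_recursion:
  fixes x' :: 'a and c' :: 'b
  defines "K \<equiv> L / \<mu>"
  shows "(norm (ystar x' c' - y'))\<^sup>2
    \<le> (1 - 1 / (4 * K)) * (norm (ystar x c - y))\<^sup>2 + K / 2 * (norm (d - gy (x, y)))\<^sup>2 / L\<^sup>2
      + 9 * K ^ 3 * (norm (x' - x) + norm (c' - c) / L)\<^sup>2"
proof -
  define a where "a = (norm (ystar x c - y))\<^sup>2"
  define q where "q = (norm (ystar x c - y'))\<^sup>2"
  define e where "e = (norm (d - gy (x, y)))\<^sup>2"
  define \<Delta> where "\<Delta> = norm (x' - x) + norm (c' - c) / L"
  have K1: "K \<ge> 1" unfolding K_def using mu_le_L mu_pos by simp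
  have muK: "\<mu> = L / K" unfolding K_def using L_pos by simp
  have "(2 * L + \<mu> / 4) * q \<le> (2 * L - \<mu> / 2) * a + e / \<mu>"
    using prox_contraction unfolding q_def a_def e_def .
  then have le: "4 * K / L * ((2 * L + \<mu> / 4) * q) \<le> 4 * K / L * ((2 * L - \<mu> / 2) * a + e / \<mu>)"
    using K1 L_pos by (intro mult_left_mono) auto
  have q: "(8 * K + 1) * q \<le> (8 * K - 2) * a + 4 * K\<^sup>2 * e / L\<^sup>2"
  proof -
    have "4 * K / L * ((2 * L + \<mu> / 4) * q) = (8 * K + 1) * q"
      using K1 L_pos unfolding muK by (simp add: field_simps)
    moreover have "4 * K / L * ((2 * L - \<mu> / 2) * a + e / \<mu>) = (8 * K - 2) * a + 4 * K\<^sup>2 * e / L\<^sup>2"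
      using K1 L_pos unfolding muK by (simp add: field_simps power2_eq_square)
    ultimately show ?thesis using le by (simp only:)
  qed
  have "norm (ystar x' c' - y') \<le> norm (ystar x c - y') + norm (ystar x' c' - ystar x c)"
    using norm_triangle_ineq[of "ystar x c - y'" "ystar x' c' - ystar x c"] by (simp add: algebra_simps)
  also have "norm (ystar x' c' - ystar x c) \<le> K * \<Delta>"
    using ystar_lipschitz'[of x' c' x c] unfolding K_def \<Delta>_def .
  finally have "(norm (ystar x' c' - y'))\<^sup>2 \<le> (norm (ystar x c - y') + K * \<Delta>)\<^sup>2"
    by (intro power_mono) auto
  \<comment> \<open>The weight \<open>1 / (8 * K)\<close> produces the factor
    \<open>(8 * K + 1) / (8 * K)\<close>, which matches the coefficient on the left of the fact
    \<open>q\<close> and leaves \<open>(8 * K - 2) / (8 * K)\<close>, that is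
    \<open>1 - 1 / (4 * K)\<close>.\<close>
  also have "\<dots> \<le> (1 + 1 / (8 * K)) * q + (1 + 1 / (1 / (8 * K))) * (K * \<Delta>)\<^sup>2"
    unfolding q_def by (rule power2_sum_le_weighted) (use K1 in simp)
  also have "(1 + 1 / (8 * K)) * q = ((8 * K + 1) * q) / (8 * K)"
    using K1 by (simp add: field_simps)
  also have "\<dots> \<le> ((8 * K - 2) * a + 4 * K\<^sup>2 * e / L\<^sup>2) / (8 * K)"
    using q K1 by (intro divide_right_mono) auto
  also have "\<dots> = (1 - 1 / (4 * K)) * a + K / 2 * e / L\<^sup>2"
    using K1 L_pos by (simp add: field_simps power2_eq_square)
  also have "(1 + 1 / (1 / (8 * K))) * (K * \<Delta>)\<^sup>2 \<le> 9 * K ^ 3 * \<Delta>\<^sup>2"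
  proof -
    have "(1 + 1 / (1 / (8 * K))) * (K * \<Delta>)\<^sup>2 = (1 + 8 * K) * (K\<^sup>2 * \<Delta>\<^sup>2)"
      by (simp add: power_mult_distrib)
    also have "\<dots> \<le> (9 * K) * (K\<^sup>2 * \<Delta>\<^sup>2)" using K1 by (intro mult_right_mono) auto
    finally show ?thesis by (simp add: power2_eq_square power3_eq_cube mult.assoc)
  qed
  finally show ?thesis unfolding a_def e_def \<Delta>_def by simp
qed

end

end

section \<open>Stacked variables and averages over the agents\<close>

definition avg :: "('m::finite \<Rightarrow> real) \<Rightarrow> real" where
  "avg F = (\<Sum>i\<in>UNIV. F i) / real CARD('m)"

lemma avg_mono: "(\<And>i. F i \<le> G i) \<Longrightarrow> avg F \<le> avg G"
  unfolding avg_def by (intro divide_right_mono sum_mono) auto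

lemma avg_nonneg: "(\<And>i. 0 \<le> F i) \<Longrightarrow> 0 \<le> avg F"
  unfolding avg_def by (intro divide_nonneg_nonneg sum_nonneg) auto

lemma avg_const [simp]: "avg (\<lambda>i::'m::finite. c) = c"
  unfolding avg_def by simp

lemma avg_add: "avg (\<lambda>i. F i + G i) = avg F + avg G"
  and avg_diff: "avg (\<lambda>i. F i - G i) = avg F - avg G"
  and avg_cmult: "avg (\<lambda>i. c * F i) = c * avg F"
  and avg_cmult_right: "avg (\<lambda>i. F i * c) = avg F * c"
  and avg_cdiv: "avg (\<lambda>i. F i / c) = avg F / c"
  unfolding avg_def
  by (simp_all add: sum.distrib sum_subtractf add_divide_distrib diff_divide_distrib
      sum_distrib_left sum_distrib_right sum_divide_distrib mult.commute)

lemmas avg_linear = avg_add avg_diff avg_cmult avg_cmult_right avg_cdiv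

lemma avg_sum: "avg (\<lambda>i. \<Sum>k\<in>A. F k i) = (\<Sum>k\<in>A. avg (F k))"
  unfolding avg_def by (subst sum.swap) (simp add: sum_divide_distrib)

lemma avg_power2_le: "(avg F)\<^sup>2 \<le> avg (\<lambda>i. (F i)\<^sup>2)"
proof -
  have "0 \<le> avg (\<lambda>i. (F i - avg F)\<^sup>2)" by (rule avg_nonneg) simp
  also have "(\<lambda>i. (F i - avg F)\<^sup>2) = (\<lambda>i. (F i)\<^sup>2 - 2 * avg F * F i + (avg F)\<^sup>2)"
    by (simp add: power2_eq_square algebra_simps)
  also have "avg \<dots> = avg (\<lambda>i. (F i)\<^sup>2) - (avg F)\<^sup>2"
    by (simp add: avg_add avg_diff avg_cmult power2_eq_square)
  finally show ?thesis by simp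
qed

section \<open>Frobenius norms of matrix products\<close>

lemma norm_matrix_rows: "(norm X)\<^sup>2 = (\<Sum>i\<in>UNIV. (norm (X $ i))\<^sup>2)"
  for X :: "real^'d::finite^'m::finite"
  by (simp add: power2_norm_eq_inner inner_vec_def)

lemma avg_norm_rows: "avg (\<lambda>i. (norm (X $ i))\<^sup>2) = (norm X)\<^sup>2 / real CARD('m)"
  for X :: "real^'d::finite^'m::finite"
  unfolding avg_def norm_matrix_rows ..

lemma avg_inner_rows: "avg (\<lambda>i. X $ i \<bullet> Y $ i) = (X \<bullet> Y) / real CARD('m)"
  for X :: "real^'d::finite^'m::finite"
  unfolding avg_def inner_vec_def[of X Y] ..

lemma norm_matrix_columns: "(norm X)\<^sup>2 = (\<Sum>j\<in>UNIV. (norm (column j X))\<^sup>2)"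
  for X :: "real^'d::finite^'m::finite"
  by (simp add: power2_norm_eq_inner inner_vec_def column_def) (rule sum.swap)

lemma column_matrix_mult: "column j (A ** X) = A *v column j X"
  unfolding column_def matrix_matrix_mult_def matrix_vector_mult_def by simp

text \<open>The squared Frobenius norm is a sum over columns, and a left factor acts on each column
  separately.\<close>

lemma norm_matrix_mult_le: "norm (A ** X) \<le> onorm (\<lambda>v. A *v v) * norm X"
  for A :: "real^'m::finite^'n::finite" and X :: "real^'d::finite^'m"
proof -
  have o: "0 \<le> onorm (\<lambda>v. A *v v)"
    by (rule onorm_pos_le) (rule matrix_vector_mul_bounded_linear)
  have "(norm (A ** X))\<^sup>2 \<le> (\<Sum>j\<in>UNIV. (onorm (\<lambda>v. A *v v) * norm (column j X))\<^sup>2)"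
    unfolding norm_matrix_columns column_matrix_mult
    by (intro sum_mono power_mono onorm matrix_vector_mul_bounded_linear) auto
  also have "\<dots> = (onorm (\<lambda>v. A *v v) * norm X)\<^sup>2"
    unfolding power_mult_distrib norm_matrix_columns[of X] by (rule sum_distrib_left[symmetric])
  finally show ?thesis
    by (rule power2_le_imp_le) (use o in auto)
qed

lemma matrix_mult_row: "(A ** X) $ i = (\<Sum>j\<in>UNIV. A $ i $ j *\<^sub>R X $ j)"
  for A :: "real^'m::finite^'n::finite" and X :: "real^'d::finite^'m"
  by (simp add: vec_eq_iff matrix_matrix_mult_def)

lemma inner_matrix_mult: "(A ** X) \<bullet> Y = X \<bullet> (transpose A ** Y)"
  for A :: "real^'m::finite^'n::finite" and X :: "real^'d::finite^'m"
  unfolding inner_vec_def[of "A ** X"] inner_vec_def[of X] matrix_mult_row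
  by (simp add: inner_sum_left inner_sum_right transpose_def) (rule sum.swap)

text \<open>Duality: for \<open>Z = transpose A ** Y\<close> the squared norm of \<open>Z\<close> is
  the inner product of \<open>A ** Z\<close> with \<open>Y\<close>.\<close>

lemma norm_transpose_mult_le:
  assumes "\<And>X :: real^'d::finite^'m::finite. norm (A ** X) \<le> K * norm X"
  shows "norm (transpose A ** Y) \<le> K * norm (Y :: real^'d^'n::finite)"
proof -
  let ?Z = "transpose A ** Y"
  have "norm ?Z * norm ?Z = (A ** ?Z) \<bullet> Y"
    by (subst inner_matrix_mult) (simp add: power2_norm_eq_inner[symmetric] power2_eq_square)
  also have "\<dots> \<le> norm (A ** ?Z) * norm Y" by (rule norm_cauchy_schwarz)
  also have "\<dots> \<le> K * norm ?Z * norm Y" by (intro mult_right_mono assms) simp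
  finally have le: "norm ?Z * norm ?Z \<le> (K * norm Y) * norm ?Z" by (simp add: mult_ac)
  show ?thesis
  proof (cases "norm ?Z = 0")
    case True
    \<comment> \<open>If the image is zero, the bound still requires \<open>0 \<le> K\<close>, which
      the hypothesis yields at any matrix of norm one.\<close>
    obtain X :: "real^'d^'m" where "norm X = 1"
      using vector_choose_size[of 1] by (metis zero_le_one)
    then have "0 \<le> K"
      using order_trans[OF norm_ge_zero assms[of X]] by simp
    then show ?thesis using True by simp
  next
    case False
    with le show ?thesis by (simp only: mult_le_cancel_right) (smt (verit) norm_ge_zero)
  qed
qed

section \<open>Row means and deviations\<close>

lemma all_rows_nth [simp]: "all_rows u $ i = u"
  unfolding all_rows_def by simp

lemma row_dev_nth: "row_dev X $ i = X $ i - row_mean X"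
  unfolding row_dev_def by simp

lemma norm_row_mean_power2: "(norm (row_mean X))\<^sup>2 \<le> avg (\<lambda>i. (norm (X $ i))\<^sup>2)"
  for X :: "real^'d::finite^'m::finite"
proof -
  have "norm (row_mean X) \<le> avg (\<lambda>i. norm (X $ i))"
    unfolding row_mean_def avg_def using norm_sum[of "\<lambda>i. X $ i" UNIV] by (simp add: divide_right_mono)
  then have "(norm (row_mean X))\<^sup>2 \<le> (avg (\<lambda>i. norm (X $ i)))\<^sup>2" by (rule power_mono) simp
  also have "\<dots> \<le> avg (\<lambda>i. (norm (X $ i))\<^sup>2)" by (rule avg_power2_le)
  finally show ?thesis .
qed

lemma avg_inner_row_mean: "avg (\<lambda>i. X $ i \<bullet> u) = row_mean X \<bullet> u"
  for X :: "real^'d::finite^'m::finite"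
  unfolding avg_def row_mean_def by (simp add: inner_sum_left)

lemma row_mean_add: "row_mean (X + Y) = row_mean X + row_mean Y"
  and row_mean_diff: "row_mean (X - Y) = row_mean X - row_mean Y"
  and row_mean_scaleR: "row_mean (c *\<^sub>R X) = c *\<^sub>R row_mean X"
  unfolding row_mean_def
  by (simp_all add: sum.distrib sum_subtractf scaleR_right_distrib scaleR_right_diff_distrib
      scaleR_sum_right[symmetric])

lemma row_dev_add: "row_dev (X + Y) = row_dev X + row_dev Y"
  and row_dev_diff: "row_dev (X - Y) = row_dev X - row_dev Y"
  and row_dev_scaleR: "row_dev (c *\<^sub>R X) = c *\<^sub>R row_dev X"
  by (simp_all add: vec_eq_iff row_dev_nth row_mean_add row_mean_diff row_mean_scaleR algebra_simps
      flip: scaleR_conv_of_real)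

lemma row_mean_all_rows [simp]: "row_mean (all_rows u :: real^'d^'m) = u"
  for u :: "real^'d::finite"
  unfolding row_mean_def by (simp add: sum_constant_scaleR del: sum_constant)

lemma norm_add_power2: "(norm (a + b))\<^sup>2 = (norm a)\<^sup>2 + (norm b)\<^sup>2 + 2 * (a \<bullet> b)"
  for a :: "'a::real_inner"
  by (simp add: power2_norm_eq_inner inner_add_left inner_add_right inner_commute)

text \<open>Variance decomposition: the cross term vanishes because deviations have mean zero. It
  makes the mean the best common row and later evaluates pairwise distances of the copies.\<close>

lemma avg_dist_row_mean:
  "avg (\<lambda>i. (norm (X $ i - u))\<^sup>2) = avg (\<lambda>i. (norm (X $ i - row_mean X))\<^sup>2) + (norm (row_mean X - u))\<^sup>2"
  for X :: "real^'d::finite^'m::finite"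
proof -
  have sq: "(norm (X $ i - u))\<^sup>2 = (norm (X $ i - row_mean X))\<^sup>2 + (norm (row_mean X - u))\<^sup>2
      + 2 * (row_dev X $ i \<bullet> (row_mean X - u))" for i
  proof -
    have e: "X $ i - u = (X $ i - row_mean X) + (row_mean X - u)" by simp
    show ?thesis unfolding row_dev_nth by (subst e) (rule norm_add_power2)
  qed
  have "row_mean (row_dev X) = 0" unfolding row_dev_def row_mean_diff by simp
  then show ?thesis
    unfolding sq avg_linear avg_inner_row_mean by simp
qed

lemma norm_row_dev_le: "(norm (row_dev X))\<^sup>2 \<le> (norm (X - all_rows u))\<^sup>2"
  for X :: "real^'d::finite^'m::finite"
proof -
  have "avg (\<lambda>i. (norm (row_dev X $ i))\<^sup>2) \<le> avg (\<lambda>i. (norm ((X - all_rows u) $ i))\<^sup>2)"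
    using avg_dist_row_mean[of X u] by (simp add: row_dev_nth)
  then show ?thesis unfolding avg_norm_rows by (simp add: divide_le_cancel)
qed

lemma norm_row_dev_le_norm: "norm (row_dev X) \<le> norm X"
  for X :: "real^'d::finite^'m::finite"
proof -
  have "X - all_rows 0 = X" by (simp add: vec_eq_iff)
  then show ?thesis using norm_row_dev_le[of X 0] by (metis norm_ge_zero power2_le_imp_le)
qed

section \<open>Maximization over the stacked dual variable\<close>

locale vrlm_problem =
  fixes p :: "('m::finite, 'a::finite, 'b::finite, 's) problem" and \<phi>lb \<sigma> :: real
    and x\<^sub>0 :: "real^'a" and y\<^sub>0 :: "real^'b"
  assumes Lip_ge_1: "Lip p \<ge> 1"
    and wp: "well_posed p"
    and cb: "concave_bounded p \<phi>lb"
    and mix: "mixing_matrix p"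
    and ss: "stochastic_smooth p \<sigma>"
    and x0: "reg_x p x\<^sub>0 < \<infinity>" and y0: "reg_y p y\<^sub>0 < \<infinity>"
begin

abbreviation "L \<equiv> Lip p"
abbreviation "W \<equiv> mixing p"
abbreviation "f \<equiv> local_fun p"
abbreviation "h \<equiv> reg_y p"
abbreviation "g \<equiv> reg_x p"
abbreviation gr :: "real^'a \<Rightarrow> real" where "gr x \<equiv> real_of_ereal (g x)"
abbreviation "\<kappa> \<equiv> kappa p"
abbreviation "r\<^sub>1 \<equiv> 1 - rho p"

abbreviation "ys i \<equiv> minimax_agent.ystar (f i) h (scv p)"
abbreviation "vl i \<equiv> minimax_agent.val (f i) h (scv p)"
abbreviation "ob i \<equiv> minimax_agent.obj (f i) h"

lemma agent: "minimax_agent (f i) h L (scv p)"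
  using ss cb wp y0 unfolding stochastic_smooth_def concave_bounded_def well_posed_def
  by unfold_locales auto

lemma g_ccf: "closed_convex_fun g" and h_ccf: "closed_convex_fun h"
  using wp unfolding well_posed_def by auto

lemma mu_pos: "scv p > 0"
  using cb unfolding concave_bounded_def by auto

lemma L_pos: "L > 0" using Lip_ge_1 by simp

lemma kappa_ge_1: "\<kappa> \<ge> 1"
  using minimax_agent.mu_le_L[OF agent] mu_pos unfolding kappa_def by simp

lemma rho_bounds: "0 \<le> rho p" "rho p < 1" "0 < r\<^sub>1" "r\<^sub>1 \<le> 1"
proof -
  show "0 \<le> rho p" unfolding rho_def
    by (rule onorm_pos_le) (rule matrix_vector_mul_bounded_linear)
  show "rho p < 1" using mix unfolding mixing_matrix_def by auto
  then show "0 < r\<^sub>1" by simp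
  show "r\<^sub>1 \<le> 1" using \<open>0 \<le> rho p\<close> by simp
qed

lemma smooth: "smooth_fun L (f i)"
  using ss unfolding stochastic_smooth_def by auto

text \<open>Scaled so that the average over the agents of
  \<open>cvec \<Lambda> i \<bullet> Y $ i\<close> is the coupling term of \<open>Phi\<close>; moving
  the matrix to the multiplier in this way decouples the maximization over the rows of
  \<open>Y\<close>.\<close>

definition cvec :: "real^'b^'m \<Rightarrow> 'm \<Rightarrow> real^'b" where
  "cvec \<Lambda> i = ((L * sqrt (real CARD('m)) / 2) *\<^sub>R (transpose (W - mat 1) ** \<Lambda>)) $ i"

lemma cvec_diff: "cvec \<Lambda>' i - cvec \<Lambda> i = cvec (\<Lambda>' - \<Lambda>) i"
  unfolding cvec_def
  by (simp add: matrix_mult_row sum_subtractf scaleR_right_diff_distrib)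

lemma norm_Wm1_le: "norm ((W - mat 1) ** X) \<le> 2 * norm X" for X :: "real^'d::finite^'m"
proof -
  have "norm ((W - mat 1) ** X) \<le> onorm (\<lambda>v. (W - mat 1) *v v) * norm X"
    by (rule norm_matrix_mult_le)
  also have "\<dots> \<le> 2 * norm X"
    using mix unfolding mixing_matrix_def by (intro mult_right_mono) auto
  finally show ?thesis .
qed

text \<open>The factor 2 from the norm of \<open>W - mat 1\<close> passes to the transpose and
  cancels the 1/2 in \<open>cvec\<close>, and the number of agents cancels in the average:
  multiplier steps count like steps of \<open>X\<close> once tilts are divided by
  \<open>L\<close>.\<close>

lemma avg_cvec: "avg (\<lambda>i. (norm (cvec \<Lambda> i))\<^sup>2) \<le> L\<^sup>2 * (norm \<Lambda>)\<^sup>2"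
proof -
  have "norm (transpose (W - mat 1) ** \<Lambda>) \<le> 2 * norm \<Lambda>"
    by (rule norm_transpose_mult_le) (rule norm_Wm1_le)
  then have "(norm (transpose (W - mat 1) ** \<Lambda>))\<^sup>2 \<le> (2 * norm \<Lambda>)\<^sup>2"
    by (rule power_mono) simp
  then have "(L * sqrt (real CARD('m)) / 2)\<^sup>2 * (norm (transpose (W - mat 1) ** \<Lambda>))\<^sup>2
      \<le> (L * sqrt (real CARD('m)) / 2)\<^sup>2 * (2 * norm \<Lambda>)\<^sup>2"
    by (rule mult_left_mono) simp
  then have "(norm ((L * sqrt (real CARD('m)) / 2) *\<^sub>R (transpose (W - mat 1) ** \<Lambda>)))\<^sup>2 \<le> L\<^sup>2 * (real CARD('m)) * (norm \<Lambda>)\<^sup>2"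
    by (simp add: power_mult_distrib power_divide)
  then show ?thesis
    unfolding cvec_def avg_norm_rows by (simp add: divide_le_eq mult_ac)
qed

lemma avg_cvec_inner:
  "avg (\<lambda>i. cvec \<Lambda> i \<bullet> Y $ i) = L / (2 * sqrt (real CARD('m))) * (\<Lambda> \<bullet> ((W - mat 1) ** Y))"
proof -
  have "avg (\<lambda>i. cvec \<Lambda> i \<bullet> Y $ i) = (L * sqrt (real CARD('m)) / 2) * ((transpose (W - mat 1) ** \<Lambda>) \<bullet> Y) / (real CARD('m))"
    unfolding cvec_def avg_inner_rows by simp
  also have "(transpose (W - mat 1) ** \<Lambda>) \<bullet> Y = \<Lambda> \<bullet> ((W - mat 1) ** Y)"
    by (simp add: inner_matrix_mult)
  also have "(L * sqrt (real CARD('m)) / 2) * (\<Lambda> \<bullet> ((W - mat 1) ** Y)) / (real CARD('m))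
      = L / (2 * sqrt (real CARD('m))) * (\<Lambda> \<bullet> ((W - mat 1) ** Y))"
    by (simp add: field_simps)
  finally show ?thesis .
qed

lemma Phi_finite:
  assumes "\<And>i. h (Y $ i) < \<infinity>"
  shows "Phi p X \<Lambda> Y = ereal (avg (\<lambda>i. ob i (X $ i) (cvec \<Lambda> i) (Y $ i)))"
proof -
  have "ereal (f i (X $ i, Y $ i)) - h (Y $ i) = ereal (f i (X $ i, Y $ i) - real_of_ereal (h (Y $ i)))" for i
    using closed_convex_real[OF h_ccf assms[of i]] by (cases "h (Y $ i)") auto
  then have "Phi p X \<Lambda> Y = ereal (avg (\<lambda>i. f i (X $ i, Y $ i) - real_of_ereal (h (Y $ i)))
      - avg (\<lambda>i. cvec \<Lambda> i \<bullet> Y $ i))"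
    unfolding Phi_def avg_cvec_inner avg_def by simp
  also have "avg (\<lambda>i. f i (X $ i, Y $ i) - real_of_ereal (h (Y $ i))) - avg (\<lambda>i. cvec \<Lambda> i \<bullet> Y $ i)
      = avg (\<lambda>i. ob i (X $ i) (cvec \<Lambda> i) (Y $ i))"
    unfolding avg_diff[symmetric] minimax_agent.obj_def[OF agent] minimax_agent.hr_def[OF agent] ..
  finally show ?thesis .
qed

text \<open>In \<open>ereal\<close> the sum of \<infinity> and -\<infinity> is \<infinity>, so it
  matters that \<open>h\<close> never takes the value -\<infinity>: no summand is \<infinity>, and a
  single summand -\<infinity> decides the sum.\<close>

lemma Phi_infinite:
  assumes "\<not> (\<forall>i. h (Y $ i) < \<infinity>)"
  shows "Phi p X \<Lambda> Y = -\<infinity>"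
proof -
  obtain k where k: "h (Y $ k) = \<infinity>" using assms by auto
  let ?F = "\<lambda>i. ereal (f i (X $ i, Y $ i)) - h (Y $ i)"
  have np: "?F i \<noteq> \<infinity>" for i
    using h_ccf unfolding closed_convex_fun_def by (cases "h (Y $ i)") auto
  have "(\<Sum>i\<in>UNIV. ?F i) = ?F k + (\<Sum>i\<in>UNIV - {k}. ?F i)"
    by (rule sum.remove) auto
  moreover have "(\<Sum>i\<in>UNIV - {k}. ?F i) \<noteq> \<infinity>"
    using np by (simp add: sum_Pinfty)
  ultimately have "(\<Sum>i\<in>UNIV. ?F i) = -\<infinity>"
    unfolding k by (cases "\<Sum>i\<in>UNIV - {k}. ?F i") auto
  then show ?thesis unfolding Phi_def by simp
qed

text \<open>The rows of \<open>Y\<close> can be chosen independently, so the supremum is reached by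
  maximizing the tilted objective of each agent on its own.\<close>

lemma Qmax_eq: "Qmax p X \<Lambda> = avg (\<lambda>i. vl i (X $ i) (cvec \<Lambda> i))"
proof -
  have "(SUP Y. Phi p X \<Lambda> Y) = ereal (avg (\<lambda>i. vl i (X $ i) (cvec \<Lambda> i)))"
  proof (rule antisym)
    show "(SUP Y. Phi p X \<Lambda> Y) \<le> ereal (avg (\<lambda>i. vl i (X $ i) (cvec \<Lambda> i)))"
    proof (rule SUP_least)
      fix Y :: "real^'b^'m"
      show "Phi p X \<Lambda> Y \<le> ereal (avg (\<lambda>i. vl i (X $ i) (cvec \<Lambda> i)))"
      proof (cases "\<forall>i. h (Y $ i) < \<infinity>")
        case True
        then show ?thesis
          by (subst Phi_finite) (auto intro!: avg_mono minimax_agent.obj_le_val[OF agent])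
      qed (simp add: Phi_infinite)
    qed
    let ?Y = "\<chi> i. ys i (X $ i) (cvec \<Lambda> i)"
    have "Phi p X \<Lambda> ?Y = ereal (avg (\<lambda>i. vl i (X $ i) (cvec \<Lambda> i)))"
      by (subst Phi_finite)
        (simp_all only: vec_lambda_beta minimax_agent.ystar_finite[OF agent] minimax_agent.val_def[OF agent])
    then show "ereal (avg (\<lambda>i. vl i (X $ i) (cvec \<Lambda> i))) \<le> (SUP Y. Phi p X \<Lambda> Y)"
      using SUP_upper[of ?Y UNIV "\<lambda>Y. Phi p X \<Lambda> Y"] by simp
  qed
  then show ?thesis unfolding Qmax_def by simp
qed

lemma Pmax_eq: "Pmax p x \<Lambda> = avg (\<lambda>i. vl i x (cvec \<Lambda> i))"
  unfolding Pmax_def Qmax_eq by simp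

lemma phi_lower: "g x < \<infinity> \<Longrightarrow> \<phi>lb \<le> Pmax p x \<Lambda> + gr x"
proof -
  assume x: "g x < \<infinity>"
  have "ereal \<phi>lb \<le> ereal (Pmax p x \<Lambda>) + g x"
    using cb unfolding concave_bounded_def phi_def by blast
  then show ?thesis
    using closed_convex_real[OF g_ccf x] by (cases "g x") auto
qed

lemma phi_real: "g x < \<infinity> \<Longrightarrow> real_of_ereal (phi p x \<Lambda>) = Pmax p x \<Lambda> + gr x"
  using closed_convex_real[OF g_ccf, of x] unfolding phi_def by (cases "g x") auto

lemma primal_gap_eq:
  assumes "\<And>i. h (Y $ i) < \<infinity>"
  shows "primal_gap p X \<Lambda> Y
    = avg (\<lambda>i. vl i (X $ i) (cvec \<Lambda> i) - ob i (X $ i) (cvec \<Lambda> i) (Y $ i))"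
  unfolding primal_gap_def Qmax_eq Phi_finite[OF assms] by (simp add: avg_diff)

section \<open>Gradients of the primal function\<close>

definition gradPx :: "real^'a \<Rightarrow> real^'b^'m \<Rightarrow> real^'a" where
  "gradPx x \<Lambda> = row_mean (\<chi> i. fst (gradient (f i) (x, ys i x (cvec \<Lambda> i))) :: real^'a^'m)"

definition Ystar :: "real^'a \<Rightarrow> real^'b^'m \<Rightarrow> real^'b^'m" where
  "Ystar x \<Lambda> = (\<chi> i. ys i x (cvec \<Lambda> i))"

text \<open>The envelope estimates of the agents are averaged at fixed tilts, and the quadratic
  remainder identifies the gradient.\<close>

lemma Pmax_GDERIV_x: "GDERIV (\<lambda>x. Pmax p x \<Lambda>) x :> gradPx x \<Lambda>"
proof (rule GDERIV_quadratic_remainder)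
  fix v
  let ?c = "cvec \<Lambda>"
  let ?G = "\<lambda>i. fst (gradient (f i) (x, ys i x (?c i)))"
  have "\<bar>vl i v (?c i) - vl i x (?c i) - (v - x) \<bullet> ?G i\<bar> \<le> (L / 2 + L\<^sup>2 / scv p) * (norm (v - x))\<^sup>2" for i
    using minimax_agent.val_linearization[OF agent, of i v "?c i" x "?c i"]
    by (simp add: algebra_simps power_mult_distrib)
  then have "avg (\<lambda>i. vl i v (?c i) - vl i x (?c i) - ?G i \<bullet> (v - x)) \<le> (L / 2 + L\<^sup>2 / scv p) * (norm (v - x))\<^sup>2"
    "avg (\<lambda>i. - (vl i v (?c i) - vl i x (?c i) - ?G i \<bullet> (v - x))) \<le> (L / 2 + L\<^sup>2 / scv p) * (norm (v - x))\<^sup>2"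
    by (intro order_trans[OF avg_mono eq_refl[OF avg_const]]; simp add: abs_le_iff inner_commute)+
  moreover have "avg (\<lambda>i. ?G i \<bullet> (v - x)) = (v - x) \<bullet> gradPx x \<Lambda>"
    using avg_inner_row_mean[of "\<chi> i. ?G i" "v - x"] unfolding gradPx_def by (simp add: inner_commute)
  moreover have "avg (\<lambda>i. - F i) = - avg F" for F :: "'m \<Rightarrow> real"
    using avg_cmult[of "-1" F] by simp
  ultimately show "\<bar>Pmax p v \<Lambda> - Pmax p x \<Lambda> - (v - x) \<bullet> gradPx x \<Lambda>\<bar>
      \<le> (L / 2 + L\<^sup>2 / scv p) * (norm (v - x))\<^sup>2"
    unfolding Pmax_eq by (simp only: avg_diff abs_le_iff)
qed

text \<open>The multiplier moves only the tilts, and linearly; \<open>avg_cvec_inner\<close> turns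
  the averaged tilt derivative back into an inner product of stacked matrices.\<close>

lemma Pmax_GDERIV_Lam:
  "GDERIV (\<lambda>\<Lambda>. Pmax p x \<Lambda>) \<Lambda> :> - (L / (2 * sqrt (real CARD('m)))) *\<^sub>R ((W - mat 1) ** Ystar x \<Lambda>)"
proof (rule GDERIV_quadratic_remainder)
  fix v :: "real^'b^'m"
  let ?y = "\<lambda>i. Ystar x \<Lambda> $ i"
  let ?d = "cvec (v - \<Lambda>)"
  have "\<bar>vl i x (cvec v i) - vl i x (cvec \<Lambda> i) + ?d i \<bullet> ?y i\<bar> \<le> (norm (?d i))\<^sup>2 / scv p" for i
    using minimax_agent.val_linearization[OF agent, of i x "cvec v i" x "cvec \<Lambda> i"]
    unfolding cvec_diff Ystar_def by simp
  then have le: "avg (\<lambda>i. vl i x (cvec v i) - vl i x (cvec \<Lambda> i) + ?d i \<bullet> ?y i) \<le> avg (\<lambda>i. (norm (?d i))\<^sup>2 / scv p)"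
    "avg (\<lambda>i. - 1 * (vl i x (cvec v i) - vl i x (cvec \<Lambda> i) + ?d i \<bullet> ?y i)) \<le> avg (\<lambda>i. (norm (?d i))\<^sup>2 / scv p)"
    by (intro avg_mono; simp add: abs_le_iff)+
  have 1: "avg (\<lambda>i. (norm (?d i))\<^sup>2 / scv p) \<le> L\<^sup>2 / scv p * (norm (v - \<Lambda>))\<^sup>2"
    using divide_right_mono[OF avg_cvec[of "v - \<Lambda>"], of "scv p"] mu_pos by (simp add: avg_cdiv)
  have 2: "avg (\<lambda>i. ?d i \<bullet> ?y i)
      = - ((v - \<Lambda>) \<bullet> (- (L / (2 * sqrt (real CARD('m)))) *\<^sub>R ((W - mat 1) ** Ystar x \<Lambda>)))"
    unfolding avg_cvec_inner by simp
  show "\<bar>Pmax p x v - Pmax p x \<Lambda> - (v - \<Lambda>) \<bullet> (- (L / (2 * sqrt (real CARD('m)))) *\<^sub>R ((W - mat 1) ** Ystar x \<Lambda>))\<bar>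
      \<le> L\<^sup>2 / scv p * (norm (v - \<Lambda>))\<^sup>2"
  proof -
    have "\<bar>a - s\<bar> \<le> K" if "a + b \<le> q" "- 1 * (a + b) \<le> q" "q \<le> K" "b = - s" for a b q s K :: real
      using that by (simp add: abs_le_iff)
    from this[OF le[unfolded avg_cmult avg_add] 1 2] show ?thesis
      unfolding Pmax_eq avg_diff[symmetric] .
  qed
qed

lemma gradient_Pmax_x: "gradient (\<lambda>x. Pmax p x \<Lambda>) x = gradPx x \<Lambda>"
  by (rule gradient_eqI[OF Pmax_GDERIV_x])

lemma gradient_Pmax_Lam:
  "gradient (\<lambda>\<Lambda>. Pmax p x \<Lambda>) \<Lambda> = - (L / (2 * sqrt (real CARD('m)))) *\<^sub>R ((W - mat 1) ** Ystar x \<Lambda>)"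
  by (rule gradient_eqI[OF Pmax_GDERIV_Lam])

section \<open>The mixing matrix\<close>

lemma row_sums:
  "(\<Sum>j\<in>UNIV. W $ i $ j) = 1" "(\<Sum>i\<in>UNIV. W $ i $ j) = 1"
proof -
  have "(1 :: real^'m) \<in> {v. (W - mat 1) *v v = 0}"
    using mix unfolding mixing_matrix_def by (metis insertI1 span_base)
  then have "W *v 1 = 1"
    by (simp add: matrix_vector_mult_diff_rdistrib)
  then have "(W *v 1) $ i = 1" by simp
  then show "(\<Sum>j\<in>UNIV. W $ i $ j) = 1" by (simp add: matrix_vector_mult_def)
  have "(transpose W *v 1) $ j = 1" using mix unfolding mixing_matrix_def by simp
  then show "(\<Sum>i\<in>UNIV. W $ i $ j) = 1" by (simp add: matrix_vector_mult_def transpose_def)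
qed

lemma row_mean_W: "row_mean (W ** X) = row_mean X" for X :: "real^'d::finite^'m"
proof -
  have "(\<Sum>i\<in>UNIV. (W ** X) $ i) = (\<Sum>j\<in>UNIV. \<Sum>i\<in>UNIV. W $ i $ j *\<^sub>R X $ j)"
    unfolding matrix_mult_row by (rule sum.swap)
  also have "\<dots> = (\<Sum>j\<in>UNIV. X $ j)"
    by (simp add: scaleR_sum_left[symmetric] row_sums)
  finally show ?thesis unfolding row_mean_def by simp
qed

text \<open>Deviations have mean zero, so the averaging matrix may be subtracted from
  \<open>W\<close>; the norm of what remains is \<open>rho p\<close>.\<close>

lemma row_dev_W: "row_dev (W ** X) = (W - (\<chi> i j. 1 / (real CARD('m)))) ** row_dev X" for X :: "real^'d::finite^'m"
proof -
  have "(\<Sum>j\<in>UNIV. (W $ i $ j - 1 / (real CARD('m))) *\<^sub>R (X $ j - row_mean X)) = (\<Sum>j\<in>UNIV. W $ i $ j *\<^sub>R X $ j) - row_mean X" for i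
  proof -
    have "(\<Sum>j\<in>UNIV. (W $ i $ j - 1 / (real CARD('m))) *\<^sub>R (X $ j - row_mean X))
        = (\<Sum>j\<in>UNIV. W $ i $ j *\<^sub>R X $ j) - (\<Sum>j\<in>UNIV. W $ i $ j) *\<^sub>R row_mean X
          - ((1 / (real CARD('m))) *\<^sub>R (\<Sum>j\<in>UNIV. X $ j) - (\<Sum>j\<in>(UNIV :: 'm set). (1 / (real CARD('m)))) *\<^sub>R row_mean X)"
      by (simp add: algebra_simps sum_subtractf sum.distrib scaleR_sum_right scaleR_sum_left del: sum_constant)
    also have "(\<Sum>j\<in>(UNIV :: 'm set). (1 / (real CARD('m)))) = 1" by simp
    also have "(1 / (real CARD('m))) *\<^sub>R (\<Sum>j\<in>UNIV. X $ j) = row_mean X" unfolding row_mean_def ..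
    finally show ?thesis unfolding row_sums by simp
  qed
  then show ?thesis
    by (simp add: vec_eq_iff[of "row_dev _"] row_dev_nth row_mean_W matrix_mult_row)
qed

lemma norm_row_dev_W: "norm (row_dev (W ** X)) \<le> rho p * norm (row_dev X)" for X :: "real^'d::finite^'m"
  unfolding row_dev_W rho_def by (rule norm_matrix_mult_le)

text \<open>The row sums of \<open>W - mat 1\<close> vanish. Hence the displacement caused by mixing
  is bounded by the consensus error.\<close>

lemma Wm1_row_dev: "(W - mat 1) ** X = (W - mat 1) ** row_dev X" for X :: "real^'d::finite^'m"
proof -
  have "(\<Sum>j\<in>UNIV. (W - mat 1) $ i $ j *\<^sub>R row_mean X) = 0" for i
  proof -
    have "(\<Sum>j\<in>UNIV. (mat 1 :: real^'m^'m) $ i $ j) = 1" by (simp add: mat_def)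
    then show ?thesis
      by (simp add: scaleR_sum_left[symmetric] sum_subtractf row_sums)
  qed
  then show ?thesis
    unfolding vec_eq_iff[of "(W - mat 1) ** X"] matrix_mult_row row_dev_nth
    by (simp add: scaleR_right_diff_distrib sum_subtractf)
qed

end

section \<open>Step sizes\<close>

context vrlm_problem
begin

abbreviation "\<eta> \<equiv> eta_x p"
abbreviation "\<eta>\<^sub>\<Lambda> \<equiv> eta_Lam p"

text \<open>The factor in the denominators of the communication count; the inverses of both step
  sizes are at most constant multiples of \<open>L * \<kappa>\<^sup>2 / \<theta>\<close>.\<close>

definition "\<theta> = min 1 (\<kappa> * r\<^sub>1\<^sup>2)"

lemma theta_pos: "0 < \<theta>" and theta_le: "\<theta> \<le> 1" "\<theta> \<le> \<kappa> * r\<^sub>1\<^sup>2"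
  using kappa_ge_1 rho_bounds unfolding \<theta>_def by auto

lemma L_P_bounds: "2 * (L * \<kappa>) \<le> L_P p" "L_P p \<le> 3 * (L * \<kappa>)" "0 < L_P p"
proof -
  have "2 * \<kappa> \<le> sqrt (4 * \<kappa>\<^sup>2 + 1)"
    by (rule real_le_rsqrt) (simp add: power_mult_distrib)
  from mult_left_mono[OF this, of L] show *: "2 * (L * \<kappa>) \<le> L_P p"
    unfolding L_P_def using L_pos by simp
  have "1 \<le> \<kappa>\<^sup>2" using kappa_ge_1 by simp
  moreover have "(3 * \<kappa>)\<^sup>2 = 9 * \<kappa>\<^sup>2" by (simp add: power_mult_distrib)
  ultimately have "4 * \<kappa>\<^sup>2 + 1 \<le> (3 * \<kappa>)\<^sup>2" by linarith
  then have "sqrt (4 * \<kappa>\<^sup>2 + 1) \<le> 3 * \<kappa>"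
    using kappa_ge_1 by (intro real_le_lsqrt) auto
  from mult_left_mono[OF this, of L] show "L_P p \<le> 3 * (L * \<kappa>)"
    unfolding L_P_def using L_pos by simp
  show "0 < L_P p" unfolding L_P_def using L_pos by (simp add: add_nonneg_pos)
qed

lemma kappa_squares: "1 \<le> \<kappa>\<^sup>2" "\<kappa> \<le> \<kappa>\<^sup>2" "\<kappa>\<^sup>2 \<le> \<kappa> ^ 4" "0 < \<kappa>"
proof -
  show "1 \<le> \<kappa>\<^sup>2" "0 < \<kappa>" using kappa_ge_1 by auto
  show "\<kappa> \<le> \<kappa>\<^sup>2" using kappa_ge_1 by (simp add: power2_eq_square)
  show "\<kappa>\<^sup>2 \<le> \<kappa> ^ 4" using kappa_ge_1 by (intro power_increasing) auto
qed

lemma r1_sq: "0 < r\<^sub>1\<^sup>2" "r\<^sub>1\<^sup>2 \<le> 1"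
  using rho_bounds by (auto intro: power_le_one)

lemma eta_pos: "0 < \<eta>" "0 < \<eta>\<^sub>\<Lambda>"
proof -
  have k: "0 < 12 * \<kappa>\<^sup>2 + 2 * \<kappa> + 5" "0 < 12 * \<kappa>\<^sup>2 + \<kappa> + 1" "0 < 20 * \<kappa>\<^sup>2 + \<kappa> + 1"
    using kappa_squares by auto
  show "0 < \<eta>"
    unfolding eta_x_def Let_def using k L_pos L_P_bounds(3) r1_sq by auto
  have "0 < 2 * L_P p + 128 * L * \<kappa>\<^sup>2 + (L + 1) * (20 * \<kappa>\<^sup>2 + \<kappa> + 1) / 2
                + 4 * L\<^sup>2 * (12 * \<kappa>\<^sup>2 + \<kappa> + 1) / (30 * L_P p)"
    using k L_pos L_P_bounds(3) kappa_squares by (intro add_pos_nonneg) auto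
  then show "0 < \<eta>\<^sub>\<Lambda>"
    unfolding eta_Lam_def Let_def using k L_pos L_P_bounds(3) r1_sq by auto
qed

text \<open>From the second entry of the minimum: 20 * 12 = 240.\<close>

lemma eta_le_1: "\<eta> * (L * \<kappa>\<^sup>2) \<le> 1 / 240"
proof -
  have "20 * (L + 1) * (12 * \<kappa>\<^sup>2 + 2 * \<kappa> + 5) \<ge> 20 * L * (12 * \<kappa>\<^sup>2)"
    using L_pos kappa_squares by (intro mult_mono) auto
  moreover have "20 * L * (12 * \<kappa>\<^sup>2) > 0" using L_pos kappa_squares by simp
  moreover have "\<eta> \<le> 1 / (20 * (L + 1) * (12 * \<kappa>\<^sup>2 + 2 * \<kappa> + 5))"
    unfolding eta_x_def Let_def by simp
  ultimately have "\<eta> \<le> 1 / (20 * L * (12 * \<kappa>\<^sup>2))"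
    by (meson divide_left_mono mult_pos_pos order_trans zero_le_one order_less_le_trans)
  then have "\<eta> * (20 * L * (12 * \<kappa>\<^sup>2)) \<le> 1"
    using \<open>20 * L * (12 * \<kappa>\<^sup>2) > 0\<close> by (subst (asm) pos_le_divide_eq) auto
  then show ?thesis by simp
qed

lemma eta_L_P: "\<eta> * L_P p \<le> r\<^sub>1\<^sup>2 / 180"
proof -
  have "\<eta> \<le> r\<^sub>1\<^sup>2 / (180 * L_P p)" unfolding eta_x_def Let_def by simp
  then have "\<eta> * (180 * L_P p) \<le> r\<^sub>1\<^sup>2"
    using L_P_bounds(3) by (subst (asm) pos_le_divide_eq) auto
  then show ?thesis by simp
qed

lemma eta_le_2: "\<eta> * (L * \<kappa>) \<le> r\<^sub>1\<^sup>2 / 360"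
  using eta_L_P mult_left_mono[OF L_P_bounds(1), of \<eta>] eta_pos(1) by argo

text \<open>138 = 128 + 20 / 2, from two terms in the denominator of the second entry; the remaining
  ones are nonnegative.\<close>

lemma eta_Lam_le_1: "\<eta>\<^sub>\<Lambda> * (L * \<kappa>\<^sup>2) \<le> 1 / 138"
proof -
  let ?B = "2 * L_P p + 128 * L * \<kappa>\<^sup>2 + (L + 1) * (20 * \<kappa>\<^sup>2 + \<kappa> + 1) / 2
                + 4 * L\<^sup>2 * (12 * \<kappa>\<^sup>2 + \<kappa> + 1) / (30 * L_P p)"
  have "(L + 1) * (20 * \<kappa>\<^sup>2 + \<kappa> + 1) \<ge> L * (20 * \<kappa>\<^sup>2)"
    using L_pos kappa_squares by (intro mult_mono) auto
  moreover have "4 * L\<^sup>2 * (12 * \<kappa>\<^sup>2 + \<kappa> + 1) / (30 * L_P p) \<ge> 0"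
    using L_P_bounds(3) kappa_squares by simp
  ultimately have B: "138 * (L * \<kappa>\<^sup>2) \<le> ?B" using L_P_bounds(3) by simp
  have pos: "0 < 138 * (L * \<kappa>\<^sup>2)" using L_pos kappa_squares by simp
  have "\<eta>\<^sub>\<Lambda> \<le> 1 / ?B" unfolding eta_Lam_def Let_def by simp
  also have "\<dots> \<le> 1 / (138 * (L * \<kappa>\<^sup>2))"
    using B pos by (intro divide_left_mono) auto
  finally have "\<eta>\<^sub>\<Lambda> * (138 * (L * \<kappa>\<^sup>2)) \<le> 1"
    using pos by (subst (asm) pos_le_divide_eq) auto
  then show ?thesis by simp
qed

text \<open>From the first entry, with \<open>L_P p\<close> at most 3L\<kappa>: 5 * 3 / (24 * 12) =
  5 / 96, slightly below 1 / 19.\<close>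

lemma eta_Lam_le_2: "\<eta>\<^sub>\<Lambda> * (L * \<kappa>) \<le> r\<^sub>1\<^sup>2 / 19"
proof -
  have pos: "0 < 24 * L\<^sup>2 * (12 * \<kappa>\<^sup>2)" using L_pos kappa_squares by simp
  have "\<eta>\<^sub>\<Lambda> \<le> 5 * L_P p * r\<^sub>1\<^sup>2 / (24 * L\<^sup>2 * (12 * \<kappa>\<^sup>2 + \<kappa> + 1))"
    unfolding eta_Lam_def Let_def by simp
  also have "\<dots> \<le> 5 * (3 * (L * \<kappa>)) * r\<^sub>1\<^sup>2 / (24 * L\<^sup>2 * (12 * \<kappa>\<^sup>2))"
    using pos L_P_bounds kappa_squares L_pos by (intro frac_le mult_right_mono mult_left_mono) auto
  finally have "\<eta>\<^sub>\<Lambda> * (L * \<kappa>) \<le> 5 * (3 * (L * \<kappa>)) * r\<^sub>1\<^sup>2 / (24 * L\<^sup>2 * (12 * \<kappa>\<^sup>2)) * (L * \<kappa>)"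
    using L_pos kappa_squares by (intro mult_right_mono) auto
  also have "\<dots> = 5 / 96 * r\<^sub>1\<^sup>2"
    using L_pos kappa_squares by (simp add: field_simps power2_eq_square)
  also have "\<dots> \<le> r\<^sub>1\<^sup>2 / 19" using r1_sq by simp
  finally show ?thesis .
qed

text \<open>The step size is not too small either, which is what turns a division by \<eta> into an
  iteration count. Both entries of the minimum are checked; in the second one
  \<open>Lip_ge_1\<close> absorbs \<open>L + 1\<close> into \<open>2 * L\<close>.\<close>

lemma inverse_eta_le: "1 / \<eta> \<le> 1300 * (L * \<kappa>\<^sup>2 / \<theta>)"
proof -
  have base: "L * \<kappa>\<^sup>2 \<le> L * \<kappa>\<^sup>2 / \<theta>"
    using theta_pos theta_le L_pos kappa_squares by (simp add: le_divide_eq)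
  have "180 * L_P p / r\<^sub>1\<^sup>2 \<le> 1300 * (L * \<kappa>\<^sup>2 / \<theta>)"
  proof -
    have "\<theta> * (180 * L_P p) \<le> (\<kappa> * r\<^sub>1\<^sup>2) * (180 * (3 * (L * \<kappa>)))"
      using theta_le theta_pos L_P_bounds kappa_squares r1_sq by (intro mult_mono) auto
    also have "\<dots> \<le> 1300 * (L * \<kappa>\<^sup>2) * r\<^sub>1\<^sup>2"
      using L_pos r1_sq kappa_squares by (simp add: power2_eq_square)
    finally show ?thesis using theta_pos r1_sq(1) by (simp add: field_simps)
  qed
  moreover have "20 * (L + 1) * (12 * \<kappa>\<^sup>2 + 2 * \<kappa> + 5) \<le> 1300 * (L * \<kappa>\<^sup>2 / \<theta>)"
  proof -
    have "20 * (L + 1) * (12 * \<kappa>\<^sup>2 + 2 * \<kappa> + 5) \<le> 20 * (2 * L) * (19 * \<kappa>\<^sup>2)"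
      using Lip_ge_1 kappa_squares by (intro mult_mono) auto
    also have "\<dots> = 760 * (L * \<kappa>\<^sup>2)" by simp
    also have "\<dots> \<le> 1300 * (L * \<kappa>\<^sup>2 / \<theta>)"
      using base L_pos kappa_squares by (intro mult_mono) auto
    finally show ?thesis .
  qed
  moreover have "\<eta> = r\<^sub>1\<^sup>2 / (180 * L_P p) \<or> \<eta> = 1 / (20 * (L + 1) * (12 * \<kappa>\<^sup>2 + 2 * \<kappa> + 5))"
    unfolding eta_x_def Let_def by (simp only: min_def split: if_split) blast
  ultimately show ?thesis by auto
qed

lemma inverse_eta_Lam_le: "1 / \<eta>\<^sub>\<Lambda> \<le> 160 * (L * \<kappa>\<^sup>2 / \<theta>)"
proof -
  have base: "L * \<kappa>\<^sup>2 \<le> L * \<kappa>\<^sup>2 / \<theta>"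
    using theta_pos theta_le L_pos kappa_squares by (simp add: le_divide_eq)
  let ?B = "2 * L_P p + 128 * L * \<kappa>\<^sup>2 + (L + 1) * (20 * \<kappa>\<^sup>2 + \<kappa> + 1) / 2
                + 4 * L\<^sup>2 * (12 * \<kappa>\<^sup>2 + \<kappa> + 1) / (30 * L_P p)"
  have Lk: "L * \<kappa> \<le> L * \<kappa>\<^sup>2" using L_pos kappa_squares by simp
  have "24 * L\<^sup>2 * (12 * \<kappa>\<^sup>2 + \<kappa> + 1) / (5 * L_P p * r\<^sub>1\<^sup>2) \<le> 160 * (L * \<kappa>\<^sup>2 / \<theta>)"
  proof -
    have "\<theta> * (24 * L\<^sup>2 * (12 * \<kappa>\<^sup>2 + \<kappa> + 1)) \<le> (\<kappa> * r\<^sub>1\<^sup>2) * (24 * L\<^sup>2 * (14 * \<kappa>\<^sup>2))"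
      using theta_le theta_pos L_pos kappa_squares r1_sq by (intro mult_mono) auto
    also have "\<dots> = 33.6 * (L * \<kappa>\<^sup>2) * (5 * (2 * (L * \<kappa>)) * r\<^sub>1\<^sup>2)"
      by (simp add: power2_eq_square)
    also have "\<dots> \<le> 160 * (L * \<kappa>\<^sup>2) * (5 * L_P p * r\<^sub>1\<^sup>2)"
      using L_pos r1_sq kappa_squares L_P_bounds by (intro mult_mono) auto
    finally show ?thesis using theta_pos r1_sq(1) L_P_bounds(3) by (simp add: field_simps)
  qed
  moreover have "?B \<le> 160 * (L * \<kappa>\<^sup>2 / \<theta>)"
  proof -
    have "(L + 1) * (20 * \<kappa>\<^sup>2 + \<kappa> + 1) \<le> (2 * L) * (22 * \<kappa>\<^sup>2)"
      using Lip_ge_1 kappa_squares by (intro mult_mono) auto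
    moreover have "4 * L\<^sup>2 * (12 * \<kappa>\<^sup>2 + \<kappa> + 1) / (30 * L_P p) \<le> 4 * L\<^sup>2 * (14 * \<kappa>\<^sup>2) / (30 * (2 * (L * \<kappa>)))"
      using L_pos L_P_bounds kappa_squares by (intro frac_le mult_left_mono) auto
    moreover have "4 * L\<^sup>2 * (14 * \<kappa>\<^sup>2) / (30 * (2 * (L * \<kappa>))) = 56 / 60 * (L * \<kappa>)"
      using L_pos kappa_squares by (simp add: field_simps power2_eq_square)
    ultimately have "?B \<le> 6 * (L * \<kappa>) + 128 * (L * \<kappa>\<^sup>2) + 22 * (L * \<kappa>\<^sup>2) + 56 / 60 * (L * \<kappa>)"
      using L_P_bounds(2) by argo
    also have "\<dots> \<le> 160 * (L * \<kappa>\<^sup>2)"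
    proof -
      have "0 \<le> L * \<kappa>\<^sup>2" using L_pos by simp
      then show ?thesis using Lk by linarith
    qed
    finally have "?B \<le> 160 * (L * \<kappa>\<^sup>2)" .
    then show ?thesis using base by simp
  qed
  moreover have "\<eta>\<^sub>\<Lambda> = 5 * L_P p * r\<^sub>1\<^sup>2 / (24 * L\<^sup>2 * (12 * \<kappa>\<^sup>2 + \<kappa> + 1)) \<or> \<eta>\<^sub>\<Lambda> = 1 / ?B"
    unfolding eta_Lam_def Let_def by (simp only: min_def split: if_split) blast
  ultimately show ?thesis by auto
qed

end

section \<open>One-step inequalities along a trajectory\<close>

text \<open>The gradient estimates \<open>d\<close> are an arbitrary sequence here: the inequalities
  below pay for their error through \<open>err\<close> and therefore hold for every
  realization.\<close>

locale vrlm_path = vrlm_problem p \<phi>lb \<sigma> x\<^sub>0 y\<^sub>0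
  for p :: "('m::finite, 'a::finite, 'b::finite, 's) problem" and \<phi>lb \<sigma> x\<^sub>0 y\<^sub>0 +
  fixes X :: "nat \<Rightarrow> real^'a^'m" and \<Lambda> :: "nat \<Rightarrow> real^'b^'m" and Y :: "nat \<Rightarrow> real^'b^'m"
    and d :: "nat \<Rightarrow> 'm \<Rightarrow> (real^'a) \<times> (real^'b)" and Vx :: "nat \<Rightarrow> real^'a^'m"
  assumes X_0: "X 0 = all_rows x\<^sub>0" and Lam_0: "\<Lambda> 0 = 0" and Y_0: "Y 0 = all_rows y\<^sub>0"
    and Vx_0: "Vx 0 = rows_x (d 0)"
    and X_Suc: "X (Suc t) = prox_rows (\<lambda>v. ereal (eta_x p) * reg_x p v) (mixing p ** X t - eta_x p *\<^sub>R Vx t)"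
    and Lam_Suc: "\<Lambda> (Suc t) = \<Lambda> t
          + (Lip p * eta_Lam p / (2 * sqrt (real CARD('m)))) *\<^sub>R ((mixing p - mat 1) ** Y t)"
    and Y_Suc: "Y (Suc t) = prox_rows (\<lambda>v. ereal (eta_y p) * reg_y p v) (Y t + eta_y p *\<^sub>R
          (rows_y (d t) - (Lip p * sqrt (real CARD('m)) / 2) *\<^sub>R (transpose (mixing p - mat 1) ** \<Lambda> t)))"
    and Vx_Suc: "Vx (Suc t) = mixing p ** (Vx t + rows_x (d (Suc t)) - rows_x (d t))"
begin

abbreviation "c t i \<equiv> cvec (\<Lambda> t) i"
abbreviation "grd t i \<equiv> gradient (f i) (X t $ i, Y t $ i)"
abbreviation "yt t i \<equiv> ys i (X t $ i) (c t i)"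

definition "stepX t = avg (\<lambda>i. (norm (X (Suc t) $ i - X t $ i))\<^sup>2)"
definition "stepL t = (norm (\<Lambda> (Suc t) - \<Lambda> t))\<^sup>2"
definition "stepY t = avg (\<lambda>i. (norm (Y (Suc t) $ i - Y t $ i))\<^sup>2)"
definition "err t = avg (\<lambda>i. (norm (d t i - grd t i))\<^sup>2)"
definition "dualD t = avg (\<lambda>i. (norm (yt t i - Y t $ i))\<^sup>2)"
definition "gap t = avg (\<lambda>i. vl i (X t $ i) (c t i) - ob i (X t $ i) (c t i) (Y t $ i))"
definition "consX t = avg (\<lambda>i. (norm (X t $ i - row_mean (X t)))\<^sup>2)"
definition "consV t = avg (\<lambda>i. (norm (Vx t $ i - row_mean (Vx t)))\<^sup>2)"
text \<open>\<open>Pmax\<close> at a single copy already averages over all agents, so this is a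
  double average over pairs of agents: the function of one at the copy of the other.\<close>

definition "merit t = avg (\<lambda>i. Pmax p (X t $ i) (\<Lambda> t) + gr (X t $ i))"

lemmas quantities = stepX_def stepL_def stepY_def err_def dualD_def consX_def consV_def

lemma quantities_nonneg [simp]:
  "0 \<le> stepX t" "0 \<le> stepL t" "0 \<le> stepY t" "0 \<le> err t" "0 \<le> dualD t" "0 \<le> consX t" "0 \<le> consV t"
  unfolding quantities by (auto intro!: avg_nonneg)

lemma eta_y_pos: "0 < eta_y p"
  using L_pos unfolding eta_y_def by simp

section \<open>Feasibility and optimality of the iterates\<close>

lemma X_finite: "g (X t $ i) < \<infinity>"
proof (cases t)
  case 0 then show ?thesis using x0 by (simp add: X_0)
next
  case (Suc s) then show ?thesis
    using prox_scaled_finite[OF g_ccf x0 eta_pos(1)] by (simp add: X_Suc prox_rows_def)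
qed

lemma Y_finite: "h (Y t $ i) < \<infinity>"
proof (cases t)
  case 0 then show ?thesis using y0 by (simp add: Y_0)
next
  case (Suc s) then show ?thesis
    using prox_scaled_finite[OF h_ccf y0 eta_y_pos] by (simp add: Y_Suc prox_rows_def)
qed

text \<open>Supplies the hypothesis \<open>sub\<close> of the ascent step: row \<open>i\<close> of
  the dual direction is \<open>snd (d t i) - c t i\<close>, and
  \<open>1 / eta_y p = 4 * L\<close>.\<close>

lemma Y_step_optimality:
  assumes "h v < \<infinity>"
  shows "minimax_agent.hr h (Y (Suc t) $ i) + (4 * L) * ((Y t $ i - Y (Suc t) $ i) \<bullet> (v - Y (Suc t) $ i))
      + (snd (d t i) - c t i) \<bullet> (v - Y (Suc t) $ i) \<le> minimax_agent.hr h v"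
proof -
  let ?u = "Y t $ i + eta_y p *\<^sub>R (snd (d t i) - c t i)"
  have eq: "Y (Suc t) $ i = prox (\<lambda>v. ereal (eta_y p) * h v) ?u"
    by (simp add: Y_Suc prox_rows_def rows_y_def cvec_def)
  have inv: "1 / eta_y p = 4 * L" unfolding eta_y_def by simp
  have "(1 / eta_y p) * ((?u - Y (Suc t) $ i) \<bullet> (v - Y (Suc t) $ i))
      = (4 * L) * ((Y t $ i - Y (Suc t) $ i) \<bullet> (v - Y (Suc t) $ i))
        + (1 / eta_y p * eta_y p) * ((snd (d t i) - c t i) \<bullet> (v - Y (Suc t) $ i))"
    unfolding inv[symmetric] by (simp add: inner_add_left inner_diff_left algebra_simps add_divide_distrib diff_divide_distrib)
  also have "1 / eta_y p * eta_y p = 1" using eta_y_pos by simp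
  finally show ?thesis
    using prox_scaled_subgradient[OF h_ccf y0 eta_y_pos assms, of ?u]
    unfolding eq[symmetric] minimax_agent.hr_def[OF agent] by simp
qed

section \<open>Dual distance and primal gap\<close>

lemma c_step: "avg (\<lambda>i. (norm (c (Suc t) i - c t i))\<^sup>2) \<le> L\<^sup>2 * stepL t"
  unfolding cvec_diff stepL_def by (rule avg_cvec)

lemma avg_drift:
  "avg (\<lambda>i. (norm (X (Suc t) $ i - X t $ i) + norm (c (Suc t) i - c t i) / L)\<^sup>2) \<le> 2 * (stepX t + stepL t)"
proof -
  have "(norm (X (Suc t) $ i - X t $ i) + norm (c (Suc t) i - c t i) / L)\<^sup>2
      \<le> 2 * (norm (X (Suc t) $ i - X t $ i))\<^sup>2 + 2 / L\<^sup>2 * (norm (c (Suc t) i - c t i))\<^sup>2" for i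
    using power2_sum_le_weighted[of 1 "norm (X (Suc t) $ i - X t $ i)" "norm (c (Suc t) i - c t i) / L"]
    by (simp add: power_divide)
  then have "avg (\<lambda>i. (norm (X (Suc t) $ i - X t $ i) + norm (c (Suc t) i - c t i) / L)\<^sup>2)
      \<le> avg (\<lambda>i. 2 * (norm (X (Suc t) $ i - X t $ i))\<^sup>2 + 2 / L\<^sup>2 * (norm (c (Suc t) i - c t i))\<^sup>2)"
    by (rule avg_mono)
  also have "\<dots> = 2 * stepX t + 2 / L\<^sup>2 * avg (\<lambda>i. (norm (c (Suc t) i - c t i))\<^sup>2)"
    unfolding avg_linear stepX_def ..
  also have "\<dots> \<le> 2 * stepX t + 2 / L\<^sup>2 * (L\<^sup>2 * stepL t)"
    by (intro add_left_mono mult_left_mono c_step) simp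
  also have "\<dots> = 2 * (stepX t + stepL t)" using L_pos by simp
  finally show ?thesis .
qed

lemma snd_err_le: "(norm (snd (d t i) - snd (grd t i)))\<^sup>2 \<le> (norm (d t i - grd t i))\<^sup>2"
  and fst_err_le: "norm (fst (d t i) - fst (grd t i)) \<le> norm (d t i - grd t i)"
  using norm_snd_le'[of "d t i - grd t i"] norm_fst_le'[of "d t i - grd t i"]
  by (simp_all add: power_mono)

lemma dualD_step:
  "dualD (Suc t) \<le> (1 - 1 / (4 * \<kappa>)) * dualD t + \<kappa> / 2 * (err t / L\<^sup>2) + 18 * \<kappa> ^ 3 * (stepX t + stepL t)"
proof -
  let ?\<Delta> = "\<lambda>i. (norm (X (Suc t) $ i - X t $ i) + norm (c (Suc t) i - c t i) / L)\<^sup>2"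
  have "(norm (yt (Suc t) i - Y (Suc t) $ i))\<^sup>2
      \<le> (1 - 1 / (4 * \<kappa>)) * (norm (yt t i - Y t $ i))\<^sup>2
        + \<kappa> / 2 * ((norm (d t i - grd t i))\<^sup>2 / L\<^sup>2) + 9 * \<kappa> ^ 3 * ?\<Delta> i" for i
  proof -
    have "\<kappa> / 2 * (norm (snd (d t i) - snd (grd t i)))\<^sup>2 / L\<^sup>2 \<le> \<kappa> / 2 * (norm (d t i - grd t i))\<^sup>2 / L\<^sup>2"
      using kappa_ge_1 by (intro divide_right_mono mult_left_mono snd_err_le) auto
    then show ?thesis
      using minimax_agent.ystar_dist_recursion[OF agent[of i] Y_finite[of t i] Y_finite[of "Suc t" i]
          Y_step_optimality[of _ t i], where x = "X t $ i" and x' = "X (Suc t) $ i" and c' = "c (Suc t) i"]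
      unfolding kappa_def by simp
  qed
  then have "dualD (Suc t) \<le> avg (\<lambda>i. (1 - 1 / (4 * \<kappa>)) * (norm (yt t i - Y t $ i))\<^sup>2
        + \<kappa> / 2 * ((norm (d t i - grd t i))\<^sup>2 / L\<^sup>2) + 9 * \<kappa> ^ 3 * ?\<Delta> i)"
    unfolding dualD_def by (rule avg_mono)
  also have "\<dots> = (1 - 1 / (4 * \<kappa>)) * dualD t + \<kappa> / 2 * (err t / L\<^sup>2) + 9 * \<kappa> ^ 3 * avg ?\<Delta>"
    unfolding avg_add avg_cmult avg_cdiv dualD_def err_def ..
  also have "9 * \<kappa> ^ 3 * avg ?\<Delta> \<le> 9 * \<kappa> ^ 3 * (2 * (stepX t + stepL t))"
    using kappa_ge_1 by (intro mult_left_mono avg_drift) auto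
  finally show ?thesis by (simp add: algebra_simps)
qed

text \<open>Young's weight \<open>6 * \<kappa>\<^sup>2\<close> is matched to the dual distance,
  whose sum will be of order \<kappa>^2 times the gradient error and \<kappa>^4 times the steps:
  divided by \<open>12 * \<kappa>\<^sup>2\<close> it has the same order as the other terms.\<close>

lemma gap_step:
  "gap (Suc t) \<le> gap t - 3 * L * stepY t + err t / (2 * L)
     + L * (dualD (Suc t) / (12 * \<kappa>\<^sup>2) + 6 * \<kappa>\<^sup>2 * (stepX t + stepL t))"
proof -
  let ?s = "\<lambda>i. norm (X (Suc t) $ i - X t $ i) + norm (c (Suc t) i - c t i) / L"
  let ?D = "\<lambda>i. norm (yt (Suc t) i - Y (Suc t) $ i)"
  have "vl i (X (Suc t) $ i) (c (Suc t) i) - ob i (X (Suc t) $ i) (c (Suc t) i) (Y (Suc t) $ i)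
      \<le> (vl i (X t $ i) (c t i) - ob i (X t $ i) (c t i) (Y t $ i))
        - 3 * L * (norm (Y (Suc t) $ i - Y t $ i))\<^sup>2 + (norm (d t i - grd t i))\<^sup>2 / (2 * L)
        + L * (3 * \<kappa>\<^sup>2 * (?s i)\<^sup>2 + (?D i)\<^sup>2 / (12 * \<kappa>\<^sup>2))" for i
  proof -
    have asc: "ob i (X t $ i) (c t i) (Y (Suc t) $ i) - ob i (X t $ i) (c t i) (Y t $ i)
        \<ge> 3 * L * (norm (Y (Suc t) $ i - Y t $ i))\<^sup>2 - (norm (snd (d t i) - snd (grd t i)))\<^sup>2 / (2 * L)"
      by (rule minimax_agent.prox_ascent[OF agent Y_finite Y_finite Y_step_optimality])
    have "(norm (snd (d t i) - snd (grd t i)))\<^sup>2 / (2 * L) \<le> (norm (d t i - grd t i))\<^sup>2 / (2 * L)"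
      using L_pos by (intro divide_right_mono snd_err_le) auto
    moreover have "(L * norm (X (Suc t) $ i - X t $ i) + norm (c (Suc t) i - c t i)) * ?D i = L * (?s i * ?D i)"
      using L_pos by (simp add: field_simps)
    moreover have "L * (?s i * ?D i) \<le> L * ((6 * \<kappa>\<^sup>2) / 2 * (?s i)\<^sup>2 + (?D i)\<^sup>2 / (2 * (6 * \<kappa>\<^sup>2)))"
      using L_pos kappa_ge_1 by (intro mult_left_mono mult_le_weighted_squares) auto
    moreover have "L * ((6 * \<kappa>\<^sup>2) / 2 * (?s i)\<^sup>2 + (?D i)\<^sup>2 / (2 * (6 * \<kappa>\<^sup>2)))
        = L * (3 * \<kappa>\<^sup>2 * (?s i)\<^sup>2 + (?D i)\<^sup>2 / (12 * \<kappa>\<^sup>2))"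
      by simp
    ultimately show ?thesis
      using asc minimax_agent.gap_move[OF agent[of i] Y_finite[of "Suc t" i], where x = "X t $ i" and c = "c t i"
          and x' = "X (Suc t) $ i" and c' = "c (Suc t) i"] by linarith
  qed
  then have "gap (Suc t) \<le> avg (\<lambda>i. (vl i (X t $ i) (c t i) - ob i (X t $ i) (c t i) (Y t $ i))
        - 3 * L * (norm (Y (Suc t) $ i - Y t $ i))\<^sup>2 + (norm (d t i - grd t i))\<^sup>2 / (2 * L)
        + L * (3 * \<kappa>\<^sup>2 * (?s i)\<^sup>2 + (?D i)\<^sup>2 / (12 * \<kappa>\<^sup>2)))"
    unfolding gap_def by (rule avg_mono)
  also have "\<dots> = gap t - 3 * L * stepY t + err t / (2 * L)
      + L * (3 * \<kappa>\<^sup>2 * avg (\<lambda>i. (?s i)\<^sup>2) + dualD (Suc t) / (12 * \<kappa>\<^sup>2))"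
    unfolding gap_def stepY_def err_def dualD_def avg_diff[symmetric] avg_add[symmetric]
      avg_cmult[symmetric] avg_cdiv[symmetric] ..
  also have "\<dots> \<le> gap t - 3 * L * stepY t + err t / (2 * L)
      + L * (3 * \<kappa>\<^sup>2 * (2 * (stepX t + stepL t)) + dualD (Suc t) / (12 * \<kappa>\<^sup>2))"
    using L_pos by (intro add_mono mult_left_mono avg_drift order_refl) auto
  finally show ?thesis by (simp add: algebra_simps)
qed

lemma gap_nonneg: "0 \<le> gap t"
  unfolding gap_def
  by (intro avg_nonneg) (simp add: minimax_agent.obj_le_val[OF agent Y_finite])

text \<open>Quadratic growth of each agent's problem. At time 0 it expresses the initial dual
  distance by the initial gap.\<close>

lemma dualD_le_gap: "dualD t \<le> 2 * \<kappa> / L * gap t"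
proof -
  have "scv p / 2 * (norm (yt t i - Y t $ i))\<^sup>2
      \<le> vl i (X t $ i) (c t i) - ob i (X t $ i) (c t i) (Y t $ i)" for i
    using minimax_agent.ystar_growth[OF agent[of i] Y_finite[of t i], where x = "X t $ i" and c = "c t i"]
    by (simp add: norm_minus_commute)
  then have "scv p / 2 * dualD t \<le> gap t"
    unfolding dualD_def gap_def avg_cmult[symmetric] by (rule avg_mono)
  then show ?thesis using mu_pos L_pos unfolding kappa_def by (simp add: field_simps)
qed

section \<open>Consensus errors of the copies and of the tracker\<close>

text \<open>Convexity of the square with weights \<open>r\<close> and \<open>1 - r\<close> at the
  points \<open>a\<close> and \<open>b / (1 - r)\<close>.\<close>

lemma norm_contraction_power2:
  fixes u a b r :: real
  assumes "u \<le> r * a + b" "0 \<le> u" "0 \<le> r" "r < 1" "0 \<le> a"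
  shows "u\<^sup>2 \<le> r * a\<^sup>2 + b\<^sup>2 / (1 - r)"
proof -
  have "u\<^sup>2 \<le> (r * a + b)\<^sup>2" using assms by (intro power_mono) auto
  also have "\<dots> \<le> r * a\<^sup>2 + b\<^sup>2 / (1 - r)"
  proof -
    have "0 \<le> r * ((1 - r) * a - b)\<^sup>2 / (1 - r)" using assms by simp
    also have "\<dots> = r * a\<^sup>2 + b\<^sup>2 / (1 - r) - (r * a + b)\<^sup>2"
      using assms by (simp add: field_simps power2_eq_square)
    finally show ?thesis by simp
  qed
  finally show ?thesis .
qed

lemma consX_eq: "consX t = (norm (row_dev (X t)))\<^sup>2 / real CARD('m)"
  and consV_eq: "consV t = (norm (row_dev (Vx t)))\<^sup>2 / real CARD('m)"
  unfolding consX_def consV_def avg_norm_rows[symmetric] row_dev_nth by (rule refl)+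

text \<open>The deviation from the mean is at most that from any common row; taking the proximal
  point of the mean input as this row lets nonexpansiveness act row by row.\<close>

lemma consX_step: "consX (Suc t) \<le> rho p * consX t + \<eta>\<^sup>2 / r\<^sub>1 * consV t"
proof -
  let ?U = "W ** X t - \<eta> *\<^sub>R Vx t" and ?P = "\<lambda>u. prox (\<lambda>v. ereal \<eta> * g v) u"
  have "(norm (row_dev (X (Suc t))))\<^sup>2 \<le> (norm (X (Suc t) - all_rows (?P (row_mean ?U))))\<^sup>2"
    by (rule norm_row_dev_le)
  also have "\<dots> \<le> (norm (row_dev ?U))\<^sup>2"
  proof -
    have "(norm ((X (Suc t) - all_rows (?P (row_mean ?U))) $ i))\<^sup>2 \<le> (norm (row_dev ?U $ i))\<^sup>2" for i
      using prox_scaled_nonexpansive[OF g_ccf x0 eta_pos(1), of "?U $ i" "row_mean ?U"]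
      by (intro power_mono) (simp_all add: X_Suc prox_rows_def row_dev_nth)
    then show ?thesis unfolding norm_matrix_rows by (rule sum_mono)
  qed
  finally have "norm (row_dev (X (Suc t))) \<le> norm (row_dev ?U)"
    by (rule power2_le_imp_le) simp
  also have "\<dots> \<le> norm (row_dev (W ** X t)) + norm (\<eta> *\<^sub>R row_dev (Vx t))"
    unfolding row_dev_diff row_dev_scaleR by (rule norm_triangle_ineq4)
  also have "\<dots> \<le> rho p * norm (row_dev (X t)) + \<eta> * norm (row_dev (Vx t))"
    using norm_row_dev_W[of "X t"] eta_pos by simp
  finally have "(norm (row_dev (X (Suc t))))\<^sup>2
      \<le> rho p * (norm (row_dev (X t)))\<^sup>2 + (\<eta> * norm (row_dev (Vx t)))\<^sup>2 / r\<^sub>1"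
    using rho_bounds by (intro norm_contraction_power2) auto
  then have "(norm (row_dev (X (Suc t))))\<^sup>2 / real CARD('m)
      \<le> (rho p * (norm (row_dev (X t)))\<^sup>2 + (\<eta> * norm (row_dev (Vx t)))\<^sup>2 / r\<^sub>1) / real CARD('m)"
    by (rule divide_right_mono) simp
  then show ?thesis
    unfolding consX_eq consV_eq by (simp add: add_divide_distrib power_mult_distrib mult.commute)
qed

lemma consX_0: "consX 0 = 0"
  unfolding consX_def X_0 by simp

text \<open>The estimates themselves have no Lipschitz property along a path, so their change is
  routed through the exact gradients at both times.\<close>

lemma rows_x_change:
  "(norm (rows_x (d (Suc t)) - rows_x (d t)))\<^sup>2 / real CARD('m)
    \<le> 3 * (err (Suc t) + err t) + 6 * L\<^sup>2 * (stepX t + stepY t)"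
proof -
  let ?a = "\<lambda>i. norm (d (Suc t) i - grd (Suc t) i)" and ?b = "\<lambda>i. norm (d t i - grd t i)"
  let ?dx = "\<lambda>i. norm (X (Suc t) $ i - X t $ i)" and ?dy = "\<lambda>i. norm (Y (Suc t) $ i - Y t $ i)"
  have "(norm ((rows_x (d (Suc t)) - rows_x (d t)) $ i))\<^sup>2
      \<le> 3 * ((?a i)\<^sup>2 + (?b i)\<^sup>2) + 6 * L\<^sup>2 * ((?dx i)\<^sup>2 + (?dy i)\<^sup>2)" for i
  proof -
    have eq: "(rows_x (d (Suc t)) - rows_x (d t)) $ i
        = (fst (d (Suc t) i) - fst (grd (Suc t) i)) + (fst (grd (Suc t) i) - fst (grd t i))
          - (fst (d t i) - fst (grd t i))"
      unfolding rows_x_def by simp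
    have "norm ((rows_x (d (Suc t)) - rows_x (d t)) $ i) \<le> ?a i + L * (?dx i + ?dy i) + ?b i"
    proof -
      have tri: "norm (A + B - C) \<le> norm A + norm B + norm C" for A B C :: "real^'a"
        by (rule order_trans[OF norm_triangle_ineq4 add_right_mono[OF norm_triangle_ineq]])
      have "norm (fst (grd (Suc t) i) - fst (grd t i)) \<le> L * (?dx i + ?dy i)"
        by (rule minimax_agent.gx_lipschitz[OF agent[of i]])
      then show ?thesis
        unfolding eq using tri[of "fst (d (Suc t) i) - fst (grd (Suc t) i)" "fst (grd (Suc t) i) - fst (grd t i)"
            "fst (d t i) - fst (grd t i)"] fst_err_le[of "Suc t" i] fst_err_le[of t i] by linarith
    qed
    then have "(norm ((rows_x (d (Suc t)) - rows_x (d t)) $ i))\<^sup>2 \<le> (?a i + L * (?dx i + ?dy i) + ?b i)\<^sup>2"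
      by (rule power_mono) simp
    also have "\<dots> \<le> 3 * ((?a i)\<^sup>2 + (?b i)\<^sup>2) + 3 * (L * (?dx i + ?dy i))\<^sup>2"
    proof -
      have "(x + y + z)\<^sup>2 \<le> 3 * (x\<^sup>2 + z\<^sup>2) + 3 * y\<^sup>2" for x y z :: real
        using zero_le_power2[of "x - y"] zero_le_power2[of "x - z"] zero_le_power2[of "y - z"]
        by (simp add: power2_eq_square algebra_simps)
      then show ?thesis .
    qed
    also have "(L * (?dx i + ?dy i))\<^sup>2 \<le> L\<^sup>2 * (2 * ((?dx i)\<^sup>2 + (?dy i)\<^sup>2))"
      unfolding power_mult_distrib
      using power2_sum_le_weighted[of 1 "?dx i" "?dy i"] by (intro mult_left_mono) auto
    finally show ?thesis by (simp add: algebra_simps)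
  qed
  then have "avg (\<lambda>i. (norm ((rows_x (d (Suc t)) - rows_x (d t)) $ i))\<^sup>2)
      \<le> avg (\<lambda>i. 3 * ((?a i)\<^sup>2 + (?b i)\<^sup>2) + 6 * L\<^sup>2 * ((?dx i)\<^sup>2 + (?dy i)\<^sup>2))"
    by (rule avg_mono)
  then show ?thesis
    unfolding avg_norm_rows unfolding avg_linear stepX_def stepY_def err_def .
qed

lemma consV_step:
  "consV (Suc t) \<le> rho p * consV t
     + (3 * (err (Suc t) + err t) + 6 * L\<^sup>2 * (stepX t + stepY t)) / r\<^sub>1"
proof -
  let ?D = "rows_x (d (Suc t)) - rows_x (d t)"
  have "norm (row_dev (Vx (Suc t))) \<le> rho p * norm (row_dev (Vx t + ?D))"
    using norm_row_dev_W[of "Vx t + ?D"] by (simp add: Vx_Suc add_diff_eq)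
  also have "\<dots> \<le> rho p * (norm (row_dev (Vx t)) + norm ?D)"
    unfolding row_dev_add
    using rho_bounds by (intro mult_left_mono order_trans[OF norm_triangle_ineq] add_mono norm_row_dev_le_norm) auto
  also have "\<dots> \<le> rho p * norm (row_dev (Vx t)) + norm ?D"
    using rho_bounds by (simp add: distrib_left mult_left_le_one_le)
  finally have "(norm (row_dev (Vx (Suc t))))\<^sup>2 \<le> rho p * (norm (row_dev (Vx t)))\<^sup>2 + (norm ?D)\<^sup>2 / r\<^sub>1"
    using rho_bounds by (intro norm_contraction_power2) auto
  then have "(norm (row_dev (Vx (Suc t))))\<^sup>2 / real CARD('m)
      \<le> (rho p * (norm (row_dev (Vx t)))\<^sup>2 + (norm ?D)\<^sup>2 / r\<^sub>1) / real CARD('m)"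
    by (rule divide_right_mono) simp
  also have "\<dots> = rho p * consV t + ((norm ?D)\<^sup>2 / real CARD('m)) / r\<^sub>1"
    unfolding consV_eq by (simp add: add_divide_distrib mult.commute)
  also have "\<dots> \<le> rho p * consV t + (3 * (err (Suc t) + err t) + 6 * L\<^sup>2 * (stepX t + stepY t)) / r\<^sub>1"
    using rho_bounds by (intro add_left_mono divide_right_mono rows_x_change) auto
  finally show ?thesis unfolding consV_eq .
qed

text \<open>The tracking invariant: mixing preserves means, and the increments telescope.\<close>

lemma row_mean_Vx: "row_mean (Vx t) = row_mean (rows_x (d t))"
proof (induction t)
  case (Suc t)
  then show ?case by (simp add: Vx_Suc row_mean_W row_mean_add row_mean_diff)
qed (simp add: Vx_0)

end

section \<open>Descent of the merit function\<close>

lemma power2_sum3_le: "(a + b + c)\<^sup>2 \<le> 3 * (a\<^sup>2 + b\<^sup>2 + c\<^sup>2)" for a b c :: real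
  using zero_le_power2[of "a - b"] zero_le_power2[of "a - c"] zero_le_power2[of "b - c"]
  by (simp add: power2_eq_square algebra_simps)

lemma matrix_diff_rdistrib: "(A - B) ** X = A ** X - B ** X"
  for A B :: "real^'m::finite^'n::finite" and X :: "real^'d::finite^'m"
  by (simp add: vec_eq_iff[of "(A - B) ** X"] matrix_mult_row sum_subtractf scaleR_left_diff_distrib)

context vrlm_path
begin

text \<open>The proximal inequality tested at the old copy; the shift of the proximal center caused
  by mixing survives as a linear term.\<close>

lemma gr_step:
  "gr (X (Suc t) $ i) - gr (X t $ i)
    \<le> - (1 / \<eta>) * (norm (X (Suc t) $ i - X t $ i))\<^sup>2 - (X (Suc t) $ i - X t $ i) \<bullet> Vx t $ i
      + (1 / \<eta>) * ((X (Suc t) $ i - X t $ i) \<bullet> ((W - mat 1) ** X t) $ i)"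
proof -
  let ?u = "(W ** X t) $ i - \<eta> *\<^sub>R Vx t $ i" and ?d = "X (Suc t) $ i - X t $ i"
  have eq: "X (Suc t) $ i = prox (\<lambda>v. ereal \<eta> * g v) ?u"
    by (simp add: X_Suc prox_rows_def)
  have WX: "((W - mat 1) ** X t) $ i = (W ** X t) $ i - X t $ i"
    using matrix_diff_rdistrib[of W "mat 1" "X t"] by simp
  have "?u - X (Suc t) $ i = ((W - mat 1) ** X t) $ i - \<eta> *\<^sub>R Vx t $ i - ?d"
    unfolding WX by simp
  moreover have "X t $ i - X (Suc t) $ i = - ?d" by simp
  ultimately have "(?u - X (Suc t) $ i) \<bullet> (X t $ i - X (Suc t) $ i)
      = - (((W - mat 1) ** X t) $ i - \<eta> *\<^sub>R Vx t $ i - ?d) \<bullet> ?d"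
    by (simp only: inner_minus_left inner_minus_right)
  also have "\<dots> = - (?d \<bullet> ((W - mat 1) ** X t) $ i) + \<eta> * (?d \<bullet> Vx t $ i) + (norm ?d)\<^sup>2"
  proof -
    have "- (z - \<eta> *\<^sub>R v - D) \<bullet> D = - (D \<bullet> z) + \<eta> * (D \<bullet> v) + (norm D)\<^sup>2" for z v D :: "real^'a"
      by (simp add: power2_norm_eq_inner inner_diff_left inner_diff_right inner_commute)
    then show ?thesis .
  qed
  finally have "(1 / \<eta>) * ((?u - X (Suc t) $ i) \<bullet> (X t $ i - X (Suc t) $ i))
      = - (1 / \<eta>) * (?d \<bullet> ((W - mat 1) ** X t) $ i) + (?d \<bullet> Vx t $ i) + (1 / \<eta>) * (norm ?d)\<^sup>2"
    using eta_pos(1) by (simp add: field_simps)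
  then show ?thesis
    using prox_scaled_subgradient[OF g_ccf x0 eta_pos(1) X_finite[of t i], of ?u]
    unfolding eq[symmetric] by linarith
qed

text \<open>Agent \<open>j\<close> is evaluated at the copy of agent \<open>i\<close>, so besides
  the drift in time the distance between the two copies enters; both are routed through the
  maximizer of \<open>j\<close> at its own copy.\<close>

lemma ystar_other_agent:
  "(norm (ys j (X (Suc t) $ i) (c (Suc t) j) - Y t $ j))\<^sup>2
    \<le> 2 * (norm (yt t j - Y t $ j))\<^sup>2 + 6 * \<kappa>\<^sup>2 * ((norm (X (Suc t) $ i - X t $ i))\<^sup>2
       + (norm (X t $ i - X t $ j))\<^sup>2 + (norm (c (Suc t) j - c t j))\<^sup>2 / L\<^sup>2)"
proof -
  let ?a = "norm (X (Suc t) $ i - X t $ i)" and ?b = "norm (X t $ i - X t $ j)"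
    and ?e = "norm (c (Suc t) j - c t j) / L"
  have "norm (ys j (X (Suc t) $ i) (c (Suc t) j) - yt t j) \<le> \<kappa> * (norm (X (Suc t) $ i - X t $ j) + ?e)"
    unfolding kappa_def by (rule minimax_agent.ystar_lipschitz'[OF agent])
  also have "\<dots> \<le> \<kappa> * (?a + ?b + ?e)"
    using norm_triangle_ineq[of "X (Suc t) $ i - X t $ i" "X t $ i - X t $ j"] kappa_ge_1
    by (intro mult_left_mono) auto
  finally have "norm (ys j (X (Suc t) $ i) (c (Suc t) j) - Y t $ j)
      \<le> norm (yt t j - Y t $ j) + \<kappa> * (?a + ?b + ?e)"
    using norm_triangle_ineq[of "ys j (X (Suc t) $ i) (c (Suc t) j) - yt t j" "yt t j - Y t $ j"] by simp
  then have "(norm (ys j (X (Suc t) $ i) (c (Suc t) j) - Y t $ j))\<^sup>2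
      \<le> (norm (yt t j - Y t $ j) + \<kappa> * (?a + ?b + ?e))\<^sup>2"
    by (rule power_mono) simp
  also have "\<dots> \<le> 2 * (norm (yt t j - Y t $ j))\<^sup>2 + 2 * (\<kappa>\<^sup>2 * (?a + ?b + ?e)\<^sup>2)"
    using power2_sum_le_weighted[of 1 "norm (yt t j - Y t $ j)" "\<kappa> * (?a + ?b + ?e)"]
    by (simp add: power_mult_distrib)
  also have "\<dots> \<le> 2 * (norm (yt t j - Y t $ j))\<^sup>2 + 2 * (\<kappa>\<^sup>2 * (3 * (?a\<^sup>2 + ?b\<^sup>2 + ?e\<^sup>2)))"
    by (intro add_left_mono mult_left_mono power2_sum3_le) auto
  finally show ?thesis by (simp add: power_divide algebra_simps)
qed

text \<open>One pair of agents: the function of \<open>j\<close> at the copy of \<open>i\<close>. Of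
  the coefficient \<open>1 / \<eta>\<close> of the squared step, four uses of Young's inequality
  take 1/4 in all, the mixing term takes 1/4 and smoothness 1/480, which leaves more than
  1/3.\<close>

lemma merit_step_pointwise:
  fixes t :: nat and i j :: 'm
  defines "\<Delta> \<equiv> X (Suc t) $ i - X t $ i" and "D \<equiv> norm (yt t j - Y t $ j)"
    and "s \<equiv> norm (c (Suc t) j - c t j)"
  shows "(vl j (X (Suc t) $ i) (c (Suc t) j) - vl j (X t $ i) (c t j)) + (gr (X (Suc t) $ i) - gr (X t $ i))
    \<le> - (1 / (3 * \<eta>)) * (norm \<Delta>)\<^sup>2 + \<Delta> \<bullet> (fst (d t j) - row_mean (Vx t))
      + 4 * \<eta> * L\<^sup>2 * (norm (X t $ i - X t $ j))\<^sup>2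
      + (4 * \<eta> + \<eta>\<^sub>\<Lambda>) * L\<^sup>2 * (2 * D\<^sup>2 + 6 * \<kappa>\<^sup>2 * ((norm \<Delta>)\<^sup>2 + (norm (X t $ i - X t $ j))\<^sup>2 + s\<^sup>2 / L\<^sup>2))
      + 4 * \<eta> * (norm (d t j - grd t j))\<^sup>2 + 1 / (4 * \<eta>\<^sub>\<Lambda> * L\<^sup>2) * s\<^sup>2
      - (c (Suc t) j - c t j) \<bullet> Y t $ j
      + 4 * \<eta> * (norm (Vx t $ i - row_mean (Vx t)))\<^sup>2
      + (1 / \<eta>) * (norm (((W - mat 1) ** X t) $ i))\<^sup>2"
proof -
  let ?u = "ys j (X (Suc t) $ i) (c (Suc t) j)"
  define w where "w = norm (?u - Y t $ j)"
  define xx where "xx = norm (X t $ i - X t $ j)"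
  define \<epsilon> where "\<epsilon> = norm (d t j - grd t j)"
  define N where "N = norm \<Delta>"
  define z where "z = ((W - mat 1) ** X t) $ i"
  define vb where "vb = row_mean (Vx t)"
  define G where "G = fst (gradient (f j) (X t $ i, ?u))"
  have w2: "w\<^sup>2 \<le> 2 * D\<^sup>2 + 6 * \<kappa>\<^sup>2 * (N\<^sup>2 + xx\<^sup>2 + s\<^sup>2 / L\<^sup>2)"
    unfolding w_def D_def N_def xx_def s_def \<Delta>_def by (rule ystar_other_agent)
  have e8: "0 < 1 / (8 * \<eta>)" using eta_pos by simp
  have young: "a * b \<le> 1 / (16 * \<eta>) * a\<^sup>2 + 4 * \<eta> * b\<^sup>2" for a b :: real
    using mult_le_weighted_squares[OF e8, of a b] by (simp add: mult.commute)
  have v: "vl j (X (Suc t) $ i) (c (Suc t) j) - vl j (X t $ i) (c t j)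
      \<le> \<Delta> \<bullet> G + L / 2 * N\<^sup>2 - (c (Suc t) j - c t j) \<bullet> ?u"
    unfolding \<Delta>_def G_def N_def by (rule minimax_agent.val_step[OF agent])
  have gr: "gr (X (Suc t) $ i) - gr (X t $ i)
      \<le> - (1 / \<eta>) * N\<^sup>2 - \<Delta> \<bullet> Vx t $ i + (1 / \<eta>) * (\<Delta> \<bullet> z)"
    unfolding \<Delta>_def N_def z_def by (rule gr_step)
  have G1: "norm (G - fst (d t j)) \<le> L * xx + L * w + \<epsilon>"
  proof -
    have "norm (G - fst (grd t j)) \<le> L * (xx + w)"
      unfolding G_def xx_def w_def by (rule minimax_agent.gx_lipschitz[OF agent])
    moreover have "norm (fst (grd t j) - fst (d t j)) \<le> \<epsilon>"
      using fst_err_le[of t j] unfolding \<epsilon>_def by (simp add: norm_minus_commute)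
    ultimately show ?thesis
      using norm_triangle_ineq[of "G - fst (grd t j)" "fst (grd t j) - fst (d t j)"]
      by (simp add: algebra_simps)
  qed
  \<comment> \<open>The first summand will have mean zero over \<open>j\<close> and is kept linear;
    the second is the error of the gradient estimate, the third the deviation of the
    tracker.\<close>
  have "\<Delta> \<bullet> G - \<Delta> \<bullet> Vx t $ i
      = \<Delta> \<bullet> (fst (d t j) - vb) + \<Delta> \<bullet> (G - fst (d t j)) + \<Delta> \<bullet> (vb - Vx t $ i)"
    by (simp add: inner_diff_right)
  moreover have "\<Delta> \<bullet> (G - fst (d t j)) \<le> N * (L * xx) + N * (L * w) + N * \<epsilon>"
  proof -
    have "\<Delta> \<bullet> (G - fst (d t j)) \<le> N * norm (G - fst (d t j))"
      unfolding N_def by (rule norm_cauchy_schwarz)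
    also have "\<dots> \<le> N * (L * xx + L * w + \<epsilon>)"
      unfolding N_def by (intro mult_left_mono G1) simp
    finally show ?thesis by (simp add: algebra_simps)
  qed
  moreover have "\<Delta> \<bullet> (vb - Vx t $ i) \<le> N * norm (Vx t $ i - vb)"
    using norm_cauchy_schwarz[of \<Delta> "vb - Vx t $ i"] unfolding N_def by (simp add: norm_minus_commute)
  moreover have "(1 / \<eta>) * (\<Delta> \<bullet> z) \<le> (1 / \<eta>) * (1 / 4 * N\<^sup>2 + (norm z)\<^sup>2)"
  proof (rule mult_left_mono)
    show "\<Delta> \<bullet> z \<le> 1 / 4 * N\<^sup>2 + (norm z)\<^sup>2"
      using norm_cauchy_schwarz[of \<Delta> z] mult_le_weighted_squares[of "1/2" N "norm z"] unfolding N_def by simp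
  qed (use eta_pos in simp)
  moreover have "- ((c (Suc t) j - c t j) \<bullet> ?u)
      \<le> - ((c (Suc t) j - c t j) \<bullet> Y t $ j) + (1 / (4 * \<eta>\<^sub>\<Lambda> * L\<^sup>2) * s\<^sup>2 + \<eta>\<^sub>\<Lambda> * L\<^sup>2 * w\<^sup>2)"
  proof -
    \<comment> \<open>With this weight the change of the tilts costs a quarter of the descent
      \<open>stepL t / \<eta>\<^sub>\<Lambda>\<close>, so that 3/4 of it remain.\<close>
    have "0 < 1 / (2 * \<eta>\<^sub>\<Lambda> * L\<^sup>2)" using eta_pos L_pos by simp
    from mult_le_weighted_squares[OF this, of s w]
    have "s * w \<le> 1 / (4 * \<eta>\<^sub>\<Lambda> * L\<^sup>2) * s\<^sup>2 + \<eta>\<^sub>\<Lambda> * L\<^sup>2 * w\<^sup>2" by (simp add: mult_ac)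
    moreover have "- ((c (Suc t) j - c t j) \<bullet> (?u - Y t $ j)) \<le> s * w"
      using Cauchy_Schwarz_ineq2[of "c (Suc t) j - c t j" "?u - Y t $ j"] unfolding s_def w_def by linarith
    ultimately show ?thesis by (simp add: inner_diff_right)
  qed
  ultimately have main: "(vl j (X (Suc t) $ i) (c (Suc t) j) - vl j (X t $ i) (c t j)) + (gr (X (Suc t) $ i) - gr (X t $ i))
    \<le> L / 2 * N\<^sup>2 - (1 / \<eta>) * N\<^sup>2 + (1 / \<eta>) * (1 / 4 * N\<^sup>2 + (norm z)\<^sup>2) + \<Delta> \<bullet> (fst (d t j) - vb)
      + 4 * (1 / (16 * \<eta>) * N\<^sup>2) + 4 * \<eta> * (L * xx)\<^sup>2 + 4 * \<eta> * (L * w)\<^sup>2 + 4 * \<eta> * \<epsilon>\<^sup>2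
      + 4 * \<eta> * (norm (Vx t $ i - vb))\<^sup>2
      - (c (Suc t) j - c t j) \<bullet> Y t $ j + 1 / (4 * \<eta>\<^sub>\<Lambda> * L\<^sup>2) * s\<^sup>2 + \<eta>\<^sub>\<Lambda> * L\<^sup>2 * w\<^sup>2"
    using v gr young[of N "L * xx"] young[of N "L * w"] young[of N \<epsilon>] young[of N "norm (Vx t $ i - vb)"]
    by linarith
  have L2: "L / 2 * N\<^sup>2 \<le> 1 / (480 * \<eta>) * N\<^sup>2"
  proof (rule mult_right_mono)
    have "\<eta> * L \<le> \<eta> * (L * \<kappa>\<^sup>2)" using eta_pos L_pos kappa_squares by simp
    then have "\<eta> * L \<le> 1 / 240" using eta_le_1 by linarith
    then show "L / 2 \<le> 1 / (480 * \<eta>)" using eta_pos by (simp add: field_simps)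
  qed simp
  have "(1 / \<eta>) * N\<^sup>2 \<ge> 0" using eta_pos by simp
  then have "L / 2 * N\<^sup>2 - (1 / \<eta>) * N\<^sup>2 + (1 / \<eta>) * (1 / 4 * N\<^sup>2 + (norm z)\<^sup>2) + 4 * (1 / (16 * \<eta>) * N\<^sup>2)
      \<le> - (1 / (3 * \<eta>)) * N\<^sup>2 + (1 / \<eta>) * (norm z)\<^sup>2"
    using L2 by (simp add: algebra_simps)
  moreover have "4 * \<eta> * (L * w)\<^sup>2 + \<eta>\<^sub>\<Lambda> * L\<^sup>2 * w\<^sup>2 = (4 * \<eta> + \<eta>\<^sub>\<Lambda>) * L\<^sup>2 * w\<^sup>2"
    by (simp add: power_mult_distrib algebra_simps)
  moreover have "(4 * \<eta> + \<eta>\<^sub>\<Lambda>) * L\<^sup>2 * w\<^sup>2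
      \<le> (4 * \<eta> + \<eta>\<^sub>\<Lambda>) * L\<^sup>2 * (2 * D\<^sup>2 + 6 * \<kappa>\<^sup>2 * (N\<^sup>2 + xx\<^sup>2 + s\<^sup>2 / L\<^sup>2))"
    using eta_pos by (intro mult_left_mono w2) auto
  moreover have "4 * \<eta> * (L * xx)\<^sup>2 = 4 * \<eta> * L\<^sup>2 * xx\<^sup>2" by (simp add: power_mult_distrib)
  ultimately show ?thesis
    using main unfolding N_def xx_def \<epsilon>_def z_def vb_def by linarith
qed

lemma avg_pair_dist: "avg (\<lambda>i. avg (\<lambda>j. (norm (X t $ i - X t $ j))\<^sup>2)) = 2 * consX t"
proof -
  have "avg (\<lambda>j. (norm (X t $ i - X t $ j))\<^sup>2) = consX t + (norm (X t $ i - row_mean (X t)))\<^sup>2" for i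
    using avg_dist_row_mean[of "X t" "X t $ i"] unfolding consX_def by (simp add: norm_minus_commute)
  then show ?thesis by (simp add: avg_add consX_def)
qed

lemma avg_Wm1_X: "avg (\<lambda>i. (norm (((W - mat 1) ** X t) $ i))\<^sup>2) \<le> 4 * consX t"
proof -
  have "norm ((W - mat 1) ** X t) \<le> 2 * norm (row_dev (X t))"
    by (subst Wm1_row_dev) (rule norm_Wm1_le)
  then have "(norm ((W - mat 1) ** X t))\<^sup>2 \<le> (2 * norm (row_dev (X t)))\<^sup>2" by (rule power_mono) simp
  then show ?thesis
    unfolding avg_norm_rows consX_eq by (simp add: power_mult_distrib divide_right_mono)
qed

lemma Lam_step_Y: "(L / (2 * sqrt (real CARD('m)))) *\<^sub>R ((W - mat 1) ** Y t) = (1 / \<eta>\<^sub>\<Lambda>) *\<^sub>R (\<Lambda> (Suc t) - \<Lambda> t)"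
  unfolding Lam_Suc using eta_pos by simp

text \<open>The multiplier moves along \<open>(W - mat 1) ** Y t\<close>, so this linear term is a
  square with the full weight \<open>1 / \<eta>\<^sub>\<Lambda>\<close>; it is the source of descent
  in the multiplier.\<close>

lemma avg_c_step_Y: "avg (\<lambda>j. (c (Suc t) j - c t j) \<bullet> Y t $ j) = (1 / \<eta>\<^sub>\<Lambda>) * stepL t"
proof -
  have "avg (\<lambda>j. (c (Suc t) j - c t j) \<bullet> Y t $ j)
      = (\<Lambda> (Suc t) - \<Lambda> t) \<bullet> ((L / (2 * sqrt (real CARD('m)))) *\<^sub>R ((W - mat 1) ** Y t))"
    unfolding cvec_diff avg_cvec_inner by simp
  then show ?thesis unfolding Lam_step_Y stepL_def by (simp add: power2_norm_eq_inner)
qed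

lemma merit_step:
  "merit (Suc t) \<le> merit t - 1 / (3 * \<eta>) * stepX t - 3 / (4 * \<eta>\<^sub>\<Lambda>) * stepL t
     + (4 * \<eta> + \<eta>\<^sub>\<Lambda>) * L\<^sup>2 * (2 * dualD t + 6 * \<kappa>\<^sup>2 * (stepX t + 2 * consX t + stepL t))
     + 4 * \<eta> * err t + 4 * \<eta> * consV t + (4 / \<eta> + 8 * \<eta> * L\<^sup>2) * consX t"
proof -
  let ?\<Delta> = "\<lambda>i. X (Suc t) $ i - X t $ i"
  let ?D = "\<lambda>j. (norm (yt t j - Y t $ j))\<^sup>2" and ?s = "\<lambda>j. (norm (c (Suc t) j - c t j))\<^sup>2"
  let ?xx = "\<lambda>i j. (norm (X t $ i - X t $ j))\<^sup>2"
  let ?z = "\<lambda>i. (norm (((W - mat 1) ** X t) $ i))\<^sup>2"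
  let ?Q = "\<lambda>i j. - (1 / (3 * \<eta>)) * (norm (?\<Delta> i))\<^sup>2 + ?\<Delta> i \<bullet> (fst (d t j) - row_mean (Vx t))
      + 4 * \<eta> * L\<^sup>2 * ?xx i j
      + (4 * \<eta> + \<eta>\<^sub>\<Lambda>) * L\<^sup>2 * (2 * ?D j + 6 * \<kappa>\<^sup>2 * ((norm (?\<Delta> i))\<^sup>2 + ?xx i j + ?s j / L\<^sup>2))
      + 4 * \<eta> * (norm (d t j - grd t j))\<^sup>2 + 1 / (4 * \<eta>\<^sub>\<Lambda> * L\<^sup>2) * ?s j
      - (c (Suc t) j - c t j) \<bullet> Y t $ j
      + 4 * \<eta> * (norm (Vx t $ i - row_mean (Vx t)))\<^sup>2
      + (1 / \<eta>) * ?z i"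
  have "merit (Suc t) - merit t = avg (\<lambda>i. avg (\<lambda>j.
      (vl j (X (Suc t) $ i) (c (Suc t) j) - vl j (X t $ i) (c t j)) + (gr (X (Suc t) $ i) - gr (X t $ i))))"
    unfolding merit_def Pmax_eq avg_linear avg_const by simp
  also have "\<dots> \<le> avg (\<lambda>i. avg (?Q i))"
    by (intro avg_mono merit_step_pointwise)
  also have "\<dots> = - (1 / (3 * \<eta>)) * stepX t + 4 * \<eta> * L\<^sup>2 * (2 * consX t)
      + (4 * \<eta> + \<eta>\<^sub>\<Lambda>) * L\<^sup>2 * (2 * dualD t + 6 * \<kappa>\<^sup>2 * (stepX t + 2 * consX t + avg ?s / L\<^sup>2))
      + 4 * \<eta> * err t + 1 / (4 * \<eta>\<^sub>\<Lambda> * L\<^sup>2) * avg ?s - (1 / \<eta>\<^sub>\<Lambda>) * stepL t + 4 * \<eta> * consV t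
      + (1 / \<eta>) * avg ?z"
  proof -
    \<comment> \<open>By \<open>row_mean_Vx\<close> the estimates \<open>fst (d t j)\<close> average
      to the mean of the tracker.\<close>
    have zero: "avg (\<lambda>j. u \<bullet> (fst (d t j) - row_mean (Vx t))) = 0" for u
      using avg_inner_row_mean[of "rows_x (d t)" u]
      unfolding row_mean_Vx inner_diff_right avg_diff avg_const
      by (simp add: rows_x_def inner_commute)
    show ?thesis
      unfolding avg_add avg_diff avg_cmult avg_cdiv avg_const zero avg_pair_dist avg_c_step_Y
        stepX_def[symmetric] dualD_def[symmetric] err_def[symmetric] consV_def[symmetric] by simp
  qed
  also have "\<dots> \<le> - (1 / (3 * \<eta>)) * stepX t + 4 * \<eta> * L\<^sup>2 * (2 * consX t)
      + (4 * \<eta> + \<eta>\<^sub>\<Lambda>) * L\<^sup>2 * (2 * dualD t + 6 * \<kappa>\<^sup>2 * (stepX t + 2 * consX t + (L\<^sup>2 * stepL t) / L\<^sup>2))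
      + 4 * \<eta> * err t + 1 / (4 * \<eta>\<^sub>\<Lambda> * L\<^sup>2) * (L\<^sup>2 * stepL t) - (1 / \<eta>\<^sub>\<Lambda>) * stepL t + 4 * \<eta> * consV t
      + (1 / \<eta>) * (4 * consX t)"
    using eta_pos by (intro add_mono diff_mono mult_left_mono divide_right_mono c_step avg_Wm1_X order_refl) auto
  also have "(L\<^sup>2 * stepL t) / L\<^sup>2 = stepL t" using L_pos by simp
  also have "1 / (4 * \<eta>\<^sub>\<Lambda> * L\<^sup>2) * (L\<^sup>2 * stepL t) = 1 / (4 * \<eta>\<^sub>\<Lambda>) * stepL t" using L_pos by simp
  finally show ?thesis by (simp add: algebra_simps add_divide_distrib)
qed

lemma merit_lower: "\<phi>lb \<le> merit t"
proof -
  have "avg (\<lambda>i::'m. \<phi>lb) \<le> merit t"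
    unfolding merit_def by (intro avg_mono phi_lower X_finite)
  then show ?thesis by simp
qed

section \<open>Bounds for the two stationarity measures\<close>

lemma avg_ystar_mean:
  "avg (\<lambda>j. (norm (ys j (row_mean (X t)) (c t j) - Y t $ j))\<^sup>2) \<le> 2 * dualD t + 2 * \<kappa>\<^sup>2 * consX t"
proof -
  have "(norm (ys j (row_mean (X t)) (c t j) - Y t $ j))\<^sup>2
      \<le> 2 * (norm (yt t j - Y t $ j))\<^sup>2 + 2 * \<kappa>\<^sup>2 * (norm (X t $ j - row_mean (X t)))\<^sup>2" for j
  proof -
    have "norm (ys j (row_mean (X t)) (c t j) - yt t j) \<le> \<kappa> * norm (X t $ j - row_mean (X t))"
      using minimax_agent.ystar_lipschitz'[OF agent, of j "row_mean (X t)" "c t j" "X t $ j" "c t j"]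
      unfolding kappa_def by (simp add: norm_minus_commute)
    then have "norm (ys j (row_mean (X t)) (c t j) - Y t $ j)
        \<le> norm (yt t j - Y t $ j) + \<kappa> * norm (X t $ j - row_mean (X t))"
      using norm_triangle_ineq[of "ys j (row_mean (X t)) (c t j) - yt t j" "yt t j - Y t $ j"] by simp
    then have "(norm (ys j (row_mean (X t)) (c t j) - Y t $ j))\<^sup>2
        \<le> (norm (yt t j - Y t $ j) + \<kappa> * norm (X t $ j - row_mean (X t)))\<^sup>2"
      by (rule power_mono) simp
    also have "\<dots> \<le> 2 * (norm (yt t j - Y t $ j))\<^sup>2 + 2 * (\<kappa> * norm (X t $ j - row_mean (X t)))\<^sup>2"
      using power2_sum_le_weighted[of 1] by simp
    finally show ?thesis by (simp add: power_mult_distrib)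
  qed
  then have "avg (\<lambda>j. (norm (ys j (row_mean (X t)) (c t j) - Y t $ j))\<^sup>2)
      \<le> avg (\<lambda>j. 2 * (norm (yt t j - Y t $ j))\<^sup>2 + 2 * \<kappa>\<^sup>2 * (norm (X t $ j - row_mean (X t)))\<^sup>2)"
    by (rule avg_mono)
  then show ?thesis unfolding avg_linear dualD_def consX_def .
qed

lemma gradient_mean_error:
  "(norm (row_mean (Vx t) - gradPx (row_mean (X t)) (\<Lambda> t)))\<^sup>2
    \<le> 3 * err t + 12 * L\<^sup>2 * \<kappa>\<^sup>2 * consX t + 6 * L\<^sup>2 * dualD t"
proof -
  let ?x = "row_mean (X t)"
  let ?y = "\<lambda>j. ys j ?x (c t j)"
  let ?G = "(\<chi> j. fst (gradient (f j) (?x, ?y j))) :: real^'a^'m"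
  have "(norm ((rows_x (d t) - ?G) $ j))\<^sup>2 \<le> 3 * ((norm (d t j - grd t j))\<^sup>2
      + L\<^sup>2 * (norm (X t $ j - ?x))\<^sup>2 + L\<^sup>2 * (norm (?y j - Y t $ j))\<^sup>2)" for j
  proof -
    have "norm (fst (grd t j) - fst (gradient (f j) (?x, ?y j)))
        \<le> L * (norm (X t $ j - ?x) + norm (Y t $ j - ?y j))"
      by (rule minimax_agent.gx_lipschitz[OF agent])
    then have "norm ((rows_x (d t) - ?G) $ j)
        \<le> norm (d t j - grd t j) + L * norm (X t $ j - ?x) + L * norm (?y j - Y t $ j)"
      using norm_triangle_ineq[of "fst (d t j) - fst (grd t j)" "fst (grd t j) - fst (gradient (f j) (?x, ?y j))"]
        fst_err_le[of t j]
      by (simp add: rows_x_def algebra_simps norm_minus_commute[of "Y t $ j"])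
    then have "(norm ((rows_x (d t) - ?G) $ j))\<^sup>2
        \<le> (norm (d t j - grd t j) + L * norm (X t $ j - ?x) + L * norm (?y j - Y t $ j))\<^sup>2"
      by (rule power_mono) simp
    also have "\<dots> \<le> 3 * ((norm (d t j - grd t j))\<^sup>2 + (L * norm (X t $ j - ?x))\<^sup>2 + (L * norm (?y j - Y t $ j))\<^sup>2)"
      by (rule power2_sum3_le)
    finally show ?thesis by (simp add: power_mult_distrib)
  qed
  then have "avg (\<lambda>j. (norm ((rows_x (d t) - ?G) $ j))\<^sup>2) \<le> avg (\<lambda>j. 3 * ((norm (d t j - grd t j))\<^sup>2
      + L\<^sup>2 * (norm (X t $ j - ?x))\<^sup>2 + L\<^sup>2 * (norm (?y j - Y t $ j))\<^sup>2))"
    by (rule avg_mono)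
  also have "\<dots> = 3 * (err t + L\<^sup>2 * consX t + L\<^sup>2 * avg (\<lambda>j. (norm (?y j - Y t $ j))\<^sup>2))"
    unfolding avg_linear err_def consX_def ..
  also have "\<dots> \<le> 3 * (err t + L\<^sup>2 * consX t + L\<^sup>2 * (2 * dualD t + 2 * \<kappa>\<^sup>2 * consX t))"
    by (intro mult_left_mono add_left_mono avg_ystar_mean) auto
  also have "\<dots> \<le> 3 * (err t + L\<^sup>2 * (\<kappa>\<^sup>2 * consX t) + L\<^sup>2 * (2 * dualD t + 2 * \<kappa>\<^sup>2 * consX t))"
    using mult_right_mono[OF kappa_squares(1) quantities_nonneg(6)[of t]]
    by (intro mult_left_mono add_mono order_refl) simp_all
  also have "\<dots> \<le> 3 * err t + 12 * L\<^sup>2 * \<kappa>\<^sup>2 * consX t + 6 * L\<^sup>2 * dualD t"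
    by (simp add: algebra_simps)
  finally have "avg (\<lambda>j. (norm ((rows_x (d t) - ?G) $ j))\<^sup>2) \<le> \<dots>" .
  moreover have "row_mean (Vx t) - gradPx ?x (\<Lambda> t) = row_mean (rows_x (d t) - ?G)"
    unfolding row_mean_Vx gradPx_def row_mean_diff ..
  ultimately show ?thesis
    using norm_row_mean_power2[of "rows_x (d t) - ?G"] by (simp only:)
qed

text \<open>The exact proximal gradient point is compared, by nonexpansiveness, with the next copy
  of each agent; the left side does not depend on the agent, so averaging loses nothing. Five error
  terms give the factor 5.\<close>

lemma prox_gradient_map_bound:
  "(norm (prox_gradient_map p \<eta> (row_mean (X t)) (\<Lambda> t)))\<^sup>2
    \<le> 5 / \<eta>\<^sup>2 * (2 * consX t + stepX t) + 5 * consV t + 15 * err t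
      + 60 * L\<^sup>2 * \<kappa>\<^sup>2 * consX t + 30 * L\<^sup>2 * dualD t"
proof -
  let ?x = "row_mean (X t)" and ?P = "\<lambda>u. prox (\<lambda>v. ereal \<eta> * g v) u"
  let ?g = "gradPx ?x (\<Lambda> t)" and ?vb = "row_mean (Vx t)"
  define q where "q = norm (?x - ?P (?x - \<eta> *\<^sub>R ?g))"
  define E where "E = norm (?vb - ?g)"
  have "q\<^sup>2 \<le> 5 * ((norm (X t $ i - ?x))\<^sup>2 + (norm (X (Suc t) $ i - X t $ i))\<^sup>2
      + (norm (row_dev (W ** X t) $ i))\<^sup>2 + \<eta>\<^sup>2 * (norm (Vx t $ i - ?vb))\<^sup>2 + \<eta>\<^sup>2 * E\<^sup>2)" for i
  proof -
    let ?u = "(W ** X t) $ i - \<eta> *\<^sub>R Vx t $ i"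
    have "norm (X (Suc t) $ i - ?P (?x - \<eta> *\<^sub>R ?g)) \<le> norm (?u - (?x - \<eta> *\<^sub>R ?g))"
      using prox_scaled_nonexpansive[OF g_ccf x0 eta_pos(1), of ?u "?x - \<eta> *\<^sub>R ?g"]
      by (simp add: X_Suc prox_rows_def)
    also have "?u - (?x - \<eta> *\<^sub>R ?g) = row_dev (W ** X t) $ i - \<eta> *\<^sub>R (Vx t $ i - ?vb) - \<eta> *\<^sub>R (?vb - ?g)"
      unfolding row_dev_nth row_mean_W by (simp add: algebra_simps)
    also have "norm \<dots> \<le> norm (row_dev (W ** X t) $ i) + norm (\<eta> *\<^sub>R (Vx t $ i - ?vb)) + norm (\<eta> *\<^sub>R (?vb - ?g))"
      by (rule order_trans[OF norm_triangle_ineq4 add_right_mono[OF norm_triangle_ineq4]])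
    also have "\<dots> = norm (row_dev (W ** X t) $ i) + \<eta> * norm (Vx t $ i - ?vb) + \<eta> * E"
      unfolding E_def using eta_pos by simp
    finally have 1: "norm (X (Suc t) $ i - ?P (?x - \<eta> *\<^sub>R ?g)) \<le> \<dots>" .
    have "?x - ?P (?x - \<eta> *\<^sub>R ?g) = - (X t $ i - ?x) - (X (Suc t) $ i - X t $ i) + (X (Suc t) $ i - ?P (?x - \<eta> *\<^sub>R ?g))"
      by simp
    then have "q \<le> norm (- (X t $ i - ?x) - (X (Suc t) $ i - X t $ i)) + norm (X (Suc t) $ i - ?P (?x - \<eta> *\<^sub>R ?g))"
      unfolding q_def by (metis norm_triangle_ineq)
    also have "norm (- (X t $ i - ?x) - (X (Suc t) $ i - X t $ i)) \<le> norm (X t $ i - ?x) + norm (X (Suc t) $ i - X t $ i)"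
      using norm_triangle_ineq4[of "- (X t $ i - ?x)" "X (Suc t) $ i - X t $ i"] by (simp only: norm_minus_cancel)
    finally have "q \<le> norm (X t $ i - ?x) + norm (X (Suc t) $ i - X t $ i)
        + norm (row_dev (W ** X t) $ i) + \<eta> * norm (Vx t $ i - ?vb) + \<eta> * E"
      using 1 by linarith
    then have "q\<^sup>2 \<le> (norm (X t $ i - ?x) + norm (X (Suc t) $ i - X t $ i)
        + norm (row_dev (W ** X t) $ i) + \<eta> * norm (Vx t $ i - ?vb) + \<eta> * E)\<^sup>2"
      by (rule power_mono) (simp add: q_def)
    also have "\<dots> \<le> 5 * ((norm (X t $ i - ?x))\<^sup>2 + (norm (X (Suc t) $ i - X t $ i))\<^sup>2
      + (norm (row_dev (W ** X t) $ i))\<^sup>2 + (\<eta> * norm (Vx t $ i - ?vb))\<^sup>2 + (\<eta> * E)\<^sup>2)"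
    proof -
      have "(a + b + c + d + e)\<^sup>2 \<le> 5 * (a\<^sup>2 + b\<^sup>2 + c\<^sup>2 + d\<^sup>2 + e\<^sup>2)" for a b c d e :: real
        using zero_le_power2[of "a - b"] zero_le_power2[of "a - c"] zero_le_power2[of "a - d"]
          zero_le_power2[of "a - e"] zero_le_power2[of "b - c"] zero_le_power2[of "b - d"]
          zero_le_power2[of "b - e"] zero_le_power2[of "c - d"] zero_le_power2[of "c - e"] zero_le_power2[of "d - e"]
        by (simp add: power2_eq_square algebra_simps)
      then show ?thesis .
    qed
    finally show ?thesis by (simp only: power_mult_distrib)
  qed
  then have "avg (\<lambda>i::'m. q\<^sup>2) \<le> avg (\<lambda>i. 5 * ((norm (X t $ i - ?x))\<^sup>2 + (norm (X (Suc t) $ i - X t $ i))\<^sup>2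
      + (norm (row_dev (W ** X t) $ i))\<^sup>2 + \<eta>\<^sup>2 * (norm (Vx t $ i - ?vb))\<^sup>2 + \<eta>\<^sup>2 * E\<^sup>2))"
    by (rule avg_mono)
  also have "\<dots> = 5 * (consX t + stepX t + avg (\<lambda>i. (norm (row_dev (W ** X t) $ i))\<^sup>2) + \<eta>\<^sup>2 * consV t + \<eta>\<^sup>2 * E\<^sup>2)"
    unfolding avg_linear avg_const consX_def stepX_def consV_def ..
  also have "avg (\<lambda>i. (norm (row_dev (W ** X t) $ i))\<^sup>2) \<le> consX t"
  proof -
    have "norm (row_dev (W ** X t)) \<le> norm (row_dev (X t))"
      using norm_row_dev_W[of "X t"] rho_bounds mult_left_le_one_le[of "norm (row_dev (X t))" "rho p"] by simp
    then have "(norm (row_dev (W ** X t)))\<^sup>2 \<le> (norm (row_dev (X t)))\<^sup>2" by (rule power_mono) simp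
    then show ?thesis unfolding avg_norm_rows consX_eq by (rule divide_right_mono) simp
  qed
  finally have "q\<^sup>2 \<le> 5 * (2 * consX t + stepX t + \<eta>\<^sup>2 * consV t + \<eta>\<^sup>2 * E\<^sup>2)"
    by simp
  then have "q\<^sup>2 / \<eta>\<^sup>2 \<le> 5 * (2 * consX t + stepX t + \<eta>\<^sup>2 * consV t + \<eta>\<^sup>2 * E\<^sup>2) / \<eta>\<^sup>2"
    by (rule divide_right_mono) simp
  also have "\<dots> = 5 / \<eta>\<^sup>2 * (2 * consX t + stepX t) + 5 * consV t + 5 * E\<^sup>2"
    using eta_pos by (simp add: field_simps)
  finally have "q\<^sup>2 / \<eta>\<^sup>2 \<le> 5 / \<eta>\<^sup>2 * (2 * consX t + stepX t) + 5 * consV t + 5 * E\<^sup>2" .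
  moreover have "(norm (prox_gradient_map p \<eta> ?x (\<Lambda> t)))\<^sup>2 = q\<^sup>2 / \<eta>\<^sup>2"
    unfolding prox_gradient_map_def gradient_Pmax_x q_def using eta_pos by (simp add: power_divide)
  ultimately show ?thesis
    using gradient_mean_error[of t] unfolding E_def by linarith
qed

text \<open>The multiplier step is a gradient step with \<open>Y t\<close> in place of the
  maximizer, so the step divided by \<open>\<eta>\<^sub>\<Lambda>\<close> is the gradient up to sign
  and the distance of \<open>Y t\<close> from the maximizer.\<close>

lemma gradient_Lam_bound:
  "(norm (gradient (\<lambda>\<Lambda>. Pmax p (row_mean (X t)) \<Lambda>) (\<Lambda> t)))\<^sup>2
    \<le> 2 / \<eta>\<^sub>\<Lambda>\<^sup>2 * stepL t + 4 * L\<^sup>2 * (dualD t + \<kappa>\<^sup>2 * consX t)"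
proof -
  let ?k = "L / (2 * sqrt (real CARD('m)))" and ?Z = "Ystar (row_mean (X t)) (\<Lambda> t)"
  have k: "0 \<le> ?k" using L_pos by simp
  have "?k *\<^sub>R ((W - mat 1) ** ?Z) = ?k *\<^sub>R ((W - mat 1) ** Y t) + ?k *\<^sub>R ((W - mat 1) ** (?Z - Y t))"
    unfolding scaleR_add_right[symmetric] matrix_add_ldistrib[symmetric] by simp
  then have "norm (?k *\<^sub>R ((W - mat 1) ** ?Z))
      \<le> norm (?k *\<^sub>R ((W - mat 1) ** Y t)) + norm (?k *\<^sub>R ((W - mat 1) ** (?Z - Y t)))"
    by (metis norm_triangle_ineq)
  moreover have "norm (?k *\<^sub>R ((W - mat 1) ** (?Z - Y t))) \<le> ?k * (2 * norm (?Z - Y t))"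
    unfolding norm_scaleR abs_of_nonneg[OF k] by (rule mult_left_mono[OF norm_Wm1_le k])
  moreover have "norm (?k *\<^sub>R ((W - mat 1) ** Y t)) = (1 / \<eta>\<^sub>\<Lambda>) * norm (\<Lambda> (Suc t) - \<Lambda> t)"
    unfolding Lam_step_Y using eta_pos by simp
  ultimately have "norm (?k *\<^sub>R ((W - mat 1) ** ?Z))
      \<le> (1 / \<eta>\<^sub>\<Lambda>) * norm (\<Lambda> (Suc t) - \<Lambda> t) + ?k * (2 * norm (?Z - Y t))" by linarith
  then have "(norm (?k *\<^sub>R ((W - mat 1) ** ?Z)))\<^sup>2
      \<le> ((1 / \<eta>\<^sub>\<Lambda>) * norm (\<Lambda> (Suc t) - \<Lambda> t) + ?k * (2 * norm (?Z - Y t)))\<^sup>2"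
    by (rule power_mono) (rule norm_ge_zero)
  also have "\<dots> \<le> 2 * ((1 / \<eta>\<^sub>\<Lambda>) * norm (\<Lambda> (Suc t) - \<Lambda> t))\<^sup>2 + 2 * (?k * (2 * norm (?Z - Y t)))\<^sup>2"
    using power2_sum_le_weighted[of 1] by simp
  also have "2 * ((1 / \<eta>\<^sub>\<Lambda>) * norm (\<Lambda> (Suc t) - \<Lambda> t))\<^sup>2 = 2 / \<eta>\<^sub>\<Lambda>\<^sup>2 * stepL t"
    unfolding stepL_def by (simp add: power_mult_distrib power_divide)
  also have "2 * (?k * (2 * norm (?Z - Y t)))\<^sup>2 = 2 * L\<^sup>2 * avg (\<lambda>j. (norm ((?Z - Y t) $ j))\<^sup>2)"
    unfolding avg_norm_rows by (simp add: power_mult_distrib power_divide)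
  also have "\<dots> \<le> 2 * L\<^sup>2 * (2 * dualD t + 2 * \<kappa>\<^sup>2 * consX t)"
    using avg_ystar_mean[of t] by (intro mult_left_mono) (simp_all add: Ystar_def)
  finally show ?thesis unfolding gradient_Pmax_Lam by (simp add: algebra_simps)
qed

end

section \<open>Summation over the iterations\<close>

text \<open>Telescoping. The final value, which remains on the left, is at least \<theta> times
  itself, so the sum reaches one index further than the recursion terms.\<close>

lemma sum_of_contraction:
  fixes u s :: "nat \<Rightarrow> real"
  assumes "\<And>t. u (Suc t) \<le> (1 - \<theta>) * u t + s t" "\<And>t. 0 \<le> u t" "\<theta> \<le> 1"
  shows "\<theta> * (\<Sum>t<Suc T. u t) \<le> u 0 + (\<Sum>t<T. s t)"
proof -
  have "u T + \<theta> * (\<Sum>t<T. u t) \<le> u 0 + (\<Sum>t<T. s t)"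
  proof (induction T)
    case (Suc T)
    then show ?case using assms(1)[of T] by (simp add: algebra_simps)
  qed simp
  moreover have "\<theta> * u T \<le> u T" using mult_right_mono[OF assms(3) assms(2)[of T]] by simp
  ultimately show ?thesis by (simp add: algebra_simps)
qed

context vrlm_path
begin

section \<open>Telescoped merit and gap inequalities\<close>

lemma merit_sum:
  "(\<Sum>t<T. 1 / (3 * \<eta>) * stepX t + 3 / (4 * \<eta>\<^sub>\<Lambda>) * stepL t) \<le> merit 0 - \<phi>lb
     + (\<Sum>t<T. (4 * \<eta> + \<eta>\<^sub>\<Lambda>) * L\<^sup>2 * (2 * dualD t + 6 * \<kappa>\<^sup>2 * (stepX t + 2 * consX t + stepL t))
         + 4 * \<eta> * err t + 4 * \<eta> * consV t + (4 / \<eta> + 8 * \<eta> * L\<^sup>2) * consX t)"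
proof -
  have "merit T + (\<Sum>t<T. 1 / (3 * \<eta>) * stepX t + 3 / (4 * \<eta>\<^sub>\<Lambda>) * stepL t) \<le> merit 0
     + (\<Sum>t<T. (4 * \<eta> + \<eta>\<^sub>\<Lambda>) * L\<^sup>2 * (2 * dualD t + 6 * \<kappa>\<^sup>2 * (stepX t + 2 * consX t + stepL t))
         + 4 * \<eta> * err t + 4 * \<eta> * consV t + (4 / \<eta> + 8 * \<eta> * L\<^sup>2) * consX t)"
  proof (induction T)
    case (Suc T)
    then show ?case using merit_step[of T] unfolding sum.lessThan_Suc by linarith
  qed simp
  then show ?thesis using merit_lower[of T] by linarith
qed

lemma gap_sum:
  "(\<Sum>t<T. 3 * L * stepY t) \<le> gap 0 + (\<Sum>t<T. err t / (2 * L)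
     + L * (dualD (Suc t) / (12 * \<kappa>\<^sup>2) + 6 * \<kappa>\<^sup>2 * (stepX t + stepL t)))"
proof -
  have "gap T + (\<Sum>t<T. 3 * L * stepY t) \<le> gap 0 + (\<Sum>t<T. err t / (2 * L)
     + L * (dualD (Suc t) / (12 * \<kappa>\<^sup>2) + 6 * \<kappa>\<^sup>2 * (stepX t + stepL t)))"
  proof (induction T)
    case (Suc T)
    then show ?case using gap_step[of T] unfolding sum.lessThan_Suc by linarith
  qed simp
  then show ?thesis using gap_nonneg[of T] by linarith
qed

lemma merit_0: "merit 0 = Pmax p x\<^sub>0 0 + gr x\<^sub>0"
  unfolding merit_def X_0 Lam_0 by simp

lemma gap_0: "gap 0 = primal_gap p (all_rows x\<^sub>0) 0 (all_rows y\<^sub>0)"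
  unfolding gap_def X_0 Lam_0 Y_0 by (subst primal_gap_eq) (use y0 in simp_all)

end

section \<open>Closing the system of summed inequalities\<close>

context vrlm_problem
begin

text \<open>Real sequences stand for the expectations of the squared steps \<open>a\<close>,
  \<open>b\<close>, \<open>y\<close> of X, the multiplier and Y, the gradient error
  \<open>e\<close>, the dual distance \<open>D\<close>, the consensus errors \<open>q\<close>,
  \<open>v\<close> of copies and tracker, and the stationarity measures \<open>G\<close>,
  \<open>H\<close>. \<open>\<Delta>\<close> and \<open>\<delta>\<close> are the initial merit and
  primal gaps, \<open>\<nu>\<close> is the checkpoint variance.\<close>

context
  fixes a b y e D q v G H :: "nat \<Rightarrow> real" and T :: nat and \<nu> \<Delta> \<delta> C\<^sub>V \<epsilon> :: real
  assumes nonneg: "\<And>t. 0 \<le> a t" "\<And>t. 0 \<le> b t" "\<And>t. 0 \<le> y t" "\<And>t. 0 \<le> e t" "\<And>t. 0 \<le> D t"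
      "\<And>t. 0 \<le> q t" "\<And>t. 0 \<le> v t"
    and D_step: "\<And>t. D (Suc t) \<le> (1 - 1 / (4 * \<kappa>)) * D t + (\<kappa> / 2 * (e t / L\<^sup>2) + 18 * \<kappa> ^ 3 * (a t + b t))"
    and D_0: "D 0 \<le> 2 * \<kappa> / L * \<delta>"
    and y_sum: "(\<Sum>t<T. 3 * L * y t) \<le> \<delta> + (\<Sum>t<T. e t / (2 * L)
       + L * (D (Suc t) / (12 * \<kappa>\<^sup>2) + 6 * \<kappa>\<^sup>2 * (a t + b t)))"
    and q_step: "\<And>t. q (Suc t) \<le> rho p * q t + \<eta>\<^sup>2 / r\<^sub>1 * v t" and q_0: "q 0 = 0"
    and v_step: "\<And>t. v (Suc t) \<le> rho p * v t + (3 * (e (Suc t) + e t) + 6 * L\<^sup>2 * (a t + y t)) / r\<^sub>1"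
    and v_0: "v 0 \<le> C\<^sub>V * (L_P p * r\<^sub>1)"
    and merit: "(\<Sum>t<T. 1 / (3 * \<eta>) * a t + 3 / (4 * \<eta>\<^sub>\<Lambda>) * b t) \<le> \<Delta>
       + (\<Sum>t<T. (4 * \<eta> + \<eta>\<^sub>\<Lambda>) * L\<^sup>2 * (2 * D t + 6 * \<kappa>\<^sup>2 * (a t + 2 * q t + b t))
         + 4 * \<eta> * e t + 4 * \<eta> * v t + (4 / \<eta> + 8 * \<eta> * L\<^sup>2) * q t)"
    and G: "\<And>t. G t \<le> 5 / \<eta>\<^sup>2 * (2 * q t + a t) + 5 * v t + 15 * e t
      + 60 * L\<^sup>2 * \<kappa>\<^sup>2 * q t + 30 * L\<^sup>2 * D t"
    and H: "\<And>t. H t \<le> 2 / \<eta>\<^sub>\<Lambda>\<^sup>2 * b t + 4 * L\<^sup>2 * (D t + \<kappa>\<^sup>2 * q t)"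
    and spider: "(\<Sum>t<T. e t) \<le> real T * \<nu> + L\<^sup>2 * (\<Sum>t<T. a t + y t)"
    and nu: "0 \<le> \<nu>" "\<nu> * \<kappa>\<^sup>2 \<le> \<epsilon>\<^sup>2 / 10 ^ 12" "\<nu> / r\<^sub>1 ^ 4 \<le> \<epsilon>\<^sup>2 / 10 ^ 12"
    and Delta: "0 \<le> \<Delta>" and delta: "0 \<le> \<delta>" and C_V: "0 \<le> C\<^sub>V"
    and T: "0 < T" and T_large: "10 ^ 12 * (1 + C\<^sub>V) * (L * \<kappa>\<^sup>2 / \<theta> * (\<Delta> + \<delta> / \<theta> + 1)) \<le> real T * \<epsilon>\<^sup>2"
begin

definition "sA = (\<Sum>t<T. a t)"
definition "sB = (\<Sum>t<T. b t)"
definition "sY = (\<Sum>t<T. y t)"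
definition "sE = (\<Sum>t<T. e t)"
text \<open>Runs one index further than the other sums, because the ascent inequality involves
  \<open>D (Suc t)\<close>.\<close>

definition "sD = (\<Sum>t<Suc T. D t)"
definition "sQ = (\<Sum>t<T. q t)"
definition "sV = (\<Sum>t<T. v t)"
definition "sN = real T * \<nu>"

lemmas sums = sA_def sB_def sY_def sE_def sD_def sQ_def sV_def sN_def

lemma sums_nonneg: "0 \<le> sA" "0 \<le> sB" "0 \<le> sY" "0 \<le> sE" "0 \<le> sD" "0 \<le> sQ" "0 \<le> sV" "0 \<le> sN"
  unfolding sums using nonneg nu by (auto intro!: sum_nonneg mult_nonneg_nonneg simp del: sum.lessThan_Suc)

lemma D_sum_le: "(\<Sum>t<T. D t) \<le> sD" "(\<Sum>t<T. D (Suc t)) \<le> sD"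
proof -
  show "(\<Sum>t<T. D t) \<le> sD" unfolding sD_def using nonneg by simp
  have "sD = D 0 + (\<Sum>t<T. D (Suc t))" unfolding sD_def by (rule sum.lessThan_Suc_shift)
  then show "(\<Sum>t<T. D (Suc t)) \<le> sD" using nonneg by simp
qed

lemma sE_le: "sE \<le> sN + L\<^sup>2 * (sA + sY)"
  using spider unfolding sums by (simp add: sum.distrib)

lemma sD_le_0: "sD \<le> 8 * \<kappa>\<^sup>2 * (\<delta> / L) + 2 * \<kappa>\<^sup>2 * (sE / L\<^sup>2) + 72 * \<kappa> ^ 4 * (sA + sB)"
proof -
  have "1 / (4 * \<kappa>) * sD \<le> D 0 + (\<Sum>t<T. \<kappa> / 2 * (e t / L\<^sup>2) + 18 * \<kappa> ^ 3 * (a t + b t))"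
    unfolding sD_def using D_step nonneg kappa_ge_1 by (intro sum_of_contraction) auto
  also have "(\<Sum>t<T. \<kappa> / 2 * (e t / L\<^sup>2) + 18 * \<kappa> ^ 3 * (a t + b t))
      = \<kappa> / 2 * (sE / L\<^sup>2) + 18 * \<kappa> ^ 3 * (sA + sB)"
    unfolding sums by (simp add: sum.distrib sum_distrib_left[symmetric] sum_divide_distrib[symmetric])
  finally have "1 / (4 * \<kappa>) * sD \<le> 2 * \<kappa> / L * \<delta> + (\<kappa> / 2 * (sE / L\<^sup>2) + 18 * \<kappa> ^ 3 * (sA + sB))"
    using D_0 by linarith
  then have "(4 * \<kappa>) * (1 / (4 * \<kappa>) * sD)
      \<le> (4 * \<kappa>) * (2 * \<kappa> / L * \<delta> + (\<kappa> / 2 * (sE / L\<^sup>2) + 18 * \<kappa> ^ 3 * (sA + sB)))"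
    using kappa_ge_1 by (intro mult_left_mono) auto
  moreover have "(4 * \<kappa>) * (1 / (4 * \<kappa>) * sD) = sD" using kappa_ge_1 by simp
  moreover have "(4 * \<kappa>) * (2 * \<kappa> / L * \<delta> + (\<kappa> / 2 * (sE / L\<^sup>2) + 18 * \<kappa> ^ 3 * (sA + sB)))
      = 8 * \<kappa>\<^sup>2 * (\<delta> / L) + 2 * \<kappa>\<^sup>2 * (sE / L\<^sup>2) + 72 * \<kappa> ^ 4 * (sA + sB)"
    by (simp add: algebra_simps power2_eq_square power3_eq_cube power4_eq_xxxx)
  ultimately show ?thesis by linarith
qed

text \<open>Breaks the circle through \<open>sE\<close> and \<open>sD\<close>: the ascent inequality
  contains \<open>sE / L\<^sup>2\<close> with weight 1/2 directly and 1/6 through \<open>sD\<close>,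
  and \<open>sE / L\<^sup>2\<close> contains \<open>sY\<close> once; the factor 3 in front of
  \<open>sY\<close> absorbs the resulting 2/3.\<close>

lemma sY_le: "sY \<le> \<delta> / L + sN / L\<^sup>2 + 6 * \<kappa>\<^sup>2 * (sA + sB)"
proof -
  have "3 * L * sY \<le> \<delta> + sE / (2 * L) + L * ((\<Sum>t<T. D (Suc t)) / (12 * \<kappa>\<^sup>2) + 6 * \<kappa>\<^sup>2 * (sA + sB))"
    using y_sum unfolding sums
    by (simp add: sum.distrib sum_distrib_left[symmetric] sum_divide_distrib[symmetric])
  also have "\<dots> \<le> \<delta> + sE / (2 * L) + L * (sD / (12 * \<kappa>\<^sup>2) + 6 * \<kappa>\<^sup>2 * (sA + sB))"
    using L_pos by (intro add_left_mono mult_left_mono add_right_mono divide_right_mono D_sum_le) auto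
  finally have "(3 * L * sY) / L \<le> (\<delta> + sE / (2 * L) + L * (sD / (12 * \<kappa>\<^sup>2) + 6 * \<kappa>\<^sup>2 * (sA + sB))) / L"
    using L_pos by (intro divide_right_mono) auto
  then have "3 * sY \<le> \<delta> / L + 1 / 2 * (sE / L\<^sup>2) + sD / (12 * \<kappa>\<^sup>2) + 6 * \<kappa>\<^sup>2 * (sA + sB)"
    using L_pos by (simp add: add_divide_distrib power2_eq_square)
  moreover have "sD / (12 * \<kappa>\<^sup>2) \<le> 2 / 3 * (\<delta> / L) + 1 / 6 * (sE / L\<^sup>2) + 6 * \<kappa>\<^sup>2 * (sA + sB)"
  proof -
    have "sD / (12 * \<kappa>\<^sup>2) \<le> (8 * \<kappa>\<^sup>2 * (\<delta> / L) + 2 * \<kappa>\<^sup>2 * (sE / L\<^sup>2) + 72 * \<kappa> ^ 4 * (sA + sB)) / (12 * \<kappa>\<^sup>2)"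
      by (rule divide_right_mono[OF sD_le_0]) simp
    also have "\<dots> = 2 / 3 * (\<delta> / L) + 1 / 6 * (sE / L\<^sup>2) + 6 * \<kappa>\<^sup>2 * (sA + sB)"
      using kappa_ge_1 L_pos by (simp add: field_simps power2_eq_square power4_eq_xxxx)
    finally show ?thesis .
  qed
  moreover have "sE / L\<^sup>2 \<le> sN / L\<^sup>2 + (sA + sY)"
    using divide_right_mono[OF sE_le, of "L\<^sup>2"] L_pos by (simp add: add_divide_distrib)
  moreover have "sA \<le> \<kappa>\<^sup>2 * (sA + sB)"
    using mult_mono[OF kappa_squares(1), of sA "sA + sB"] sums_nonneg by simp
  moreover have "0 \<le> \<delta> / L" "0 \<le> sN / L\<^sup>2" "0 \<le> \<kappa>\<^sup>2 * (sA + sB)"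
    using delta L_pos sums_nonneg by auto
  ultimately show ?thesis using sums_nonneg by linarith
qed

lemma sE_bound: "sE \<le> 2 * sN + L * \<delta> + 7 * L\<^sup>2 * \<kappa>\<^sup>2 * (sA + sB)"
proof -
  have "sA \<le> \<kappa>\<^sup>2 * (sA + sB)"
    using mult_mono[OF kappa_squares(1), of sA "sA + sB"] sums_nonneg by simp
  then have "L\<^sup>2 * (sA + sY) \<le> L\<^sup>2 * (\<delta> / L + sN / L\<^sup>2 + 7 * \<kappa>\<^sup>2 * (sA + sB))"
    using sY_le by (intro mult_left_mono) auto
  also have "\<dots> = L * \<delta> + sN + 7 * L\<^sup>2 * \<kappa>\<^sup>2 * (sA + sB)"
    using L_pos by (simp add: field_simps power2_eq_square)
  finally show ?thesis using sE_le by linarith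
qed

lemma sD_bound: "sD \<le> 10 * \<kappa>\<^sup>2 * (\<delta> / L) + 4 * \<kappa>\<^sup>2 * (sN / L\<^sup>2) + 86 * \<kappa> ^ 4 * (sA + sB)"
proof -
  have "2 * \<kappa>\<^sup>2 * (sE / L\<^sup>2) \<le> 2 * \<kappa>\<^sup>2 * ((2 * sN + L * \<delta> + 7 * L\<^sup>2 * \<kappa>\<^sup>2 * (sA + sB)) / L\<^sup>2)"
    by (intro mult_left_mono divide_right_mono sE_bound) auto
  also have "\<dots> = 4 * \<kappa>\<^sup>2 * (sN / L\<^sup>2) + 2 * \<kappa>\<^sup>2 * (\<delta> / L) + 14 * \<kappa> ^ 4 * (sA + sB)"
    using L_pos by (simp add: field_simps power2_eq_square power4_eq_xxxx)
  finally have "2 * \<kappa>\<^sup>2 * (sE / L\<^sup>2) \<le> 4 * \<kappa>\<^sup>2 * (sN / L\<^sup>2) + 2 * \<kappa>\<^sup>2 * (\<delta> / L) + 14 * \<kappa> ^ 4 * (sA + sB)" .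
  moreover have "s \<le> 10 * k * d + 4 * k * n + 86 * K * S"
    if "x \<le> 4 * k * n + 2 * k * d + 14 * K * S" "s \<le> 8 * k * d + x + 72 * K * S" for s x k d n K S :: real
    using that by argo
  ultimately show ?thesis using sD_le_0 by blast
qed

lemma sV_bound: "sV \<le> C\<^sub>V * L_P p + (18 * sN + 12 * L * \<delta> + 84 * L\<^sup>2 * \<kappa>\<^sup>2 * (sA + sB)) / r\<^sub>1\<^sup>2"
proof -
  \<comment> \<open>The recursion for \<open>v\<close> uses the error at \<open>Suc t\<close> while
    \<open>sE\<close> stops before \<open>T\<close>, so it is summed over one index less than
    \<open>T\<close>.\<close>
  obtain T' where T': "T = Suc T'" using T by (cases T) auto
  have "r\<^sub>1 * sV \<le> v 0 + (\<Sum>t<T'. (3 * (e (Suc t) + e t) + 6 * L\<^sup>2 * (a t + y t)) / r\<^sub>1)"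
    unfolding sV_def unfolding T' by (rule sum_of_contraction) (use v_step nonneg rho_bounds in simp_all)
  also have "(\<Sum>t<T'. (3 * (e (Suc t) + e t) + 6 * L\<^sup>2 * (a t + y t)) / r\<^sub>1)
      \<le> (6 * sE + 6 * L\<^sup>2 * (sA + sY)) / r\<^sub>1"
  proof -
    have "(\<Sum>t<T'. e (Suc t)) \<le> sE" "(\<Sum>t<T'. e t) \<le> sE" "(\<Sum>t<T'. a t) \<le> sA" "(\<Sum>t<T'. y t) \<le> sY"
    proof -
      have "sE = e 0 + (\<Sum>t<T'. e (Suc t))" unfolding sE_def unfolding T' by (rule sum.lessThan_Suc_shift)
      then show "(\<Sum>t<T'. e (Suc t)) \<le> sE" using nonneg by simp
    qed (use nonneg in \<open>unfold sums, unfold T', simp_all\<close>)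
    then have "3 * ((\<Sum>t<T'. e (Suc t)) + (\<Sum>t<T'. e t)) + 6 * L\<^sup>2 * ((\<Sum>t<T'. a t) + (\<Sum>t<T'. y t))
        \<le> 3 * (sE + sE) + 6 * L\<^sup>2 * (sA + sY)"
      by (intro add_mono mult_left_mono) auto
    then show ?thesis
      unfolding sum_divide_distrib[symmetric] sum.distrib sum_distrib_left[symmetric]
      using rho_bounds by (intro divide_right_mono) auto
  qed
  also have "v 0 \<le> C\<^sub>V * (L_P p * r\<^sub>1)" by (rule v_0)
  also have "(6 * sE + 6 * L\<^sup>2 * (sA + sY)) / r\<^sub>1 \<le> (18 * sN + 12 * L * \<delta> + 84 * L\<^sup>2 * \<kappa>\<^sup>2 * (sA + sB)) / r\<^sub>1"
  proof -
    have "sA \<le> \<kappa>\<^sup>2 * (sA + sB)"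
      using mult_mono[OF kappa_squares(1), of sA "sA + sB"] sums_nonneg by simp
    then have "6 * L\<^sup>2 * (sA + sY) \<le> 6 * L\<^sup>2 * (\<delta> / L + sN / L\<^sup>2 + 7 * \<kappa>\<^sup>2 * (sA + sB))"
      using sY_le by (intro mult_left_mono) auto
    also have "\<dots> = 6 * (L * \<delta>) + 6 * sN + 42 * L\<^sup>2 * \<kappa>\<^sup>2 * (sA + sB)"
      using L_pos by (simp add: field_simps power2_eq_square)
    finally show ?thesis using sE_bound rho_bounds by (intro divide_right_mono) auto
  qed
  finally have "r\<^sub>1 * sV \<le> C\<^sub>V * (L_P p * r\<^sub>1) + (18 * sN + 12 * L * \<delta> + 84 * L\<^sup>2 * \<kappa>\<^sup>2 * (sA + sB)) / r\<^sub>1"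
    by simp
  then have "(r\<^sub>1 * sV) / r\<^sub>1 \<le> (C\<^sub>V * (L_P p * r\<^sub>1) + (18 * sN + 12 * L * \<delta> + 84 * L\<^sup>2 * \<kappa>\<^sup>2 * (sA + sB)) / r\<^sub>1) / r\<^sub>1"
    using rho_bounds by (intro divide_right_mono) auto
  then show ?thesis using rho_bounds by (simp add: add_divide_distrib power2_eq_square)
qed

text \<open>All copies start equal, so no initial term appears and the tracker alone drives the
  consensus error.\<close>

lemma sQ_bound: "sQ \<le> \<eta>\<^sup>2 / r\<^sub>1\<^sup>2 * sV"
proof -
  obtain T' where T': "T = Suc T'" using T by (cases T) auto
  have "r\<^sub>1 * sQ \<le> q 0 + (\<Sum>t<T'. \<eta>\<^sup>2 / r\<^sub>1 * v t)"
    unfolding sQ_def unfolding T' by (rule sum_of_contraction) (use q_step nonneg rho_bounds in simp_all)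
  also have "\<dots> \<le> \<eta>\<^sup>2 / r\<^sub>1 * sV"
    unfolding q_0 sum_distrib_left[symmetric] sV_def unfolding T'
    using nonneg rho_bounds by (simp add: mult_left_mono divide_right_mono)
  finally have "(r\<^sub>1 * sQ) / r\<^sub>1 \<le> (\<eta>\<^sup>2 / r\<^sub>1 * sV) / r\<^sub>1"
    using rho_bounds by (intro divide_right_mono) auto
  then show ?thesis using rho_bounds by (simp add: power2_eq_square)
qed

text \<open>\<open>sW\<close> is the total progress and \<open>sU\<close> the consensus cost; the merit inequality bounds the
  former by the latter, which in turn is a small multiple of the former plus the data \<open>R\<close>.\<close>

definition "sW = sA / \<eta> + sB / \<eta>\<^sub>\<Lambda>"
definition "sU = \<eta> / r\<^sub>1\<^sup>2 * sV"
definition "sR = \<Delta> + C\<^sub>V + \<delta> / \<theta> + 200 * (\<eta> + \<eta>\<^sub>\<Lambda>) * (real T * \<epsilon>\<^sup>2 / 10 ^ 12)"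
definition "noise = real T * \<epsilon>\<^sup>2 / 10 ^ 12"

lemma noise_bounds: "sN * \<kappa>\<^sup>2 \<le> noise" "sN / r\<^sub>1 ^ 4 \<le> noise" "sN \<le> noise" "0 \<le> noise"
proof -
  have "real T * (\<nu> * \<kappa>\<^sup>2) \<le> real T * (\<epsilon>\<^sup>2 / 10 ^ 12)" "real T * (\<nu> / r\<^sub>1 ^ 4) \<le> real T * (\<epsilon>\<^sup>2 / 10 ^ 12)"
    using nu by (intro mult_left_mono; simp)+
  then show k: "sN * \<kappa>\<^sup>2 \<le> noise" "sN / r\<^sub>1 ^ 4 \<le> noise"
    unfolding sN_def noise_def by (simp_all add: mult.assoc)
  have "sN * 1 \<le> sN * \<kappa>\<^sup>2" using sums_nonneg kappa_squares by (intro mult_left_mono) auto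
  then show "sN \<le> noise" using k by simp
  show "0 \<le> noise" unfolding noise_def by simp
qed

text \<open>Smallness of the step sizes in summed form: dividing a sum by its step size pays for a
  factor \<open>L * \<kappa>\<^sup>2\<close> or \<open>L * \<kappa> / r\<^sub>1\<^sup>2\<close>. The
  constants are those of the multiplier step, the weaker of the two.\<close>

lemma sW_bounds:
  "L * \<kappa>\<^sup>2 * (sA + sB) \<le> sW / 138" "L * \<kappa> / r\<^sub>1\<^sup>2 * (sA + sB) \<le> sW / 19" "0 \<le> sW"
  "sA / \<eta> \<le> sW" "sB / \<eta>\<^sub>\<Lambda> \<le> sW"
proof -
  have scale: "k * s \<le> K * (s / h)" if "h * k \<le> K" "0 < h" "0 \<le> s" for h k K s :: real
  proof -
    have "(h * k) * (s / h) \<le> K * (s / h)" using that by (intro mult_right_mono) auto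
    then show ?thesis using that by simp
  qed
  have "L * \<kappa>\<^sup>2 * sA \<le> 1 / 240 * (sA / \<eta>)" "L * \<kappa>\<^sup>2 * sB \<le> 1 / 138 * (sB / \<eta>\<^sub>\<Lambda>)"
    by (intro scale eta_le_1 eta_Lam_le_1 eta_pos sums_nonneg)+
  moreover have "0 \<le> sA / \<eta>" "0 \<le> sB / \<eta>\<^sub>\<Lambda>" using sums_nonneg eta_pos by auto
  ultimately show "L * \<kappa>\<^sup>2 * (sA + sB) \<le> sW / 138" "0 \<le> sW" "sA / \<eta> \<le> sW" "sB / \<eta>\<^sub>\<Lambda> \<le> sW"
    unfolding sW_def by (auto simp: distrib_left)
  have "\<eta> * (L * \<kappa> / r\<^sub>1\<^sup>2) \<le> 1 / 360" "\<eta>\<^sub>\<Lambda> * (L * \<kappa> / r\<^sub>1\<^sup>2) \<le> 1 / 19"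
    using divide_right_mono[OF eta_le_2, of "r\<^sub>1\<^sup>2"] divide_right_mono[OF eta_Lam_le_2, of "r\<^sub>1\<^sup>2"] r1_sq by simp_all
  then have "L * \<kappa> / r\<^sub>1\<^sup>2 * sA \<le> 1 / 360 * (sA / \<eta>)" "L * \<kappa> / r\<^sub>1\<^sup>2 * sB \<le> 1 / 19 * (sB / \<eta>\<^sub>\<Lambda>)"
    using scale[OF _ eta_pos(1) sums_nonneg(1)] scale[OF _ eta_pos(2) sums_nonneg(2)] by blast+
  then show "L * \<kappa> / r\<^sub>1\<^sup>2 * (sA + sB) \<le> sW / 19"
    using \<open>0 \<le> sA / \<eta>\<close> unfolding sW_def by (simp add: distrib_left)
qed

text \<open>The assumed size of the initial tracker is just what \<open>eta_L_P\<close> turns into a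
  constant. The summed steps return with the small factor 84 / (360 * 19), which is what lets the
  loop close.\<close>

lemma sU_bound: "sU \<le> C\<^sub>V / 180 + \<delta> / (30 * \<theta>) + sW / 80 + 18 * \<eta> * noise"
proof -
  have "sU \<le> \<eta> / r\<^sub>1\<^sup>2 * (C\<^sub>V * L_P p + (18 * sN + 12 * L * \<delta> + 84 * L\<^sup>2 * \<kappa>\<^sup>2 * (sA + sB)) / r\<^sub>1\<^sup>2)"
    unfolding sU_def using eta_pos by (intro mult_left_mono sV_bound) auto
  also have "\<dots> = C\<^sub>V * (\<eta> * L_P p / r\<^sub>1\<^sup>2) + 18 * \<eta> * (sN / r\<^sub>1 ^ 4) + 12 * \<delta> * (\<eta> * L / r\<^sub>1 ^ 4)
      + 84 * (\<eta> * (L * \<kappa>) / r\<^sub>1\<^sup>2) * (L * \<kappa> / r\<^sub>1\<^sup>2 * (sA + sB))"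
  proof -
    have "e / r\<^sup>2 * (C\<^sub>V * L_P p + (18 * sN + 12 * L * \<delta> + 84 * L\<^sup>2 * \<kappa>\<^sup>2 * S) / r\<^sup>2)
      = C\<^sub>V * (e * L_P p / r\<^sup>2) + 18 * e * (sN / r ^ 4) + 12 * \<delta> * (e * L / r ^ 4)
        + 84 * (e * (L * \<kappa>) / r\<^sup>2) * (L * \<kappa> / r\<^sup>2 * S)" if "0 < r" for e r S :: real
      using that by (simp add: field_simps power2_eq_square power4_eq_xxxx)
    then show ?thesis using rho_bounds(3) .
  qed
  also have "C\<^sub>V * (\<eta> * L_P p / r\<^sub>1\<^sup>2) \<le> C\<^sub>V * (1 / 180)"
    using divide_right_mono[OF eta_L_P, of "r\<^sub>1\<^sup>2"] r1_sq C_V by (intro mult_left_mono) auto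
  also have "18 * \<eta> * (sN / r\<^sub>1 ^ 4) \<le> 18 * \<eta> * noise"
    using eta_pos by (intro mult_left_mono noise_bounds) auto
  also have "12 * \<delta> * (\<eta> * L / r\<^sub>1 ^ 4) \<le> 12 * \<delta> * (1 / (360 * \<theta>))"
  proof (rule mult_left_mono)
    \<comment> \<open>Here the primal gap picks up the factor \<open>1 / \<theta>\<close> that it
      carries in the communication count: two powers of \<open>r\<^sub>1\<^sup>2\<close> must be
      compensated, one by the step size and one by \<theta>.\<close>
    have "\<theta> * (\<eta> * L) \<le> (\<kappa> * r\<^sub>1\<^sup>2) * (\<eta> * L)"
      using theta_le eta_pos L_pos by (intro mult_right_mono) auto
    also have "\<dots> = r\<^sub>1\<^sup>2 * (\<eta> * (L * \<kappa>))" by simp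
    also have "\<dots> \<le> r\<^sub>1\<^sup>2 * (r\<^sub>1\<^sup>2 / 360)" by (intro mult_left_mono eta_le_2) simp
    also have "\<dots> = r\<^sub>1 ^ 4 / 360" by (simp add: power2_eq_square power4_eq_xxxx)
    finally show "\<eta> * L / r\<^sub>1 ^ 4 \<le> 1 / (360 * \<theta>)"
      using theta_pos rho_bounds by (simp add: field_simps)
  qed (use delta in simp)
  also have "84 * (\<eta> * (L * \<kappa>) / r\<^sub>1\<^sup>2) * (L * \<kappa> / r\<^sub>1\<^sup>2 * (sA + sB)) \<le> 84 * (1 / 360) * (sW / 19)"
  proof (rule mult_mono)
    have "\<eta> * (L * \<kappa>) / r\<^sub>1\<^sup>2 \<le> r\<^sub>1\<^sup>2 / 360 / r\<^sub>1\<^sup>2"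
      by (rule divide_right_mono[OF eta_le_2]) simp
    also have "\<dots> = 1 / 360" using rho_bounds by simp
    finally show "84 * (\<eta> * (L * \<kappa>) / r\<^sub>1\<^sup>2) \<le> 84 * (1 / 360)" by linarith
    show "L * \<kappa> / r\<^sub>1\<^sup>2 * (sA + sB) \<le> sW / 19" by (rule sW_bounds)
    show "0 \<le> L * \<kappa> / r\<^sub>1\<^sup>2 * (sA + sB)" using L_pos kappa_squares sums_nonneg by simp
  qed simp
  finally show ?thesis using sW_bounds(3) by simp
qed

lemma sU_nonneg: "0 \<le> sU" and sV_le: "sV \<le> sU / \<eta>" and sQ_le: "sQ \<le> \<eta> * sU"
proof -
  show "0 \<le> sU" unfolding sU_def using eta_pos sums_nonneg by simp
  have "1 * sV \<le> 1 / r\<^sub>1\<^sup>2 * sV"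
    using r1_sq sums_nonneg by (intro mult_right_mono) auto
  then show "sV \<le> sU / \<eta>" unfolding sU_def using eta_pos by simp
  show "sQ \<le> \<eta> * sU" using sQ_bound unfolding sU_def by (simp add: power2_eq_square)
qed

lemma eta_L_small: "\<eta> * L \<le> 1 / 240" "\<eta> * (L * \<kappa>) \<le> 1 / 360"
proof -
  have "\<eta> * L \<le> \<eta> * (L * \<kappa>\<^sup>2)" using eta_pos L_pos kappa_squares by simp
  then show "\<eta> * L \<le> 1 / 240" using eta_le_1 by linarith
  show "\<eta> * (L * \<kappa>) \<le> 1 / 360" using eta_le_2 r1_sq by linarith
qed

lemma L2_sD_bound: "L\<^sup>2 * sD \<le> L * \<kappa>\<^sup>2 * (10 * \<delta> + 86 / 138 * sW) + 4 * (\<kappa>\<^sup>2 * sN)"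
proof -
  have "L\<^sup>2 * sD \<le> L\<^sup>2 * (10 * \<kappa>\<^sup>2 * (\<delta> / L) + 4 * \<kappa>\<^sup>2 * (sN / L\<^sup>2) + 86 * \<kappa> ^ 4 * (sA + sB))"
    by (intro mult_left_mono sD_bound) simp
  also have "\<dots> = L * \<kappa>\<^sup>2 * (10 * \<delta> + 86 * (L * \<kappa>\<^sup>2 * (sA + sB))) + 4 * (\<kappa>\<^sup>2 * sN)"
    using L_pos by (simp add: field_simps power2_eq_square power4_eq_xxxx)
  also have "\<dots> \<le> L * \<kappa>\<^sup>2 * (10 * \<delta> + 86 * (sW / 138)) + 4 * (\<kappa>\<^sup>2 * sN)"
    using L_pos by (intro add_mono mult_left_mono sW_bounds order_refl) auto
  finally show ?thesis by simp
qed

lemma sE_eta_bound: "\<eta> * sE \<le> 2 * \<eta> * noise + \<delta> / 240 + sW / 4000"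
proof -
  have "\<eta> * sE \<le> \<eta> * (2 * sN + L * \<delta> + 7 * L\<^sup>2 * \<kappa>\<^sup>2 * (sA + sB))"
    using eta_pos by (intro mult_left_mono sE_bound) auto
  also have "\<dots> = 2 * \<eta> * sN + (\<eta> * L) * \<delta> + 7 * (\<eta> * L) * (L * \<kappa>\<^sup>2 * (sA + sB))"
    by (simp add: algebra_simps power2_eq_square)
  also have "\<dots> \<le> 2 * \<eta> * noise + (1 / 240) * \<delta> + 7 * (1 / 240) * (sW / 138)"
    using eta_pos delta L_pos sums_nonneg sW_bounds
    by (intro add_mono mult_mono mult_left_mono noise_bounds eta_L_small sW_bounds) auto
  finally show ?thesis using sW_bounds(3) by simp
qed

lemma merit_summed:
  "sA / (3 * \<eta>) + 3 / (4 * \<eta>\<^sub>\<Lambda>) * sB \<le> \<Delta> + (4 * \<eta> + \<eta>\<^sub>\<Lambda>) * L\<^sup>2 * (2 * sD + 6 * \<kappa>\<^sup>2 * (sA + 2 * sQ + sB))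
     + 4 * \<eta> * sE + 4 * \<eta> * sV + (4 / \<eta> + 8 * \<eta> * L\<^sup>2) * sQ"
proof -
  have "sA / (3 * \<eta>) + 3 / (4 * \<eta>\<^sub>\<Lambda>) * sB
      \<le> \<Delta> + (4 * \<eta> + \<eta>\<^sub>\<Lambda>) * L\<^sup>2 * (2 * (\<Sum>t<T. D t) + 6 * \<kappa>\<^sup>2 * (sA + 2 * sQ + sB))
     + 4 * \<eta> * sE + 4 * \<eta> * sV + (4 / \<eta> + 8 * \<eta> * L\<^sup>2) * sQ"
    using merit unfolding sums
    by (simp add: sum.distrib sum_distrib_left[symmetric] sum_divide_distrib[symmetric] del: sum.lessThan_Suc)
  moreover have "(4 * \<eta> + \<eta>\<^sub>\<Lambda>) * L\<^sup>2 * (2 * (\<Sum>t<T. D t) + 6 * \<kappa>\<^sup>2 * (sA + 2 * sQ + sB))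
      \<le> (4 * \<eta> + \<eta>\<^sub>\<Lambda>) * L\<^sup>2 * (2 * sD + 6 * \<kappa>\<^sup>2 * (sA + 2 * sQ + sB))"
    using eta_pos by (intro mult_left_mono add_right_mono D_sum_le) auto
  ultimately show ?thesis by linarith
qed

text \<open>The loop closes because \<open>sW\<close> reappears on the right with total coefficient
  33/1000 + 82/800, well below the 1/3 on the left.\<close>

lemma sW_le_sR: "sW \<le> 6 * sR"
proof -
  define h where "h = 4 * \<eta> + \<eta>\<^sub>\<Lambda>"
  \<comment> \<open>4 / 240 + 1 / 138 is just below 24 / 1000.\<close>
  have h: "0 < h" "h * (L * \<kappa>\<^sup>2) \<le> 24 / 1000"
    using eta_pos eta_le_1 eta_Lam_le_1 unfolding h_def by (simp_all add: distrib_right)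
  have hL: "0 \<le> h * L\<^sup>2" using h by simp
  have 1: "h * L\<^sup>2 * (2 * sD + 6 * \<kappa>\<^sup>2 * (sA + 2 * sQ + sB))
      \<le> 48 / 100 * \<delta> + 31 / 1000 * sW + 8 * h * noise + sU / 800"
  proof -
    have "h * (2 * (L\<^sup>2 * sD)) \<le> h * (2 * (L * \<kappa>\<^sup>2 * (10 * \<delta> + 86 / 138 * sW) + 4 * (\<kappa>\<^sup>2 * sN)))"
      using h by (intro mult_left_mono L2_sD_bound) auto
    also have "\<dots> = (h * (L * \<kappa>\<^sup>2)) * (20 * \<delta> + 172 / 138 * sW) + 8 * h * (sN * \<kappa>\<^sup>2)"
      by (simp add: algebra_simps)
    also have "\<dots> \<le> 24 / 1000 * (20 * \<delta> + 172 / 138 * sW) + 8 * h * noise"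
      using h delta sW_bounds by (intro add_mono mult_right_mono mult_left_mono noise_bounds) auto
    finally have a: "h * (2 * (L\<^sup>2 * sD)) \<le> 24 / 1000 * (20 * \<delta> + 172 / 138 * sW) + 8 * h * noise" .
    have hL: "h * L \<le> 24 / 1000"
    proof -
      have "h * (L * 1) \<le> h * (L * \<kappa>\<^sup>2)"
        using h L_pos kappa_squares by (intro mult_left_mono) auto
      then show ?thesis using h by linarith
    qed
    have "h * L\<^sup>2 * (6 * \<kappa>\<^sup>2 * (sA + sB)) = 6 * (h * L) * (L * \<kappa>\<^sup>2 * (sA + sB))"
      by (simp add: power2_eq_square)
    also have "\<dots> \<le> 6 * (24 / 1000) * (sW / 138)"
      using hL h L_pos sums_nonneg sW_bounds by (intro mult_mono) auto
    finally have b: "h * L\<^sup>2 * (6 * \<kappa>\<^sup>2 * (sA + sB)) \<le> 6 * (24 / 1000) * (sW / 138)" .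
    have "h * L\<^sup>2 * (12 * \<kappa>\<^sup>2 * sQ) \<le> h * L\<^sup>2 * (12 * \<kappa>\<^sup>2 * (\<eta> * sU))"
      using h by (intro mult_left_mono sQ_le) auto
    also have "\<dots> = 12 * (h * (L * \<kappa>\<^sup>2)) * (\<eta> * L) * sU" by (simp add: power2_eq_square)
    also have "\<dots> \<le> 12 * (24 / 1000) * (1 / 240) * sU"
      using h eta_pos L_pos sU_nonneg by (intro mult_mono mult_right_mono eta_L_small) auto
    finally have c: "h * L\<^sup>2 * (12 * \<kappa>\<^sup>2 * sQ) \<le> 12 * (24 / 1000) * (1 / 240) * sU" .
    have "h * L\<^sup>2 * (2 * sD + 6 * \<kappa>\<^sup>2 * (sA + 2 * sQ + sB))
        = h * (2 * (L\<^sup>2 * sD)) + h * L\<^sup>2 * (6 * \<kappa>\<^sup>2 * (sA + sB)) + h * L\<^sup>2 * (12 * \<kappa>\<^sup>2 * sQ)"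
      by (simp add: algebra_simps)
    then show ?thesis using a b c sW_bounds(3) sU_nonneg by argo
  qed
  have 2: "(4 / \<eta> + 8 * \<eta> * L\<^sup>2) * sQ \<le> 41 / 10 * sU"
  proof -
    have "(4 / \<eta> + 8 * \<eta> * L\<^sup>2) * sQ \<le> (4 / \<eta> + 8 * \<eta> * L\<^sup>2) * (\<eta> * sU)"
      using eta_pos by (intro mult_left_mono sQ_le) auto
    also have "\<dots> = 4 * sU + 8 * (\<eta> * L) * (\<eta> * L) * sU"
      using eta_pos by (simp add: field_simps power2_eq_square)
    also have "8 * (\<eta> * L) * (\<eta> * L) * sU \<le> 8 * (1 / 240) * (1 / 240) * sU"
      using eta_pos L_pos sU_nonneg by (intro mult_mono mult_right_mono eta_L_small) auto
    finally show ?thesis using sU_nonneg by simp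
  qed
  have 3: "4 * \<eta> * sV \<le> 4 * sU"
    using mult_left_mono[OF sV_le, of "4 * \<eta>"] eta_pos by simp
  have "sW / 3 \<le> sA / (3 * \<eta>) + 3 / (4 * \<eta>\<^sub>\<Lambda>) * sB"
  proof -
    have "0 \<le> sB / \<eta>\<^sub>\<Lambda>" using sums_nonneg eta_pos by simp
    then show ?thesis unfolding sW_def by (simp add: add_divide_distrib)
  qed
  also have "\<dots> \<le> \<Delta> + (48 / 100 * \<delta> + 31 / 1000 * sW + 8 * h * noise + sU / 800)
      + 4 * (2 * \<eta> * noise + \<delta> / 240 + sW / 4000) + 4 * sU + 41 / 10 * sU"
  proof -
    have 4: "4 * \<eta> * sE \<le> 4 * (2 * \<eta> * noise + \<delta> / 240 + sW / 4000)"
      using sE_eta_bound by simp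
    show ?thesis
      by (rule order_trans[OF merit_summed])
        (use add_mono[OF add_mono[OF add_mono[OF add_left_mono[OF 1, of \<Delta>] 4] 3] 2] in \<open>simp only: h_def\<close>)
  qed
  \<comment> \<open>The coefficients of \<open>sU\<close> add up to 1/800 + 4 + 41/10, rounded up to
    82/10.\<close>
  finally have "sW / 3 \<le> \<Delta> + 50 / 100 * \<delta> + 33 / 1000 * sW + (40 * \<eta> + 8 * \<eta>\<^sub>\<Lambda>) * noise + 82 / 10 * sU"
    using delta sU_nonneg sW_bounds(3) unfolding h_def by (simp add: algebra_simps)
  moreover have "82 / 10 * sU \<le> 82 / 10 * (C\<^sub>V / 180 + \<delta> / (30 * \<theta>) + sW / 80 + 18 * \<eta> * noise)"
    using sU_bound by simp
  ultimately have "sW / 3 \<le> \<Delta> + 50 / 100 * \<delta> + 33 / 1000 * sW + (40 * \<eta> + 8 * \<eta>\<^sub>\<Lambda>) * noise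
      + 82 / 10 * (C\<^sub>V / 180 + \<delta> / (30 * \<theta>) + sW / 80 + 18 * \<eta> * noise)" by linarith
  moreover have "\<delta> \<le> \<delta> / \<theta>"
    using theta_pos theta_le delta by (simp add: le_divide_eq mult_left_le)
  moreover have "\<delta> / (30 * \<theta>) = 1 / 30 * (\<delta> / \<theta>)" by simp
  moreover have "0 \<le> \<eta> * noise" "0 \<le> \<eta>\<^sub>\<Lambda> * noise" using eta_pos noise_bounds by auto
  moreover have "sR = \<Delta> + C\<^sub>V + \<delta> / \<theta> + 200 * (\<eta> * noise) + 200 * (\<eta>\<^sub>\<Lambda> * noise)"
    unfolding sR_def noise_def by (simp add: algebra_simps)
  moreover have "(40 * \<eta> + 8 * \<eta>\<^sub>\<Lambda>) * noise = 40 * (\<eta> * noise) + 8 * (\<eta>\<^sub>\<Lambda> * noise)" by (simp add: algebra_simps)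
  ultimately show ?thesis using Delta C_V delta sW_bounds(3) by (simp only: mult.assoc) argo
qed

lemma sR_nonneg: "0 \<le> sR"
  using Delta C_V delta theta_pos eta_pos unfolding sR_def by simp

lemma sR_parts: "\<delta> \<le> sR" "C\<^sub>V \<le> sR" "\<delta> / \<theta> \<le> sR" "200 * (\<eta> * noise) \<le> sR"
proof -
  have "\<delta> \<le> \<delta> / \<theta>"
    using theta_pos theta_le delta by (simp add: le_divide_eq mult_left_le)
  moreover have "0 \<le> \<eta> * noise" "0 \<le> \<eta>\<^sub>\<Lambda> * noise" using eta_pos noise_bounds by auto
  moreover have "sR = \<Delta> + C\<^sub>V + \<delta> / \<theta> + 200 * (\<eta> * noise) + 200 * (\<eta>\<^sub>\<Lambda> * noise)"
    unfolding sR_def noise_def by (simp add: algebra_simps)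
  ultimately show "\<delta> \<le> sR" "C\<^sub>V \<le> sR" "\<delta> / \<theta> \<le> sR" "200 * (\<eta> * noise) \<le> sR"
    using Delta C_V delta by linarith+
qed

lemma sU_le_sR: "sU \<le> sR"
proof -
  have "\<delta> / (30 * \<theta>) = 1 / 30 * (\<delta> / \<theta>)" by simp
  then show ?thesis
    using sU_bound sW_le_sR sR_parts sR_nonneg unfolding mult.assoc by argo
qed

lemma L2_sD_eta: "\<eta> * (L\<^sup>2 * sD) \<le> sR"
proof -
  have "\<eta> * (L\<^sup>2 * sD) \<le> \<eta> * (L * \<kappa>\<^sup>2 * (10 * \<delta> + 86 / 138 * sW) + 4 * (\<kappa>\<^sup>2 * sN))"
    using eta_pos by (intro mult_left_mono L2_sD_bound) auto
  also have "\<dots> = (\<eta> * (L * \<kappa>\<^sup>2)) * (10 * \<delta> + 86 / 138 * sW) + 4 * (\<eta> * (sN * \<kappa>\<^sup>2))"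
    by (simp add: algebra_simps)
  also have "\<dots> \<le> 1 / 240 * (10 * \<delta> + 86 / 138 * sW) + 4 * (\<eta> * noise)"
    using eta_pos delta sW_bounds by (intro add_mono mult_right_mono mult_left_mono eta_le_1 noise_bounds) auto
  also have "\<dots> \<le> sR" using sR_parts sW_le_sR sR_nonneg by argo
  finally show ?thesis .
qed

lemma L2_sQ_eta: "\<eta> * (L\<^sup>2 * (\<kappa>\<^sup>2 * sQ)) \<le> sR / 60" "\<eta> * (L\<^sup>2 * sQ) \<le> sR"
proof -
  have "\<eta> * (L\<^sup>2 * (\<kappa>\<^sup>2 * sQ)) \<le> \<eta> * (L\<^sup>2 * (\<kappa>\<^sup>2 * (\<eta> * sU)))"
    using eta_pos by (intro mult_left_mono sQ_le) auto
  also have "\<dots> = (\<eta> * (L * \<kappa>)) * (\<eta> * (L * \<kappa>)) * sU" by (simp add: power2_eq_square)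
  also have "\<dots> \<le> (1 / 360) * (1 / 360) * sR"
    using eta_pos L_pos kappa_squares sU_nonneg by (intro mult_mono eta_L_small sU_le_sR) auto
  finally show 1: "\<eta> * (L\<^sup>2 * (\<kappa>\<^sup>2 * sQ)) \<le> sR / 60" using sR_nonneg by simp
  have "L\<^sup>2 * (1 * sQ) \<le> L\<^sup>2 * (\<kappa>\<^sup>2 * sQ)"
    using sums_nonneg kappa_squares by (intro mult_left_mono mult_right_mono) auto
  then have "\<eta> * (L\<^sup>2 * sQ) \<le> \<eta> * (L\<^sup>2 * (\<kappa>\<^sup>2 * sQ))" using eta_pos by simp
  then show "\<eta> * (L\<^sup>2 * sQ) \<le> sR" using 1 sR_nonneg by linarith
qed

text \<open>The initial data are covered by the lower bound on \<open>T\<close>. The noise inside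
  \<open>sR\<close> carries a step size, which cancels the factor
  \<open>L * \<kappa>\<^sup>2 / \<theta>\<close>; it adds 200 / 240 + 200 / 19, less than
  12.\<close>

lemma scale_sR: "L * \<kappa>\<^sup>2 / \<theta> * sR \<le> 13 * noise"
proof -
  let ?l = "L * \<kappa>\<^sup>2 / \<theta>"
  have l: "0 \<le> ?l" using L_pos theta_pos by simp
  have small: "\<eta> * ?l \<le> 1 / 240" "\<eta>\<^sub>\<Lambda> * ?l \<le> 1 / 19"
  proof -
    have "\<eta> * (L * \<kappa>\<^sup>2) \<le> \<kappa> * (r\<^sub>1\<^sup>2 / 360)"
      using mult_left_mono[OF eta_le_2, of \<kappa>] kappa_squares by (simp add: power2_eq_square mult_ac)
    moreover have "\<kappa> * (r\<^sub>1\<^sup>2 / 360) \<le> (\<kappa> * r\<^sub>1\<^sup>2) / 240" using kappa_squares r1_sq by simp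
    ultimately have "\<eta> * (L * \<kappa>\<^sup>2) \<le> \<theta> / 240"
      using eta_le_1 unfolding \<theta>_def by (simp add: min_def)
    then show "\<eta> * ?l \<le> 1 / 240" using theta_pos by (simp add: field_simps)
    have "\<eta>\<^sub>\<Lambda> * (L * \<kappa>\<^sup>2) \<le> \<kappa> * r\<^sub>1\<^sup>2 / 19"
      using mult_left_mono[OF eta_Lam_le_2, of \<kappa>] kappa_squares by (simp add: power2_eq_square mult_ac)
    then have "\<eta>\<^sub>\<Lambda> * (L * \<kappa>\<^sup>2) \<le> \<theta> / 19"
      using eta_Lam_le_1 unfolding \<theta>_def by (simp add: min_def)
    then show "\<eta>\<^sub>\<Lambda> * ?l \<le> 1 / 19" using theta_pos by (simp add: field_simps)
  qed
  have "\<Delta> + C\<^sub>V + \<delta> / \<theta> \<le> (1 + C\<^sub>V) * (\<Delta> + \<delta> / \<theta> + 1)"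
  proof -
    have "0 \<le> C\<^sub>V * \<Delta>" "0 \<le> C\<^sub>V * (\<delta> / \<theta>)" using C_V Delta delta theta_pos by auto
    moreover have "0 \<le> \<delta> / \<theta>" using delta theta_pos by simp
    ultimately show ?thesis unfolding distrib_left distrib_right by linarith
  qed
  then have "?l * (\<Delta> + C\<^sub>V + \<delta> / \<theta>) \<le> ?l * ((1 + C\<^sub>V) * (\<Delta> + \<delta> / \<theta> + 1))"
    by (rule mult_left_mono[OF _ l])
  also have "\<dots> = (1 + C\<^sub>V) * (?l * (\<Delta> + \<delta> / \<theta> + 1))" by (rule mult.left_commute)
  also have "\<dots> \<le> noise"
  proof -
    have "x \<le> y / 10 ^ 12" if "10 ^ 12 * x \<le> y" for x y :: real using that by simp
    then show ?thesis unfolding noise_def using T_large unfolding mult.assoc .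
  qed
  finally have 1: "?l * (\<Delta> + C\<^sub>V + \<delta> / \<theta>) \<le> noise" .
  have "?l * sR = ?l * (\<Delta> + C\<^sub>V + \<delta> / \<theta>) + 200 * ((\<eta> * ?l) * noise) + 200 * ((\<eta>\<^sub>\<Lambda> * ?l) * noise)"
    unfolding sR_def noise_def[symmetric] by (simp only: distrib_left distrib_right mult_ac add_ac)
  also have "\<dots> \<le> noise + 200 * (1 / 240 * noise) + 200 * (1 / 19 * noise)"
    using noise_bounds by (intro add_mono 1 mult_left_mono mult_right_mono small) auto
  finally show ?thesis using noise_bounds(4) by linarith
qed

text \<open>Both sums are bounded by multiples of \<open>sR\<close> divided by step sizes;
  \<open>inverse_eta_le\<close>, \<open>inverse_eta_Lam_le\<close> and \<open>scale_sR\<close> turn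
  these into multiples of \<open>noise\<close>. The largest factor, 92 * 16900, stays below
  2000000.\<close>

lemma stationarity_sums:
  "(\<Sum>t<T. G t) + L\<^sup>2 * (\<Sum>t<T. q t) \<le> real T * \<epsilon>\<^sup>2" "(\<Sum>t<T. H t) \<le> real T * \<epsilon>\<^sup>2"
proof -
  have inv: "sR / \<eta> \<le> 16900 * noise" "sR / \<eta>\<^sub>\<Lambda> \<le> 2080 * noise"
  proof -
    have le: "sR / \<eta> \<le> sR * (1300 * (L * \<kappa>\<^sup>2 / \<theta>))" "sR / \<eta>\<^sub>\<Lambda> \<le> sR * (160 * (L * \<kappa>\<^sup>2 / \<theta>))"
      using mult_left_mono[OF inverse_eta_le sR_nonneg] mult_left_mono[OF inverse_eta_Lam_le sR_nonneg]
      by (simp_all only: times_divide_eq_right mult_1_right)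
    have "x \<le> 16900 * c" if "x \<le> s * (1300 * l)" "l * s \<le> 13 * c" for x s l c :: real
      using that by (simp add: mult.commute mult.left_commute)
    from this[OF le(1) scale_sR] show "sR / \<eta> \<le> 16900 * noise" .
    have "x \<le> 2080 * c" if "x \<le> s * (160 * l)" "l * s \<le> 13 * c" for x s l c :: real
      using that by (simp add: mult.commute mult.left_commute)
    from this[OF le(2) scale_sR] show "sR / \<eta>\<^sub>\<Lambda> \<le> 2080 * noise" .
  qed
  have noise: "2000000 * noise \<le> real T * \<epsilon>\<^sup>2"
    unfolding noise_def by simp
  have "(\<Sum>t<T. G t) \<le> (\<Sum>t<T. 5 / \<eta>\<^sup>2 * (2 * q t + a t) + 5 * v t + 15 * e t
      + 60 * L\<^sup>2 * \<kappa>\<^sup>2 * q t + 30 * L\<^sup>2 * D t)"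
    by (intro sum_mono G)
  also have "\<dots> = 5 / \<eta>\<^sup>2 * (2 * sQ + sA) + 5 * sV + 15 * sE + 60 * L\<^sup>2 * \<kappa>\<^sup>2 * sQ + 30 * L\<^sup>2 * (\<Sum>t<T. D t)"
    unfolding sums by (simp only: sum.distrib sum_distrib_left[symmetric])
  also have "\<dots> \<le> 5 / \<eta>\<^sup>2 * (2 * sQ + sA) + 5 * sV + 15 * sE + 60 * L\<^sup>2 * \<kappa>\<^sup>2 * sQ + 30 * L\<^sup>2 * sD"
    by (intro add_left_mono mult_left_mono D_sum_le) simp
  finally have "\<eta> * ((\<Sum>t<T. G t) + L\<^sup>2 * sQ)
      \<le> \<eta> * (5 / \<eta>\<^sup>2 * (2 * sQ + sA) + 5 * sV + 15 * sE + 60 * L\<^sup>2 * \<kappa>\<^sup>2 * sQ + 30 * L\<^sup>2 * sD + L\<^sup>2 * sQ)"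
    using eta_pos by (intro mult_left_mono) auto
  also have "\<dots> = 10 * (sQ / \<eta>) + 5 * (sA / \<eta>) + 5 * (\<eta> * sV) + 15 * (\<eta> * sE)
      + 60 * (\<eta> * (L\<^sup>2 * (\<kappa>\<^sup>2 * sQ))) + 30 * (\<eta> * (L\<^sup>2 * sD)) + \<eta> * (L\<^sup>2 * sQ)"
    using eta_pos by (simp add: field_simps power2_eq_square)
  \<comment> \<open>In the order of the terms: 10 + 5 * 6 + 5 + 15 + 1 + 30 + 1.\<close>
  also have "\<dots> \<le> 92 * sR"
  proof -
    have "sQ / \<eta> \<le> sU" using sQ_le eta_pos by (simp add: pos_divide_le_eq mult.commute)
    moreover have "\<eta> * sV \<le> sU" using sV_le eta_pos by (simp add: pos_le_divide_eq mult.commute)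
    moreover have "\<eta> * sE \<le> sR"
      using sE_eta_bound sR_parts sW_le_sR sR_nonneg unfolding mult.assoc by argo
    ultimately show ?thesis
      using sU_le_sR sW_bounds(4) sW_le_sR L2_sQ_eta L2_sD_eta sR_nonneg by argo
  qed
  finally have "(\<Sum>t<T. G t) + L\<^sup>2 * sQ \<le> 92 * (sR / \<eta>)"
    using eta_pos by (simp add: pos_le_divide_eq mult.commute)
  then show "(\<Sum>t<T. G t) + L\<^sup>2 * (\<Sum>t<T. q t) \<le> real T * \<epsilon>\<^sup>2"
    unfolding sQ_def[symmetric] using inv noise noise_bounds by argo
  have "(\<Sum>t<T. H t) \<le> (\<Sum>t<T. 2 / \<eta>\<^sub>\<Lambda>\<^sup>2 * b t + 4 * L\<^sup>2 * (D t + \<kappa>\<^sup>2 * q t))"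
    by (intro sum_mono H)
  also have "\<dots> = 2 / \<eta>\<^sub>\<Lambda>\<^sup>2 * sB + 4 * L\<^sup>2 * ((\<Sum>t<T. D t) + \<kappa>\<^sup>2 * sQ)"
    unfolding sums by (simp only: sum.distrib sum_distrib_left[symmetric])
  also have "\<dots> \<le> 2 / \<eta>\<^sub>\<Lambda>\<^sup>2 * sB + 4 * L\<^sup>2 * (sD + \<kappa>\<^sup>2 * sQ)"
    by (intro add_left_mono mult_left_mono add_right_mono D_sum_le) simp
  also have "\<dots> = 2 / \<eta>\<^sub>\<Lambda> * (sB / \<eta>\<^sub>\<Lambda>) + 4 * ((\<eta> * (L\<^sup>2 * sD) + \<eta> * (L\<^sup>2 * (\<kappa>\<^sup>2 * sQ))) / \<eta>)"
    using eta_pos by (simp add: field_simps power2_eq_square)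
  also have "\<dots> \<le> 2 / \<eta>\<^sub>\<Lambda> * (6 * sR) + 4 * ((sR + sR / 60) / \<eta>)"
    using eta_pos sW_bounds(5) sW_le_sR
    by (intro add_mono mult_left_mono divide_right_mono L2_sQ_eta L2_sD_eta) auto
  also have "\<dots> \<le> 12 * (sR / \<eta>\<^sub>\<Lambda>) + 8 * (sR / \<eta>)"
  proof -
    have "0 \<le> sR / \<eta>" using sR_nonneg eta_pos by simp
    then show ?thesis by (simp add: add_divide_distrib)
  qed
  finally show "(\<Sum>t<T. H t) \<le> real T * \<epsilon>\<^sup>2" using inv noise noise_bounds by argo
qed

end

end

section \<open>Independent samples\<close>

locale indep_samples = prob_space M for M :: "'w measure" +
  fixes Lw :: "'k \<Rightarrow> 's measure" and S :: "'k \<Rightarrow> 'w \<Rightarrow> 's"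
  assumes indep: "indep_vars Lw S UNIV"
    and S_distr: "\<And>k. distr M (Lw k) (S k) = Lw k"
    and Lw_prob: "\<And>k. prob_space (Lw k)"
begin

text \<open>The past as a random element of a product space: functions of the past become Borel
  functions on \<open>PiM K Lw\<close>, which replaces conditioning on a sigma-algebra.\<close>

definition hist :: "'k set \<Rightarrow> 'w \<Rightarrow> 'k \<Rightarrow> 's" where
  "hist K \<omega> = (\<lambda>k\<in>K. S k \<omega>)"

lemma S_measurable [measurable]: "S k \<in> measurable M (Lw k)"
  using indep unfolding indep_vars_def by auto

lemma hist_measurable [measurable]: "hist K \<in> measurable M (PiM K Lw)"
  unfolding hist_def by (rule measurable_restrict) simp

text \<open>Freezing: a sample outside \<open>K\<close> is independent of the history, so their
  joint law is a product, and Fubini can integrate the sample with the history held fixed.\<close>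

lemma frozen_distr:
  assumes "k \<notin> K"
  shows "distr M (PiM K Lw \<Otimes>\<^sub>M Lw k) (\<lambda>\<omega>. (hist K \<omega>, S k \<omega>)) = distr M (PiM K Lw) (hist K) \<Otimes>\<^sub>M Lw k"
proof -
  let ?N = "PiM K Lw" and ?N1 = "PiM {k} Lw" and ?g = "\<lambda>x::'k \<Rightarrow> 's. x k"
  have g [measurable]: "?g \<in> measurable ?N1 (Lw k)" by measurable
  \<comment> \<open>The single sample is first viewed as the history over the singleton
    \<open>{k}\<close>, so that independence of disjoint index blocks applies; \<open>?g\<close>
    then reads off its coordinate.\<close>
  have "indep_var ?N (hist K) ?N1 (hist {k})"
    unfolding hist_def using indep_var_restrict[OF indep, of K "{k}"] assms by simp
  then have prod: "distr M ?N (hist K) \<Otimes>\<^sub>M distr M ?N1 (hist {k})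
      = distr M (?N \<Otimes>\<^sub>M ?N1) (\<lambda>\<omega>. (hist K \<omega>, hist {k} \<omega>))"
    unfolding indep_var_distribution_eq by simp
  have gk: "?g (hist {k} \<omega>) = S k \<omega>" for \<omega> unfolding hist_def by simp
  have dk: "distr (distr M ?N1 (hist {k})) (Lw k) ?g = Lw k"
    by (subst distr_distr) (simp_all add: comp_def gk S_distr)
  interpret Lk: prob_space "Lw k" by (rule Lw_prob)
  have "distr M ?N (hist K) \<Otimes>\<^sub>M Lw k
      = distr (distr M ?N (hist K)) ?N (\<lambda>x. x) \<Otimes>\<^sub>M distr (distr M ?N1 (hist {k})) (Lw k) ?g"
    unfolding dk by (simp add: distr_id2)
  also have "\<dots> = distr (distr M ?N (hist K) \<Otimes>\<^sub>M distr M ?N1 (hist {k})) (?N \<Otimes>\<^sub>M Lw k) (\<lambda>(s, x). (s, x k))"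
    by (rule pair_measure_distr) (simp_all add: dk Lk.sigma_finite_measure_axioms)
  also have "\<dots> = distr M (?N \<Otimes>\<^sub>M Lw k) ((\<lambda>(s, x). (s, x k)) \<circ> (\<lambda>\<omega>. (hist K \<omega>, hist {k} \<omega>)))"
    unfolding prod by (rule distr_distr) measurable
  also have "(\<lambda>(s, x). (s, x k)) \<circ> (\<lambda>\<omega>. (hist K \<omega>, hist {k} \<omega>)) = (\<lambda>\<omega>. (hist K \<omega>, S k \<omega>))"
    by (simp add: fun_eq_iff gk)
  finally show ?thesis by simp
qed

text \<open>Orthogonality of martingale increments: given the history the increment is centered, so
  the cross term integrates to zero and second moments add.\<close>

lemma second_moment_increment:
  fixes u :: "('k \<Rightarrow> 's) \<Rightarrow> 'v::euclidean_space" and \<phi> :: "('k \<Rightarrow> 's) \<times> 's \<Rightarrow> 'v"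
    and w :: "('k \<Rightarrow> 's) \<Rightarrow> real"
  assumes k: "k \<notin> K"
    and u [measurable]: "u \<in> borel_measurable (PiM K Lw)"
    and \<phi> [measurable]: "\<phi> \<in> borel_measurable (PiM K Lw \<Otimes>\<^sub>M Lw k)"
    and w [measurable]: "w \<in> borel_measurable (PiM K Lw)"
    and mean: "\<And>s. s \<in> space (PiM K Lw) \<Longrightarrow> integrable (Lw k) (\<lambda>\<xi>. \<phi> (s, \<xi>)) \<and> (\<integral>\<xi>. \<phi> (s, \<xi>) \<partial>Lw k) = 0"
    and var: "\<And>s. s \<in> space (PiM K Lw) \<Longrightarrow> integrable (Lw k) (\<lambda>\<xi>. (norm (\<phi> (s, \<xi>)))\<^sup>2)
        \<and> (\<integral>\<xi>. (norm (\<phi> (s, \<xi>)))\<^sup>2 \<partial>Lw k) \<le> w s"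
    and int_w: "integrable M (\<lambda>\<omega>. w (hist K \<omega>))"
    and int_u: "integrable M (\<lambda>\<omega>. (norm (u (hist K \<omega>)))\<^sup>2)"
  shows "integrable M (\<lambda>\<omega>. (norm (u (hist K \<omega>) + c *\<^sub>R \<phi> (hist K \<omega>, S k \<omega>)))\<^sup>2)" (is ?int)
    and "(\<integral>\<omega>. (norm (u (hist K \<omega>) + c *\<^sub>R \<phi> (hist K \<omega>, S k \<omega>)))\<^sup>2 \<partial>M)
      \<le> (\<integral>\<omega>. (norm (u (hist K \<omega>)))\<^sup>2 \<partial>M) + c\<^sup>2 * (\<integral>\<omega>. w (hist K \<omega>) \<partial>M)" (is ?le)
proof -
  let ?N = "PiM K Lw"
  let ?D = "distr M ?N (hist K)"
  interpret Lk: prob_space "Lw k" by (rule Lw_prob)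
  interpret D: prob_space ?D by (rule prob_space_distr) simp
  interpret P: pair_prob_space ?D "Lw k" ..
  have pm [measurable]: "(\<lambda>\<omega>. (hist K \<omega>, S k \<omega>)) \<in> measurable M (?N \<Otimes>\<^sub>M Lw k)" by measurable
  have setsD: "sets (?D \<Otimes>\<^sub>M Lw k) = sets (?N \<Otimes>\<^sub>M Lw k)"
    by (rule sets_pair_measure_cong) simp_all
  have in_space: "hist K \<omega> \<in> space ?N" if "\<omega> \<in> space M" for \<omega>
    using measurable_space[OF hist_measurable that] .
  \<comment> \<open>Tonelli for nonnegative functions, used before integrability of the squared
    increment is known.\<close>
  have nn: "(\<integral>\<^sup>+\<omega>. F (hist K \<omega>, S k \<omega>) \<partial>M) = (\<integral>\<^sup>+\<omega>. (\<integral>\<^sup>+\<xi>. F (hist K \<omega>, \<xi>) \<partial>Lw k) \<partial>M)"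
    if F [measurable]: "F \<in> borel_measurable (?N \<Otimes>\<^sub>M Lw k)" for F :: "_ \<Rightarrow> ennreal"
  proof -
    have "(\<integral>\<^sup>+\<omega>. F (hist K \<omega>, S k \<omega>) \<partial>M) = integral\<^sup>N (distr M (?N \<Otimes>\<^sub>M Lw k) (\<lambda>\<omega>. (hist K \<omega>, S k \<omega>))) F"
      by (subst nn_integral_distr) simp_all
    also have "\<dots> = integral\<^sup>N (?D \<Otimes>\<^sub>M Lw k) F" unfolding frozen_distr[OF k] ..
    also have "\<dots> = (\<integral>\<^sup>+s. (\<integral>\<^sup>+\<xi>. F (s, \<xi>) \<partial>Lw k) \<partial>?D)"
      by (rule Lk.nn_integral_fst[symmetric]) (simp add: measurable_cong_sets[OF setsD refl] F)
    also have "\<dots> = (\<integral>\<^sup>+\<omega>. (\<integral>\<^sup>+\<xi>. F (hist K \<omega>, \<xi>) \<partial>Lw k) \<partial>M)"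
      by (subst nn_integral_distr) simp_all
    finally show ?thesis .
  qed
  have w_nonneg: "0 \<le> w (hist K \<omega>)" if "\<omega> \<in> space M" for \<omega>
  proof -
    have "0 \<le> (\<integral>\<xi>. (norm (\<phi> (hist K \<omega>, \<xi>)))\<^sup>2 \<partial>Lw k)" by (rule Bochner_Integration.integral_nonneg) simp
    then show ?thesis using var[OF in_space[OF that]] by linarith
  qed
  have "(\<integral>\<^sup>+\<omega>. ennreal ((norm (\<phi> (hist K \<omega>, S k \<omega>)))\<^sup>2) \<partial>M)
      = (\<integral>\<^sup>+\<omega>. (\<integral>\<^sup>+\<xi>. ennreal ((norm (\<phi> (hist K \<omega>, \<xi>)))\<^sup>2) \<partial>Lw k) \<partial>M)"
    by (rule nn[of "\<lambda>z. ennreal ((norm (\<phi> z))\<^sup>2)"]) simp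
  also have "\<dots> \<le> (\<integral>\<^sup>+\<omega>. ennreal (w (hist K \<omega>)) \<partial>M)"
  proof (rule nn_integral_mono)
    fix \<omega> assume "\<omega> \<in> space M"
    from var[OF in_space[OF this]]
    show "(\<integral>\<^sup>+\<xi>. ennreal ((norm (\<phi> (hist K \<omega>, \<xi>)))\<^sup>2) \<partial>Lw k) \<le> ennreal (w (hist K \<omega>))"
      by (subst nn_integral_eq_integral) (auto intro: ennreal_leI)
  qed
  also have "\<dots> = ennreal (\<integral>\<omega>. w (hist K \<omega>) \<partial>M)"
    by (rule nn_integral_eq_integral[OF int_w]) (use w_nonneg in \<open>auto intro!: AE_I2\<close>)
  finally have nn_le: "(\<integral>\<^sup>+\<omega>. ennreal ((norm (\<phi> (hist K \<omega>, S k \<omega>)))\<^sup>2) \<partial>M) \<le> ennreal (\<integral>\<omega>. w (hist K \<omega>) \<partial>M)" .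
  have int_phi: "integrable M (\<lambda>\<omega>. (norm (\<phi> (hist K \<omega>, S k \<omega>)))\<^sup>2)"
    by (rule integrableI_nonneg) (use nn_le in \<open>auto simp: le_less_trans[OF _ ennreal_less_top]\<close>)
  have w_int_nonneg: "0 \<le> (\<integral>\<omega>. w (hist K \<omega>) \<partial>M)"
    by (rule integral_nonneg_AE) (use w_nonneg in \<open>auto intro!: AE_I2\<close>)
  have phi_le: "(\<integral>\<omega>. (norm (\<phi> (hist K \<omega>, S k \<omega>)))\<^sup>2 \<partial>M) \<le> (\<integral>\<omega>. w (hist K \<omega>) \<partial>M)"
    using nn_le w_int_nonneg by (subst (asm) nn_integral_eq_integral[OF int_phi]) auto
  let ?I = "\<lambda>\<omega>. u (hist K \<omega>) \<bullet> \<phi> (hist K \<omega>, S k \<omega>)"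
  \<comment> \<open>Fubini for the signed cross term requires its integrability first; it follows
    from Cauchy-Schwarz and the two squares.\<close>
  have int_inner: "integrable M ?I"
  proof (rule Bochner_Integration.integrable_bound)
    show "integrable M (\<lambda>\<omega>. (norm (u (hist K \<omega>)))\<^sup>2 + (norm (\<phi> (hist K \<omega>, S k \<omega>)))\<^sup>2)"
      by (intro Bochner_Integration.integrable_add int_u int_phi)
    show "AE \<omega> in M. norm (?I \<omega>) \<le> norm ((norm (u (hist K \<omega>)))\<^sup>2 + (norm (\<phi> (hist K \<omega>, S k \<omega>)))\<^sup>2)"
    proof (rule AE_I2)
      fix \<omega>
      have "\<bar>?I \<omega>\<bar> \<le> norm (u (hist K \<omega>)) * norm (\<phi> (hist K \<omega>, S k \<omega>))" by (rule Cauchy_Schwarz_ineq2)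
      also have "\<dots> \<le> 1 / 2 * (norm (u (hist K \<omega>)))\<^sup>2 + (norm (\<phi> (hist K \<omega>, S k \<omega>)))\<^sup>2 / (2 * 1)"
        by (rule mult_le_weighted_squares) simp
      finally show "norm (?I \<omega>) \<le> norm ((norm (u (hist K \<omega>)))\<^sup>2 + (norm (\<phi> (hist K \<omega>, S k \<omega>)))\<^sup>2)"
        by (simp add: abs_of_nonneg)
    qed
  qed measurable
  have inner_0: "(\<integral>\<omega>. ?I \<omega> \<partial>M) = 0"
  proof -
    let ?F = "\<lambda>z. u (fst z) \<bullet> \<phi> z"
    have Fm [measurable]: "?F \<in> borel_measurable (?N \<Otimes>\<^sub>M Lw k)" by measurable
    have "integrable (distr M (?N \<Otimes>\<^sub>M Lw k) (\<lambda>\<omega>. (hist K \<omega>, S k \<omega>))) ?F"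
      using int_inner by (subst integrable_distr_eq) simp_all
    then have intF: "integrable (?D \<Otimes>\<^sub>M Lw k) (case_prod (\<lambda>s \<xi>. u s \<bullet> \<phi> (s, \<xi>)))"
      unfolding frozen_distr[OF k] by (simp add: case_prod_unfold)
    have "(\<integral>\<omega>. ?I \<omega> \<partial>M) = integral\<^sup>L (distr M (?N \<Otimes>\<^sub>M Lw k) (\<lambda>\<omega>. (hist K \<omega>, S k \<omega>))) ?F"
      by (subst integral_distr) simp_all
    also have "\<dots> = integral\<^sup>L (?D \<Otimes>\<^sub>M Lw k) (case_prod (\<lambda>s \<xi>. u s \<bullet> \<phi> (s, \<xi>)))"
      unfolding frozen_distr[OF k] by (simp add: case_prod_unfold)
    also have "\<dots> = (\<integral>s. (\<integral>\<xi>. u s \<bullet> \<phi> (s, \<xi>) \<partial>Lw k) \<partial>?D)"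
      by (rule P.integral_fst[OF intF, symmetric])
    also have "\<dots> = (\<integral>s. 0 \<partial>?D)"
    proof (rule Bochner_Integration.integral_cong[OF refl])
      fix s assume "s \<in> space ?D"
      then have "s \<in> space ?N" by simp
      with mean[OF this] show "(\<integral>\<xi>. u s \<bullet> \<phi> (s, \<xi>) \<partial>Lw k) = 0"
        by (simp add: integral_inner_right)
    qed
    finally show ?thesis by simp
  qed
  have expand: "(norm (u (hist K \<omega>) + c *\<^sub>R \<phi> (hist K \<omega>, S k \<omega>)))\<^sup>2
      = (norm (u (hist K \<omega>)))\<^sup>2 + c\<^sup>2 * (norm (\<phi> (hist K \<omega>, S k \<omega>)))\<^sup>2 + (2 * c) * ?I \<omega>" for \<omega>
    unfolding norm_add_power2 by (simp add: power_mult_distrib)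
  show ?int
    unfolding expand by (intro Bochner_Integration.integrable_add int_u int_phi int_inner integrable_mult_right)
  have "(\<integral>\<omega>. (norm (u (hist K \<omega>) + c *\<^sub>R \<phi> (hist K \<omega>, S k \<omega>)))\<^sup>2 \<partial>M)
      = (\<integral>\<omega>. (norm (u (hist K \<omega>)))\<^sup>2 \<partial>M) + c\<^sup>2 * (\<integral>\<omega>. (norm (\<phi> (hist K \<omega>, S k \<omega>)))\<^sup>2 \<partial>M) + (2 * c) * (\<integral>\<omega>. ?I \<omega> \<partial>M)"
    unfolding expand using int_u int_phi int_inner by simp
  also have "\<dots> \<le> (\<integral>\<omega>. (norm (u (hist K \<omega>)))\<^sup>2 \<partial>M) + c\<^sup>2 * (\<integral>\<omega>. w (hist K \<omega>) \<partial>M)"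
    unfolding inner_0 using phi_le by (simp add: mult_left_mono)
  finally show ?le .
qed

text \<open>Samples are added one at a time: the earlier ones of the batch join the history, with
  respect to which the next one is still fresh and centered.\<close>

lemma second_moment_batch:
  fixes u :: "('k \<Rightarrow> 's) \<Rightarrow> 'v::euclidean_space" and \<phi> :: "('k \<Rightarrow> 's) \<times> 's \<Rightarrow> 'v"
    and w :: "('k \<Rightarrow> 's) \<Rightarrow> real" and \<iota> :: "nat \<Rightarrow> 'k"
  assumes \<iota>: "inj \<iota>" "\<And>j. \<iota> j \<notin> K" "\<And>j. Lw (\<iota> j) = Q"
    and u [measurable]: "u \<in> borel_measurable (PiM K Lw)"
    and \<phi> [measurable]: "\<phi> \<in> borel_measurable (PiM K Lw \<Otimes>\<^sub>M Q)"
    and w [measurable]: "w \<in> borel_measurable (PiM K Lw)"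
    and mean: "\<And>s. s \<in> space (PiM K Lw) \<Longrightarrow> integrable Q (\<lambda>\<xi>. \<phi> (s, \<xi>)) \<and> (\<integral>\<xi>. \<phi> (s, \<xi>) \<partial>Q) = 0"
    and var: "\<And>s. s \<in> space (PiM K Lw) \<Longrightarrow> integrable Q (\<lambda>\<xi>. (norm (\<phi> (s, \<xi>)))\<^sup>2)
        \<and> (\<integral>\<xi>. (norm (\<phi> (s, \<xi>)))\<^sup>2 \<partial>Q) \<le> w s"
    and int_w: "integrable M (\<lambda>\<omega>. w (hist K \<omega>))"
    and int_u: "integrable M (\<lambda>\<omega>. (norm (u (hist K \<omega>)))\<^sup>2)"
  shows "integrable M (\<lambda>\<omega>. (norm (u (hist K \<omega>) + c *\<^sub>R (\<Sum>j<n. \<phi> (hist K \<omega>, S (\<iota> j) \<omega>))))\<^sup>2)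
    \<and> (\<integral>\<omega>. (norm (u (hist K \<omega>) + c *\<^sub>R (\<Sum>j<n. \<phi> (hist K \<omega>, S (\<iota> j) \<omega>))))\<^sup>2 \<partial>M)
      \<le> (\<integral>\<omega>. (norm (u (hist K \<omega>)))\<^sup>2 \<partial>M) + real n * c\<^sup>2 * (\<integral>\<omega>. w (hist K \<omega>) \<partial>M)"
proof (induction n)
  case 0
  then show ?case using int_u by simp
next
  case (Suc n)
  define K' where "K' = K \<union> \<iota> ` {..<n}"
  let ?r = "\<lambda>s. restrict s K"
  let ?u = "\<lambda>s. u (?r s) + c *\<^sub>R (\<Sum>j<n. \<phi> (?r s, s (\<iota> j)))"
  let ?\<phi> = "\<lambda>(s, \<xi>). \<phi> (?r s, \<xi>)"
  have k': "\<iota> n \<notin> K'" using \<iota>(1,2) unfolding K'_def by (auto dest: injD)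
  have r [measurable]: "?r \<in> measurable (PiM K' Lw) (PiM K Lw)"
    unfolding K'_def by (rule measurable_restrict_subset) auto
  have rh: "?r (hist K' \<omega>) = hist K \<omega>" for \<omega>
    unfolding hist_def K'_def by (auto simp: restrict_def fun_eq_iff)
  have hj: "hist K' \<omega> (\<iota> j) = S (\<iota> j) \<omega>" if "j < n" for \<omega> j
    using that unfolding hist_def K'_def by auto
  have comp [measurable]: "(\<lambda>s. s (\<iota> j)) \<in> measurable (PiM K' Lw) Q" if "j < n" for j
    using measurable_component_singleton[of "\<iota> j" K' Lw] that unfolding \<iota>(3) K'_def by auto
  have um: "?u \<in> borel_measurable (PiM K' Lw)"
    by (intro borel_measurable_add borel_measurable_scaleR borel_measurable_const borel_measurable_sum
        measurable_compose[OF r u] measurable_compose[OF _ \<phi>] measurable_Pair r comp) auto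
  have \<phi>m: "?\<phi> \<in> borel_measurable (PiM K' Lw \<Otimes>\<^sub>M Lw (\<iota> n))"
    unfolding \<iota>(3) case_prod_unfold by measurable
  have wm: "(\<lambda>s. w (?r s)) \<in> borel_measurable (PiM K' Lw)" by measurable
  have sp: "?r s \<in> space (PiM K Lw)" if "s \<in> space (PiM K' Lw)" for s
    using measurable_space[OF r that] .
  have eq: "?u (hist K' \<omega>) = u (hist K \<omega>) + c *\<^sub>R (\<Sum>j<n. \<phi> (hist K \<omega>, S (\<iota> j) \<omega>))" for \<omega>
    unfolding rh by (simp add: hj)
  have eq2: "u (hist K \<omega>) + c *\<^sub>R (\<Sum>j<Suc n. \<phi> (hist K \<omega>, S (\<iota> j) \<omega>))
      = ?u (hist K' \<omega>) + c *\<^sub>R ?\<phi> (hist K' \<omega>, S (\<iota> n) \<omega>)" for \<omega>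
    unfolding eq by (simp add: rh scaleR_add_right)
  have mean': "s \<in> space (PiM K' Lw) \<Longrightarrow> integrable (Lw (\<iota> n)) (\<lambda>\<xi>. ?\<phi> (s, \<xi>)) \<and> (\<integral>\<xi>. ?\<phi> (s, \<xi>) \<partial>Lw (\<iota> n)) = 0"
    and var': "s \<in> space (PiM K' Lw) \<Longrightarrow> integrable (Lw (\<iota> n)) (\<lambda>\<xi>. (norm (?\<phi> (s, \<xi>)))\<^sup>2)
        \<and> (\<integral>\<xi>. (norm (?\<phi> (s, \<xi>)))\<^sup>2 \<partial>Lw (\<iota> n)) \<le> w (?r s)" for s
    using mean[OF sp] var[OF sp] unfolding \<iota>(3) by simp_all
  have iw: "integrable M (\<lambda>\<omega>. w (?r (hist K' \<omega>)))" unfolding rh by (rule int_w)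
  have iu: "integrable M (\<lambda>\<omega>. (norm (?u (hist K' \<omega>)))\<^sup>2)" unfolding eq using Suc by blast
  note * = second_moment_increment[OF k' um \<phi>m wm mean' var' iw iu, of c]
  have "integrable M (\<lambda>\<omega>. (norm (u (hist K \<omega>) + c *\<^sub>R (\<Sum>j<Suc n. \<phi> (hist K \<omega>, S (\<iota> j) \<omega>))))\<^sup>2)"
    unfolding eq2 by (rule *(1))
  moreover have "(\<integral>\<omega>. (norm (u (hist K \<omega>) + c *\<^sub>R (\<Sum>j<Suc n. \<phi> (hist K \<omega>, S (\<iota> j) \<omega>))))\<^sup>2 \<partial>M)
      \<le> (\<integral>\<omega>. (norm (?u (hist K' \<omega>)))\<^sup>2 \<partial>M) + c\<^sup>2 * (\<integral>\<omega>. w (?r (hist K' \<omega>)) \<partial>M)"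
    unfolding eq2 by (rule *(2))
  moreover have "(\<integral>\<omega>. (norm (?u (hist K' \<omega>)))\<^sup>2 \<partial>M)
      \<le> (\<integral>\<omega>. (norm (u (hist K \<omega>)))\<^sup>2 \<partial>M) + real n * c\<^sup>2 * (\<integral>\<omega>. w (hist K \<omega>) \<partial>M)"
    unfolding eq using Suc by blast
  ultimately show ?case unfolding rh by (simp add: algebra_simps)
qed

end

section \<open>The iterates as random variables\<close>

text \<open>Treats both sampling regimes at once: a checkpoint gradient is either a sample mean of
  variance at most \<open>\<nu>\<close> or exact. \<open>Bf_local\<close> says that a batch depends
  only on the samples of its own time and agent.\<close>

locale vrlm_run = vrlm_problem p \<phi>lb \<sigma> x\<^sub>0 y\<^sub>0 + indep_samples M "\<lambda>(t, i, j). law p i" S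
  for p :: "('m::finite, 'a::finite, 'b::finite, 's) problem" and \<phi>lb \<sigma> x\<^sub>0 y\<^sub>0
    and M :: "'w measure" and S :: "nat \<times> 'm \<times> nat \<Rightarrow> 'w \<Rightarrow> 's" +
  fixes Bf :: "(nat \<times> 'm \<times> nat \<Rightarrow> 's) \<Rightarrow> nat \<Rightarrow> 'm \<Rightarrow> 's list" and q :: nat and \<nu> :: real
  assumes q_pos: "0 < q" and nu_nonneg: "0 \<le> \<nu>"
    and Bf_local: "\<And>s s' t i. (\<And>j. s (t, i, j) = s' (t, i, j)) \<Longrightarrow> Bf s t i = Bf s' t i"
    and Bf_fresh: "\<And>s t i. \<not> q dvd t \<Longrightarrow> Bf s t i = map (\<lambda>j. s (t, i, j)) [0..<q]"
    and Bf_checkpoint: "\<And>t. q dvd t \<Longrightarrow>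
        (\<exists>n>0. \<sigma>\<^sup>2 / real n \<le> \<nu> \<and> (\<forall>s i. Bf s t i = map (\<lambda>j. s (t, i, j)) [0..<n]))
        \<or> (\<forall>s i X Y. batch_grad p i X Y (Bf s t i) = gradient (local_fun p i) (X $ i, Y $ i))"
begin

abbreviation "Lw \<equiv> \<lambda>(t :: nat, i :: 'm, j :: nat). law p i"
abbreviation "run s t \<equiv> vrlm p x\<^sub>0 y\<^sub>0 q (Bf s) t"

section \<open>Dependence of the iterates on past samples\<close>

lemma run_path:
  "vrlm_path p \<phi>lb \<sigma> x\<^sub>0 y\<^sub>0 (\<lambda>t. it_X (run s t)) (\<lambda>t. it_Lam (run s t)) (\<lambda>t. it_Y (run s t))
     (\<lambda>t. it_d (run s t)) (\<lambda>t. it_Vx (run s t))"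
  by unfold_locales (simp_all add: vrlm_step_def Let_def)

lemma run_cong:
  assumes "\<And>k. fst k \<le> t \<Longrightarrow> s k = s' k"
  shows "run s t = run s' t"
  using assms
proof (induction t)
  case 0
  then have "Bf s 0 = Bf s' 0" by (intro ext Bf_local) auto
  then show ?case by simp
next
  case (Suc t)
  then have "Bf s (Suc t) = Bf s' (Suc t)" by (intro ext Bf_local) auto
  moreover have "run s t = run s' t" using Suc by auto
  ultimately show ?case by simp
qed

text \<open>The points at time \<open>t\<close> are fixed by samples of strictly earlier times,
  while \<open>it_d\<close> already uses those of time \<open>t\<close>. This shift makes the batch
  at time \<open>t\<close> fresh for the points at which it is evaluated.\<close>

lemma run_XY_cong:
  assumes "\<And>k. fst k < t \<Longrightarrow> s k = s' k"
  shows "it_X (run s t) = it_X (run s' t)" "it_Y (run s t) = it_Y (run s' t)"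
    "it_Lam (run s t) = it_Lam (run s' t)"
proof -
  have "it_X (run s t) = it_X (run s' t) \<and> it_Y (run s t) = it_Y (run s' t) \<and> it_Lam (run s t) = it_Lam (run s' t)"
  proof (cases t)
    case (Suc u)
    have "run s u = run s' u" by (rule run_cong) (use assms Suc in auto)
    then show ?thesis unfolding Suc by (simp add: vrlm_step_def Let_def)
  qed (simp add: Let_def)
  then show "it_X (run s t) = it_X (run s' t)" "it_Y (run s t) = it_Y (run s' t)"
    "it_Lam (run s t) = it_Lam (run s' t)" by auto
qed

section \<open>Measurability of the iterates\<close>

lemma continuous_prox_rows_x: "continuous_on UNIV (\<lambda>U :: real^'a^'m. prox_rows (\<lambda>v. ereal \<eta> * g v) U)"
  and continuous_prox_rows_y: "continuous_on UNIV (\<lambda>U :: real^'b^'m. prox_rows (\<lambda>v. ereal (eta_y p) * h v) U)"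
proof -
  have ey: "0 < eta_y p" using L_pos unfolding eta_y_def by simp
  have lip: "continuous_on UNIV P" if "\<And>u v. norm (P u - P v) \<le> norm (u - v)"
    for P :: "real^'d::finite \<Rightarrow> real^'d"
  proof -
    have "1-lipschitz_on UNIV P" using that by (intro lipschitz_onI) (auto simp: dist_norm)
    then show ?thesis by (rule lipschitz_on_continuous_on)
  qed
  have rows: "continuous_on UNIV (\<lambda>U :: real^'d^'m. \<chi> i. P (U $ i))" if "continuous_on UNIV P"
    for P :: "real^'d::finite \<Rightarrow> real^'d"
    by (intro continuous_on_vec_lambda continuous_on_compose2[OF that] continuous_intros) auto
  show "continuous_on UNIV (\<lambda>U :: real^'a^'m. prox_rows (\<lambda>v. ereal \<eta> * g v) U)"
    unfolding prox_rows_def by (intro rows lip prox_scaled_nonexpansive[OF g_ccf x0 eta_pos(1)])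
  show "continuous_on UNIV (\<lambda>U :: real^'b^'m. prox_rows (\<lambda>v. ereal (eta_y p) * h v) U)"
    unfolding prox_rows_def by (intro rows lip prox_scaled_nonexpansive[OF h_ccf y0 ey])
qed

lemma borel_matrix_mult [measurable]:
  fixes A :: "real^'m^'m" and Z :: "'z \<Rightarrow> real^'d::finite^'m"
  assumes "Z \<in> borel_measurable N"
  shows "(\<lambda>s. A ** Z s) \<in> borel_measurable N"
proof -
  have "linear (\<lambda>Z :: real^'d^'m. A ** Z)"
    by (intro linearI) (simp_all add: matrix_add_ldistrib vec_eq_iff[of "A ** _"] matrix_mult_row scaleR_sum_right mult.commute)
  then have "continuous_on UNIV (\<lambda>Z :: real^'d^'m. A ** Z)"
    using linear_continuous_on linear_conv_bounded_linear by blast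
  from borel_measurable_continuous_onI[OF this] assms show ?thesis by (rule measurable_compose_rev)
qed

lemma borel_row [measurable]:
  fixes Z :: "'z \<Rightarrow> real^'d::finite^'m"
  assumes "Z \<in> borel_measurable N"
  shows "(\<lambda>s. Z s $ i) \<in> borel_measurable N"
  by (rule measurable_compose_rev[OF borel_measurable_continuous_onI assms]) (intro continuous_intros)

lemma borel_vec_lambda:
  fixes Z :: "'m \<Rightarrow> 'z \<Rightarrow> real^'d::finite"
  assumes "\<And>i. Z i \<in> borel_measurable N"
  shows "(\<lambda>s. \<chi> i. Z i s) \<in> borel_measurable N"
  unfolding borel_measurable_euclidean_space[where f = "\<lambda>s. \<chi> i. Z i s"]
proof (intro ballI)
  fix e :: "real^'d^'m" assume "e \<in> Basis"
  then obtain i u where e: "e = axis i u" by (auto simp: Basis_vec_def)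
  have "(\<lambda>s. Z i s \<bullet> u) \<in> borel_measurable N" using assms[of i] by measurable
  then show "(\<lambda>s. (\<chi> i. Z i s) \<bullet> e) \<in> borel_measurable N" unfolding e inner_axis by simp
qed

lemma borel_gradient [measurable]:
  assumes "Z \<in> borel_measurable N"
  shows "(\<lambda>s. gradient (f i) (Z s)) \<in> borel_measurable N"
  by (rule measurable_compose_rev[OF borel_measurable_continuous_onI assms])
    (rule smooth_fun_gradient_continuous[OF smooth])

lemma borel_sgrad:
  assumes [measurable]: "Z \<in> borel_measurable N" "\<zeta> \<in> measurable N (law p i)"
  shows "(\<lambda>s. sgrad p i (Z s) (\<zeta> s)) \<in> borel_measurable N"
proof -
  have "(\<lambda>(z, \<xi>). sgrad p i z \<xi>) \<in> borel_measurable (borel \<Otimes>\<^sub>M law p i)"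
    using wp unfolding well_posed_def by auto
  from measurable_compose[OF _ this, of "\<lambda>s. (Z s, \<zeta> s)" N] show ?thesis by simp
qed

lemma component_measurable:
  assumes "(t, i, j) \<in> K"
  shows "(\<lambda>s. s (t, i, j)) \<in> measurable (PiM K Lw) (law p i)"
  using measurable_component_singleton[OF assms, of Lw] by simp

lemma batch_grad_map:
  "batch_grad p i X Y (map \<zeta> [0..<n]) = (1 / real n) *\<^sub>R (\<Sum>j<n. sgrad p i (X $ i, Y $ i) (\<zeta> j))"
  unfolding batch_grad_def
  by (simp add: interv_sum_list_conv_sum_set_nat atLeast0LessThan o_def)

lemma batch_measurable:
  assumes K: "{k. fst k \<le> t} \<subseteq> K"
    and [measurable]: "XX \<in> borel_measurable (PiM K Lw)" "YY \<in> borel_measurable (PiM K Lw)"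
  shows "(\<lambda>s. batch_grad p i (XX s) (YY s) (Bf s t i)) \<in> borel_measurable (PiM K Lw)"
proof -
  have lst: "(\<lambda>s. batch_grad p i (XX s) (YY s) (Bf s t i)) \<in> borel_measurable (PiM K Lw)"
    if "\<And>s. Bf s t i = map (\<lambda>j. s (t, i, j)) [0..<n]" for n
    unfolding that batch_grad_map
    by (intro borel_measurable_scaleR borel_measurable_const borel_measurable_sum borel_sgrad
        component_measurable) (use K in auto)
  show ?thesis
  proof (cases "q dvd t")
    case True
    from Bf_checkpoint[OF True] show ?thesis
    proof (elim disjE exE conjE)
      assume "\<forall>s i X Y. batch_grad p i X Y (Bf s t i) = gradient (f i) (X $ i, Y $ i)"
      then have "(\<lambda>s. batch_grad p i (XX s) (YY s) (Bf s t i)) = (\<lambda>s. gradient (f i) (XX s $ i, YY s $ i))"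
        by simp
      then show ?thesis by simp
    qed (use lst in blast)
  next
    case False
    show ?thesis by (rule lst[OF Bf_fresh[OF False]])
  qed
qed

lemma run_Suc:
  "it_X (run s (Suc t)) = prox_rows (\<lambda>v. ereal \<eta> * g v) (W ** it_X (run s t) - \<eta> *\<^sub>R it_Vx (run s t))"
  "it_Lam (run s (Suc t)) = it_Lam (run s t) + (L * \<eta>\<^sub>\<Lambda> / (2 * sqrt (real CARD('m)))) *\<^sub>R ((W - mat 1) ** it_Y (run s t))"
  "it_Y (run s (Suc t)) = prox_rows (\<lambda>v. ereal (eta_y p) * h v) (it_Y (run s t) + eta_y p *\<^sub>R
     (rows_y (it_d (run s t)) - (L * sqrt (real CARD('m)) / 2) *\<^sub>R (transpose (W - mat 1) ** it_Lam (run s t))))"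
  "it_Vx (run s (Suc t)) = W ** (it_Vx (run s t) + rows_x (it_d (run s (Suc t))) - rows_x (it_d (run s t)))"
  "it_d (run s (Suc t)) i = (if q dvd Suc t
     then batch_grad p i (it_X (run s (Suc t))) (it_Y (run s (Suc t))) (Bf s (Suc t) i)
     else batch_grad p i (it_X (run s (Suc t))) (it_Y (run s (Suc t))) (Bf s (Suc t) i)
        - batch_grad p i (it_X (run s t)) (it_Y (run s t)) (Bf s (Suc t) i) + it_d (run s t) i)"
  by (simp_all add: vrlm_step_def Let_def)

lemma run_XY_Suc_measurable:
  assumes [measurable]: "(\<lambda>s. it_X (run s t)) \<in> borel_measurable N" "(\<lambda>s. it_Y (run s t)) \<in> borel_measurable N"
    "(\<lambda>s. it_Lam (run s t)) \<in> borel_measurable N" "(\<lambda>s. it_Vx (run s t)) \<in> borel_measurable N"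
    and d: "\<And>i. (\<lambda>s. it_d (run s t) i) \<in> borel_measurable N"
  shows "(\<lambda>s. it_X (run s (Suc t))) \<in> borel_measurable N" "(\<lambda>s. it_Y (run s (Suc t))) \<in> borel_measurable N"
    "(\<lambda>s. it_Lam (run s (Suc t))) \<in> borel_measurable N"
proof -
  have [measurable]: "(\<lambda>s. rows_y (it_d (run s t))) \<in> borel_measurable N"
    unfolding rows_y_def
    by (intro borel_vec_lambda measurable_compose[OF d] borel_measurable_continuous_onI continuous_intros)
  show "(\<lambda>s. it_X (run s (Suc t))) \<in> borel_measurable N"
    unfolding run_Suc by (rule measurable_compose[OF _ borel_measurable_continuous_onI[OF continuous_prox_rows_x]]) measurable
  show "(\<lambda>s. it_Y (run s (Suc t))) \<in> borel_measurable N"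
    unfolding run_Suc by (rule measurable_compose[OF _ borel_measurable_continuous_onI[OF continuous_prox_rows_y]]) measurable
  show "(\<lambda>s. it_Lam (run s (Suc t))) \<in> borel_measurable N"
    unfolding run_Suc by measurable
qed

text \<open>\<open>K\<close> is left general because two cases occur: the history for the SPIDER
  recursion, and all indices for the random output.\<close>

lemma run_measurable:
  assumes "{k. fst k \<le> t} \<subseteq> K"
  shows "(\<lambda>s. it_X (run s t)) \<in> borel_measurable (PiM K Lw) \<and> (\<lambda>s. it_Y (run s t)) \<in> borel_measurable (PiM K Lw)
    \<and> (\<lambda>s. it_Lam (run s t)) \<in> borel_measurable (PiM K Lw) \<and> (\<lambda>s. it_Vx (run s t)) \<in> borel_measurable (PiM K Lw)
    \<and> (\<forall>i. (\<lambda>s. it_d (run s t) i) \<in> borel_measurable (PiM K Lw))"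
  using assms
proof (induction t)
  case 0
  have d: "(\<lambda>s. it_d (run s 0) i) \<in> borel_measurable (PiM K Lw)" for i
    using batch_measurable[OF 0, of "\<lambda>_. all_rows x\<^sub>0" "\<lambda>_. all_rows y\<^sub>0" i] by (simp add: Let_def)
  then have "(\<lambda>s. rows_x (it_d (run s 0))) \<in> borel_measurable (PiM K Lw)"
    unfolding rows_x_def
    by (intro borel_vec_lambda measurable_compose[OF d] borel_measurable_continuous_onI continuous_intros)
  then show ?case using d by (simp add: Let_def)
next
  case (Suc t)
  have K: "{k. fst k \<le> t} \<subseteq> K" using Suc.prems by auto
  note IH = Suc.IH[OF K]
  have XY [measurable]: "(\<lambda>s. it_X (run s (Suc t))) \<in> borel_measurable (PiM K Lw)" "(\<lambda>s. it_Y (run s (Suc t))) \<in> borel_measurable (PiM K Lw)"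
    "(\<lambda>s. it_Lam (run s (Suc t))) \<in> borel_measurable (PiM K Lw)"
    using run_XY_Suc_measurable[of t "PiM K Lw"] IH by blast+
  have d: "(\<lambda>s. it_d (run s (Suc t)) i) \<in> borel_measurable (PiM K Lw)" for i
  proof (cases "q dvd Suc t")
    case True
    then show ?thesis unfolding run_Suc(5)[of _ t i] using batch_measurable[OF Suc.prems XY(1,2), of i] by simp
  next
    case False
    have [measurable]: "(\<lambda>s. batch_grad p i (it_X (run s (Suc t))) (it_Y (run s (Suc t))) (Bf s (Suc t) i)) \<in> borel_measurable (PiM K Lw)"
      "(\<lambda>s. batch_grad p i (it_X (run s t)) (it_Y (run s t)) (Bf s (Suc t) i)) \<in> borel_measurable (PiM K Lw)"
      "(\<lambda>s. it_d (run s t) i) \<in> borel_measurable (PiM K Lw)"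
      using batch_measurable[OF Suc.prems] XY IH by blast+
    show ?thesis unfolding run_Suc(5)[of _ t i] if_not_P[OF False] by measurable
  qed
  have rows: "(\<lambda>s. rows_x (\<delta> s)) \<in> borel_measurable (PiM K Lw)"
    if "\<And>i. (\<lambda>s. \<delta> s i) \<in> borel_measurable (PiM K Lw)" for \<delta> :: "_ \<Rightarrow> 'm \<Rightarrow> (real^'a) \<times> (real^'b)"
    unfolding rows_x_def
    by (intro borel_vec_lambda measurable_compose[OF that] borel_measurable_continuous_onI continuous_intros)
  have [measurable]: "(\<lambda>s. rows_x (it_d (run s (Suc t)))) \<in> borel_measurable (PiM K Lw)"
    "(\<lambda>s. rows_x (it_d (run s t))) \<in> borel_measurable (PiM K Lw)"
    using IH by (auto intro!: rows d simp del: vrlm.simps)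
  have [measurable]: "(\<lambda>s. it_Vx (run s t)) \<in> borel_measurable (PiM K Lw)" using IH by blast
  have "(\<lambda>s. it_Vx (run s (Suc t))) \<in> borel_measurable (PiM K Lw)"
    unfolding run_Suc(4) by measurable
  then show ?case using XY d by blast
qed

lemma run_XY_measurable:
  assumes K: "{k. fst k < t} \<subseteq> K"
  shows "(\<lambda>s. it_X (run s t)) \<in> borel_measurable (PiM K Lw)" "(\<lambda>s. it_Y (run s t)) \<in> borel_measurable (PiM K Lw)"
proof -
  have "(\<lambda>s. it_X (run s t)) \<in> borel_measurable (PiM K Lw) \<and> (\<lambda>s. it_Y (run s t)) \<in> borel_measurable (PiM K Lw)"
  proof (cases t)
    case (Suc u)
    have "{k. fst k \<le> u} \<subseteq> K" using K Suc by auto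
    from run_measurable[OF this] show ?thesis
      unfolding Suc using run_XY_Suc_measurable[of u "PiM K Lw"] by blast
  qed (simp add: Let_def)
  then show "(\<lambda>s. it_X (run s t)) \<in> borel_measurable (PiM K Lw)" "(\<lambda>s. it_Y (run s t)) \<in> borel_measurable (PiM K Lw)"
    by auto
qed

abbreviation "smp \<omega> \<equiv> (\<lambda>k. S k \<omega>)"

lemma run_hist:
  assumes "{k. fst k \<le> t} \<subseteq> K" shows "run (hist K \<omega>) t = run (smp \<omega>) t"
  by (rule run_cong) (use assms in \<open>auto simp: hist_def\<close>)

lemma run_XY_hist:
  assumes "{k. fst k < t} \<subseteq> K"
  shows "it_X (run (hist K \<omega>) t) = it_X (run (smp \<omega>) t)" "it_Y (run (hist K \<omega>) t) = it_Y (run (smp \<omega>) t)"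
  by (rule run_XY_cong; use assms in \<open>auto simp: hist_def\<close>)+

end

section \<open>Centered second moments and the epoch sum\<close>

lemma (in prob_space) second_moment_centered:
  fixes Z :: "'a \<Rightarrow> 'v::euclidean_space"
  assumes Z: "integrable M Z" and Z2: "integrable M (\<lambda>\<omega>. (norm (Z \<omega>))\<^sup>2)" and m: "(\<integral>\<omega>. Z \<omega> \<partial>M) = m"
  shows "integrable M (\<lambda>\<omega>. (norm (Z \<omega> - m))\<^sup>2)"
    and "(\<integral>\<omega>. (norm (Z \<omega> - m))\<^sup>2 \<partial>M) \<le> (\<integral>\<omega>. (norm (Z \<omega>))\<^sup>2 \<partial>M)"
proof -
  have e: "(norm (Z \<omega> - m))\<^sup>2 = (norm (Z \<omega>))\<^sup>2 - 2 * (m \<bullet> Z \<omega>) + (norm m)\<^sup>2" for \<omega>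
    by (simp add: power2_norm_eq_inner inner_diff_left inner_diff_right inner_commute)
  have i: "integrable M (\<lambda>\<omega>. m \<bullet> Z \<omega>)" using Z by (rule integrable_inner_right)
  show "integrable M (\<lambda>\<omega>. (norm (Z \<omega> - m))\<^sup>2)"
    unfolding e using Z2 i by simp
  have "(\<integral>\<omega>. m \<bullet> Z \<omega> \<partial>M) = m \<bullet> m"
    using integral_inner_right[of m M Z] Z m by simp
  then have "(\<integral>\<omega>. (norm (Z \<omega> - m))\<^sup>2 \<partial>M) = (\<integral>\<omega>. (norm (Z \<omega>))\<^sup>2 \<partial>M) - (norm m)\<^sup>2"
    unfolding e using Z2 i by (simp add: prob_space power2_norm_eq_inner[of m])
  then show "(\<integral>\<omega>. (norm (Z \<omega> - m))\<^sup>2 \<partial>M) \<le> (\<integral>\<omega>. (norm (Z \<omega>))\<^sup>2 \<partial>M)" by simp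
qed

lemma spider_sum:
  fixes e D :: "nat \<Rightarrow> real"
  assumes q: "0 < q" and c: "0 \<le> c" and D: "\<And>t. 0 \<le> D t"
    and checkpoint: "\<And>t. q dvd t \<Longrightarrow> e t \<le> \<nu>"
    and step: "\<And>t. \<not> q dvd Suc t \<Longrightarrow> e (Suc t) \<le> e t + c / real q * D t"
  shows "(\<Sum>t<T. e t) \<le> real T * \<nu> + c * (\<Sum>t<T. D t)"
proof -
  \<comment> \<open>Each increment is charged to the at most \<open>q - 1\<close> later steps of its epoch; the second
    summand below is the part of the charge that is still outstanding.\<close>
  define e' where "e' t = max (e t) \<nu>" for t
  have st: "e' (Suc t) \<le> e' t + c / real q * D t" if "\<not> q dvd Suc t" for t
  proof -
    have "0 \<le> c / real q * D t" using c D by simp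
    then show ?thesis using step[OF that] unfolding e'_def by linarith
  qed
  have ck: "e' t = \<nu>" if "q dvd t" for t using checkpoint[OF that] unfolding e'_def by simp
  have "(\<Sum>t<Suc T. e' t) + (real q - 1 - real (T mod q)) * (e' T - \<nu>) \<le> real (Suc T) * \<nu> + c * (\<Sum>t<T. D t)" for T
  proof (induction T)
    case 0
    then show ?case using ck[of 0] by simp
  next
    case (Suc T)
    show ?case
    proof (cases "q dvd Suc T")
      case True
      then have "Suc (T mod q) = q" using q by (metis dvd_imp_mod_0 mod_Suc nat.distinct(1))
      then have last: "real q - 1 - real (T mod q) = 0" by linarith
      show ?thesis
        using Suc.IH ck[OF True] mult_nonneg_nonneg[OF c D[of T]] unfolding last by (simp add: algebra_simps)
    next
      case False
      then have m: "Suc T mod q = Suc (T mod q)" by (metis mod_Suc mod_0_imp_dvd)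
      have lt: "Suc (T mod q) < q" using m q by (metis mod_less_divisor)
      define k where "k = real q - 1 - real (T mod q)"
      have k: "1 \<le> k" "k \<le> real q" using lt unfolding k_def by auto
      have "k * (e' (Suc T)) \<le> k * (e' T + c / real q * D T)"
        using k by (intro mult_left_mono st[OF False]) auto
      \<comment> \<open>An epoch has \<open>q\<close> steps and each increment carries the factor
        \<open>1 / real q\<close> of a batch of \<open>q\<close> samples, so the repeated charges
        add up to at most \<open>c * D T\<close>.\<close>
      moreover have "k * (c / real q * D T) \<le> real q * (c / real q * D T)"
        using k c D by (intro mult_right_mono) auto
      moreover have "real q * (c / real q * D T) = c * D T" using q by simp
      moreover have "real q - 1 - real (Suc T mod q) = k - 1" unfolding m k_def by simp
      ultimately show ?thesis
        using Suc.IH unfolding k_def[symmetric] by (simp add: algebra_simps)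
    qed
  qed
  note inv = this
  show ?thesis
  proof (cases T)
    case (Suc T')
    have "0 \<le> (real q - 1 - real (T' mod q)) * (e' T' - \<nu>)"
    proof -
      have "T' mod q < q" using q by simp
      then show ?thesis unfolding e'_def by (intro mult_nonneg_nonneg) auto
    qed
    with inv[of T'] have "(\<Sum>t<T. e' t) \<le> real T * \<nu> + c * (\<Sum>t<T'. D t)" unfolding Suc by linarith
    moreover have "(\<Sum>t<T. e t) \<le> (\<Sum>t<T. e' t)" unfolding e'_def by (intro sum_mono) simp
    moreover have "c * (\<Sum>t<T'. D t) \<le> c * (\<Sum>t<T. D t)" unfolding Suc using c D by (simp add: algebra_simps)
    ultimately show ?thesis by linarith
  qed simp
qed

section \<open>Square integrability and the SPIDER error\<close>

context vrlm_run
begin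

text \<open>All parts of an update other than the sampled gradients are linear or Lipschitz, and
  such maps preserve this class.\<close>

definition sqi :: "('w \<Rightarrow> 'v::euclidean_space) \<Rightarrow> bool" where
  "sqi Z \<longleftrightarrow> Z \<in> borel_measurable M \<and> integrable M (\<lambda>\<omega>. (norm (Z \<omega>))\<^sup>2)"

lemma sqiD: "sqi Z \<Longrightarrow> Z \<in> borel_measurable M" "sqi Z \<Longrightarrow> integrable M (\<lambda>\<omega>. (norm (Z \<omega>))\<^sup>2)"
  unfolding sqi_def by auto

lemma sqi_dominated:
  fixes F :: "'w \<Rightarrow> 'v::euclidean_space"
  assumes "F \<in> borel_measurable M" "integrable M H" "\<And>\<omega>. (norm (F \<omega>))\<^sup>2 \<le> H \<omega>"
  shows "sqi F"
  unfolding sqi_def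
proof
  show "F \<in> borel_measurable M" by fact
  show "integrable M (\<lambda>\<omega>. (norm (F \<omega>))\<^sup>2)"
  proof (rule Bochner_Integration.integrable_bound[OF assms(2)])
    show "AE \<omega> in M. norm ((norm (F \<omega>))\<^sup>2) \<le> norm (H \<omega>)"
      using assms(3) by (intro AE_I2) (simp add: order_trans[OF _ abs_ge_self])
  qed (use assms(1) in measurable)
qed

lemma sqi_const: "sqi (\<lambda>_. c)"
  unfolding sqi_def by simp

lemma sqi_add:
  fixes F G :: "'w \<Rightarrow> 'v::euclidean_space"
  assumes "sqi F" "sqi G"
  shows "sqi (\<lambda>\<omega>. F \<omega> + G \<omega>)"
proof (rule sqi_dominated)
  show "integrable M (\<lambda>\<omega>. 2 * (norm (F \<omega>))\<^sup>2 + 2 * (norm (G \<omega>))\<^sup>2)"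
    using assms[THEN sqiD(2)] by simp
  show "(norm (F \<omega> + G \<omega>))\<^sup>2 \<le> 2 * (norm (F \<omega>))\<^sup>2 + 2 * (norm (G \<omega>))\<^sup>2" for \<omega>
  proof -
    have "(norm (F \<omega> + G \<omega>))\<^sup>2 \<le> (norm (F \<omega>) + norm (G \<omega>))\<^sup>2"
      by (intro power_mono norm_triangle_ineq) simp
    also have "\<dots> \<le> 2 * (norm (F \<omega>))\<^sup>2 + 2 * (norm (G \<omega>))\<^sup>2"
      using power2_sum_le_weighted[of 1] by simp
    finally show ?thesis .
  qed
qed (use assms[THEN sqiD(1)] in measurable)

lemma sqi_lipschitz:
  fixes Z :: "'w \<Rightarrow> 'v::euclidean_space" and F :: "'v \<Rightarrow> 'u::euclidean_space"
  assumes Z: "sqi Z" and F: "\<And>u v. norm (F u - F v) \<le> K * norm (u - v)"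
  shows "sqi (\<lambda>\<omega>. F (Z \<omega>))"
proof -
  have "(max K 0)-lipschitz_on UNIV F"
  proof (rule lipschitz_onI)
    fix u v :: 'v
    have "K * norm (u - v) \<le> max K 0 * norm (u - v)" by (intro mult_right_mono) auto
    with F[of u v] show "dist (F u) (F v) \<le> max K 0 * dist u v" unfolding dist_norm by linarith
  qed simp
  then have [measurable]: "F \<in> borel_measurable borel"
    by (intro borel_measurable_continuous_onI lipschitz_on_continuous_on)
  have [measurable]: "Z \<in> borel_measurable M" by (rule sqiD(1)[OF Z])
  show ?thesis
  proof (rule sqi_dominated)
    show "integrable M (\<lambda>\<omega>. 2 * (norm (F 0))\<^sup>2 + 2 * K\<^sup>2 * (norm (Z \<omega>))\<^sup>2)"
      using sqiD(2)[OF Z] by simp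
    show "(norm (F (Z \<omega>)))\<^sup>2 \<le> 2 * (norm (F 0))\<^sup>2 + 2 * K\<^sup>2 * (norm (Z \<omega>))\<^sup>2" for \<omega>
    proof -
      have "norm (F (Z \<omega>)) \<le> norm (F 0) + K * norm (Z \<omega>)"
        using F[of "Z \<omega>" 0] norm_triangle_sub[of "F (Z \<omega>)" "F 0"] by simp
      then have "(norm (F (Z \<omega>)))\<^sup>2 \<le> (norm (F 0) + K * norm (Z \<omega>))\<^sup>2" by (rule power_mono) simp
      also have "\<dots> \<le> 2 * (norm (F 0))\<^sup>2 + 2 * (K * norm (Z \<omega>))\<^sup>2"
        using power2_sum_le_weighted[of 1] by simp
      finally show ?thesis by (simp add: power_mult_distrib)
    qed
  qed measurable
qed

lemma sqi_linear:
  fixes Z :: "'w \<Rightarrow> 'v::euclidean_space" and F :: "'v \<Rightarrow> 'u::euclidean_space"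
  assumes Z: "sqi Z" and F: "linear F"
  shows "sqi (\<lambda>\<omega>. F (Z \<omega>))"
proof -
  have bl: "bounded_linear F" using F linear_conv_bounded_linear by blast
  show ?thesis
    by (rule sqi_lipschitz[OF Z, of F "onorm F"])
      (metis bl onorm linear_diff[OF F])
qed

lemma sqi_scale: "sqi Z \<Longrightarrow> sqi (\<lambda>\<omega>. c *\<^sub>R Z \<omega>)" for Z :: "'w \<Rightarrow> 'v::euclidean_space"
  by (rule sqi_linear) (auto intro: linear_scale_self)

lemma sqi_diff: "sqi F \<Longrightarrow> sqi G \<Longrightarrow> sqi (\<lambda>\<omega>. F \<omega> - G \<omega>)" for F :: "'w \<Rightarrow> 'v::euclidean_space"
  using sqi_add[of F "\<lambda>\<omega>. (-1) *\<^sub>R G \<omega>"] sqi_scale[of G "-1"] by simp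

lemma sqi_row: "sqi Z \<Longrightarrow> sqi (\<lambda>\<omega>. Z \<omega> $ i)" for Z :: "'w \<Rightarrow> real^'d::finite^'m"
  by (rule sqi_linear) (auto intro: linearI)

lemma sqi_Pair: "sqi F \<Longrightarrow> sqi G \<Longrightarrow> sqi (\<lambda>\<omega>. (F \<omega>, G \<omega>))"
  for F :: "'w \<Rightarrow> 'v::euclidean_space" and G :: "'w \<Rightarrow> 'u::euclidean_space"
  unfolding sqi_def by (auto simp: norm_Pair)

lemma sqi_vec:
  fixes Z :: "'m \<Rightarrow> 'w \<Rightarrow> real^'d::finite"
  assumes "\<And>i. sqi (Z i)" shows "sqi (\<lambda>\<omega>. \<chi> i. Z i \<omega>)"
  unfolding sqi_def norm_matrix_rows using assms[THEN sqiD(1)] assms[THEN sqiD(2)]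
  by (auto intro!: borel_vec_lambda)

lemma linear_matrix_mult: "linear (\<lambda>Z :: real^'d::finite^'m. A ** Z)" for A :: "real^'m^'m"
  by (intro linearI) (simp_all add: matrix_add_ldistrib vec_eq_iff[of "A ** _"] matrix_mult_row scaleR_sum_right mult.commute)

lemma sqi_rows: "(\<And>i. sqi (\<lambda>\<omega>. d \<omega> i)) \<Longrightarrow> sqi (\<lambda>\<omega>. rows_x (d \<omega>))"
    "(\<And>i. sqi (\<lambda>\<omega>. d \<omega> i)) \<Longrightarrow> sqi (\<lambda>\<omega>. rows_y (d \<omega>))"
  for d :: "'w \<Rightarrow> 'm \<Rightarrow> (real^'a) \<times> (real^'b)"
  unfolding rows_x_def rows_y_def
  by (rule sqi_vec, rule sqi_linear, simp, simp add: linear_fst)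
    (rule sqi_vec, rule sqi_linear, simp, simp add: linear_snd)

lemma sqi_prox_rows:
  fixes Z :: "'w \<Rightarrow> real^'d::finite^'m"
  assumes r: "closed_convex_fun r" "r v < \<infinity>" and e: "e > 0" and Z: "sqi Z"
  shows "sqi (\<lambda>\<omega>. prox_rows (\<lambda>v. ereal e * r v) (Z \<omega>))"
  unfolding prox_rows_def
proof (rule sqi_vec)
  fix i
  show "sqi (\<lambda>\<omega>. prox (\<lambda>v. ereal e * r v) (Z \<omega> $ i))"
    by (rule sqi_lipschitz[OF sqi_row[OF Z], of _ 1]) (use prox_scaled_nonexpansive[OF r e] in simp)
qed

lemma sqi_gradient: "sqi Z \<Longrightarrow> sqi (\<lambda>\<omega>. gradient (f i) (Z \<omega>))"
  by (rule sqi_lipschitz[where F = "gradient (f i)", OF _ smooth_fun_gradient_lipschitz[OF smooth]])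

text \<open>Written as a function of the sample array, so that it can be evaluated at a history as
  well as at all samples; likewise \<open>er\<close>.\<close>

definition "zz t i s = (it_X (run s t) $ i, it_Y (run s t) $ i)"
definition "er t i s = it_d (run s t) i - gradient (f i) (zz t i s)"

lemma zz_hist: "{k. fst k < t} \<subseteq> K \<Longrightarrow> zz t i (hist K \<omega>) = zz t i (smp \<omega>)"
  unfolding zz_def using run_XY_hist by simp

lemma zz_measurable:
  assumes "{k. fst k < t} \<subseteq> K"
  shows "zz t i \<in> borel_measurable (PiM K Lw)"
  unfolding zz_def[abs_def]
  by (intro borel_measurable_Pair borel_row run_XY_measurable[OF assms])

lemma sgrad_facts:
  "integrable (law p i) (sgrad p i z)"
  "(\<integral>\<xi>. sgrad p i z \<xi> \<partial>law p i) = gradient (f i) z"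
  "integrable (law p i) (\<lambda>\<xi>. (norm (sgrad p i z \<xi> - gradient (f i) z))\<^sup>2)"
  "(\<integral>\<xi>. (norm (sgrad p i z \<xi> - gradient (f i) z))\<^sup>2 \<partial>law p i) \<le> \<sigma>\<^sup>2"
  "integrable (law p i) (\<lambda>\<xi>. (norm (sgrad p i z \<xi> - sgrad p i z' \<xi>))\<^sup>2)"
  "(\<integral>\<xi>. (norm (sgrad p i z \<xi> - sgrad p i z' \<xi>))\<^sup>2 \<partial>law p i) \<le> L\<^sup>2 * (norm (z - z'))\<^sup>2"
proof -
  note a = ss[unfolded stochastic_smooth_def]
  show "integrable (law p i) (sgrad p i z)"
    "(\<integral>\<xi>. sgrad p i z \<xi> \<partial>law p i) = gradient (f i) z"
    "integrable (law p i) (\<lambda>\<xi>. (norm (sgrad p i z \<xi> - gradient (f i) z))\<^sup>2)"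
    "(\<integral>\<xi>. (norm (sgrad p i z \<xi> - gradient (f i) z))\<^sup>2 \<partial>law p i) \<le> \<sigma>\<^sup>2"
    using a by blast+
  obtain x y x' y' where z: "z = (x, y)" "z' = (x', y')" by (cases z; cases z') auto
  have e: "integrable (law p i) (\<lambda>\<xi>. (norm (sgrad p i (x, y) \<xi> - sgrad p i (x', y') \<xi>))\<^sup>2) \<and>
      (\<integral>\<xi>. (norm (sgrad p i (x, y) \<xi> - sgrad p i (x', y') \<xi>))\<^sup>2 \<partial>law p i)
        \<le> L\<^sup>2 * ((norm (x - x'))\<^sup>2 + (norm (y - y'))\<^sup>2)"
    using a by blast
  have "(norm (z - z'))\<^sup>2 = (norm (x - x'))\<^sup>2 + (norm (y - y'))\<^sup>2" unfolding z by (simp add: norm_Pair)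
  then show "integrable (law p i) (\<lambda>\<xi>. (norm (sgrad p i z \<xi> - sgrad p i z' \<xi>))\<^sup>2)"
    "(\<integral>\<xi>. (norm (sgrad p i z \<xi> - sgrad p i z' \<xi>))\<^sup>2 \<partial>law p i) \<le> L\<^sup>2 * (norm (z - z'))\<^sup>2"
    using e unfolding z by simp_all
qed

lemma d_checkpoint:
  assumes "q dvd t"
  shows "it_d (run s t) i = batch_grad p i (it_X (run s t)) (it_Y (run s t)) (Bf s t i)"
proof (cases t)
  case 0 then show ?thesis by (simp add: Let_def)
next
  case (Suc u) then show ?thesis using assms run_Suc(5)[of s u i] by (simp only: if_P)
qed

text \<open>Either the checkpoint gradient is exact, or the error is an average of \<open>n\<close>
  centered samples at a point fixed by the past, so the variance is divided by \<open>n\<close>; the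
  batch estimate is used with \<open>u\<close> equal to 0.\<close>

lemma er_checkpoint:
  assumes t: "q dvd t"
  shows "integrable M (\<lambda>\<omega>. (norm (er t i (smp \<omega>)))\<^sup>2) \<and> (\<integral>\<omega>. (norm (er t i (smp \<omega>)))\<^sup>2 \<partial>M) \<le> \<nu>"
  using Bf_checkpoint[OF t]
proof (elim disjE exE conjE)
  assume "\<forall>s i X Y. batch_grad p i X Y (Bf s t i) = gradient (f i) (X $ i, Y $ i)"
  then have "er t i s = 0" for s unfolding er_def d_checkpoint[OF t] zz_def by simp
  then show ?thesis using nu_nonneg by simp
next
  fix n :: nat
  assume n: "0 < n" "\<sigma>\<^sup>2 / real n \<le> \<nu>" and B: "\<forall>s i. Bf s t i = map (\<lambda>j. s (t, i, j)) [0..<n]"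
  define K :: "(nat \<times> 'm \<times> nat) set" where "K = {k. fst k < t}"
  have K: "{k. fst k < t} \<subseteq> K" unfolding K_def by simp
  let ?\<phi> = "\<lambda>z. sgrad p i (zz t i (fst z)) (snd z) - gradient (f i) (zz t i (fst z))"
  have zm [measurable]: "zz t i \<in> borel_measurable (PiM K Lw)" by (rule zz_measurable[OF K])
  have "?\<phi> \<in> borel_measurable (PiM K Lw \<Otimes>\<^sub>M law p i)"
    by (intro borel_measurable_diff borel_sgrad borel_gradient measurable_compose[OF measurable_fst zm] measurable_snd)
  note \<phi>m = this
  have mean: "integrable (law p i) (\<lambda>\<xi>. ?\<phi> (s, \<xi>)) \<and> (\<integral>\<xi>. ?\<phi> (s, \<xi>) \<partial>law p i) = 0"
    and var: "integrable (law p i) (\<lambda>\<xi>. (norm (?\<phi> (s, \<xi>)))\<^sup>2) \<and> (\<integral>\<xi>. (norm (?\<phi> (s, \<xi>)))\<^sup>2 \<partial>law p i) \<le> \<sigma>\<^sup>2" for s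
  proof -
    interpret Q: prob_space "law p i" using Lw_prob[of "(0, i, 0)"] by simp
    show "integrable (law p i) (\<lambda>\<xi>. ?\<phi> (s, \<xi>)) \<and> (\<integral>\<xi>. ?\<phi> (s, \<xi>) \<partial>law p i) = 0"
      using sgrad_facts(1,2) Q.prob_space by simp
    show "integrable (law p i) (\<lambda>\<xi>. (norm (?\<phi> (s, \<xi>)))\<^sup>2) \<and> (\<integral>\<xi>. (norm (?\<phi> (s, \<xi>)))\<^sup>2 \<partial>law p i) \<le> \<sigma>\<^sup>2"
      using sgrad_facts(3,4) by simp
  qed
  have *: "integrable M (\<lambda>\<omega>. (norm (0 + (1 / real n) *\<^sub>R (\<Sum>j<n. ?\<phi> (hist K \<omega>, S (t, i, j) \<omega>))))\<^sup>2)
    \<and> (\<integral>\<omega>. (norm (0 + (1 / real n) *\<^sub>R (\<Sum>j<n. ?\<phi> (hist K \<omega>, S (t, i, j) \<omega>))))\<^sup>2 \<partial>M)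
      \<le> (\<integral>\<omega>. (norm (0 :: (real^'a) \<times> (real^'b)))\<^sup>2 \<partial>M) + real n * (1 / real n)\<^sup>2 * (\<integral>\<omega>. \<sigma>\<^sup>2 \<partial>M)"
    by (rule second_moment_batch[where \<iota> = "\<lambda>j. (t, i, j)" and Q = "law p i" and u = "\<lambda>_. 0"
          and \<phi> = ?\<phi> and w = "\<lambda>_. \<sigma>\<^sup>2"])
      (use \<phi>m mean var in \<open>auto simp: K_def inj_on_def\<close>)
  have "0 + (1 / real n) *\<^sub>R (\<Sum>j<n. ?\<phi> (hist K \<omega>, S (t, i, j) \<omega>)) = er t i (smp \<omega>)" for \<omega>
  proof -
    have "(\<Sum>j<n. ?\<phi> (hist K \<omega>, S (t, i, j) \<omega>))
        = (\<Sum>j<n. sgrad p i (zz t i (smp \<omega>)) (S (t, i, j) \<omega>)) - real n *\<^sub>R gradient (f i) (zz t i (smp \<omega>))"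
      by (simp add: zz_hist[OF K] sum_subtractf sum_constant_scaleR del: sum_constant)
    then show ?thesis
      unfolding er_def d_checkpoint[OF t] using n B
      by (simp add: batch_grad_map zz_def scaleR_right_diff_distrib)
  qed
  moreover have "real n * (1 / real n)\<^sup>2 * (\<integral>\<omega>. \<sigma>\<^sup>2 \<partial>M) = \<sigma>\<^sup>2 / real n"
    using n by (simp add: prob_space power2_eq_square)
  ultimately show ?thesis using * n by simp
qed

text \<open>The new error is the old one plus an average of \<open>q\<close> centered gradient
  differences at points fixed by the past. Centering does not increase second moments, so the
  mean-square Lipschitz condition applies, and averaging divides the variance by
  \<open>q\<close>.\<close>

lemma er_step:
  assumes t: "\<not> q dvd Suc t"
    and er: "integrable M (\<lambda>\<omega>. (norm (er t i (smp \<omega>)))\<^sup>2)"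
    and dz: "integrable M (\<lambda>\<omega>. (norm (zz (Suc t) i (smp \<omega>) - zz t i (smp \<omega>)))\<^sup>2)"
  shows "integrable M (\<lambda>\<omega>. (norm (er (Suc t) i (smp \<omega>)))\<^sup>2)
    \<and> (\<integral>\<omega>. (norm (er (Suc t) i (smp \<omega>)))\<^sup>2 \<partial>M) \<le> (\<integral>\<omega>. (norm (er t i (smp \<omega>)))\<^sup>2 \<partial>M)
      + L\<^sup>2 / real q * (\<integral>\<omega>. (norm (zz (Suc t) i (smp \<omega>) - zz t i (smp \<omega>)))\<^sup>2 \<partial>M)"
proof -
  \<comment> \<open>The history contains the samples of time \<open>t\<close>, on which the old
    error depends, but none of time \<open>Suc t\<close>.\<close>
  define K :: "(nat \<times> 'm \<times> nat) set" where "K = {k. fst k < Suc t}"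
  have K: "{k. fst k < Suc t} \<subseteq> K" "{k. fst k < t} \<subseteq> K" "{k. fst k \<le> t} \<subseteq> K" unfolding K_def by auto
  let ?z' = "zz (Suc t) i" and ?z = "zz t i" and ?G = "\<lambda>z. gradient (f i) z"
  let ?\<phi> = "\<lambda>z. (sgrad p i (?z' (fst z)) (snd z) - sgrad p i (?z (fst z)) (snd z)) - (?G (?z' (fst z)) - ?G (?z (fst z)))"
  let ?w = "\<lambda>s. L\<^sup>2 * (norm (?z' s - ?z s))\<^sup>2"
  have zm [measurable]: "?z \<in> borel_measurable (PiM K Lw)" "?z' \<in> borel_measurable (PiM K Lw)"
    using zz_measurable K by auto
  have dm: "(\<lambda>s. it_d (run s t) i) \<in> borel_measurable (PiM K Lw)"
    using run_measurable[OF K(3)] by blast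
  have um: "er t i \<in> borel_measurable (PiM K Lw)"
    unfolding er_def[abs_def] by (intro borel_measurable_diff dm borel_gradient zm)
  have \<phi>m: "?\<phi> \<in> borel_measurable (PiM K Lw \<Otimes>\<^sub>M law p i)"
    by (intro borel_measurable_diff borel_sgrad borel_gradient measurable_compose[OF measurable_fst zm(1)]
        measurable_compose[OF measurable_fst zm(2)] measurable_snd)
  have wm: "?w \<in> borel_measurable (PiM K Lw)" by measurable
  have er_hist: "er t i (hist K \<omega>) = er t i (smp \<omega>)" for \<omega>
    unfolding er_def run_hist[OF K(3)] zz_hist[OF K(2)] ..
  have mean: "integrable (law p i) (\<lambda>\<xi>. ?\<phi> (s, \<xi>)) \<and> (\<integral>\<xi>. ?\<phi> (s, \<xi>) \<partial>law p i) = 0"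
    and var: "integrable (law p i) (\<lambda>\<xi>. (norm (?\<phi> (s, \<xi>)))\<^sup>2) \<and> (\<integral>\<xi>. (norm (?\<phi> (s, \<xi>)))\<^sup>2 \<partial>law p i) \<le> ?w s" for s
  proof -
    interpret Q: prob_space "law p i" using Lw_prob[of "(0, i, 0)"] by simp
    let ?Z = "\<lambda>\<xi>. sgrad p i (?z' s) \<xi> - sgrad p i (?z s) \<xi>"
    have Z: "integrable (law p i) ?Z" and EZ: "(\<integral>\<xi>. ?Z \<xi> \<partial>law p i) = ?G (?z' s) - ?G (?z s)"
      using sgrad_facts(1,2) by simp_all
    then show "integrable (law p i) (\<lambda>\<xi>. ?\<phi> (s, \<xi>)) \<and> (\<integral>\<xi>. ?\<phi> (s, \<xi>) \<partial>law p i) = 0"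
      using Q.prob_space by simp
    show "integrable (law p i) (\<lambda>\<xi>. (norm (?\<phi> (s, \<xi>)))\<^sup>2) \<and> (\<integral>\<xi>. (norm (?\<phi> (s, \<xi>)))\<^sup>2 \<partial>law p i) \<le> ?w s"
      using Q.second_moment_centered[OF Z sgrad_facts(5) EZ] sgrad_facts(6)[of i "?z' s" "?z s"] by simp
  qed
  have "integrable M (\<lambda>\<omega>. (norm (er t i (hist K \<omega>) + (1 / real q) *\<^sub>R (\<Sum>j<q. ?\<phi> (hist K \<omega>, S (Suc t, i, j) \<omega>))))\<^sup>2)
    \<and> (\<integral>\<omega>. (norm (er t i (hist K \<omega>) + (1 / real q) *\<^sub>R (\<Sum>j<q. ?\<phi> (hist K \<omega>, S (Suc t, i, j) \<omega>))))\<^sup>2 \<partial>M)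
      \<le> (\<integral>\<omega>. (norm (er t i (hist K \<omega>)))\<^sup>2 \<partial>M) + real q * (1 / real q)\<^sup>2 * (\<integral>\<omega>. ?w (hist K \<omega>) \<partial>M)"
  proof (rule second_moment_batch[where \<iota> = "\<lambda>j. (Suc t, i, j)" and Q = "law p i" and u = "er t i" and \<phi> = ?\<phi> and w = ?w])
    show "integrable M (\<lambda>\<omega>. ?w (hist K \<omega>))"
      unfolding zz_hist[OF K(1)] zz_hist[OF K(2)] using dz by simp
    show "integrable M (\<lambda>\<omega>. (norm (er t i (hist K \<omega>)))\<^sup>2)" unfolding er_hist by (rule er)
  qed (use um \<phi>m wm mean var in \<open>auto simp: K_def inj_on_def\<close>)
  moreover have "er t i (hist K \<omega>) + (1 / real q) *\<^sub>R (\<Sum>j<q. ?\<phi> (hist K \<omega>, S (Suc t, i, j) \<omega>)) = er (Suc t) i (smp \<omega>)" for \<omega>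
  proof -
    have sumeq: "(\<Sum>j<q. ?\<phi> (hist K \<omega>, S (Suc t, i, j) \<omega>))
        = (\<Sum>j<q. sgrad p i (?z' (smp \<omega>)) (S (Suc t, i, j) \<omega>)) - (\<Sum>j<q. sgrad p i (?z (smp \<omega>)) (S (Suc t, i, j) \<omega>))
          - real q *\<^sub>R (?G (?z' (smp \<omega>)) - ?G (?z (smp \<omega>)))"
      by (simp add: zz_hist[OF K(1)] zz_hist[OF K(2)] sum_subtractf sum_constant_scaleR
          scaleR_right_diff_distrib del: sum_constant)
    show ?thesis
      unfolding er_hist sumeq unfolding er_def run_Suc(5) if_not_P[OF t] Bf_fresh[OF t] batch_grad_map zz_def[symmetric] using q_pos
      by (simp add: scaleR_right_diff_distrib algebra_simps)
  qed
  moreover have "real q * (1 / real q)\<^sup>2 * (\<integral>\<omega>. ?w (hist K \<omega>) \<partial>M)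
      = L\<^sup>2 / real q * (\<integral>\<omega>. (norm (?z' (smp \<omega>) - ?z (smp \<omega>)))\<^sup>2 \<partial>M)"
    unfolding zz_hist[OF K(1)] zz_hist[OF K(2)] using q_pos by (simp add: power2_eq_square)
  ultimately show ?thesis unfolding er_hist by simp
qed

lemma smp_measurable:
  assumes "F \<in> borel_measurable (PiM UNIV Lw)"
  shows "(\<lambda>\<omega>. F (smp \<omega>)) \<in> borel_measurable M"
  using measurable_compose[OF hist_measurable[of UNIV] assms] by (simp add: hist_def restrict_def)

text \<open>Single sampled gradients need not be Lipschitz in the point, so square integrability of
  \<open>it_d\<close> is obtained through the error \<open>er\<close>, which the batch estimates
  bound, and the exact gradient, which is Lipschitz. The components are treated in one induction
  because each update uses the others.\<close>

lemma run_sqi: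
  "sqi (\<lambda>\<omega>. it_X (run (smp \<omega>) t)) \<and> sqi (\<lambda>\<omega>. it_Y (run (smp \<omega>) t)) \<and> sqi (\<lambda>\<omega>. it_Lam (run (smp \<omega>) t))
    \<and> sqi (\<lambda>\<omega>. it_Vx (run (smp \<omega>) t)) \<and> (\<forall>i. sqi (\<lambda>\<omega>. it_d (run (smp \<omega>) t) i))"
proof -
  have dsqi: "sqi (\<lambda>\<omega>. it_d (run (smp \<omega>) t) i)"
    if XY: "sqi (\<lambda>\<omega>. it_X (run (smp \<omega>) t))" "sqi (\<lambda>\<omega>. it_Y (run (smp \<omega>) t))"
      and er: "integrable M (\<lambda>\<omega>. (norm (er t i (smp \<omega>)))\<^sup>2)" for t i
  proof -
    have zz: "sqi (\<lambda>\<omega>. zz t i (smp \<omega>))" unfolding zz_def by (intro sqi_Pair sqi_row XY)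
    have "(\<lambda>s. it_d (run s t) i) \<in> borel_measurable (PiM UNIV Lw)" using run_measurable[of t UNIV] by blast
    then have "(\<lambda>\<omega>. it_d (run (smp \<omega>) t) i) \<in> borel_measurable M" by (rule smp_measurable)
    then have "(\<lambda>\<omega>. er t i (smp \<omega>)) \<in> borel_measurable M"
      unfolding er_def by (intro borel_measurable_diff sqiD(1)[OF sqi_gradient[OF zz]])
    then have "sqi (\<lambda>\<omega>. er t i (smp \<omega>))" using er unfolding sqi_def by blast
    from sqi_add[OF this sqi_gradient[OF zz, of i]] show ?thesis by (simp add: er_def)
  qed
  show ?thesis
  proof (induction t)
    case 0
    have XY: "sqi (\<lambda>\<omega>. it_X (run (smp \<omega>) 0))" "sqi (\<lambda>\<omega>. it_Y (run (smp \<omega>) 0))" "sqi (\<lambda>\<omega>. it_Lam (run (smp \<omega>) 0))"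
      by (simp_all add: Let_def sqi_const)
    have d: "sqi (\<lambda>\<omega>. it_d (run (smp \<omega>) 0) i)" for i
      by (rule dsqi[OF XY(1,2)]) (use er_checkpoint[of 0 i] in blast)+
    have "it_Vx (run s 0) = rows_x (it_d (run s 0))" for s by (simp add: Let_def)
    then show ?case using XY d sqi_rows(1)[of "\<lambda>\<omega>. it_d (run (smp \<omega>) 0)", OF d] by simp
  next
    case (Suc t)
    then have X: "sqi (\<lambda>\<omega>. it_X (run (smp \<omega>) t))" and Y: "sqi (\<lambda>\<omega>. it_Y (run (smp \<omega>) t))"
      and Lm: "sqi (\<lambda>\<omega>. it_Lam (run (smp \<omega>) t))" and V: "sqi (\<lambda>\<omega>. it_Vx (run (smp \<omega>) t))"
      and d: "\<And>i. sqi (\<lambda>\<omega>. it_d (run (smp \<omega>) t) i)" by blast+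
    have ey: "0 < eta_y p" using L_pos unfolding eta_y_def by simp
    have X': "sqi (\<lambda>\<omega>. it_X (run (smp \<omega>) (Suc t)))"
      unfolding run_Suc by (intro sqi_prox_rows[OF g_ccf x0 eta_pos(1)] sqi_diff sqi_scale sqi_linear[OF X] linear_matrix_mult V)
    have Y': "sqi (\<lambda>\<omega>. it_Y (run (smp \<omega>) (Suc t)))"
      unfolding run_Suc by (intro sqi_prox_rows[OF h_ccf y0 ey] sqi_add sqi_diff sqi_scale sqi_rows(2) sqi_linear[OF Lm] linear_matrix_mult Y d)
    have L': "sqi (\<lambda>\<omega>. it_Lam (run (smp \<omega>) (Suc t)))"
      unfolding run_Suc by (intro sqi_add sqi_scale sqi_linear[OF Y] linear_matrix_mult Lm)
    have z: "sqi (\<lambda>\<omega>. zz t i (smp \<omega>))" and z': "sqi (\<lambda>\<omega>. zz (Suc t) i (smp \<omega>))" for i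
      unfolding zz_def by (intro sqi_Pair sqi_row X Y X' Y')+
    have er: "integrable M (\<lambda>\<omega>. (norm (er t i (smp \<omega>)))\<^sup>2)" for i
      unfolding er_def by (intro sqiD(2) sqi_diff d sqi_gradient z)
    have dz: "integrable M (\<lambda>\<omega>. (norm (zz (Suc t) i (smp \<omega>) - zz t i (smp \<omega>)))\<^sup>2)" for i
      by (intro sqiD(2) sqi_diff z z')
    have er': "integrable M (\<lambda>\<omega>. (norm (er (Suc t) i (smp \<omega>)))\<^sup>2)" for i
      using er_checkpoint[of "Suc t" i] er_step[OF _ er dz, of i] by blast
    have d': "sqi (\<lambda>\<omega>. it_d (run (smp \<omega>) (Suc t)) i)" for i
      by (rule dsqi[OF X' Y' er'])
    have V': "sqi (\<lambda>\<omega>. it_Vx (run (smp \<omega>) (Suc t)))"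
      unfolding run_Suc(4) by (rule sqi_linear[OF _ linear_matrix_mult]) (intro sqi_diff sqi_add V sqi_rows(1) d d')
    show ?case using X' Y' L' d' V' by blast
  qed
qed

end

section \<open>Expectations and the random output index\<close>

text \<open>Independence is used one index at a time: the integrand is almost surely a finite sum of
  indicators of \<open>\<tau> = t\<close> times functions of \<open>Z\<close>, and the expectation
  of each product factorizes.\<close>

lemma (in prob_space) random_index_integral:
  fixes g :: "nat \<Rightarrow> 'z \<Rightarrow> real"
  assumes \<tau> [measurable]: "\<tau> \<in> measurable M (count_space UNIV)"
    and \<tau>_distr: "distr M (count_space UNIV) \<tau> = measure_pmf (pmf_of_set {..<T})"
    and T: "0 < T"
    and Z [measurable]: "Z \<in> measurable M N"
    and ind: "indep_set (sets (vimage_algebra (space M) \<tau> (count_space UNIV)))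
        (sets (vimage_algebra (space M) Z N))"
    and g [measurable]: "\<And>t. g t \<in> borel_measurable N"
    and int: "\<And>t. integrable M (\<lambda>\<omega>. g t (Z \<omega>))"
  shows "integrable M (\<lambda>\<omega>. g (\<tau> \<omega>) (Z \<omega>))"
    and "(\<integral>\<omega>. g (\<tau> \<omega>) (Z \<omega>) \<partial>M) = (\<Sum>t<T. \<integral>\<omega>. g t (Z \<omega>) \<partial>M) / real T"
proof -
  let ?I = "\<lambda>t \<omega>. indicator {t} (\<tau> \<omega>) :: real"
  have fin: "finite {..<T}" "{..<T} \<noteq> {}" using T by auto
  have meas_\<tau>: "prob (\<tau> -` A \<inter> space M) = measure_pmf.prob (pmf_of_set {..<T}) A" for A
    using measure_distr[OF \<tau>, of A] unfolding \<tau>_distr by simp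
  have prob_t: "(\<integral>\<omega>. ?I t \<omega> \<partial>M) = 1 / real T" if "t < T" for t
  proof -
    have "(\<integral>\<omega>. ?I t \<omega> \<partial>M) = (\<integral>\<omega>. indicator (\<tau> -` {t} \<inter> space M) \<omega> \<partial>M)"
      by (intro Bochner_Integration.integral_cong) (auto simp: indicator_def)
    also have "\<dots> = prob (\<tau> -` {t} \<inter> space M)" by simp
    also have "\<dots> = 1 / real T"
      unfolding meas_\<tau> using that fin by (simp add: measure_pmf_of_set)
    finally show ?thesis .
  qed
  \<comment> \<open>\<open>\<tau>\<close> may leave the range of indices on a null set, so the
    decomposition is only almost sure.\<close>
  have ae: "AE \<omega> in M. \<tau> \<omega> < T"
  proof -
    have "prob (\<tau> -` {..<T} \<inter> space M) = 1"
      unfolding meas_\<tau> using fin T by (simp add: measure_pmf_of_set)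
    then have "AE \<omega> in M. \<omega> \<in> \<tau> -` {..<T} \<inter> space M"
      by (subst (asm) prob_eq_1) auto
    then show ?thesis by auto
  qed
  \<comment> \<open>A function of \<open>\<tau>\<close> and a function of \<open>Z\<close> generate
    smaller sigma-algebras than \<open>\<tau>\<close> and \<open>Z\<close>, so independence is
    inherited.\<close>
  have iv: "indep_var borel (?I t) borel (\<lambda>\<omega>. g t (Z \<omega>))" for t
    unfolding indep_var_eq
  proof (intro conjI)
    have sub1: "sigma_sets (space M) {?I t -` A \<inter> space M |A. A \<in> sets borel}
        \<subseteq> sets (vimage_algebra (space M) \<tau> (count_space UNIV))"
    proof -
      have "{?I t -` A \<inter> space M |A. A \<in> sets borel} \<subseteq> sets (vimage_algebra (space M) \<tau> (count_space UNIV))"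
      proof safe
        fix A :: "real set"
        have "?I t -` A \<inter> space M = \<tau> -` ((\<lambda>n. indicator {t} n :: real) -` A) \<inter> space M" by auto
        also have "\<dots> \<in> sets (vimage_algebra (space M) \<tau> (count_space UNIV))"
          by (rule in_vimage_algebra) simp
        finally show "?I t -` A \<inter> space M \<in> sets (vimage_algebra (space M) \<tau> (count_space UNIV))" .
      qed
      from sets.sigma_sets_subset[OF this] show ?thesis by simp
    qed
    have sub2: "sigma_sets (space M) {(\<lambda>\<omega>. g t (Z \<omega>)) -` A \<inter> space M |A. A \<in> sets borel}
        \<subseteq> sets (vimage_algebra (space M) Z N)"
    proof -
      have "{(\<lambda>\<omega>. g t (Z \<omega>)) -` A \<inter> space M |A. A \<in> sets borel} \<subseteq> sets (vimage_algebra (space M) Z N)"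
      proof safe
        fix A :: "real set" assume A: "A \<in> sets borel"
        have "(\<lambda>\<omega>. g t (Z \<omega>)) -` A \<inter> space M = Z -` (g t -` A \<inter> space N) \<inter> space M"
          using measurable_space[OF Z] by auto
        also have "\<dots> \<in> sets (vimage_algebra (space M) Z N)"
          by (rule in_vimage_algebra) (rule measurable_sets[OF g A])
        finally show "(\<lambda>\<omega>. g t (Z \<omega>)) -` A \<inter> space M \<in> sets (vimage_algebra (space M) Z N)" .
      qed
      from sets.sigma_sets_subset[OF this] show ?thesis by simp
    qed
    show "indep_set (sigma_sets (space M) {?I t -` A \<inter> space M |A. A \<in> sets borel})
       (sigma_sets (space M) {(\<lambda>\<omega>. g t (Z \<omega>)) -` A \<inter> space M |A. A \<in> sets borel})"
      using ind sub1 sub2 unfolding indep_sets2_eq by blast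
    show "?I t \<in> borel_measurable M"
      by (rule measurable_compose[OF \<tau>]) simp
    show "(\<lambda>\<omega>. g t (Z \<omega>)) \<in> borel_measurable M"
      by (rule measurable_compose[OF Z g])
  qed
  have intI: "integrable M (?I t)" for t
  proof (rule integrable_const_bound[of _ 1])
    show "?I t \<in> borel_measurable M" by (rule measurable_compose[OF \<tau>]) simp
  qed (auto simp: indicator_def)
  have prod: "integrable M (\<lambda>\<omega>. ?I t \<omega> * g t (Z \<omega>))"
      "(\<integral>\<omega>. ?I t \<omega> * g t (Z \<omega>) \<partial>M) = (\<integral>\<omega>. ?I t \<omega> \<partial>M) * (\<integral>\<omega>. g t (Z \<omega>) \<partial>M)" for t
    using indep_var_integrable[OF iv intI int, of t] indep_var_lebesgue_integral[OF iv intI int, of t] by auto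
  have eq: "AE \<omega> in M. g (\<tau> \<omega>) (Z \<omega>) = (\<Sum>t<T. ?I t \<omega> * g t (Z \<omega>))"
    using ae
  proof (eventually_elim)
    case (elim \<omega>)
    have "(\<Sum>t<T. ?I t \<omega> * g t (Z \<omega>)) = (\<Sum>t<T. if t = \<tau> \<omega> then g t (Z \<omega>) else 0)"
      by (intro sum.cong) (auto simp: indicator_def)
    then show ?case using elim by simp
  qed
  have meas: "(\<lambda>\<omega>. g (\<tau> \<omega>) (Z \<omega>)) \<in> borel_measurable M"
    by (rule measurable_compose_countable[OF measurable_compose[OF Z g] \<tau>])
  have ints: "integrable M (\<lambda>\<omega>. \<Sum>t<T. ?I t \<omega> * g t (Z \<omega>))"
    by (intro Bochner_Integration.integrable_sum prod)
  show "integrable M (\<lambda>\<omega>. g (\<tau> \<omega>) (Z \<omega>))"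
    using ints integrable_cong_AE[OF meas borel_measurable_integrable[OF ints] eq] by simp
  have "(\<integral>\<omega>. g (\<tau> \<omega>) (Z \<omega>) \<partial>M) = (\<integral>\<omega>. (\<Sum>t<T. ?I t \<omega> * g t (Z \<omega>)) \<partial>M)"
    by (rule integral_cong_AE[OF meas borel_measurable_integrable[OF ints] eq])
  also have "\<dots> = (\<Sum>t<T. \<integral>\<omega>. ?I t \<omega> * g t (Z \<omega>) \<partial>M)"
    by (intro Bochner_Integration.integral_sum prod)
  also have "\<dots> = (\<Sum>t<T. \<integral>\<omega>. g t (Z \<omega>) \<partial>M) / real T"
    unfolding prod(2) sum_divide_distrib by (intro sum.cong) (auto simp: prob_t)
  finally show "(\<integral>\<omega>. g (\<tau> \<omega>) (Z \<omega>) \<partial>M) = (\<Sum>t<T. \<integral>\<omega>. g t (Z \<omega>) \<partial>M) / real T" .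
qed

section \<open>Pathwise inequalities in expectation\<close>

context vrlm_run
begin

text \<open>This and the following are the pathwise quantities as functions of the sample array
  \<open>s\<close> rather than of \<omega>: the random index argument needs measurability on the
  product space.\<close>

definition "qA t s = avg (\<lambda>i. (norm (it_X (run s (Suc t)) $ i - it_X (run s t) $ i))\<^sup>2)"
definition "qB t s = (norm (it_Lam (run s (Suc t)) - it_Lam (run s t)))\<^sup>2"
definition "qY t s = avg (\<lambda>i. (norm (it_Y (run s (Suc t)) $ i - it_Y (run s t) $ i))\<^sup>2)"
definition "qE t s = avg (\<lambda>i. (norm (er t i s))\<^sup>2)"
definition "qD t s = avg (\<lambda>i. (norm (ys i (it_X (run s t) $ i) (cvec (it_Lam (run s t)) i) - it_Y (run s t) $ i))\<^sup>2)"
definition "qP t s = avg (\<lambda>i. (norm (it_X (run s t) $ i - row_mean (it_X (run s t))))\<^sup>2)"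
definition "qV t s = avg (\<lambda>i. (norm (it_Vx (run s t) $ i - row_mean (it_Vx (run s t))))\<^sup>2)"
definition "qG t s = (norm (prox_gradient_map p \<eta> (row_mean (it_X (run s t))) (it_Lam (run s t))))\<^sup>2"
definition "qH t s = (norm (gradient (\<lambda>\<Lambda>. Pmax p (row_mean (it_X (run s t))) \<Lambda>) (it_Lam (run s t))))\<^sup>2"

lemmas qdefs = qA_def qB_def qY_def qE_def qD_def qP_def qV_def

lemma q_nonneg: "0 \<le> qA t s" "0 \<le> qB t s" "0 \<le> qY t s" "0 \<le> qE t s" "0 \<le> qD t s" "0 \<le> qP t s" "0 \<le> qV t s"
  unfolding qdefs by (auto intro!: avg_nonneg)

lemma path_facts:
  "qD (Suc t) s \<le> (1 - 1 / (4 * \<kappa>)) * qD t s + (\<kappa> / 2 * (qE t s / L\<^sup>2) + 18 * \<kappa> ^ 3 * (qA t s + qB t s))"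
  "qD 0 s \<le> 2 * \<kappa> / L * primal_gap p (all_rows x\<^sub>0) 0 (all_rows y\<^sub>0)"
  "(\<Sum>t<T. 3 * L * qY t s) \<le> primal_gap p (all_rows x\<^sub>0) 0 (all_rows y\<^sub>0) + (\<Sum>t<T. qE t s / (2 * L)
       + L * (qD (Suc t) s / (12 * \<kappa>\<^sup>2) + 6 * \<kappa>\<^sup>2 * (qA t s + qB t s)))"
  "qP (Suc t) s \<le> rho p * qP t s + \<eta>\<^sup>2 / r\<^sub>1 * qV t s"
  "qP 0 s = 0"
  "qV (Suc t) s \<le> rho p * qV t s + (3 * (qE (Suc t) s + qE t s) + 6 * L\<^sup>2 * (qA t s + qY t s)) / r\<^sub>1"
  "(\<Sum>t<T. 1 / (3 * \<eta>) * qA t s + 3 / (4 * \<eta>\<^sub>\<Lambda>) * qB t s) \<le> (Pmax p x\<^sub>0 0 + gr x\<^sub>0 - \<phi>lb)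
       + (\<Sum>t<T. (4 * \<eta> + \<eta>\<^sub>\<Lambda>) * L\<^sup>2 * (2 * qD t s + 6 * \<kappa>\<^sup>2 * (qA t s + 2 * qP t s + qB t s))
         + 4 * \<eta> * qE t s + 4 * \<eta> * qV t s + (4 / \<eta> + 8 * \<eta> * L\<^sup>2) * qP t s)"
  "qG t s \<le> 5 / \<eta>\<^sup>2 * (2 * qP t s + qA t s) + 5 * qV t s + 15 * qE t s
      + 60 * L\<^sup>2 * \<kappa>\<^sup>2 * qP t s + 30 * L\<^sup>2 * qD t s"
  "qH t s \<le> 2 / \<eta>\<^sub>\<Lambda>\<^sup>2 * qB t s + 4 * L\<^sup>2 * (qD t s + \<kappa>\<^sup>2 * qP t s)"
  "0 \<le> primal_gap p (all_rows x\<^sub>0) 0 (all_rows y\<^sub>0)"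
  "0 \<le> Pmax p x\<^sub>0 0 + gr x\<^sub>0 - \<phi>lb"
proof -
  interpret P: vrlm_path p \<phi>lb \<sigma> x\<^sub>0 y\<^sub>0 "\<lambda>t. it_X (run s t)" "\<lambda>t. it_Lam (run s t)" "\<lambda>t. it_Y (run s t)"
     "\<lambda>t. it_d (run s t)" "\<lambda>t. it_Vx (run s t)"
    by (rule run_path)
  have eqs: "qA t s = P.stepX t" "qB t s = P.stepL t" "qY t s = P.stepY t"
    "qE t s = P.err t" "qD t s = P.dualD t" "qP t s = P.consX t" "qV t s = P.consV t" for t
    unfolding qdefs er_def zz_def P.stepX_def P.stepL_def P.stepY_def P.err_def P.dualD_def P.consX_def P.consV_def
    by (rule refl)+
  show "qD (Suc t) s \<le> (1 - 1 / (4 * \<kappa>)) * qD t s + (\<kappa> / 2 * (qE t s / L\<^sup>2) + 18 * \<kappa> ^ 3 * (qA t s + qB t s))"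
    using P.dualD_step[of t] unfolding eqs by (simp add: add.assoc)
  show "qD 0 s \<le> 2 * \<kappa> / L * primal_gap p (all_rows x\<^sub>0) 0 (all_rows y\<^sub>0)"
    using P.dualD_le_gap[of 0] unfolding eqs P.gap_0 .
  show "(\<Sum>t<T. 3 * L * qY t s) \<le> primal_gap p (all_rows x\<^sub>0) 0 (all_rows y\<^sub>0) + (\<Sum>t<T. qE t s / (2 * L)
       + L * (qD (Suc t) s / (12 * \<kappa>\<^sup>2) + 6 * \<kappa>\<^sup>2 * (qA t s + qB t s)))"
    using P.gap_sum[of T] unfolding eqs P.gap_0 .
  show "qP (Suc t) s \<le> rho p * qP t s + \<eta>\<^sup>2 / r\<^sub>1 * qV t s"
    using P.consX_step[of t] unfolding eqs .
  show "qP 0 s = 0" unfolding eqs by (rule P.consX_0)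
  show "qV (Suc t) s \<le> rho p * qV t s + (3 * (qE (Suc t) s + qE t s) + 6 * L\<^sup>2 * (qA t s + qY t s)) / r\<^sub>1"
    using P.consV_step[of t] unfolding eqs .
  show "(\<Sum>t<T. 1 / (3 * \<eta>) * qA t s + 3 / (4 * \<eta>\<^sub>\<Lambda>) * qB t s) \<le> (Pmax p x\<^sub>0 0 + gr x\<^sub>0 - \<phi>lb)
       + (\<Sum>t<T. (4 * \<eta> + \<eta>\<^sub>\<Lambda>) * L\<^sup>2 * (2 * qD t s + 6 * \<kappa>\<^sup>2 * (qA t s + 2 * qP t s + qB t s))
         + 4 * \<eta> * qE t s + 4 * \<eta> * qV t s + (4 / \<eta> + 8 * \<eta> * L\<^sup>2) * qP t s)"
    using P.merit_sum[of T] unfolding eqs P.merit_0 .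
  show "qG t s \<le> 5 / \<eta>\<^sup>2 * (2 * qP t s + qA t s) + 5 * qV t s + 15 * qE t s
      + 60 * L\<^sup>2 * \<kappa>\<^sup>2 * qP t s + 30 * L\<^sup>2 * qD t s"
    using P.prox_gradient_map_bound[of t] unfolding eqs qG_def .
  show "qH t s \<le> 2 / \<eta>\<^sub>\<Lambda>\<^sup>2 * qB t s + 4 * L\<^sup>2 * (qD t s + \<kappa>\<^sup>2 * qP t s)"
    using P.gradient_Lam_bound[of t] unfolding eqs qH_def .
  show "0 \<le> primal_gap p (all_rows x\<^sub>0) 0 (all_rows y\<^sub>0)"
    using P.gap_nonneg[of 0] unfolding P.gap_0 .
  show "0 \<le> Pmax p x\<^sub>0 0 + gr x\<^sub>0 - \<phi>lb"
    using P.merit_lower[of 0] unfolding P.merit_0 by simp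
qed

lemma integrable_avg:
  fixes F :: "'m \<Rightarrow> 'w \<Rightarrow> real"
  assumes "\<And>i. integrable M (F i)"
  shows "integrable M (\<lambda>\<omega>. avg (\<lambda>i. F i \<omega>))" "(\<integral>\<omega>. avg (\<lambda>i. F i \<omega>) \<partial>M) = avg (\<lambda>i. \<integral>\<omega>. F i \<omega> \<partial>M)"
  unfolding avg_def using assms by simp_all

lemma linear_row_mean: "linear (row_mean :: real^'d::finite^'m \<Rightarrow> real^'d)"
  by (intro linearI row_mean_add row_mean_scaleR)

lemma linear_cvec: "linear (\<lambda>\<Lambda>. cvec \<Lambda> i)"
  unfolding cvec_def
  by (intro linearI) (simp_all add: matrix_add_ldistrib scaleR_add_right matrix_mult_row scaleR_sum_right mult.commute mult.left_commute)

lemma q_integrable: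
  "integrable M (\<lambda>\<omega>. qA t (smp \<omega>))" "integrable M (\<lambda>\<omega>. qB t (smp \<omega>))" "integrable M (\<lambda>\<omega>. qY t (smp \<omega>))"
  "integrable M (\<lambda>\<omega>. qE t (smp \<omega>))" "integrable M (\<lambda>\<omega>. qD t (smp \<omega>))" "integrable M (\<lambda>\<omega>. qP t (smp \<omega>))"
  "integrable M (\<lambda>\<omega>. qV t (smp \<omega>))"
proof -
  have X: "sqi (\<lambda>\<omega>. it_X (run (smp \<omega>) t))" and Y: "sqi (\<lambda>\<omega>. it_Y (run (smp \<omega>) t))"
    and Lm: "sqi (\<lambda>\<omega>. it_Lam (run (smp \<omega>) t))" and V: "sqi (\<lambda>\<omega>. it_Vx (run (smp \<omega>) t))"
    and d: "\<And>i. sqi (\<lambda>\<omega>. it_d (run (smp \<omega>) t) i)" for t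
    using run_sqi[of t] by blast+
  show "integrable M (\<lambda>\<omega>. qA t (smp \<omega>))" "integrable M (\<lambda>\<omega>. qY t (smp \<omega>))"
    unfolding qdefs by (intro integrable_avg sqiD(2) sqi_diff sqi_row X Y)+
  show "integrable M (\<lambda>\<omega>. qB t (smp \<omega>))"
    unfolding qdefs by (intro sqiD(2) sqi_diff Lm)
  show "integrable M (\<lambda>\<omega>. qE t (smp \<omega>))"
    unfolding qdefs er_def zz_def by (intro integrable_avg sqiD(2) sqi_diff sqi_gradient sqi_Pair sqi_row X Y d)
  show "integrable M (\<lambda>\<omega>. qP t (smp \<omega>))" "integrable M (\<lambda>\<omega>. qV t (smp \<omega>))"
    unfolding qdefs by (intro integrable_avg sqiD(2) sqi_diff sqi_row X V sqi_linear[OF _ linear_row_mean])+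
  have ysq: "sqi (\<lambda>\<omega>. ys i (it_X (run (smp \<omega>) t) $ i) (cvec (it_Lam (run (smp \<omega>) t)) i))" for i
  proof -
    let ?Z = "\<lambda>\<omega>. (it_X (run (smp \<omega>) t) $ i, cvec (it_Lam (run (smp \<omega>) t)) i)"
    have Z: "sqi ?Z" by (intro sqi_Pair sqi_row X sqi_linear[OF Lm linear_cvec])
    have "norm (ys i (fst u) (snd u) - ys i (fst v) (snd v)) \<le> (L + 1) / scv p * norm (u - v)" for u v
    proof -
      have "norm (ys i (fst u) (snd u) - ys i (fst v) (snd v))
          \<le> (L * norm (fst u - fst v) + norm (snd u - snd v)) / scv p"
        by (rule minimax_agent.ystar_lipschitz[OF agent])
      also have "\<dots> \<le> (L * norm (u - v) + norm (u - v)) / scv p"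
        using norm_fst_le'[of "u - v"] norm_snd_le'[of "u - v"] L_pos mu_pos
        by (intro divide_right_mono add_mono mult_left_mono) auto
      also have "\<dots> = (L + 1) / scv p * norm (u - v)" by (simp add: algebra_simps)
      finally show ?thesis .
    qed
    from sqi_lipschitz[OF Z, of "\<lambda>u. ys i (fst u) (snd u)", OF this] show ?thesis by simp
  qed
  show "integrable M (\<lambda>\<omega>. qD t (smp \<omega>))"
    unfolding qdefs by (intro integrable_avg sqiD(2) sqi_diff sqi_row Y ysq)
qed

lemma run_state_measurable:
  "(\<lambda>s. it_X (run s t)) \<in> borel_measurable (PiM UNIV Lw)" "(\<lambda>s. it_Lam (run s t)) \<in> borel_measurable (PiM UNIV Lw)"
  using run_measurable[of t UNIV] by blast+

lemma borel_linear:
  fixes F :: "'v::euclidean_space \<Rightarrow> 'u::euclidean_space"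
  assumes "linear F" "Z \<in> borel_measurable N" shows "(\<lambda>s. F (Z s)) \<in> borel_measurable N"
proof -
  have "continuous_on UNIV F" using assms(1) linear_continuous_on linear_conv_bounded_linear by blast
  from measurable_compose[OF assms(2) borel_measurable_continuous_onI[OF this]] show ?thesis .
qed

lemma borel_ystar:
  assumes x: "x \<in> borel_measurable N" and l: "l \<in> borel_measurable N"
  shows "(\<lambda>s. ys i (x s) (cvec (l s) i)) \<in> borel_measurable N"
proof -
  have "continuous_on UNIV (\<lambda>z :: (real^'a) \<times> (real^'b). ys i (fst z) (snd z))"
    by (intro minimax_agent.continuous_on_ystar[OF agent] continuous_intros)
  from measurable_compose[OF borel_measurable_Pair[OF x borel_linear[OF linear_cvec l]] borel_measurable_continuous_onI[OF this]]
  show ?thesis by simp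
qed

lemma q_G_measurable: "qG t \<in> borel_measurable (PiM UNIV Lw)" "qH t \<in> borel_measurable (PiM UNIV Lw)"
proof -
  let ?N = "PiM UNIV Lw"
  have x [measurable]: "(\<lambda>s. row_mean (it_X (run s t))) \<in> borel_measurable ?N"
    by (rule borel_linear[OF linear_row_mean run_state_measurable(1)])
  have y: "(\<lambda>s. ys i (row_mean (it_X (run s t))) (cvec (it_Lam (run s t)) i)) \<in> borel_measurable ?N" for i
    by (rule borel_ystar[OF x run_state_measurable(2)])
  have g [measurable]: "(\<lambda>s. gradPx (row_mean (it_X (run s t))) (it_Lam (run s t))) \<in> borel_measurable ?N"
    unfolding gradPx_def
    by (intro borel_linear[OF linear_row_mean] borel_vec_lambda borel_linear[OF linear_fst] borel_gradient
        borel_measurable_Pair x y)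
  have cp: "continuous_on UNIV (\<lambda>u. prox (\<lambda>v. ereal \<eta> * reg_x p v) u)"
  proof -
    have "1-lipschitz_on UNIV (\<lambda>u. prox (\<lambda>v. ereal \<eta> * reg_x p v) u)"
      using prox_scaled_nonexpansive[OF g_ccf x0 eta_pos(1)] by (intro lipschitz_onI) (auto simp: dist_norm)
    then show ?thesis by (rule lipschitz_on_continuous_on)
  qed
  have "(\<lambda>s. prox (\<lambda>v. ereal \<eta> * reg_x p v) (row_mean (it_X (run s t)) - \<eta> *\<^sub>R gradPx (row_mean (it_X (run s t))) (it_Lam (run s t))))
      \<in> borel_measurable ?N"
    by (rule measurable_compose[OF _ borel_measurable_continuous_onI[OF cp]]) measurable
  then show "qG t \<in> borel_measurable ?N"
    unfolding qG_def[abs_def] prox_gradient_map_def gradient_Pmax_x by measurable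
  have "(\<lambda>s. Ystar (row_mean (it_X (run s t))) (it_Lam (run s t))) \<in> borel_measurable ?N"
    unfolding Ystar_def by (intro borel_vec_lambda y)
  then show "qH t \<in> borel_measurable ?N"
    unfolding qH_def[abs_def] gradient_Pmax_Lam by measurable
qed

text \<open>Integrability is inherited from the pathwise upper bounds, whose terms are
  integrable.\<close>

lemma q_G_integrable: "integrable M (\<lambda>\<omega>. qG t (smp \<omega>))" "integrable M (\<lambda>\<omega>. qH t (smp \<omega>))"
proof -
  have *: "integrable M F" if "integrable M R" "F \<in> borel_measurable M" "\<And>\<omega>. 0 \<le> F \<omega>" "\<And>\<omega>. F \<omega> \<le> R \<omega>" for F R :: "'w \<Rightarrow> real"
    by (rule Bochner_Integration.integrable_bound[OF that(1,2)]) (use that in \<open>auto intro!: AE_I2 simp: order_trans[OF _ abs_ge_self]\<close>)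
  show "integrable M (\<lambda>\<omega>. qG t (smp \<omega>))"
    by (rule *[of "\<lambda>\<omega>. 5 / \<eta>\<^sup>2 * (2 * qP t (smp \<omega>) + qA t (smp \<omega>)) + 5 * qV t (smp \<omega>) + 15 * qE t (smp \<omega>)
      + 60 * L\<^sup>2 * \<kappa>\<^sup>2 * qP t (smp \<omega>) + 30 * L\<^sup>2 * qD t (smp \<omega>)"])
      (intro Bochner_Integration.integrable_add integrable_mult_right q_integrable smp_measurable[OF q_G_measurable(1)] path_facts | simp add: qG_def)+
  show "integrable M (\<lambda>\<omega>. qH t (smp \<omega>))"
    by (rule *[of "\<lambda>\<omega>. 2 / \<eta>\<^sub>\<Lambda>\<^sup>2 * qB t (smp \<omega>) + 4 * L\<^sup>2 * (qD t (smp \<omega>) + \<kappa>\<^sup>2 * qP t (smp \<omega>))"])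
      (intro Bochner_Integration.integrable_add integrable_mult_right q_integrable smp_measurable[OF q_G_measurable(2)] path_facts | simp add: qH_def)+
qed

text \<open>The SPIDER recursion runs separately for each agent; after averaging, the joint
  displacement of the pair of copies splits into the steps of X and Y.\<close>

lemma spider_expectation:
  "(\<Sum>t<T. \<integral>\<omega>. qE t (smp \<omega>) \<partial>M) \<le> real T * \<nu> + L\<^sup>2 * (\<Sum>t<T. (\<integral>\<omega>. qA t (smp \<omega>) \<partial>M) + (\<integral>\<omega>. qY t (smp \<omega>) \<partial>M))"
proof -
  have X: "sqi (\<lambda>\<omega>. it_X (run (smp \<omega>) t))" and Y: "sqi (\<lambda>\<omega>. it_Y (run (smp \<omega>) t))"
    and d: "\<And>i. sqi (\<lambda>\<omega>. it_d (run (smp \<omega>) t) i)" for t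
    using run_sqi[of t] by blast+
  let ?e = "\<lambda>i t. \<integral>\<omega>. (norm (er t i (smp \<omega>)))\<^sup>2 \<partial>M"
  let ?D = "\<lambda>i t. \<integral>\<omega>. (norm (zz (Suc t) i (smp \<omega>) - zz t i (smp \<omega>)))\<^sup>2 \<partial>M"
  have er: "integrable M (\<lambda>\<omega>. (norm (er t i (smp \<omega>)))\<^sup>2)" for t i
    unfolding er_def zz_def by (intro sqiD(2) sqi_diff sqi_gradient sqi_Pair sqi_row X Y d)
  have dz: "integrable M (\<lambda>\<omega>. (norm (zz (Suc t) i (smp \<omega>) - zz t i (smp \<omega>)))\<^sup>2)" for t i
    unfolding zz_def by (intro sqiD(2) sqi_diff sqi_Pair sqi_row X Y)
  have Dt: "avg (\<lambda>i. ?D i t) = (\<integral>\<omega>. qA t (smp \<omega>) \<partial>M) + (\<integral>\<omega>. qY t (smp \<omega>) \<partial>M)" for t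
  proof -
    have "avg (\<lambda>i. ?D i t) = (\<integral>\<omega>. avg (\<lambda>i. (norm (zz (Suc t) i (smp \<omega>) - zz t i (smp \<omega>)))\<^sup>2) \<partial>M)"
      by (rule integrable_avg(2)[OF dz, symmetric])
    also have "\<dots> = (\<integral>\<omega>. qA t (smp \<omega>) + qY t (smp \<omega>) \<partial>M)"
      unfolding zz_def qA_def qY_def avg_add[symmetric] by (simp add: norm_Pair)
    finally show ?thesis using q_integrable by simp
  qed
  have "(\<Sum>t<T. ?e i t) \<le> real T * \<nu> + L\<^sup>2 * (\<Sum>t<T. ?D i t)" for i
    by (rule spider_sum[OF q_pos]) (use er_checkpoint er_step[OF _ er dz] in auto)
  then have "avg (\<lambda>i. \<Sum>t<T. ?e i t) \<le> avg (\<lambda>i. real T * \<nu> + L\<^sup>2 * (\<Sum>t<T. ?D i t))"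
    by (rule avg_mono)
  also have "\<dots> = real T * \<nu> + L\<^sup>2 * (\<Sum>t<T. avg (\<lambda>i. ?D i t))"
    unfolding avg_add avg_const avg_cmult avg_sum ..
  finally have "avg (\<lambda>i. \<Sum>t<T. ?e i t) \<le> real T * \<nu>
      + L\<^sup>2 * (\<Sum>t<T. (\<integral>\<omega>. qA t (smp \<omega>) \<partial>M) + (\<integral>\<omega>. qY t (smp \<omega>) \<partial>M))" unfolding Dt .
  moreover have "avg (\<lambda>i. \<Sum>t<T. ?e i t) = (\<Sum>t<T. \<integral>\<omega>. qE t (smp \<omega>) \<partial>M)"
    unfolding avg_sum qE_def integrable_avg(2)[OF er] ..
  ultimately show ?thesis by simp
qed

lemma expected_stationarity_sums:
  assumes nu: "\<nu> * \<kappa>\<^sup>2 \<le> \<epsilon>\<^sup>2 / 10 ^ 12" "\<nu> / r\<^sub>1 ^ 4 \<le> \<epsilon>\<^sup>2 / 10 ^ 12"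
    and C_V: "0 \<le> C\<^sub>V" "initial_tracker_bound p M C\<^sub>V x\<^sub>0 y\<^sub>0 q (\<lambda>\<omega>. Bf (smp \<omega>))"
    and T: "0 < T" and T_large: "10 ^ 12 * (1 + C\<^sub>V) * (L * \<kappa>\<^sup>2 / \<theta> * ((Pmax p x\<^sub>0 0 + gr x\<^sub>0 - \<phi>lb)
      + primal_gap p (all_rows x\<^sub>0) 0 (all_rows y\<^sub>0) / \<theta> + 1)) \<le> real T * \<epsilon>\<^sup>2"
  shows "(\<Sum>t<T. \<integral>\<omega>. qG t (smp \<omega>) \<partial>M) + L\<^sup>2 * (\<Sum>t<T. \<integral>\<omega>. qP t (smp \<omega>) \<partial>M) \<le> real T * \<epsilon>\<^sup>2"
    and "(\<Sum>t<T. \<integral>\<omega>. qH t (smp \<omega>) \<partial>M) \<le> real T * \<epsilon>\<^sup>2"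
proof -
  let ?E = "\<lambda>Q t. \<integral>\<omega>. Q t (smp \<omega>) \<partial>M"
  note i = q_integrable q_G_integrable
  have mono: "(\<integral>\<omega>. F \<omega> \<partial>M) \<le> (\<integral>\<omega>. R \<omega> \<partial>M)" if "integrable M F" "integrable M R" "\<And>\<omega>. F \<omega> \<le> R \<omega>" for F R :: "'w \<Rightarrow> real"
    using that by (intro integral_mono)
  have c: "(\<integral>\<omega>. k \<partial>M) = k" for k :: real by (simp add: prob_space)
  note ints = Bochner_Integration.integral_add Bochner_Integration.integral_diff integral_mult_right_zero
    integral_divide_zero Bochner_Integration.integral_sum Bochner_Integration.integrable_add
    integrable_mult_right integrable_divide Bochner_Integration.integrable_sum integrable_const c
  have V0: "?E qV 0 \<le> C\<^sub>V * (L_P p * r\<^sub>1)"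
  proof -
    have "qV 0 s = (norm (row_dev (it_Vx (run s 0))))\<^sup>2 / real CARD('m)" for s
      unfolding qV_def avg_norm_rows[symmetric] row_dev_nth ..
    then have "?E qV 0 = (\<integral>\<omega>. (norm (row_dev (it_Vx (run (smp \<omega>) 0))))\<^sup>2 \<partial>M) / real CARD('m)"
      by (simp del: vrlm.simps)
    also have "\<dots> \<le> (C\<^sub>V * (real CARD('m) * L_P p * r\<^sub>1)) / real CARD('m)"
      using C_V(2) unfolding initial_tracker_bound_def by (intro divide_right_mono) auto
    finally show ?thesis by simp
  qed
  \<comment> \<open>Each pathwise inequality is integrated by monotonicity, and the rules
    \<open>ints\<close> move the integral to the single quantities; this works because no products
    of random quantities occur.\<close>
  have facts:
    "\<And>t. ?E qD (Suc t) \<le> (1 - 1 / (4 * \<kappa>)) * ?E qD t + (\<kappa> / 2 * (?E qE t / L\<^sup>2) + 18 * \<kappa> ^ 3 * (?E qA t + ?E qB t))"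
    "?E qD 0 \<le> 2 * \<kappa> / L * primal_gap p (all_rows x\<^sub>0) 0 (all_rows y\<^sub>0)"
    "(\<Sum>t<T. 3 * L * ?E qY t) \<le> primal_gap p (all_rows x\<^sub>0) 0 (all_rows y\<^sub>0) + (\<Sum>t<T. ?E qE t / (2 * L)
       + L * (?E qD (Suc t) / (12 * \<kappa>\<^sup>2) + 6 * \<kappa>\<^sup>2 * (?E qA t + ?E qB t)))"
    "\<And>t. ?E qP (Suc t) \<le> rho p * ?E qP t + \<eta>\<^sup>2 / r\<^sub>1 * ?E qV t"
    "?E qP 0 = 0"
    "\<And>t. ?E qV (Suc t) \<le> rho p * ?E qV t + (3 * (?E qE (Suc t) + ?E qE t) + 6 * L\<^sup>2 * (?E qA t + ?E qY t)) / r\<^sub>1"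
    "(\<Sum>t<T. 1 / (3 * \<eta>) * ?E qA t + 3 / (4 * \<eta>\<^sub>\<Lambda>) * ?E qB t) \<le> (Pmax p x\<^sub>0 0 + gr x\<^sub>0 - \<phi>lb)
       + (\<Sum>t<T. (4 * \<eta> + \<eta>\<^sub>\<Lambda>) * L\<^sup>2 * (2 * ?E qD t + 6 * \<kappa>\<^sup>2 * (?E qA t + 2 * ?E qP t + ?E qB t))
         + 4 * \<eta> * ?E qE t + 4 * \<eta> * ?E qV t + (4 / \<eta> + 8 * \<eta> * L\<^sup>2) * ?E qP t)"
    "\<And>t. ?E qG t \<le> 5 / \<eta>\<^sup>2 * (2 * ?E qP t + ?E qA t) + 5 * ?E qV t + 15 * ?E qE t
      + 60 * L\<^sup>2 * \<kappa>\<^sup>2 * ?E qP t + 30 * L\<^sup>2 * ?E qD t"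
    "\<And>t. ?E qH t \<le> 2 / \<eta>\<^sub>\<Lambda>\<^sup>2 * ?E qB t + 4 * L\<^sup>2 * (?E qD t + \<kappa>\<^sup>2 * ?E qP t)"
    subgoal for t using mono[of "\<lambda>\<omega>. qD (Suc t) (smp \<omega>)", OF _ _ path_facts(1)] by (simp only: ints i simp_thms)
    subgoal using mono[of "\<lambda>\<omega>. qD 0 (smp \<omega>)", OF _ _ path_facts(2)] by (simp only: ints i simp_thms)
    subgoal using mono[of "\<lambda>\<omega>. \<Sum>t<T. 3 * L * qY t (smp \<omega>)", OF _ _ path_facts(3)] by (simp only: ints i simp_thms)
    subgoal for t using mono[of "\<lambda>\<omega>. qP (Suc t) (smp \<omega>)", OF _ _ path_facts(4)] by (simp only: ints i simp_thms)
    subgoal unfolding path_facts(5) by simp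
    subgoal for t using mono[of "\<lambda>\<omega>. qV (Suc t) (smp \<omega>)", OF _ _ path_facts(6)] by (simp only: ints i simp_thms)
    subgoal using mono[of "\<lambda>\<omega>. \<Sum>t<T. 1 / (3 * \<eta>) * qA t (smp \<omega>) + 3 / (4 * \<eta>\<^sub>\<Lambda>) * qB t (smp \<omega>)", OF _ _ path_facts(7)] by (simp only: ints i simp_thms)
    subgoal for t using mono[of "\<lambda>\<omega>. qG t (smp \<omega>)", OF _ _ path_facts(8)] by (simp only: ints i simp_thms)
    subgoal for t using mono[of "\<lambda>\<omega>. qH t (smp \<omega>)", OF _ _ path_facts(9)] by (simp only: ints i simp_thms)
    done
  have nn: "0 \<le> ?E qA t" "0 \<le> ?E qB t" "0 \<le> ?E qY t" "0 \<le> ?E qE t" "0 \<le> ?E qD t" "0 \<le> ?E qP t" "0 \<le> ?E qV t" for t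
    using q_nonneg by (auto intro!: Bochner_Integration.integral_nonneg)
  note final = stationarity_sums[where a = "?E qA" and b = "?E qB" and y = "?E qY" and e = "?E qE" and D = "?E qD"
      and q = "?E qP" and v = "?E qV" and G = "?E qG" and H = "?E qH" and T = T and \<nu> = \<nu>
      and \<Delta> = "Pmax p x\<^sub>0 0 + gr x\<^sub>0 - \<phi>lb" and \<delta> = "primal_gap p (all_rows x\<^sub>0) 0 (all_rows y\<^sub>0)"
      and C\<^sub>V = C\<^sub>V and \<epsilon> = \<epsilon>, OF nn facts(1-6) V0 facts(7-9) spider_expectation nu_nonneg nu
      path_facts(11) path_facts(10) C_V(1) T T_large]
  show "(\<Sum>t<T. ?E qG t) + L\<^sup>2 * (\<Sum>t<T. ?E qP t) \<le> real T * \<epsilon>\<^sup>2" by (rule final(1))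
  show "(\<Sum>t<T. ?E qH t) \<le> real T * \<epsilon>\<^sup>2" by (rule final(2))
qed

end

section \<open>Stationarity at the random index\<close>

context vrlm_run
begin

text \<open>The step length of the proximal gradient map in the stationarity measure is taken to be
  that of the algorithm. The averages over agents agree with the Frobenius norms divided by
  m.\<close>

lemma run_stationary:
  assumes nu: "\<nu> * \<kappa>\<^sup>2 \<le> \<epsilon>\<^sup>2 / 10 ^ 12" "\<nu> / r\<^sub>1 ^ 4 \<le> \<epsilon>\<^sup>2 / 10 ^ 12"
    and C_V: "0 \<le> C\<^sub>V" "initial_tracker_bound p M C\<^sub>V x\<^sub>0 y\<^sub>0 q (\<lambda>\<omega>. Bf (smp \<omega>))"
    and T: "0 < T" and T_large: "10 ^ 12 * (1 + C\<^sub>V) * (L * \<kappa>\<^sup>2 / \<theta> * ((Pmax p x\<^sub>0 0 + gr x\<^sub>0 - \<phi>lb)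
      + primal_gap p (all_rows x\<^sub>0) 0 (all_rows y\<^sub>0) / \<theta> + 1)) \<le> real T * \<epsilon>\<^sup>2"
    and \<tau>: "\<tau> \<in> measurable M (count_space UNIV)"
      "distr M (count_space UNIV) \<tau> = measure_pmf (pmf_of_set {..<T})"
      "indep_set (sets (vimage_algebra (space M) \<tau> (count_space UNIV)))
         (sets (vimage_algebra (space M) smp (PiM UNIV Lw)))"
  shows "vrlm_stationary p M \<epsilon> x\<^sub>0 y\<^sub>0 q (\<lambda>\<omega>. Bf (smp \<omega>)) \<tau>"
proof -
  have smp: "smp \<in> measurable M (PiM UNIV Lw)"
    using hist_measurable[of UNIV] by (simp add: hist_def[abs_def] restrict_def)
  have qP_m: "qP t \<in> borel_measurable (PiM UNIV Lw)" for t
  proof -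
    note [measurable] = run_state_measurable(1) borel_linear[OF linear_row_mean run_state_measurable(1)]
    show ?thesis unfolding qP_def[abs_def] avg_def by measurable
  qed
  note G = random_index_integral[where g = qG, OF \<tau>(1,2) T smp \<tau>(3) q_G_measurable(1) q_G_integrable(1)]
    and H = random_index_integral[where g = qH, OF \<tau>(1,2) T smp \<tau>(3) q_G_measurable(2) q_G_integrable(2)]
    and P = random_index_integral[where g = qP, OF \<tau>(1,2) T smp \<tau>(3) qP_m q_integrable(6)]
  note sums = expected_stationarity_sums[OF nu C_V T T_large]
  have P_eq: "(norm (row_dev (it_X (run s t))))\<^sup>2 = real CARD('m) * qP t s" for s t
    unfolding qP_def row_dev_nth[symmetric] avg_norm_rows by simp
  have T': "0 < real T" using T by simp
  have "(\<integral>\<omega>. qG (\<tau> \<omega>) (smp \<omega>) \<partial>M) + L\<^sup>2 * (\<integral>\<omega>. qP (\<tau> \<omega>) (smp \<omega>) \<partial>M)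
      = ((\<Sum>t<T. \<integral>\<omega>. qG t (smp \<omega>) \<partial>M) + L\<^sup>2 * (\<Sum>t<T. \<integral>\<omega>. qP t (smp \<omega>) \<partial>M)) / real T"
    unfolding G(2) P(2) by (simp add: add_divide_distrib)
  also have "\<dots> \<le> \<epsilon>\<^sup>2" using sums(1) T' by (simp add: pos_divide_le_eq mult.commute)
  finally have GP: "(\<integral>\<omega>. qG (\<tau> \<omega>) (smp \<omega>) \<partial>M) + L\<^sup>2 * (\<integral>\<omega>. qP (\<tau> \<omega>) (smp \<omega>) \<partial>M) \<le> \<epsilon>\<^sup>2" .
  have Hb: "(\<integral>\<omega>. qH (\<tau> \<omega>) (smp \<omega>) \<partial>M) \<le> \<epsilon>\<^sup>2"
    unfolding H(2) using sums(2) T' by (simp add: pos_divide_le_eq mult.commute)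
  show ?thesis
    unfolding vrlm_stationary_def stationary_in_expectation_def P_eq
    using eta_pos(1) G(1) H(1) P(1) GP Hb unfolding qG_def qH_def
    by (intro conjI exI[of _ \<eta>]) simp_all
qed

end

section \<open>Counting stochastic gradients\<close>

text \<open>There are at most \<open>T / q + 1\<close> checkpoints of cost \<open>n\<close>. As
  \<open>q\<close> is at least the square root of \<open>n\<close>, they cost that root per
  iteration plus one full batch; the other steps cost \<open>2 * q\<close>, and rounding up at most
  doubles the root.\<close>

lemma grad_count_bounds:
  assumes n: "0 < n" and q: "q = nat \<lceil>sqrt (real n)\<rceil>" and T: "0 < T"
  shows "real n \<le> real (grad_count n q q T)" "sqrt (real n) * real T \<le> real (grad_count n q q T)"
    "real (grad_count n q q T) \<le> real n + 5 * (sqrt (real n) * real T)"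
proof -
  let ?s = "sqrt (real n)"
  have s1: "1 \<le> ?s" using n by simp
  have qs: "?s \<le> real q" "real q \<le> 2 * ?s"
    using s1 unfolding q by linarith+
  have q0: "0 < q" using qs s1 by linarith
  have ss: "?s * ?s = real n" by simp
  have count: "real (grad_count n q q T) = (\<Sum>t<T. if q dvd t then real n else 2 * real q)"
    unfolding grad_count_def by (simp add: if_distrib cong: if_cong)
  have "real n = (if q dvd 0 then real n else 2 * real q)" by simp
  also have "\<dots> \<le> (\<Sum>t<T. if q dvd t then real n else 2 * real q)"
    by (rule member_le_sum) (use T in auto)
  finally show "real n \<le> real (grad_count n q q T)" unfolding count .
  have "?s \<le> real n" using mult_left_mono[OF s1, of ?s] s1 ss by simp
  then have "(\<Sum>t<T. ?s) \<le> (\<Sum>t<T. if q dvd t then real n else 2 * real q)"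
    using qs s1 by (intro sum_mono) auto
  then show "?s * real T \<le> real (grad_count n q q T)"
    unfolding count by (simp add: mult.commute)
  have "(\<Sum>t<T. if q dvd t then real n else 2 * real q) \<le> real n + real T * (?s + 2 * real q)"
  proof -
    have "(\<Sum>t<T. if q dvd t then real n else 2 * real q) \<le> (\<Sum>t<T. (if q dvd t then real n else 0) + 2 * real q)"
      by (intro sum_mono) auto
    also have "\<dots> = real n * real (card {t. t < T \<and> q dvd t}) + real T * (2 * real q)"
      by (simp add: sum.distrib sum.If_cases Int_def mult.commute)
    also have "real n * real (card {t. t < T \<and> q dvd t}) \<le> real n * (real T / ?s + 1)"
    proof (rule mult_left_mono)
      have "{t. t < T \<and> q dvd t} \<subseteq> (\<lambda>k. q * k) ` {..T div q}"
      proof safe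
        fix t assume t: "t < T" "q dvd t"
        then show "t \<in> (\<lambda>k. q * k) ` {..T div q}"
          by (intro image_eqI[of _ _ "t div q"]) (auto intro: div_le_mono)
      qed
      then have "card {t. t < T \<and> q dvd t} \<le> card ((\<lambda>k. q * k) ` {..T div q})"
        by (intro card_mono) auto
      also have "\<dots> \<le> Suc (T div q)" using card_image_le[of "{..T div q}" "\<lambda>k. q * k"] by simp
      finally have "real (card {t. t < T \<and> q dvd t}) \<le> real (T div q) + 1" by simp
      also have "real (T div q) \<le> real T / real q" by (rule of_nat_div_le_of_nat)
      also have "real T / real q \<le> real T / ?s" using qs q0 n by (intro divide_left_mono mult_pos_pos) auto
      finally show "real (card {t. t < T \<and> q dvd t}) \<le> real T / ?s + 1" by simp
    qed simp
    also have "real n * (real T / ?s + 1) = real T * ?s + real n"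
    proof -
      have "(x * x) * (y / x + 1) = y * x + x * x" if "0 < x" for x y :: real
        using that by (simp add: field_simps)
      from this[of ?s "real T"] show ?thesis using s1 by simp
    qed
    finally show ?thesis by (simp add: algebra_simps)
  qed
  also have "real n + real T * (?s + 2 * real q) \<le> real n + real T * (?s + 2 * (2 * ?s))"
    using qs by (intro add_left_mono mult_left_mono) auto
  finally show "real (grad_count n q q T) \<le> real n + 5 * (?s * real T)"
    unfolding count by (simp add: algebra_simps)
qed

lemma grad_count_same_order:
  assumes "0 < n" "q = nat \<lceil>sqrt (real n)\<rceil>" "0 < T"
  shows "same_order 10 (real (grad_count n q q T)) (real n + sqrt (real n) * real T)"
  using grad_count_bounds[OF assms] unfolding same_order_def by simp

text \<open>The bound \<open>1 \<le> c * N\<^sup>2\<close> makes rounding at most double the batch,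
  and \<open>N \<le> real T\<close> lets the cost of the iterations absorb the initial batch of
  order \<open>c * N\<^sup>2\<close>.\<close>

lemma grad_count_noise_order:
  assumes n: "n = max 1 (nat \<lceil>c * N\<^sup>2\<rceil>)" and q: "q = nat \<lceil>sqrt (real n)\<rceil>" and T: "0 < T"
    and c: "1 \<le> c" and N: "0 \<le> N" "1 \<le> c * N\<^sup>2" "N \<le> real T"
  shows "same_order (100 * c) (real (grad_count n q q T)) (N * real T)"
proof -
  have n0: "0 < n" unfolding n by simp
  note b = grad_count_bounds[OF n0 q T]
  have n1: "c * N\<^sup>2 \<le> real n" "real n \<le> 2 * (c * N\<^sup>2)"
    using N(2) unfolding n by linarith+
  have "N\<^sup>2 \<le> c * N\<^sup>2" using c by (simp add: mult_le_cancel_right1)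
  then have "N\<^sup>2 \<le> real n" using n1 by linarith
  then have lo: "N \<le> sqrt (real n)" by (rule real_le_rsqrt)
  have "real n \<le> (2 * c * N)\<^sup>2"
  proof -
    have "2 * (c * N\<^sup>2) \<le> (2 * c) * ((2 * c) * N\<^sup>2)"
      using c mult_right_mono[of 1 "2 * c" "2 * (c * N\<^sup>2)"] N by simp
    then show ?thesis using n1 by (simp add: power2_eq_square mult_ac)
  qed
  then have hi: "sqrt (real n) \<le> 2 * c * N" using c N by (intro real_le_lsqrt) auto
  have nT: "real n \<le> 2 * c * (N * real T)"
  proof -
    have "N * N \<le> N * real T" using N by (intro mult_left_mono) auto
    then have "2 * c * N\<^sup>2 \<le> 2 * c * (N * real T)" using c by (simp add: power2_eq_square)
    then show ?thesis using n1 by simp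
  qed
  have sT: "sqrt (real n) * real T \<le> 2 * c * (N * real T)"
    using mult_right_mono[OF hi, of "real T"] by (simp add: mult_ac)
  have NT: "0 \<le> N * real T" using N by simp
  have "N * real T / (100 * c) \<le> N * real T"
    using c NT by (simp add: divide_le_eq mult_le_cancel_left1)
  also have "\<dots> \<le> sqrt (real n) * real T" using lo by (rule mult_right_mono) simp
  also have "\<dots> \<le> real (grad_count n q q T)" by (rule b(2))
  finally have 1: "N * real T / (100 * c) \<le> real (grad_count n q q T)" .
  have "real (grad_count n q q T) \<le> 2 * c * (N * real T) + 5 * (2 * c * (N * real T))"
    using b(3) nT sT by linarith
  also have "\<dots> \<le> 100 * c * (N * real T)"
  proof -
    have "0 \<le> c * (N * real T)" using c NT by simp
    then show ?thesis unfolding mult.assoc by linarith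
  qed
  finally show ?thesis using 1 unfolding same_order_def by simp
qed

text \<open>With the noise order in place of the square root of the batch size the count can fail at
  both ends: a batch has at least one sample however small the noise, and the first batch alone can
  be too expensive when the noise order is large compared with \<open>T\<close>. The two conditions
  in front of that form exclude these cases.\<close>

theorem corollary1:
  fixes p :: "('m::finite, 'a::finite, 'b::finite, 's) problem"
    and M :: "'w measure"
    and S :: "nat \<times> 'm \<times> nat \<Rightarrow> 'w \<Rightarrow> 's"
    and \<tau> :: "'w \<Rightarrow> nat"
    and x\<^sub>0 :: "real^'a" and y\<^sub>0 :: "real^'b"
    and \<epsilon> \<sigma> \<phi>lb C\<^sub>V C\<^sub>Y c\<^sub>S c\<^sub>T :: real
    and T :: nat
  assumes "\<epsilon> > 0" and "Lip p \<ge> 1"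
    and "well_posed p"
    and "concave_bounded p \<phi>lb"
    and "mixing_matrix p"
    and "stochastic_smooth p \<sigma>"
    and "x\<^sub>0 \<in> effective_domain (reg_x p)" and "y\<^sub>0 \<in> effective_domain (reg_y p)"
    and "C\<^sub>V \<ge> 0" and "C\<^sub>Y \<ge> 0"
    and "initial_dual_bound p C\<^sub>Y x\<^sub>0 y\<^sub>0"
    and "c\<^sub>S \<ge> theta_threshold" and "c\<^sub>T \<ge> theta_threshold * (1 + C\<^sub>V + C\<^sub>Y)"
    and "T = nat \<lceil>c\<^sub>T * communication_order p \<epsilon> \<phi>lb x\<^sub>0 y\<^sub>0\<rceil>"
    and "sampling p M T S \<tau>"
  shows
    "(\<forall>S\<^sub>1 q B.
        S\<^sub>1 = max 1 (nat \<lceil>c\<^sub>S * (\<sigma>\<^sup>2 * max ((kappa p)\<^sup>2) (1 / (1 - rho p) ^ 4) / \<epsilon>\<^sup>2)\<rceil>) \<longrightarrow>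
        q = nat \<lceil>sqrt (real S\<^sub>1)\<rceil> \<longrightarrow>
        B = (\<lambda>\<omega>. stochastic_batches S\<^sub>1 q q (\<lambda>k. S k \<omega>)) \<longrightarrow>
        initial_tracker_bound p M C\<^sub>V x\<^sub>0 y\<^sub>0 q B \<longrightarrow>
          vrlm_stationary p M \<epsilon> x\<^sub>0 y\<^sub>0 q B \<tau> \<and>
          same_order 10 (real (grad_count S\<^sub>1 q q T)) (real S\<^sub>1 + sqrt (real S\<^sub>1) * real T) \<and>
          (1 \<le> c\<^sub>S * (noise_order p \<epsilon> \<sigma>)\<^sup>2 \<and> noise_order p \<epsilon> \<sigma> \<le> real T \<longrightarrow>
             same_order (100 * c\<^sub>S) (real (grad_count S\<^sub>1 q q T)) (noise_order p \<epsilon> \<sigma> * real T)))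
     \<and>
     (\<forall>n \<zeta> q B.
        finite_sum p n \<zeta> \<longrightarrow>
        q = nat \<lceil>sqrt (real n)\<rceil> \<longrightarrow>
        B = (\<lambda>\<omega>. finite_sum_batches n \<zeta> q q (\<lambda>k. S k \<omega>)) \<longrightarrow>
        initial_tracker_bound p M C\<^sub>V x\<^sub>0 y\<^sub>0 q B \<longrightarrow>
          vrlm_stationary p M \<epsilon> x\<^sub>0 y\<^sub>0 q B \<tau> \<and>
          same_order 10 (real (grad_count n q q T)) (real n + sqrt (real n) * real T))"
proof -
  have x0: "reg_x p x\<^sub>0 < \<infinity>" and y0: "reg_y p y\<^sub>0 < \<infinity>"
    using assms(7,8) unfolding effective_domain_def by auto
  interpret V: vrlm_problem p \<phi>lb \<sigma> x\<^sub>0 y\<^sub>0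
    by unfold_locales (use assms x0 y0 in auto)
  note smp = assms(15)[unfolded sampling_def]
  interpret prob_space M using smp by blast
  have wp: "prob_space (law p i)" for i using assms(3) unfolding well_posed_def by blast
  have I: "indep_samples M (\<lambda>(t, i, j). law p i) S"
  proof (intro indep_samples.intro indep_samples_axioms.intro prob_space_axioms)
    show "indep_vars (\<lambda>(t, i, j). law p i) S UNIV" using smp by blast
    show "distr M (case k of (t, i, j) \<Rightarrow> law p i) (S k) = (case k of (t, i, j) \<Rightarrow> law p i)" for k
    proof (cases k)
      case (fields t i j)
      have "\<forall>t i j. distr M (law p i) (S (t, i, j)) = law p i" using smp by blast
      then show ?thesis unfolding fields by simp
    qed
    show "prob_space (case k of (t, i, j) \<Rightarrow> law p i)" for k
      by (cases k) (simp add: wp)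
  qed
  let ?\<theta> = "vrlm_problem.\<theta> p"
  let ?\<Delta> = "Pmax p x\<^sub>0 0 + real_of_ereal (reg_x p x\<^sub>0) - \<phi>lb"
  let ?\<delta> = "primal_gap p (all_rows x\<^sub>0) 0 (all_rows y\<^sub>0)"
  let ?R = "Lip p * (kappa p)\<^sup>2 / ?\<theta> * (?\<Delta> + ?\<delta> / ?\<theta> + 1)"
  have thr: "theta_threshold = 10 ^ 12" by (rule theta_threshold_def)
  have \<Delta>: "0 \<le> ?\<Delta>" using V.phi_lower[OF x0, of 0] by simp
  have \<delta>: "0 \<le> ?\<delta>"
  proof -
    have "?\<delta> = avg (\<lambda>i. V.vl i (all_rows x\<^sub>0 $ i) (V.cvec 0 i) - V.ob i (all_rows x\<^sub>0 $ i) (V.cvec 0 i) (all_rows y\<^sub>0 $ i))"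
      by (rule V.primal_gap_eq) (simp only: all_rows_nth y0)
    also have "0 \<le> \<dots>"
      by (rule avg_nonneg) (simp only: all_rows_nth diff_ge_0_iff_ge minimax_agent.obj_le_val[OF V.agent y0])
    finally show ?thesis .
  qed
  have R1: "0 < ?R"
    using V.L_pos V.kappa_squares V.theta_pos \<Delta> \<delta> by (intro mult_pos_pos divide_pos_pos add_nonneg_pos add_nonneg_nonneg divide_nonneg_pos) auto
  have comm: "communication_order p \<epsilon> \<phi>lb x\<^sub>0 y\<^sub>0 = ?R / \<epsilon>\<^sup>2"
    unfolding communication_order_def Let_def row_mean_all_rows V.phi_real[OF x0] V.\<theta>_def[symmetric]
    by (simp add: mult_ac)
  have cT: "c\<^sub>T \<ge> 10 ^ 12 * (1 + C\<^sub>V)"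
    using assms(10,13) unfolding thr by simp
  have "0 < 10 ^ 12 * (1 + C\<^sub>V)" using assms(9) by simp
  then have cT0: "0 < c\<^sub>T" using cT by linarith
  \<comment> \<open>Rounding up only increases \<open>T\<close>, and both properties of
    \<open>T\<close> used below are lower bounds.\<close>
  have Tge: "c\<^sub>T * (?R / \<epsilon>\<^sup>2) \<le> real T"
    unfolding assms(14) comm by linarith
  have T: "0 < T"
  proof -
    have "0 < c\<^sub>T * (?R / \<epsilon>\<^sup>2)"
      by (intro mult_pos_pos divide_pos_pos cT0 R1 zero_less_power assms(1))
    then show ?thesis using Tge by linarith
  qed
  have T_large: "10 ^ 12 * (1 + C\<^sub>V) * ?R \<le> real T * \<epsilon>\<^sup>2"
  proof -
    have "10 ^ 12 * (1 + C\<^sub>V) * ?R \<le> c\<^sub>T * ?R" using cT R1 by (intro mult_right_mono) auto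
    also have "\<dots> = c\<^sub>T * (?R / \<epsilon>\<^sup>2) * \<epsilon>\<^sup>2" using assms(1) by simp
    also have "\<dots> \<le> real T * \<epsilon>\<^sup>2" using Tge by (rule mult_right_mono) simp
    finally show ?thesis .
  qed
  have cS: "10 ^ 12 \<le> c\<^sub>S" using assms(12) unfolding thr .
  have tau: "\<tau> \<in> measurable M (count_space UNIV)"
      "distr M (count_space UNIV) \<tau> = measure_pmf (pmf_of_set {..<T})"
      "indep_set (sets (vimage_algebra (space M) \<tau> (count_space UNIV)))
         (sets (vimage_algebra (space M) (\<lambda>\<omega> k. S k \<omega>) (PiM UNIV (\<lambda>(t, i, j). law p i))))"
    using smp by blast+
  show ?thesis
  proof (intro conjI allI impI)
    fix S\<^sub>1 q :: nat and B
    assume S1: "S\<^sub>1 = max 1 (nat \<lceil>c\<^sub>S * (\<sigma>\<^sup>2 * max ((kappa p)\<^sup>2) (1 / (1 - rho p) ^ 4) / \<epsilon>\<^sup>2)\<rceil>)"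
      and q: "q = nat \<lceil>sqrt (real S\<^sub>1)\<rceil>"
      and B: "B = (\<lambda>\<omega>. stochastic_batches S\<^sub>1 q q (\<lambda>k. S k \<omega>))"
      and tr: "initial_tracker_bound p M C\<^sub>V x\<^sub>0 y\<^sub>0 q B"
    have S1_pos: "0 < S\<^sub>1" unfolding S1 by simp
    have q_pos: "0 < q"
    proof -
      have "1 \<le> sqrt (real S\<^sub>1)" using S1_pos by simp
      then show ?thesis unfolding q by linarith
    qed
    let ?m = "max ((kappa p)\<^sup>2) (1 / (1 - rho p) ^ 4)"
    \<comment> \<open>The noise level of the run is the variance bound of one checkpoint
      batch.\<close>
    have R: "vrlm_run p \<phi>lb \<sigma> x\<^sub>0 y\<^sub>0 M S (stochastic_batches S\<^sub>1 q q) q (\<sigma>\<^sup>2 / real S\<^sub>1)"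
    proof (intro vrlm_run.intro V.vrlm_problem_axioms I vrlm_run_axioms.intro)
      show "0 < q" by (rule q_pos)
      show "stochastic_batches S\<^sub>1 q q s t i = stochastic_batches S\<^sub>1 q q s' t i"
        if "\<And>j. s (t, i, j) = s' (t, i, j)" for s s' t i
        unfolding stochastic_batches_def using that by simp
    qed (use S1_pos in \<open>auto simp: stochastic_batches_def\<close>)
    have m: "0 < ?m" "(kappa p)\<^sup>2 \<le> ?m" "1 / (1 - rho p) ^ 4 \<le> ?m"
      using V.kappa_squares by (auto simp: less_max_iff_disj)
    \<comment> \<open>The maximum in the batch size serves both noise conditions of
      \<open>run_stationary\<close> at once.\<close>
    have noise: "\<sigma>\<^sup>2 / real S\<^sub>1 * ?m \<le> \<epsilon>\<^sup>2 / 10 ^ 12"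
    proof -
      have "c\<^sub>S * (\<sigma>\<^sup>2 * ?m / \<epsilon>\<^sup>2) \<le> real S\<^sub>1" unfolding S1 by linarith
      moreover have "10 ^ 12 * (\<sigma>\<^sup>2 * ?m / \<epsilon>\<^sup>2) \<le> c\<^sub>S * (\<sigma>\<^sup>2 * ?m / \<epsilon>\<^sup>2)"
        using cS m by (intro mult_right_mono) auto
      ultimately have "10 ^ 12 * (\<sigma>\<^sup>2 * ?m) / \<epsilon>\<^sup>2 \<le> real S\<^sub>1" by simp
      then have "10 ^ 12 * (\<sigma>\<^sup>2 * ?m) \<le> real S\<^sub>1 * \<epsilon>\<^sup>2"
        using assms(1) by (simp only: pos_divide_le_eq zero_less_power)
      then have "(\<sigma>\<^sup>2 * ?m) * 10 ^ 12 \<le> \<epsilon>\<^sup>2 * real S\<^sub>1" by (simp only: mult.commute)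
      then have "(\<sigma>\<^sup>2 * ?m) / real S\<^sub>1 \<le> \<epsilon>\<^sup>2 / 10 ^ 12"
        using S1_pos by (subst frac_le_eq) (auto simp: divide_le_0_iff)
      then show ?thesis by simp
    qed
    have nu: "\<sigma>\<^sup>2 / real S\<^sub>1 * (kappa p)\<^sup>2 \<le> \<epsilon>\<^sup>2 / 10 ^ 12" "\<sigma>\<^sup>2 / real S\<^sub>1 / (1 - rho p) ^ 4 \<le> \<epsilon>\<^sup>2 / 10 ^ 12"
    proof -
      have c: "0 \<le> \<sigma>\<^sup>2 / real S\<^sub>1" by simp
      show "\<sigma>\<^sup>2 / real S\<^sub>1 * (kappa p)\<^sup>2 \<le> \<epsilon>\<^sup>2 / 10 ^ 12"
        by (rule order_trans[OF mult_left_mono[OF m(2) c] noise])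
      have "\<sigma>\<^sup>2 / real S\<^sub>1 * (1 / (1 - rho p) ^ 4) \<le> \<epsilon>\<^sup>2 / 10 ^ 12"
        by (rule order_trans[OF mult_left_mono[OF m(3) c] noise])
      then show "\<sigma>\<^sup>2 / real S\<^sub>1 / (1 - rho p) ^ 4 \<le> \<epsilon>\<^sup>2 / 10 ^ 12" by simp
    qed
    show "vrlm_stationary p M \<epsilon> x\<^sub>0 y\<^sub>0 q B \<tau>"
      unfolding B by (rule vrlm_run.run_stationary[OF R nu assms(9) tr[unfolded B] T T_large tau])
    show "same_order 10 (real (grad_count S\<^sub>1 q q T)) (real S\<^sub>1 + sqrt (real S\<^sub>1) * real T)"
      by (rule grad_count_same_order[OF S1_pos q T])
    assume N: "1 \<le> c\<^sub>S * (noise_order p \<epsilon> \<sigma>)\<^sup>2 \<and> noise_order p \<epsilon> \<sigma> \<le> real T"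
    have sq: "(noise_order p \<epsilon> \<sigma>)\<^sup>2 = \<sigma>\<^sup>2 * ?m / \<epsilon>\<^sup>2"
    proof -
      have "(max a b)\<^sup>2 = max (a\<^sup>2) (b\<^sup>2)" if "0 \<le> a" "0 \<le> b" for a b :: real
        using that power_mono[of a b 2] power_mono[of b a 2] by (simp add: max_def)
      from this[of "kappa p" "1 / (1 - rho p)\<^sup>2"]
      have "(max (kappa p) (1 / (1 - rho p)\<^sup>2))\<^sup>2 = ?m"
        using V.kappa_squares(4) by (simp add: power_divide)
      then show ?thesis
        unfolding noise_order_def power_mult_distrib power_divide by simp
    qed
    have "0 \<le> \<sigma>" using assms(6) unfolding stochastic_smooth_def by blast
    then have N0: "0 \<le> noise_order p \<epsilon> \<sigma>"
      using assms(1) V.kappa_squares(4) unfolding noise_order_def by (auto simp: le_max_iff_disj)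
    show "same_order (100 * c\<^sub>S) (real (grad_count S\<^sub>1 q q T)) (noise_order p \<epsilon> \<sigma> * real T)"
      by (rule grad_count_noise_order[OF _ q T _ N0]) (use S1 sq N cS in auto)
  next
    fix n \<zeta> q B
    assume fs: "finite_sum p n \<zeta>" and q: "q = nat \<lceil>sqrt (real n)\<rceil>"
      and B: "B = (\<lambda>\<omega>. finite_sum_batches n \<zeta> q q (\<lambda>k. S k \<omega>))"
      and tr: "initial_tracker_bound p M C\<^sub>V x\<^sub>0 y\<^sub>0 q B"
    have n: "0 < n" using fs unfolding finite_sum_def by simp
    have q_pos: "0 < q"
    proof -
      have "1 \<le> sqrt (real n)" using n by simp
      then show ?thesis unfolding q by linarith
    qed
    \<comment> \<open>The integral over the law is pulled back to the index set, where repeated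
      samples count with multiplicity; therefore the full batch reproduces the exact
      gradient.\<close>
    have full: "batch_grad p i X Y (map (\<zeta> i) [0..<n]) = gradient (local_fun p i) (X $ i, Y $ i)" for i X Y
    proof -
      let ?z = "(X $ i, Y $ i)" and ?U = "uniform_count_measure {..<n}"
      have law: "law p i = distr ?U (count_space (\<zeta> i ` {..<n})) (\<zeta> i)"
        using fs unfolding finite_sum_def by blast
      have "(\<integral>\<xi>. sgrad p i ?z \<xi> \<partial>law p i) = (\<integral>j. sgrad p i ?z (\<zeta> i j) \<partial>?U)"
        unfolding law by (subst integral_distr) (auto simp: uniform_count_measure_def point_measure_def)
      also have "\<dots> = (1 / real n) *\<^sub>R (\<Sum>j<n. sgrad p i ?z (\<zeta> i j))"
        unfolding uniform_count_measure_def
        by (subst lebesgue_integral_point_measure_finite) (auto simp: scaleR_sum_right)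
      finally have "(1 / real n) *\<^sub>R (\<Sum>j<n. sgrad p i ?z (\<zeta> i j)) = gradient (local_fun p i) ?z"
        using assms(6) unfolding stochastic_smooth_def by metis
      then show ?thesis
        unfolding batch_grad_def by (simp add: interv_sum_list_conv_sum_set_nat atLeast0LessThan o_def)
    qed
    \<comment> \<open>Checkpoint gradients are exact, so the noise level is 0.\<close>
    have R: "vrlm_run p \<phi>lb \<sigma> x\<^sub>0 y\<^sub>0 M S (finite_sum_batches n \<zeta> q q) q 0"
    proof (intro vrlm_run.intro V.vrlm_problem_axioms I vrlm_run_axioms.intro)
      show "finite_sum_batches n \<zeta> q q s t i = finite_sum_batches n \<zeta> q q s' t i"
        if "\<And>j. s (t, i, j) = s' (t, i, j)" for s s' t i
        unfolding finite_sum_batches_def using that by simp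
    qed (use q_pos full in \<open>auto simp: finite_sum_batches_def\<close>)
    show "vrlm_stationary p M \<epsilon> x\<^sub>0 y\<^sub>0 q B \<tau>"
      unfolding B
      by (rule vrlm_run.run_stationary[OF R _ _ assms(9) tr[unfolded B] T T_large tau]) simp_all
    show "same_order 10 (real (grad_count n q q T)) (real n + sqrt (real n) * real T)"
      by (rule grad_count_same_order[OF n q T])
  qed
qed

end
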